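(* Let $R$ be a commutative ring with unity and let $(S,\mathcal{F},\mathcal{L})$ be a $p$-local finite group. For every right $R\mathcal{L}$-module $M$, there is a spectral sequence $$E_2^{p,q}=H^p(\mathcal{O}^c(\mathcal{F});\mathcal{H}^q_M)\Rightarrow H^{p+q}(\mathcal{L};M),$$ where $\mathcal{H}^q_M$ is the right $R\mathcal{O}^c(\mathcal{F})$-module such that for every $\mathcal{F}$-centric subgroup $P\le S$, $\mathcal{H}^q_M(P)=H^q(P;\mathrm{Res}_{j_P}M(P))$.
   Context: A right $R\mathcal{C}$-module is a contravariant functor $\mathcal{C}^{op}\to R\text{-Mod}$, and $H^*(\mathcal{C};M)=\mathrm{Ext}^*_{R\mathcal{C}}(\underline R,M)$ with $\underline R$ the constant functor. "$E_2^{p,q}\Rightarrow H^{p+q}$" means a convergent first quadrant cohomological spectral sequence. Fusion systems. A fusion system $\mathcal{F}$ over a finite $p$-group $S$ is a category whose objects are the subgroups of $S$, whose morphism sets satisfy $\mathrm{Hom}_S(P,Q)\subseteq\mathrm{Mor}_{\mathcal{F}}(P,Q)\subseteq\mathrm{Inj}(P,Q)$ ($\mathrm{Hom}_S$ = conjugations by elements of $S$), and such that every $\varphi\in\mathrm{Mor}_{\mathcal{F}}(P,Q)$ is an $\mathcal{F}$-isomorphism $P\to\varphi(P)$ followed by an inclusion. All fusion systems are assumed saturated: each $\mathcal{F}$-isomorphism class contains a subgroup $P$ such that $\mathrm{Aut}_S(P)$ is a Sylow $p$-subgroup of $\mathrm{Aut}_{\mathcal{F}}(P)$ and every $\mathcal{F}$-isomorphism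 $\varphi:Q\to P$ extends to a morphism in $\mathcal{F}$ from $N_\varphi=\{g\in N_S(Q):\varphi c_g\varphi^{-1}\in\mathrm{Aut}_S(P)\}$ to $S$. A subgroup $P\le S$ is $\mathcal{F}$-centric if $C_S(Q)\le Q$ for all $Q$ that are $\mathcal{F}$-isomorphic to $P$; $\mathcal{F}^c$ is the full subcategory of $\mathcal{F}$ on the $\mathcal{F}$-centric subgroups. Centric linking systems. Let $\mathcal{T}^c_S(S)$ be the category whose objects are the $\mathcal{F}$-centric subgroups, with morphism sets $N_S(P,Q)=\{g\in S: gPg^{-1}\le Q\}$ and composition given by multiplication. A centric linking system associated to $\mathcal{F}$ is a category $\mathcal{L}$ whose objects are the $\mathcal{F}$-centric subgroups with functors $\mathcal{T}^c_S(S)\xrightarrow{\epsilon}\mathcal{L}\xrightarrow{\pi}\mathcal{F}^c$ such that: (1) $\epsilon,\pi$ are the identity on objects, $\epsilon$ is injective and $\pi$ is surjective on morphism sets; (2) $\epsilon_{P,P}(P)$ acts freely on $\mathrm{Mor}_{\mathcal{L}}(P,Q)$ by precomposition and $\pi_{P,Q}$ induces a bijection $\mathrm{Mor}_{\mathcal{L}}(P,Q)/\epsilon_{P,P}(Z(P))\cong\mathrm{Mor}_{\mathcal{F}^c}(P,Q)$; (3) $\pi(\epsilon(g))=c_g$ for $g\in N_S(P,Q)$; (4) for $\psi\in\mathrm{Mor}_{\mathcal{L}}(P,Q)$ and $g\in P$, $\psi\circ\epsilon_{P,P}(g)=\epsilon_{Q,Q}(\pi(\psi)(g))\circ\psi$.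 A $p$-local finite group is a triple $(S,\mathcal{F},\mathcal{L})$ with $\mathcal{F}$ a saturated fusion system over $S$ and $\mathcal{L}$ an associated centric linking system. The orbit category $\mathcal{O}^c(\mathcal{F})$ has as objects the $\mathcal{F}$-centric subgroups and morphisms $\mathrm{Inn}(Q)\backslash\mathrm{Mor}_{\mathcal{F}}(P,Q)$. The homomorphism $j_P:P\to\mathrm{Aut}_{\mathcal{L}}(P)$ is the restriction of $\epsilon_{P,P}:N_S(P)\to\mathrm{Aut}_{\mathcal{L}}(P)$ to $P$, and $\mathrm{Res}_{j_P}M(P)$ is $M(P)$ as an $RP$-module via $j_P$. For a morphism $\varphi:P\to Q$ in $\mathcal{O}^c(\mathcal{F})$, choose a lift $\widetilde\varphi:P\to Q$ of $\varphi$ in $\mathcal{F}^c$ and a lift $\widetilde{\widetilde\varphi}$ of $\widetilde\varphi$ in $\mathcal{L}$; then $\mathcal{H}^q_M(\varphi)$ is the composite $$H^q(Q;\mathrm{Res}_{j_Q}M(Q))\xrightarrow{\widetilde\varphi^*}H^q(P;\mathrm{Res}_{\widetilde\varphi}\mathrm{Res}_{j_Q}M(Q))\xrightarrow{M(\widetilde{\widetilde\varphi})_*}H^q(P;\mathrm{Res}_{j_P}M(P)).$$ *)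

theory Defs
  imports "HOL-Algebra.AbelCoset" "HOL-Algebra.Module" "HOL-Computational_Algebra.Primes"
begin

section \<open>Modules over a commutative ring\<close>

definition mod_hom ::
  "'r ring \<Rightarrow> ('r, 'x) module \<Rightarrow> ('r, 'y) module \<Rightarrow> ('x \<Rightarrow> 'y) set" where
  "mod_hom R A B = {f \<in> carrier A \<rightarrow> carrier B.
     (\<forall>x\<in>carrier A. \<forall>y\<in>carrier A. f (x \<oplus>\<^bsub>A\<^esub> y) = f x \<oplus>\<^bsub>B\<^esub> f y) \<and>
     (\<forall>a\<in>carrier R. \<forall>x\<in>carrier A. f (a \<odot>\<^bsub>A\<^esub> x) = a \<odot>\<^bsub>B\<^esub> f x)}"

definition mod_isomorphic :: "'r ring \<Rightarrow> ('r, 'x) module \<Rightarrow> ('r, 'y) module \<Rightarrow> bool" where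
  "mod_isomorphic R A B \<longleftrightarrow> (\<exists>f\<in>mod_hom R A B. bij_betw f (carrier A) (carrier B))"

text \<open>
  The record type of modules extends that of rings; its fields \<open>mult\<close> and \<open>one\<close> play no role for
  modules and are filled arbitrarily here and below.
\<close>

definition quot_mod :: "('r, 'x) module \<Rightarrow> 'x set \<Rightarrow> ('r, 'x set) module" where
  "quot_mod M B = \<lparr>carrier = a_rcosets\<^bsub>M\<^esub> B, monoid.mult = (\<lambda>_ _. B), one = B, ring.zero = B,
     ring.add = set_add M, module.smult = (\<lambda>a U. \<Union>u\<in>U. B +>\<^bsub>M\<^esub> (a \<odot>\<^bsub>M\<^esub> u))\<rparr>"

definition regular_mod :: "'r ring \<Rightarrow> ('r, 'r) module" where
  "regular_mod R = \<lparr>carrier = carrier R, monoid.mult = monoid.mult R, one = one R, ring.zero = ring.zero R,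
     ring.add = ring.add R, module.smult = monoid.mult R\<rparr>"

section \<open>Small categories and functors\<close>

text \<open>
  Hom-sets of different pairs of objects need not be disjoint, so composition is indexed by objects:
  \<open>Comp C x y z g f\<close> is the composite of \<open>f : x \<rightarrow> y\<close> and \<open>g : y \<rightarrow> z\<close>. The same applies to the
  morphism part of functors and to the action of modules over a category.
\<close>

record ('o, 'm) cat =
  Obj :: "'o set"
  Hom :: "'o \<Rightarrow> 'o \<Rightarrow> 'm set"
  Comp :: "'o \<Rightarrow> 'o \<Rightarrow> 'o \<Rightarrow> 'm \<Rightarrow> 'm \<Rightarrow> 'm"
  Ident :: "'o \<Rightarrow> 'm"

definition category :: "('o, 'm) cat \<Rightarrow> bool" where
  "category C \<longleftrightarrow>
     (\<forall>x\<in>Obj C. Ident C x \<in> Hom C x x) \<and>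
     (\<forall>x\<in>Obj C. \<forall>y\<in>Obj C. \<forall>z\<in>Obj C. \<forall>f\<in>Hom C x y. \<forall>g\<in>Hom C y z.
        Comp C x y z g f \<in> Hom C x z) \<and>
     (\<forall>x\<in>Obj C. \<forall>y\<in>Obj C. \<forall>f\<in>Hom C x y.
        Comp C x x y f (Ident C x) = f \<and> Comp C x y y (Ident C y) f = f) \<and>
     (\<forall>w\<in>Obj C. \<forall>x\<in>Obj C. \<forall>y\<in>Obj C. \<forall>z\<in>Obj C.
        \<forall>f\<in>Hom C w x. \<forall>g\<in>Hom C x y. \<forall>h\<in>Hom C y z.
          Comp C w y z h (Comp C w x y g f) = Comp C w x z (Comp C x y z h g) f)"

definition is_functor ::
  "('o, 'm) cat \<Rightarrow> ('u, 'n) cat \<Rightarrow> ('o \<Rightarrow> 'u) \<Rightarrow> ('o \<Rightarrow> 'o \<Rightarrow> 'm \<Rightarrow> 'n) \<Rightarrow> bool" where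
  "is_functor C D \<Phi> \<phi> \<longleftrightarrow>
     (\<forall>x\<in>Obj C. \<Phi> x \<in> Obj D) \<and>
     (\<forall>x\<in>Obj C. \<forall>y\<in>Obj C. \<forall>f\<in>Hom C x y. \<phi> x y f \<in> Hom D (\<Phi> x) (\<Phi> y)) \<and>
     (\<forall>x\<in>Obj C. \<phi> x x (Ident C x) = Ident D (\<Phi> x)) \<and>
     (\<forall>x\<in>Obj C. \<forall>y\<in>Obj C. \<forall>z\<in>Obj C. \<forall>f\<in>Hom C x y. \<forall>g\<in>Hom C y z.
        \<phi> x z (Comp C x y z g f) = Comp D (\<Phi> x) (\<Phi> y) (\<Phi> z) (\<phi> y z g) (\<phi> x y f))"

definition isos :: "('o, 'm) cat \<Rightarrow> 'o \<Rightarrow> 'o \<Rightarrow> 'm set" where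
  "isos C x y = {f \<in> Hom C x y. \<exists>g\<in>Hom C y x.
     Comp C x y x g f = Ident C x \<and> Comp C y x y f g = Ident C y}"

definition aut_group :: "('o, 'm) cat \<Rightarrow> 'o \<Rightarrow> 'm monoid" where
  "aut_group C x = \<lparr>carrier = isos C x x, monoid.mult = Comp C x x x, one = Ident C x\<rparr>"

definition full_subcat :: "('o, 'm) cat \<Rightarrow> 'o set \<Rightarrow> ('o, 'm) cat" where
  "full_subcat C X = C\<lparr>Obj := X\<rparr>"

definition group_cat :: "'a monoid \<Rightarrow> (unit, 'a) cat" where
  "group_cat G = \<lparr>Obj = {()}, Hom = (\<lambda>_ _. carrier G), Comp = (\<lambda>_ _ _. monoid.mult G),
     Ident = (\<lambda>_. one G)\<rparr>"

section \<open>Right modules over a category\<close>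

text \<open>A morphism \<open>f : x \<rightarrow> y\<close> acts as \<open>act M x y f : M(y) \<rightarrow> M(x)\<close>.\<close>

record ('o, 'm, 'r, 'x) cmod =
  val :: "'o \<Rightarrow> ('r, 'x) module"
  act :: "'o \<Rightarrow> 'o \<Rightarrow> 'm \<Rightarrow> 'x \<Rightarrow> 'x"

definition right_module :: "'r ring \<Rightarrow> ('o, 'm) cat \<Rightarrow> ('o, 'm, 'r, 'x) cmod \<Rightarrow> bool" where
  "right_module R C M \<longleftrightarrow>
     (\<forall>x\<in>Obj C. module R (val M x)) \<and>
     (\<forall>x\<in>Obj C. \<forall>y\<in>Obj C. \<forall>f\<in>Hom C x y. act M x y f \<in> mod_hom R (val M y) (val M x)) \<and>
     (\<forall>x\<in>Obj C. \<forall>m\<in>carrier (val M x). act M x x (Ident C x) m = m) \<and>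
     (\<forall>x\<in>Obj C. \<forall>y\<in>Obj C. \<forall>z\<in>Obj C. \<forall>f\<in>Hom C x y. \<forall>g\<in>Hom C y z.
        \<forall>m\<in>carrier (val M z). act M x z (Comp C x y z g f) m = act M x y f (act M y z g m))"

definition const_mod :: "'r ring \<Rightarrow> ('o, 'm, 'r, 'r) cmod" where
  "const_mod R = \<lparr>val = (\<lambda>_. regular_mod R), act = (\<lambda>_ _ _ m. m)\<rparr>"

definition restrict_mod ::
  "('o \<Rightarrow> 'u) \<Rightarrow> ('o \<Rightarrow> 'o \<Rightarrow> 'm \<Rightarrow> 'n) \<Rightarrow> ('u, 'n, 'r, 'x) cmod \<Rightarrow> ('o, 'm, 'r, 'x) cmod" where
  "restrict_mod \<Phi> \<phi> M = \<lparr>val = (\<lambda>x. val M (\<Phi> x)), act = (\<lambda>x y f. act M (\<Phi> x) (\<Phi> y) (\<phi> x y f))\<rparr>"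

text \<open>
  Natural transformations are taken extensional, so that equality of transformations is equality
  in HOL and they form a module.
\<close>

definition nat_trans ::
  "'r ring \<Rightarrow> ('o, 'm) cat \<Rightarrow> ('o, 'm, 'r, 'x) cmod \<Rightarrow> ('o, 'm, 'r, 'y) cmod \<Rightarrow>
    ('o \<Rightarrow> 'x \<Rightarrow> 'y) set" where
  "nat_trans R C A B = {\<eta> \<in> extensional (Obj C).
     (\<forall>x\<in>Obj C. \<eta> x \<in> mod_hom R (val A x) (val B x) \<inter> extensional (carrier (val A x))) \<and>
     (\<forall>x\<in>Obj C. \<forall>y\<in>Obj C. \<forall>f\<in>Hom C x y. \<forall>a\<in>carrier (val A y).
        \<eta> x (act A x y f a) = act B x y f (\<eta> y a))}"

definition pointwise ::
  "('o, 'm) cat \<Rightarrow> ('o, 'm, 'r, 'x) cmod \<Rightarrow> ('o \<Rightarrow> 'x \<Rightarrow> 'y) \<Rightarrow> 'o \<Rightarrow> 'x \<Rightarrow> 'y" where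
  "pointwise C A t = (\<lambda>x\<in>Obj C. \<lambda>a\<in>carrier (val A x). t x a)"

definition hom_mod ::
  "'r ring \<Rightarrow> ('o, 'm) cat \<Rightarrow> ('o, 'm, 'r, 'x) cmod \<Rightarrow> ('o, 'm, 'r, 'y) cmod \<Rightarrow>
    ('r, 'o \<Rightarrow> 'x \<Rightarrow> 'y) module" where
  "hom_mod R C A B = \<lparr>carrier = nat_trans R C A B,
     monoid.mult = (\<lambda>_ _. pointwise C A (\<lambda>x a. \<zero>\<^bsub>val B x\<^esub>)),
     one = pointwise C A (\<lambda>x a. \<zero>\<^bsub>val B x\<^esub>),
     ring.zero = pointwise C A (\<lambda>x a. \<zero>\<^bsub>val B x\<^esub>),
     ring.add = (\<lambda>\<eta> \<theta>. pointwise C A (\<lambda>x a. \<eta> x a \<oplus>\<^bsub>val B x\<^esub> \<theta> x a)),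
     module.smult = (\<lambda>r \<eta>. pointwise C A (\<lambda>x a. r \<odot>\<^bsub>val B x\<^esub> \<eta> x a))\<rparr>"

definition objectwise_surj ::
  "('o, 'm) cat \<Rightarrow> ('o, 'm, 'r, 'x) cmod \<Rightarrow> ('o, 'm, 'r, 'y) cmod \<Rightarrow> ('o \<Rightarrow> 'x \<Rightarrow> 'y) \<Rightarrow> bool" where
  "objectwise_surj C A B g \<longleftrightarrow> (\<forall>x\<in>Obj C. g x ` carrier (val A x) = carrier (val B x))"

text \<open>
  Projectivity is the lifting property against epimorphisms \<open>g : A \<rightarrow> B\<close>. A definition cannot
  quantify over the types of elements of \<open>A\<close> and \<open>B\<close>, so these are fixed, but large enough to lose
  nothing: for \<open>B = P\<close> one may take for \<open>A\<close> the free module on the elements of \<open>P\<close>, where \<open>A(x)\<close>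
  consists of the finitely supported functions to \<open>R\<close> on the triples \<open>(y, f, b)\<close> with
  \<open>f : x \<rightarrow> y\<close> and \<open>b \<in> P(y)\<close>. Lifting the identity of \<open>P\<close> makes \<open>P\<close> a direct summand of a free
  module, which has the lifting property against epimorphisms of modules over all types.
\<close>

definition projective :: "'r ring \<Rightarrow> ('o, 'm) cat \<Rightarrow> ('o, 'm, 'r, 'x) cmod \<Rightarrow> bool" where
  "projective R C P \<longleftrightarrow> right_module R C P \<and>
     (\<forall>(A :: ('o, 'm, 'r, 'o \<times> 'm \<times> 'x \<Rightarrow> 'r) cmod) (B :: ('o, 'm, 'r, 'x) cmod) g h.
        right_module R C A \<and> right_module R C B \<and>
        g \<in> nat_trans R C A B \<and> objectwise_surj C A B g \<and> h \<in> nat_trans R C P B \<longrightarrow>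
        (\<exists>k\<in>nat_trans R C P A. \<forall>x\<in>Obj C. \<forall>a\<in>carrier (val P x). g x (k x a) = h x a))"

section \<open>Projective resolutions and Ext\<close>

text \<open>\<open>Bd X n : X\<^bsub>n+1\<^esub> \<rightarrow> X\<^bsub>n\<^esub>\<close> and \<open>Aug X : X\<^bsub>0\<^esub> \<rightarrow> A\<close>.\<close>

record ('o, 'm, 'r, 'x, 'y) resolution =
  Term :: "nat \<Rightarrow> ('o, 'm, 'r, 'x) cmod"
  Bd :: "nat \<Rightarrow> 'o \<Rightarrow> 'x \<Rightarrow> 'x"
  Aug :: "'o \<Rightarrow> 'x \<Rightarrow> 'y"

definition mod_ker :: "('r, 'x) module \<Rightarrow> ('r, 'y) module \<Rightarrow> ('x \<Rightarrow> 'y) \<Rightarrow> 'x set" where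
  "mod_ker A B f = {x \<in> carrier A. f x = \<zero>\<^bsub>B\<^esub>}"

definition projective_resolution ::
  "'r ring \<Rightarrow> ('o, 'm) cat \<Rightarrow> ('o, 'm, 'r, 'y) cmod \<Rightarrow> ('o, 'm, 'r, 'x, 'y) resolution \<Rightarrow> bool" where
  "projective_resolution R C A X \<longleftrightarrow>
     (\<forall>n. projective R C (Term X n)) \<and>
     (\<forall>n. Bd X n \<in> nat_trans R C (Term X (Suc n)) (Term X n)) \<and>
     Aug X \<in> nat_trans R C (Term X 0) A \<and>
     objectwise_surj C (Term X 0) A (Aug X) \<and>
     (\<forall>x\<in>Obj C. mod_ker (val (Term X 0) x) (val A x) (Aug X x) =
        Bd X 0 x ` carrier (val (Term X 1) x)) \<and>
     (\<forall>n. \<forall>x\<in>Obj C. mod_ker (val (Term X (Suc n)) x) (val (Term X n) x) (Bd X n x) =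
        Bd X (Suc n) x ` carrier (val (Term X (Suc (Suc n))) x))"

definition cocycles ::
  "'r ring \<Rightarrow> ('o, 'm) cat \<Rightarrow> ('o, 'm, 'r, 'x, 'y) resolution \<Rightarrow> ('o, 'm, 'r, 'z) cmod \<Rightarrow> nat \<Rightarrow>
    ('o \<Rightarrow> 'x \<Rightarrow> 'z) set" where
  "cocycles R C X M n = {f \<in> nat_trans R C (Term X n) M.
     \<forall>x\<in>Obj C. \<forall>a\<in>carrier (val (Term X (Suc n)) x). f x (Bd X n x a) = \<zero>\<^bsub>val M x\<^esub>}"

definition coboundaries ::
  "'r ring \<Rightarrow> ('o, 'm) cat \<Rightarrow> ('o, 'm, 'r, 'x, 'y) resolution \<Rightarrow> ('o, 'm, 'r, 'z) cmod \<Rightarrow> nat \<Rightarrow>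
    ('o \<Rightarrow> 'x \<Rightarrow> 'z) set" where
  "coboundaries R C X M n = (case n of
     0 \<Rightarrow> {\<zero>\<^bsub>hom_mod R C (Term X 0) M\<^esub>}
   | Suc m \<Rightarrow> (\<lambda>f. pointwise C (Term X (Suc m)) (\<lambda>x a. f x (Bd X m x a))) `
       nat_trans R C (Term X m) M)"

definition Ext_via ::
  "'r ring \<Rightarrow> ('o, 'm) cat \<Rightarrow> ('o, 'm, 'r, 'x, 'y) resolution \<Rightarrow> ('o, 'm, 'r, 'z) cmod \<Rightarrow> nat \<Rightarrow>
    ('r, ('o \<Rightarrow> 'x \<Rightarrow> 'z) set) module" where
  "Ext_via R C X M n =
     quot_mod ((hom_mod R C (Term X n) M)\<lparr>carrier := cocycles R C X M n\<rparr>) (coboundaries R C X M n)"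

text \<open>
  \<open>H\<^sup>n(C;M)\<close> is \<open>Ext\<close> from the constant functor, computed with an arbitrary but fixed
  projective resolution. The element type of the resolution admits one for every small category:
  in the bar resolution, \<open>X\<^bsub>n\<^esub>(x)\<close> is free on the chains \<open>x \<rightarrow> y\<^bsub>0\<^esub> \<rightarrow> \<dots> \<rightarrow> y\<^bsub>n\<^esub>\<close>, which
  are lists of pairs of a target and a morphism, so its elements are finitely supported functions on
  such lists.
\<close>

definition chosen_resolution ::
  "'r ring \<Rightarrow> ('o, 'm) cat \<Rightarrow> ('o, 'm, 'r, ('o \<times> 'm) list \<Rightarrow> 'r, 'r) resolution" where
  "chosen_resolution R C = (SOME X. projective_resolution R C (const_mod R) X)"

definition cohomology ::
  "'r ring \<Rightarrow> ('o, 'm) cat \<Rightarrow> ('o, 'm, 'r, 'z) cmod \<Rightarrow> nat \<Rightarrow>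
    ('r, ('o \<Rightarrow> (('o \<times> 'm) list \<Rightarrow> 'r) \<Rightarrow> 'z) set) module" where
  "cohomology R C M n = Ext_via R C (chosen_resolution R C) M n"

text \<open>
  The map \<open>H\<^sup>n(C;M) \<rightarrow> H\<^sup>n(C;N)\<close> induced by a map of coefficients \<open>\<eta> : M \<rightarrow> N\<close>. A class is a coset,
  and all its representatives give the same coset on the right.
\<close>

definition coefficient_map ::
  "'r ring \<Rightarrow> ('o, 'm) cat \<Rightarrow> ('o, 'm, 'r, 'z) cmod \<Rightarrow> ('o \<Rightarrow> 'y \<Rightarrow> 'z) \<Rightarrow> nat \<Rightarrow>
    ('o \<Rightarrow> (('o \<times> 'm) list \<Rightarrow> 'r) \<Rightarrow> 'y) set \<Rightarrow> ('o \<Rightarrow> (('o \<times> 'm) list \<Rightarrow> 'r) \<Rightarrow> 'z) set" where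
  "coefficient_map R C N \<eta> n U =
     (let X = chosen_resolution R C in
      \<Union>f\<in>U. coboundaries R C X N n +>\<^bsub>hom_mod R C (Term X n) N\<^esub>
        pointwise C (Term X n) (\<lambda>x a. \<eta> x (f x a)))"

text \<open>
  The map \<open>H\<^sup>n(D;N) \<rightarrow> H\<^sup>n(C;\<Phi>\<^sup>*N)\<close> induced by a functor \<open>\<Phi> : C \<rightarrow> D\<close>, by means of a chain map from
  the resolution over \<open>C\<close> to the restriction of that over \<open>D\<close> lifting the identity of the constant
  functor.
\<close>

definition comparison_map ::
  "'r ring \<Rightarrow> ('o, 'm) cat \<Rightarrow> ('o, 'm, 'r, 'x, 'r) resolution \<Rightarrow> ('u, 'n, 'r, 'y, 'r) resolution \<Rightarrow>
    ('o \<Rightarrow> 'u) \<Rightarrow> ('o \<Rightarrow> 'o \<Rightarrow> 'm \<Rightarrow> 'n) \<Rightarrow> (nat \<Rightarrow> 'o \<Rightarrow> 'x \<Rightarrow> 'y) \<Rightarrow> bool" where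
  "comparison_map R C X Y \<Phi> \<phi> \<tau> \<longleftrightarrow>
     (\<forall>n. \<tau> n \<in> nat_trans R C (Term X n) (restrict_mod \<Phi> \<phi> (Term Y n))) \<and>
     (\<forall>n. \<forall>x\<in>Obj C. \<forall>a\<in>carrier (val (Term X (Suc n)) x).
        \<tau> n x (Bd X n x a) = Bd Y n (\<Phi> x) (\<tau> (Suc n) x a)) \<and>
     (\<forall>x\<in>Obj C. \<forall>a\<in>carrier (val (Term X 0) x). Aug Y (\<Phi> x) (\<tau> 0 x a) = Aug X x a)"

definition pullback_map ::
  "'r ring \<Rightarrow> ('o, 'm) cat \<Rightarrow> ('u, 'n) cat \<Rightarrow> ('o \<Rightarrow> 'u) \<Rightarrow> ('o \<Rightarrow> 'o \<Rightarrow> 'm \<Rightarrow> 'n) \<Rightarrow>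
    ('u, 'n, 'r, 'z) cmod \<Rightarrow> nat \<Rightarrow>
    ('u \<Rightarrow> (('u \<times> 'n) list \<Rightarrow> 'r) \<Rightarrow> 'z) set \<Rightarrow> ('o \<Rightarrow> (('o \<times> 'm) list \<Rightarrow> 'r) \<Rightarrow> 'z) set" where
  "pullback_map R C D \<Phi> \<phi> N n U =
     (let X = chosen_resolution R C; Y = chosen_resolution R D;
          \<tau> = (SOME \<tau>. comparison_map R C X Y \<Phi> \<phi> \<tau>);
          \<Phi>N = restrict_mod \<Phi> \<phi> N in
      \<Union>f\<in>U. coboundaries R C X \<Phi>N n +>\<^bsub>hom_mod R C (Term X n) \<Phi>N\<^esub>
        pointwise C (Term X n) (\<lambda>x a. f (\<Phi> x) (\<tau> n x a)))"

section \<open>Fusion systems\<close>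

text \<open>Homomorphisms between subgroups \<open>P, Q\<close> of \<open>S\<close> are functions that are extensional on \<open>P\<close>.\<close>

definition conj_by :: "'a monoid \<Rightarrow> 'a \<Rightarrow> 'a \<Rightarrow> 'a" where
  "conj_by S g x = g \<otimes>\<^bsub>S\<^esub> x \<otimes>\<^bsub>S\<^esub> inv\<^bsub>S\<^esub> g"

definition transporter :: "'a monoid \<Rightarrow> 'a set \<Rightarrow> 'a set \<Rightarrow> 'a set" where
  "transporter S P Q = {g \<in> carrier S. conj_by S g ` P \<subseteq> Q}"

definition Hom_conj :: "'a monoid \<Rightarrow> 'a set \<Rightarrow> 'a set \<Rightarrow> ('a \<Rightarrow> 'a) set" where
  "Hom_conj S P Q = (\<lambda>g. restrict (conj_by S g) P) ` transporter S P Q"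

definition Inj_hom :: "'a monoid \<Rightarrow> 'a set \<Rightarrow> 'a set \<Rightarrow> ('a \<Rightarrow> 'a) set" where
  "Inj_hom S P Q = mon (S\<lparr>carrier := P\<rparr>) (S\<lparr>carrier := Q\<rparr>) \<inter> extensional P"

definition fusion_cat :: "'a monoid \<Rightarrow> ('a set \<Rightarrow> 'a set \<Rightarrow> ('a \<Rightarrow> 'a) set) \<Rightarrow> ('a set, 'a \<Rightarrow> 'a) cat" where
  "fusion_cat S F = \<lparr>Obj = {P. subgroup P S}, Hom = F, Comp = (\<lambda>P _ _. compose P),
     Ident = (\<lambda>P. \<lambda>x\<in>P. x)\<rparr>"

definition fusion_system ::
  "nat \<Rightarrow> 'a monoid \<Rightarrow> ('a set \<Rightarrow> 'a set \<Rightarrow> ('a \<Rightarrow> 'a) set) \<Rightarrow> bool" where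
  "fusion_system p S F \<longleftrightarrow>
     prime p \<and> group S \<and> (\<exists>n. order S = p ^ n) \<and>
     category (fusion_cat S F) \<and>
     (\<forall>P Q. subgroup P S \<and> subgroup Q S \<longrightarrow>
        Hom_conj S P Q \<subseteq> F P Q \<and> F P Q \<subseteq> Inj_hom S P Q \<and>
        (\<forall>\<phi>\<in>F P Q. \<phi> \<in> isos (fusion_cat S F) P (\<phi> ` P)))"

definition sylow_subgroup :: "nat \<Rightarrow> 'b set \<Rightarrow> 'b monoid \<Rightarrow> bool" where
  "sylow_subgroup p K G \<longleftrightarrow> subgroup K G \<and> card K = p ^ multiplicity p (order G)"

definition extender :: "'a monoid \<Rightarrow> 'a set \<Rightarrow> 'a set \<Rightarrow> ('a \<Rightarrow> 'a) \<Rightarrow> 'a set" where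
  "extender S Q P \<phi> = {g \<in> transporter S Q Q.
     (\<lambda>y\<in>P. \<phi> (conj_by S g (inv_into Q \<phi> y))) \<in> Hom_conj S P P}"

definition saturated ::
  "nat \<Rightarrow> 'a monoid \<Rightarrow> ('a set \<Rightarrow> 'a set \<Rightarrow> ('a \<Rightarrow> 'a) set) \<Rightarrow> bool" where
  "saturated p S F \<longleftrightarrow>
     (\<forall>P\<^sub>0. subgroup P\<^sub>0 S \<longrightarrow> (\<exists>P. subgroup P S \<and> isos (fusion_cat S F) P\<^sub>0 P \<noteq> {} \<and>
        sylow_subgroup p (Hom_conj S P P) (aut_group (fusion_cat S F) P) \<and>
        (\<forall>Q. subgroup Q S \<longrightarrow> (\<forall>\<phi>\<in>isos (fusion_cat S F) Q P.
           \<exists>\<phi>'\<in>F (extender S Q P \<phi>) (carrier S). \<forall>x\<in>Q. \<phi>' x = \<phi> x))))"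

definition centralizer_in :: "'a monoid \<Rightarrow> 'a set \<Rightarrow> 'a set" where
  "centralizer_in S Q = {g \<in> carrier S. \<forall>x\<in>Q. g \<otimes>\<^bsub>S\<^esub> x = x \<otimes>\<^bsub>S\<^esub> g}"

definition centrics :: "'a monoid \<Rightarrow> ('a set \<Rightarrow> 'a set \<Rightarrow> ('a \<Rightarrow> 'a) set) \<Rightarrow> 'a set set" where
  "centrics S F = {P. subgroup P S \<and>
     (\<forall>Q. subgroup Q S \<and> isos (fusion_cat S F) P Q \<noteq> {} \<longrightarrow> centralizer_in S Q \<subseteq> Q)}"

definition centric_cat :: "'a monoid \<Rightarrow> ('a set \<Rightarrow> 'a set \<Rightarrow> ('a \<Rightarrow> 'a) set) \<Rightarrow> ('a set, 'a \<Rightarrow> 'a) cat" where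
  "centric_cat S F = full_subcat (fusion_cat S F) (centrics S F)"

definition Inn_orbit :: "'a monoid \<Rightarrow> 'a set \<Rightarrow> 'a set \<Rightarrow> ('a \<Rightarrow> 'a) \<Rightarrow> ('a \<Rightarrow> 'a) set" where
  "Inn_orbit S P Q \<phi> = (\<lambda>y. compose P (conj_by S y) \<phi>) ` Q"

text \<open>
  Composites of representatives of two orbits form exactly one orbit, as
  \<open>\<psi> \<circ> c\<^bsub>y\<^esub> = c\<^bsub>\<psi>(y)\<^esub> \<circ> \<psi>\<close>.
\<close>

definition orbit_cat ::
  "'a monoid \<Rightarrow> ('a set \<Rightarrow> 'a set \<Rightarrow> ('a \<Rightarrow> 'a) set) \<Rightarrow> ('a set, ('a \<Rightarrow> 'a) set) cat" where
  "orbit_cat S F = \<lparr>Obj = centrics S F, Hom = (\<lambda>P Q. Inn_orbit S P Q ` F P Q),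
     Comp = (\<lambda>P _ _ \<Psi> \<Phi>. {compose P \<psi> \<phi> | \<psi> \<phi>. \<psi> \<in> \<Psi> \<and> \<phi> \<in> \<Phi>}),
     Ident = (\<lambda>P. Inn_orbit S P P (\<lambda>x\<in>P. x))\<rparr>"

section \<open>Centric linking systems\<close>

definition transporter_cat ::
  "'a monoid \<Rightarrow> ('a set \<Rightarrow> 'a set \<Rightarrow> ('a \<Rightarrow> 'a) set) \<Rightarrow> ('a set, 'a) cat" where
  "transporter_cat S F = \<lparr>Obj = centrics S F, Hom = transporter S, Comp = (\<lambda>_ _ _. monoid.mult S),
     Ident = (\<lambda>_. one S)\<rparr>"

definition linking_system ::
  "'a monoid \<Rightarrow> ('a set \<Rightarrow> 'a set \<Rightarrow> ('a \<Rightarrow> 'a) set) \<Rightarrow> ('a set, 'l) cat \<Rightarrow>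
    ('a set \<Rightarrow> 'a set \<Rightarrow> 'a \<Rightarrow> 'l) \<Rightarrow> ('a set \<Rightarrow> 'a set \<Rightarrow> 'l \<Rightarrow> 'a \<Rightarrow> 'a) \<Rightarrow> bool" where
  "linking_system S F L \<epsilon> \<pi> \<longleftrightarrow>
     category L \<and> Obj L = centrics S F \<and>
     is_functor (transporter_cat S F) L (\<lambda>P. P) \<epsilon> \<and>
     is_functor L (centric_cat S F) (\<lambda>P. P) \<pi> \<and>
     (\<forall>P\<in>Obj L. \<forall>Q\<in>Obj L.
        inj_on (\<epsilon> P Q) (transporter S P Q) \<and>
        \<pi> P Q ` Hom L P Q = F P Q \<and>
        (\<forall>\<psi>\<in>Hom L P Q. \<forall>g\<in>P. Comp L P P Q \<psi> (\<epsilon> P P g) = \<psi> \<longrightarrow> \<epsilon> P P g = Ident L P) \<and>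
        (\<forall>\<psi>\<in>Hom L P Q. \<forall>\<psi>'\<in>Hom L P Q. \<pi> P Q \<psi> = \<pi> P Q \<psi>' \<longleftrightarrow>
           (\<exists>z\<in>P \<inter> centralizer_in S P. \<psi>' = Comp L P P Q \<psi> (\<epsilon> P P z))) \<and>
        (\<forall>g\<in>transporter S P Q. \<pi> P Q (\<epsilon> P Q g) = restrict (conj_by S g) P) \<and>
        (\<forall>\<psi>\<in>Hom L P Q. \<forall>g\<in>P.
           Comp L P P Q \<psi> (\<epsilon> P P g) = Comp L P Q Q (\<epsilon> Q Q (\<pi> P Q \<psi> g)) \<psi>))"

definition p_local_finite_group ::
  "nat \<Rightarrow> 'a monoid \<Rightarrow> ('a set \<Rightarrow> 'a set \<Rightarrow> ('a \<Rightarrow> 'a) set) \<Rightarrow> ('a set, 'l) cat \<Rightarrow>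
    ('a set \<Rightarrow> 'a set \<Rightarrow> 'a \<Rightarrow> 'l) \<Rightarrow> ('a set \<Rightarrow> 'a set \<Rightarrow> 'l \<Rightarrow> 'a \<Rightarrow> 'a) \<Rightarrow> bool" where
  "p_local_finite_group p S F L \<epsilon> \<pi> \<longleftrightarrow>
     fusion_system p S F \<and> saturated p S F \<and> linking_system S F L \<epsilon> \<pi>"

section \<open>The coefficient functors\<close>

text \<open>
  A right \<open>RG\<close>-module is a right module over the one-object category of \<open>G\<close>, and a homomorphism of
  groups is a functor between such categories. In particular \<open>Res_j\<close> is restriction along the functor
  sending the object to \<open>P\<close> and \<open>g \<in> P\<close> to \<open>j\<^bsub>P\<^esub>(g) \<in> Aut\<^bsub>L\<^esub>(P)\<close>.
\<close>

definition sub_cat :: "'a monoid \<Rightarrow> 'a set \<Rightarrow> (unit, 'a) cat" where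
  "sub_cat S P = group_cat (S\<lparr>carrier := P\<rparr>)"

definition Res_j ::
  "('a set \<Rightarrow> 'a set \<Rightarrow> 'a \<Rightarrow> 'l) \<Rightarrow> ('a set, 'l, 'r, 'x) cmod \<Rightarrow> 'a set \<Rightarrow> (unit, 'a, 'r, 'x) cmod" where
  "Res_j \<epsilon> M P = restrict_mod (\<lambda>_. P) (\<lambda>_ _. \<epsilon> P P) M"

text \<open>
  For \<open>\<phi> : P \<rightarrow> Q\<close> in the fusion system and a lift \<open>\<psi>\<close> of \<open>\<phi>\<close> to the linking system, the composite
  \<open>H\<^sup>q(Q; Res\<^bsub>j\<^esub> M(Q)) \<rightarrow> H\<^sup>q(P; Res\<^bsub>\<phi>\<^esub> Res\<^bsub>j\<^esub> M(Q)) \<rightarrow> H\<^sup>q(P; Res\<^bsub>j\<^esub> M(P))\<close>.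
\<close>

definition HM_composite ::
  "'r ring \<Rightarrow> 'a monoid \<Rightarrow> ('a set \<Rightarrow> 'a set \<Rightarrow> 'a \<Rightarrow> 'l) \<Rightarrow> ('a set, 'l, 'r, 'x) cmod \<Rightarrow> nat \<Rightarrow>
    'a set \<Rightarrow> 'a set \<Rightarrow> ('a \<Rightarrow> 'a) \<Rightarrow> 'l \<Rightarrow>
    (unit \<Rightarrow> ((unit \<times> 'a) list \<Rightarrow> 'r) \<Rightarrow> 'x) set \<Rightarrow> (unit \<Rightarrow> ((unit \<times> 'a) list \<Rightarrow> 'r) \<Rightarrow> 'x) set" where
  "HM_composite R S \<epsilon> M q P Q \<phi> \<psi> U =
     coefficient_map R (sub_cat S P) (Res_j \<epsilon> M P) (\<lambda>_. act M P Q \<psi>) q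
       (pullback_map R (sub_cat S P) (sub_cat S Q) (\<lambda>_. ()) (\<lambda>_ _. \<phi>) (Res_j \<epsilon> M Q) q U)"

definition HM ::
  "'r ring \<Rightarrow> 'a monoid \<Rightarrow> ('a set, 'l) cat \<Rightarrow>
    ('a set \<Rightarrow> 'a set \<Rightarrow> 'a \<Rightarrow> 'l) \<Rightarrow> ('a set \<Rightarrow> 'a set \<Rightarrow> 'l \<Rightarrow> 'a \<Rightarrow> 'a) \<Rightarrow>
    ('a set, 'l, 'r, 'x) cmod \<Rightarrow> nat \<Rightarrow>
    ('a set, ('a \<Rightarrow> 'a) set, 'r, (unit \<Rightarrow> ((unit \<times> 'a) list \<Rightarrow> 'r) \<Rightarrow> 'x) set) cmod" where
  "HM R S L \<epsilon> \<pi> M q =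
     \<lparr>val = (\<lambda>P. cohomology R (sub_cat S P) (Res_j \<epsilon> M P) q),
      act = (\<lambda>P Q \<Phi>.
        let \<phi> = (SOME \<phi>. \<phi> \<in> \<Phi>); \<psi> = (SOME \<psi>. \<psi> \<in> Hom L P Q \<and> \<pi> P Q \<psi> = \<phi>)
        in HM_composite R S \<epsilon> M q P Q \<phi> \<psi>)\<rparr>"

section \<open>Spectral sequences\<close>

text \<open>
  Cohomological spectral sequences starting on page 2, concentrated in the first quadrant, with
  \<open>d r p q : E r p q \<rightarrow> E r (p + r) (q - r + 1)\<close>.
\<close>

definition first_quadrant_spectral_sequence ::
  "'r ring \<Rightarrow> (nat \<Rightarrow> int \<Rightarrow> int \<Rightarrow> ('r, 'e) module) \<Rightarrow> (nat \<Rightarrow> int \<Rightarrow> int \<Rightarrow> 'e \<Rightarrow> 'e) \<Rightarrow> bool" where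
  "first_quadrant_spectral_sequence R E d \<longleftrightarrow>
     (\<forall>r\<ge>2. \<forall>p q.
        module R (E r p q) \<and>
        (p < 0 \<or> q < 0 \<longrightarrow> carrier (E r p q) = {\<zero>\<^bsub>E r p q\<^esub>}) \<and>
        d r p q \<in> mod_hom R (E r p q) (E r (p + int r) (q - int r + 1)) \<and>
        (\<forall>x\<in>carrier (E r p q). d r (p + int r) (q - int r + 1) (d r p q x) =
           \<zero>\<^bsub>E r (p + int r + int r) (q - int r + 1 - int r + 1)\<^esub>) \<and>
        mod_isomorphic R (E (Suc r) p q)
          (quot_mod
            ((E r p q)\<lparr>carrier :=
               mod_ker (E r p q) (E r (p + int r) (q - int r + 1)) (d r p q)\<rparr>)
            (d r (p - int r) (q + int r - 1) ` carrier (E r (p - int r) (q + int r - 1)))))"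

text \<open>
  \<open>Fil\<close> is a finite decreasing filtration of \<open>H n\<close> with graded pieces \<open>E\<^bsub>\<infinity>\<^esub>\<close>.
  The differentials from and to \<open>E r p q\<close> vanish for \<open>r > max p (q + 1)\<close>, so that \<open>E\<^bsub>\<infinity>\<^esub>\<close> is
  \<open>E r p q\<close> for any such \<open>r\<close>.
\<close>

definition converges_to ::
  "'r ring \<Rightarrow> (nat \<Rightarrow> int \<Rightarrow> int \<Rightarrow> ('r, 'e) module) \<Rightarrow> (nat \<Rightarrow> ('r, 'h) module) \<Rightarrow> bool" where
  "converges_to R E H \<longleftrightarrow>
     (\<forall>n. \<exists>Fil :: nat \<Rightarrow> 'h set.
        (\<forall>p. submodule (Fil p) R (H n)) \<and>
        (\<forall>p. Fil (Suc p) \<subseteq> Fil p) \<and>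
        Fil 0 = carrier (H n) \<and> Fil (Suc n) = {\<zero>\<^bsub>H n\<^esub>} \<and>
        (\<forall>p q r. p + q = n \<and> 2 \<le> r \<and> p < r \<and> q + 1 < r \<longrightarrow>
           mod_isomorphic R (quot_mod ((H n)\<lparr>carrier := Fil p\<rparr>) (Fil (Suc p)))
             (E r (int p) (int q))))"

end

(* Let D be the orbit category, and let K^q(P) be the q-cochains with values in M of the bar
 resolution of the comma category of L over P. A D-linear map from B to K^q is a family of R-linear
 maps from B(z) to M(x), one for each chain x -> ... -> z in L. Hence Hom_D(-, K^q) is exact on the
 bar resolution Y of the constant D-module, which is contractible objectwise, and the double complex
 Hom_D(Y_p, K^q) has the cohomology of its first column Hom_D(R, K^q) = Hom_L(Bar_q, M), namely
 H^*(L; M). The other filtration gives E_2^{p,q} = H^p(D; H^q(K)). As P is centric, it acts simply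
 transitively on the fibres of Mor_L(x, P) -> Mor_D(x, P). So the comma category retracts onto its
 full subcategory on the identity of P, which is the group P, and H^q(K(P)) = H^q(P; M(P)). *)

theory Submission imports Defs
begin

text \<open>The rows are exact because \<open>K q\<close> is coinduced: a chain over the comma
  category of \<open>d\<close> is a chain of \<open>L\<close> together with one morphism of
  \<open>D\<close> from its last object \<open>z\<close> to \<open>d\<close>, and naturality in
  \<open>d\<close> ties all such chains to the universal case \<open>d = z\<close>. What remains is
  plain \<open>R\<close>-linear data without compatibility conditions. Hence the contraction of the
  bar resolution, which is linear at each object but not natural, suffices, and no injective modules
  occur. Two features of the statement shape the rest. \<open>cohomology\<close> is defined by an
  arbitrary fixed resolution, and the action on the coefficient functors by choices of lifts.
  Therefore quotients are handled as modules with a surjection of known kernel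
  (\<open>quotient_map\<close>), and maps between cohomology groups are compared through the
  uniqueness of comparison maps up to homotopy. Moreover all pages of a spectral sequence share one
  type of elements and the second page is prescribed literally, so the later pages have to be
  realised within the type of the second.\<close>

abbreviation module_add ("(_ +[_] _)" [65, 0, 66] 65) where "x +[M] y \<equiv> ring.add M x y"
abbreviation module_minus ("(_ -[_] _)" [65, 0, 66] 65) where "x -[M] y \<equiv> a_minus M x y"
abbreviation module_smult ("(_ *[_] _)" [70, 0, 71] 70) where "a *[M] x \<equiv> module.smult M a x"
abbreviation module_zero ("\<zero>[_]") where "\<zero>[M] \<equiv> ring.zero M"
abbreviation module_restrict (infixl "<|" 200) where "M <| Z \<equiv> M\<lparr>carrier := Z\<rparr>"
abbreviation el where "el A x \<equiv> carrier (val A x)"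

section \<open>Homomorphisms and quotients of modules\<close>

lemma (in abelian_group) neg_zero: "\<ominus> \<zero> = \<zero>"
 by (rule minus_equality) simp_all

text \<open>The attribute \<open>algebra\<close> lets the method of that name normalise sums and
  differences in the additive groups of modules.\<close>

lemmas (in abelian_group) abelian_simprules
 [algebra abelian_group "zero G" "add G" "a_inv G" "a_minus G"] =
 a_closed zero_closed a_inv_closed minus_closed a_assoc l_zero l_neg a_comm r_zero r_neg
 r_neg2 r_neg1 minus_add minus_minus neg_zero a_lcomm minus_eq

lemma (in abelian_group) minus_zero_iff:
 assumes "x : carrier G" "y : carrier G"
 shows "x \<ominus> y = \<zero> \<longleftrightarrow> x = y"
proof
 assume "x \<ominus> y = \<zero>"
 moreover have "x = (x \<ominus> y) \<oplus> y" using assms by algebra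
 ultimately show "x = y" using assms by simp
qed (insert assms, simp add: a_minus_def r_neg)

lemma mod_homI:
 assumes "!!x. x : carrier A ==> f x : carrier B"
  and "!!x y. x : carrier A ==> y : carrier A ==> f (x +[A] y) = f x +[B] f y"
  and "!!a x. a : carrier R ==> x : carrier A ==> f (a *[A] x) = a *[B] f x"
 shows "f : mod_hom R A B"
 using assms by (auto simp: mod_hom_def)

lemma hom_closed: "f : mod_hom R A B ==> x : carrier A ==> f x : carrier B"
 by (auto simp: mod_hom_def)

lemma hom_add:
 "f : mod_hom R A B ==> x : carrier A ==> y : carrier A ==> f (x +[A] y) = f x +[B] f y"
 by (auto simp: mod_hom_def)

lemma hom_smult:
 "f : mod_hom R A B ==> a : carrier R ==> x : carrier A ==> f (a *[A] x) = a *[B] f x"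
 by (auto simp: mod_hom_def)

lemma hom_zero:
 assumes "module R A" "module R B" "f : mod_hom R A B"
 shows "f \<zero>[A] = \<zero>[B]"
proof -
 interpret A: module R A by fact
 interpret B: module R B by fact
 have c: "f \<zero>[A] : carrier B" using hom_closed[OF assms(3)] by simp
 have "f \<zero>[A] = \<zero>[R] *[B] f \<zero>[A]"
  using hom_smult[OF assms(3), of "\<zero>[R]" "\<zero>[A]"] by simp
 thus ?thesis using c by simp
qed

lemma mod_hom_neg:
 assumes "module R A" "module R B" "f : mod_hom R A B" "x : carrier A"
 shows "f (\<ominus>\<^bsub>A\<^esub> x) = \<ominus>\<^bsub>B\<^esub> f x"
proof -
 interpret A: module R A by fact
 interpret B: module R B by fact
 have "f x +[B] f (\<ominus>\<^bsub>A\<^esub> x) = \<zero>[B]"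
  using hom_add[OF assms(3,4), of "\<ominus>\<^bsub>A\<^esub> x"] hom_zero[OF assms(1-3)] assms(4)
  by (simp add: A.M.r_neg)
 hence "f (\<ominus>\<^bsub>A\<^esub> x) +[B] f x = \<zero>[B]"
  using hom_closed[OF assms(3)] assms(4) by (simp add: B.M.a_comm)
 thus ?thesis
  using hom_closed[OF assms(3)] assms(4) B.M.minus_equality by simp
qed

lemma hom_minus:
 assumes "module R A" "module R B" "f : mod_hom R A B" "x : carrier A" "y : carrier A"
 shows "f (x -[A] y) = f x -[B] f y"
proof -
 interpret A: module R A by fact
 show ?thesis using hom_add[OF assms(3,4)] mod_hom_neg[OF assms(1-3)] assms(5)
  by (simp add: a_minus_def)
qed

lemma hom_comp:
 assumes "f : mod_hom R A B" "g : mod_hom R B C"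
 shows "(%x. g (f x)) : mod_hom R A C"
 using assms unfolding mod_hom_def by (auto simp: Pi_iff)

lemma mod_hom_id: "(%x. x) : mod_hom R A A"
 by (auto simp: mod_hom_def)

lemma mod_hom_cong:
 assumes "module R A" "f : mod_hom R A B" "!!x. x : carrier A ==> g x = f x"
 shows "g : mod_hom R A B"
proof -
 interpret A: module R A by fact
 show ?thesis using assms(2,3) by (auto simp: mod_hom_def Pi_iff)
qed

lemma module_zero_hom:
 assumes "module R A" "module R B"
 shows "(%x. \<zero>[B]) : mod_hom R A B"
proof -
 interpret B: module R B by fact
 show ?thesis by (rule mod_homI) auto
qed

lemma zero_mem: "module R A ==> \<zero>[A] : carrier A"
 by (simp add: module_def abelian_group_def abelian_monoid.zero_closed)

text \<open>Taking \<open>a\<close> to be one gives additivity; this forces \<open>f\<close> to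
  preserve zero by cancellation, and then \<open>y\<close> zero gives compatibility with
  scalars.\<close>

lemma mod_homI_linear:
 assumes "module R A" "module R B"
  and "!!x. x : carrier A ==> f x : carrier B"
  and "!!a x y. a : carrier R ==> x : carrier A ==> y : carrier A ==>
   f (a *[A] x +[A] y) = a *[B] f x +[B] f y"
 shows "f : mod_hom R A B"
proof -
 interpret A: module R A by fact
 interpret B: module R B by fact
 have add: "f (x +[A] y) = f x +[B] f y" if "x : carrier A" "y : carrier A" for x y
  using assms(4)[of "\<one>\<^bsub>R\<^esub>" x y] assms(3) that by simp
 have z: "f \<zero>[A] = \<zero>[B]"
  using add[of "\<zero>[A]" "\<zero>[A]"] assms(3)[of "\<zero>[A]"]
  by (metis A.M.zero_closed A.M.r_zero B.M.add.r_cancel_one' B.M.zero_closed)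
 show ?thesis
  using assms(3) add assms(4)[of _ _ "\<zero>[A]"] z by (intro mod_homI) auto
qed

text \<open>The module axioms are identities, so they pass to the image of any map that respects the
  operations. The target is a bare record here: this is how quotients and transported structures
  become modules.\<close>

lemma module_surj_image:
 assumes "module R A" "f ` carrier A = carrier E" "\<zero>[E] = f \<zero>[A]"
  and add: "!!x y. x : carrier A ==> y : carrier A ==> f (x +[A] y) = f x +[E] f y"
  and smult: "!!a x. a : carrier R ==> x : carrier A ==> f (a *[A] x) = a *[E] f x"
 shows "module R E"
proof -
 interpret A: module R A by fact
 have ex: "\<exists>x\<in>carrier A. u = f x" if "u : carrier E" for u
  using assms(2) that by auto
 have cl: "f x : carrier E" if "x : carrier A" for x
  using assms(2) that by auto
 have grp: "abelian_group E"
 proof (rule abelian_groupI)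
  show "u +[E] v : carrier E" if "u : carrier E" "v : carrier E" for u v
   using that[THEN ex] cl by (auto simp: add[symmetric])
  show "u +[E] v +[E] w = u +[E] (v +[E] w)"
   if "u : carrier E" "v : carrier E" "w : carrier E" for u v w
   using that[THEN ex] by (auto simp: add[symmetric] A.M.a_assoc)
  show "u +[E] v = v +[E] u" if "u : carrier E" "v : carrier E" for u v
   using that[THEN ex] by (auto simp: add[symmetric] A.M.a_comm)
  show "\<zero>[E] +[E] u = u" if "u : carrier E" for u
   using ex[OF that] by (auto simp: add[symmetric] assms(3))
  show "\<exists>y\<in>carrier E. y +[E] u = \<zero>[E]" if "u : carrier E" for u
  proof -
   from ex[OF that] obtain x where "x : carrier A" "u = f x" by blast
   thus ?thesis using cl
    by (intro bexI[of _ "f (\<ominus>\<^bsub>A\<^esub> x)"]) (simp_all add: add[symmetric] A.M.l_neg assms(3))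
  qed
  show "\<zero>[E] : carrier E" using assms(3) cl by simp
 qed
 show ?thesis
 proof (rule moduleI)
  show "cring R" by (rule A.R.is_cring)
  show "abelian_group E" by fact
  show "a *[E] u : carrier E" if "a : carrier R" "u : carrier E" for a u
   using that(1) ex[OF that(2)] cl by (auto simp: smult[symmetric])
  show "(a +[R] b) *[E] u = a *[E] u +[E] b *[E] u"
   if "a : carrier R" "b : carrier R" "u : carrier E" for a b u
   using that(1,2) ex[OF that(3)] by (auto simp: smult[symmetric] add[symmetric] A.smult_l_distr)
  show "a *[E] (u +[E] v) = a *[E] u +[E] a *[E] v"
   if "a : carrier R" "u : carrier E" "v : carrier E" for a u v
   using that(1) that(2,3)[THEN ex] by (auto simp: smult[symmetric] add[symmetric] A.smult_r_distr)
  show "(a \<otimes>\<^bsub>R\<^esub> b) *[E] u = a *[E] (b *[E] u)"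
   if "a : carrier R" "b : carrier R" "u : carrier E" for a b u
   using that(1,2) ex[OF that(3)] by (auto simp: smult[symmetric] A.smult_assoc1)
  show "\<one>\<^bsub>R\<^esub> *[E] u = u" if "u : carrier E" for u
   using ex[OF that] by (auto simp: smult[symmetric])
 qed
qed

lemma submoduleI':
 assumes "module R A" "Z \<subseteq> carrier A" "\<zero>[A] : Z"
  and "!!x y. x : Z ==> y : Z ==> x +[A] y : Z"
  and "!!a x. a : carrier R ==> x : Z ==> a *[A] x : Z"
 shows "submodule Z R A"
proof -
 interpret A: module R A by fact
 show ?thesis
 proof (rule A.submoduleI)
  fix x assume x: "x : Z"
  hence "\<ominus>\<^bsub>A\<^esub> x = (\<ominus>\<^bsub>R\<^esub> \<one>\<^bsub>R\<^esub>) *[A] x"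
   using assms(2) A.smult_l_minus[of "\<one>\<^bsub>R\<^esub>" x] by auto
  thus "\<ominus>\<^bsub>A\<^esub> x : Z" using assms(5) x by simp
 qed (use assms in auto)
qed

lemma
 assumes "submodule Z R A"
 shows submodule_subset: "x : Z ==> x : carrier A"
  and submodule_zero: "\<zero>[A] : Z"
  and submodule_add: "x : Z ==> y : Z ==> x +[A] y : Z"
  and submodule_smult: "a : carrier R ==> x : Z ==> a *[A] x : Z"
proof -
 interpret submodule Z R A by fact
 show "x : Z ==> x : carrier A" using subset by auto
 show "\<zero>[A] : Z" using one_closed by simp
 show "x : Z ==> y : Z ==> x +[A] y : Z" using m_closed by simp
 show "a : carrier R ==> x : Z ==> a *[A] x : Z" by simp
qed

lemma submodule_neg:
 assumes "module R A" "submodule Z R A" "x : Z"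
 shows "\<ominus>\<^bsub>A\<^esub> x : Z"
 using module.submoduleE(3)[OF assms(1,2)] assms(3) by simp

lemma submodule_minus:
 assumes "module R A" "submodule Z R A" "x : Z" "y : Z"
 shows "x -[A] y : Z"
 using submodule_add[OF assms(2,3)] submodule_neg[OF assms(1,2,4)] by (simp add: a_minus_def)

lemma submodule_module:
 "module R A ==> submodule Z R A ==> module R (A <| Z)"
 by (rule submodule.submodule_is_module)

text \<open>The relation \<open>E = A/N\<close> up to isomorphism, with projection
  \<open>\<kappa>\<close>. Only the part of \<open>N\<close> inside \<open>A\<close> matters, and
  \<open>E\<close> may be any model; so one \<open>E\<close> can serve at once as a subquotient of a
  filtered complex, as a cohomology group and as a term of a page.\<close>

definition quotient_map ::
 "'r ring => ('r, 'x) module => 'x set => ('x => 'e) => ('r, 'e) module => bool" where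
 "quotient_map R A N \<kappa> E \<longleftrightarrow> module R A \<and> module R E \<and> \<kappa> : mod_hom R A E \<and>
  \<kappa> ` carrier A = carrier E \<and> (\<forall>x\<in>carrier A. \<kappa> x = \<zero>[E] \<longleftrightarrow> x : N)"

lemma quotD:
 assumes "quotient_map R A N \<kappa> E"
 shows "module R A" "module R E" "\<kappa> : mod_hom R A E" "\<kappa> ` carrier A = carrier E"
  "!!x. x : carrier A ==> \<kappa> x = \<zero>[E] \<longleftrightarrow> x : N"
 using assms by (auto simp: quotient_map_def)

lemma quotient_map_surj:
 assumes "quotient_map R A N \<kappa> E" "u : carrier E"
 obtains x where "x : carrier A" "u = \<kappa> x"
 using quotD(4)[OF assms(1)] assms(2) by auto

lemma quotient_map_eq_iff:
 assumes "quotient_map R A N \<kappa> E" "x : carrier A" "y : carrier A"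
 shows "\<kappa> x = \<kappa> y \<longleftrightarrow> x -[A] y : N"
proof -
 note q = quotD[OF assms(1)]
 interpret A: module R A by fact
 interpret E: module R E by fact
 have "\<kappa> (x -[A] y) = \<kappa> x -[E] \<kappa> y" using hom_minus[OF q(1-3)] assms by simp
 moreover have "\<kappa> x : carrier E" "\<kappa> y : carrier E" using hom_closed[OF q(3)] assms by auto
 ultimately have "\<kappa> (x -[A] y) = \<zero>[E] \<longleftrightarrow> \<kappa> x = \<kappa> y"
  by (simp add: E.M.minus_zero_iff)
 thus ?thesis using q(5)[of "x -[A] y"] assms by simp
qed

text \<open>The map is \<open>f\<close> of a chosen preimage; the choice is harmless because two
  preimages differ by an element of \<open>N\<close>, on which \<open>f\<close> vanishes.\<close>

lemma quotient_map_descend: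
 assumes q: "quotient_map R A N \<kappa> E" and "module R B" "f : mod_hom R A B"
  and "!!x. x : carrier A ==> x : N ==> f x = \<zero>[B]"
 obtains g where "g : mod_hom R E B" "!!x. x : carrier A ==> g (\<kappa> x) = f x"
proof -
 note D = quotD[OF q]
 interpret A: module R A by fact
 interpret B: module R B by fact
 have wd: "f x = f y" if "x : carrier A" "y : carrier A" "\<kappa> x = \<kappa> y" for x y
 proof -
  have "x -[A] y : N" using quotient_map_eq_iff[OF q] that by simp
  hence "f x -[B] f y = \<zero>[B]"
   using assms(4)[of "x -[A] y"] hom_minus[OF D(1) assms(2,3)] that by simp
  moreover have "f x : carrier B" "f y : carrier B" using hom_closed[OF assms(3)] that by auto
  ultimately show ?thesis by (simp add: B.M.minus_zero_iff)
 qed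
 define g where "g u = f (SOME x. x : carrier A \<and> \<kappa> x = u)" for u
 have g: "g (\<kappa> x) = f x" if "x : carrier A" for x
  unfolding g_def using someI[of "%y. y : carrier A \<and> \<kappa> y = \<kappa> x" x] that
  by (intro wd) auto
 have "g : mod_hom R E B"
 proof (rule mod_homI)
  show "g u : carrier B" if "u : carrier E" for u
  proof -
   from that obtain x where "x : carrier A" "u = \<kappa> x" by (rule quotient_map_surj[OF q])
   thus ?thesis using g hom_closed[OF assms(3)] by simp
  qed
  show "g (a *[E] u) = a *[B] g u" if "a : carrier R" "u : carrier E" for a u
  proof -
   from that(2) obtain x where "x : carrier A" "u = \<kappa> x" by (rule quotient_map_surj[OF q])
   thus ?thesis
    using that(1) g[of "a *[A] x"] hom_smult[OF assms(3)] hom_smult[OF D(3)] by (simp add: g)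
  qed
  show "g (u +[E] v) = g u +[B] g v" if "u : carrier E" "v : carrier E" for u v
  proof -
   from that(1) obtain x where x: "x : carrier A" "u = \<kappa> x" by (rule quotient_map_surj[OF q])
   from that(2) obtain y where y: "y : carrier A" "v = \<kappa> y" by (rule quotient_map_surj[OF q])
   show ?thesis
    using x y g[of "x +[A] y"] hom_add[OF assms(3)] hom_add[OF D(3)] by (simp add: g)
  qed
 qed
 thus thesis using g that by blast
qed

lemma quotient_map_iso:
 assumes q: "quotient_map R A N \<kappa> E" and q': "quotient_map R A N \<kappa>' E'"
 obtains h where "h : mod_hom R E E'" "bij_betw h (carrier E) (carrier E')"
  "!!x. x : carrier A ==> h (\<kappa> x) = \<kappa>' x"
proof -
 obtain h where h: "h : mod_hom R E E'" "!!x. x : carrier A ==> h (\<kappa> x) = \<kappa>' x"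
  using quotD(5)[OF q'] by (auto intro: quotient_map_descend[OF q quotD(2,3)[OF q']])
 have "inj_on h (carrier E)"
 proof (rule inj_onI)
  fix u v assume *: "u : carrier E" "v : carrier E" "h u = h v"
  obtain x where x: "x : carrier A" "u = \<kappa> x" using *(1) by (rule quotient_map_surj[OF q])
  obtain y where "y : carrier A" "v = \<kappa> y" using *(2) by (rule quotient_map_surj[OF q])
  thus "u = v"
   using x * h(2) quotient_map_eq_iff[OF q] quotient_map_eq_iff[OF q'] by simp
 qed
 moreover have "h ` carrier E = carrier E'"
  unfolding quotD(4)[OF q, symmetric] quotD(4)[OF q', symmetric] image_image
  using h(2) by (intro image_cong) auto
 ultimately show thesis using that h by (auto simp: bij_betw_def)
qed

lemma quotient_map_isomorphic:
 assumes "quotient_map R A N \<kappa> E" "quotient_map R A N \<kappa>' E'"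
 shows "mod_isomorphic R E E'"
 using quotient_map_iso[OF assms] unfolding mod_isomorphic_def by blast

text \<open>\<open>f\<close> need not be onto: it suffices that it meets every class modulo
  \<open>N\<close>, and then \<open>B\<close> modulo the preimage of \<open>N\<close> is the same
  quotient. This is the main device for identifying subquotients of different complexes.\<close>

lemma quotient_map_precomp:
 assumes q: "quotient_map R A N \<kappa> E" and "module R B" "f : mod_hom R B A"
  and "!!x. x : carrier A ==> \<exists>y\<in>carrier B. \<kappa> (f y) = \<kappa> x"
  and "!!y. y : carrier B ==> f y : N \<longleftrightarrow> y : N'"
 shows "quotient_map R B N' (%y. \<kappa> (f y)) E"
 unfolding quotient_map_def
proof (intro conjI ballI)
 note D = quotD[OF q]
 show "(%y. \<kappa> (f y)) : mod_hom R B E" using hom_comp assms(3) D(3) by blast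
 show "(%y. \<kappa> (f y)) ` carrier B = carrier E"
 proof
  show "(%y. \<kappa> (f y)) ` carrier B \<subseteq> carrier E"
   using hom_closed[OF assms(3)] hom_closed[OF D(3)] by auto
  show "carrier E \<subseteq> (%y. \<kappa> (f y)) ` carrier B"
  proof
   fix u assume "u : carrier E"
   then obtain x where "x : carrier A" "\<kappa> x = u" by (rule quotient_map_surj[OF q]) simp
   moreover obtain y where "y : carrier B" "\<kappa> (f y) = \<kappa> x"
    using assms(4)[OF \<open>x : carrier A\<close>] by blast
   ultimately have "y : carrier B" "u = \<kappa> (f y)" by simp_all
   thus "u : (%y. \<kappa> (f y)) ` carrier B" by blast
  qed
 qed
 show "\<kappa> (f y) = \<zero>[E] \<longleftrightarrow> y : N'" if "y : carrier B" for y
  using D(5)[of "f y"] assms(5) hom_closed[OF assms(3)] that by simp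
qed (use assms quotD[OF q] in auto)

lemma quotient_map_quot_mod:
 assumes "module R A" "submodule N R A"
 shows "quotient_map R A N (%x. N +>\<^bsub>A\<^esub> x) (quot_mod A N)"
proof -
 interpret A: module R A by fact
 interpret N: abelian_subgroup N A
  using submodule.axioms(1)[OF assms(2)]
  by (intro abelian_subgroupI3 additive_subgroupI) (auto intro: A.M.abelian_group_axioms)
 have carr: "carrier (quot_mod A N) = (%x. N +>\<^bsub>A\<^esub> x) ` carrier A"
  by (auto simp: quot_mod_def A_RCOSETS_def')
 have add: "N +>\<^bsub>A\<^esub> (x +[A] y) = (N +>\<^bsub>A\<^esub> x) +[quot_mod A N] (N +>\<^bsub>A\<^esub> y)"
  if "x : carrier A" "y : carrier A" for x y
  using that N.a_rcos_sum by (simp add: quot_mod_def)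
 have smult: "N +>\<^bsub>A\<^esub> (a *[A] x) = a *[quot_mod A N] (N +>\<^bsub>A\<^esub> x)"
  if "a : carrier R" "x : carrier A" for a x
 proof -
  \<comment> \<open>\<open>quot_mod\<close> scales a coset by a union over its elements; all members
    of that union are the coset of \<open>a *[A] x\<close>, so the union collapses.\<close>
  have "N +>\<^bsub>A\<^esub> (a *[A] u) = N +>\<^bsub>A\<^esub> (a *[A] x)" if "u : N +>\<^bsub>A\<^esub> x" for u
  proof -
   have "\<exists>n\<in>N. u = n +[A] x" using that unfolding a_r_coset_def' by simp
   then obtain n where n: "n : N" "u = n +[A] x" by blast
   have "a *[A] u = a *[A] n +[A] a *[A] x"
    using n \<open>a : carrier R\<close> \<open>x : carrier A\<close> by (simp add: A.smult_r_distr)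
   moreover have "a *[A] n : N" using submodule_smult[OF assms(2)] n \<open>a : carrier R\<close> by simp
   ultimately have "a *[A] u : N +>\<^bsub>A\<^esub> (a *[A] x)"
    unfolding a_r_coset_def' by blast
   thus ?thesis
    using N.a_repr_independence' \<open>a : carrier R\<close> \<open>x : carrier A\<close> by simp
  qed
  hence "(\<Union>u\<in>N +>\<^bsub>A\<^esub> x. N +>\<^bsub>A\<^esub> (a *[A] u)) = N +>\<^bsub>A\<^esub> (a *[A] x)"
   using N.a_rcos_self[OF that(2)] by blast
  thus ?thesis by (simp add: quot_mod_def)
 qed
 have zero: "\<zero>[quot_mod A N] = N +>\<^bsub>A\<^esub> \<zero>[A]"
  using N.a_subset by (simp add: quot_mod_def)
 have "module R (quot_mod A N)"
  by (rule module_surj_image[OF assms(1) carr[symmetric] zero add smult])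
 moreover have "(%x. N +>\<^bsub>A\<^esub> x) : mod_hom R A (quot_mod A N)"
  by (rule mod_homI) (auto simp: carr add smult)
 moreover have "N +>\<^bsub>A\<^esub> x = \<zero>[quot_mod A N] \<longleftrightarrow> x : N" if "x : carrier A" for x
  using that N.a_rcos_self[OF that] N.a_rcos_const by (auto simp: quot_mod_def)
 ultimately show ?thesis using assms(1) carr by (auto simp: quotient_map_def)
qed

text \<open>Relabels the elements along an injection, so that a quotient whose elements are cosets
  can be given elements of a prescribed type.\<close>

lemma module_transport:
 assumes "module R Q" "inj_on j (carrier Q)"
 obtains E where "module R E" "carrier E = j ` carrier Q" "j : mod_hom R Q E"
proof -
 interpret Q: module R Q by fact
 let ?i = "inv_into (carrier Q) j"
 define E where "E = \<lparr>carrier = j ` carrier Q, monoid.mult = (%_ _. j \<zero>[Q]), one = j \<zero>[Q],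
  ring.zero = j \<zero>[Q], ring.add = (%u v. j (?i u +[Q] ?i v)), module.smult = (%a u. j (a *[Q] ?i u))\<rparr>"
 have "module R E"
  by (rule module_surj_image[OF assms(1), of j]) (insert assms(2), auto simp: E_def)
 moreover have "j : mod_hom R Q E"
  by (rule mod_homI) (insert assms(2), auto simp: E_def)
 ultimately show thesis using that by (auto simp: E_def)
qed

text \<open>Inverses are defined by reference to the carrier of a record, so subtraction in a
  submodule is a different term from subtraction in \<open>A\<close>; uniqueness of negatives
  identifies the two.\<close>

lemma minus_restrict_carrier:
 assumes A: "module R A" and Z: "submodule Z R A" and y: "y : Z"
 shows "x -[A <| Z] y = x -[A] y"
proof -
 interpret A: module R A by fact
 interpret C: module R "A <| Z" by (rule submodule_module[OF A Z])
 let ?m = "\<ominus>\<^bsub>A <| Z\<^esub> y"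
 have "?m : Z" "?m +[A] y = \<zero>[A]"
  using C.M.a_inv_closed[of y] C.M.l_neg[of y] y by auto
 hence "\<ominus>\<^bsub>A\<^esub> y = ?m"
  using A.M.minus_equality[of ?m y] submodule_subset[OF Z] y by blast
 thus ?thesis by (simp add: a_minus_def)
qed

lemma quotient_restrict_eq_iff:
 assumes "quotient_map R (A <| Z) N \<kappa> E" "module R A" "submodule Z R A" "x : Z" "y : Z"
 shows "\<kappa> x = \<kappa> y \<longleftrightarrow> x -[A] y : N"
 using quotient_map_eq_iff[OF assms(1), of x y] minus_restrict_carrier[OF assms(2,3,5)] assms(4,5) by simp

text \<open>All pages of a spectral sequence have one element type, here that of the second page.\<close>

lemma small_quotient:
 assumes q2: "quotient_map R A N\<^sub>2 \<kappa>\<^sub>2 (E2 :: ('r, 'e) module)"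
  and Z: "submodule Z R A" and N: "submodule N R (A <| Z)" and "N\<^sub>2 \<inter> Z \<subseteq> N"
 obtains \<kappa> and E :: "('r, 'e) module" where "quotient_map R (A <| Z) N \<kappa> E"
proof -
 note D2 = quotD[OF q2]
 interpret A: module R A by fact
 let ?Z = "A <| Z" let ?Q = "quot_mod ?Z N" let ?k = "%x. N +>\<^bsub>?Z\<^esub> x"
 have mZ: "module R ?Z" using submodule_module[OF D2(1) Z] .
 note q = quotient_map_quot_mod[OF mZ N]
 \<comment> \<open>A coset is sent to the class in \<open>E2\<close> of one of its representatives,
   which places it in the type \<open>'e\<close>.\<close>
 define j where "j U = \<kappa>\<^sub>2 (SOME x. x : Z \<and> ?k x = U)" for U
 have ex: "\<exists>x. x : Z \<and> ?k x = U \<and> j U = \<kappa>\<^sub>2 x" if "U : carrier ?Q" for U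
 proof -
  have "\<exists>x. x : Z \<and> ?k x = U" by (rule quotient_map_surj[OF q that]) auto
  from someI_ex[OF this] show ?thesis unfolding j_def by blast
 qed
 \<comment> \<open>Equal classes in \<open>E2\<close> mean that the representatives differ by an
   element of \<open>N\<^sub>2\<close>; as both lie in \<open>Z\<close>, the difference lies in
   \<open>N\<close>.\<close>
 have "inj_on j (carrier ?Q)"
 proof (rule inj_onI)
  fix U V assume *: "U : carrier ?Q" "V : carrier ?Q" "j U = j V"
  obtain x y where xy: "x : Z" "?k x = U" "j U = \<kappa>\<^sub>2 x" "y : Z" "?k y = V" "j V = \<kappa>\<^sub>2 y"
   using ex * by meson
  have c: "x : carrier A" "y : carrier A" using xy submodule_subset[OF Z] by auto
  have "x -[A] y : N"
   using xy * quotient_map_eq_iff[OF q2 c] assms(4) submodule_minus[OF D2(1) Z] by auto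
  hence "?k (x -[A] y) = \<zero>[?Q]"
   using quotD(5)[OF q] submodule_subset[OF N] by auto
  have "?k ((x -[A] y) +[?Z] y) = ?k (x -[A] y) +[?Q] ?k y"
   using hom_add[OF quotD(3)[OF q]] submodule_minus[OF D2(1) Z] xy by simp
  moreover have "(x -[A] y) +[?Z] y = x" using c by simp algebra
  moreover interpret Q: module R ?Q using quotD(2)[OF q] .
  have "?k y : carrier ?Q" using * xy by simp
  ultimately have "?k x = ?k y" using \<open>?k (x -[A] y) = \<zero>[?Q]\<close> by simp
  thus "U = V" using xy by simp
 qed
 then obtain E where E: "module R E" "carrier E = j ` carrier ?Q" "j : mod_hom R ?Q E"
  using module_transport[OF quotD(2)[OF q]] by blast
 have "quotient_map R ?Z N (%x. j (?k x)) E"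
  unfolding quotient_map_def
 proof (intro conjI ballI)
  show "(%x. j (?k x)) : mod_hom R ?Z E" using hom_comp[OF quotD(3)[OF q] E(3)] .
  show "(%x. j (?k x)) ` carrier ?Z = carrier E" by (simp only: E(2) quotD(4)[OF q, symmetric] image_image)
  fix x assume x: "x : carrier ?Z"
  have "j (?k x) = j \<zero>[?Q] \<longleftrightarrow> ?k x = \<zero>[?Q]"
   using \<open>inj_on j _\<close> quotD(4)[OF q] x zero_mem[OF quotD(2)[OF q]]
   by (intro inj_on_eq_iff[of j "carrier ?Q"]) auto
  thus "j (?k x) = \<zero>[E] \<longleftrightarrow> x : N"
   using hom_zero[OF quotD(2)[OF q] E(1,3)] quotD(5)[OF q x] by simp
 qed (use mZ E in auto)
 thus thesis using that by blast
qed

section \<open>The spectral sequence of a filtered complex\<close>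

text \<open>Degrees and filtration indices are integers, so that shifts such as
  \<open>p - r + 1\<close> are never truncated. \<open>F_low\<close> and \<open>F_high\<close> make
  the filtration finite in each degree, which is what convergence rests on.\<close>

locale filtered_complex =
 fixes R :: "'r ring" and T :: "int => ('r, 't) module" and d :: "int => 't => 't"
  and F :: "int => int => 't set"
 assumes T: "module R (T n)"
  and d: "d n : mod_hom R (T n) (T (n + 1))"
  and d_d: "x : carrier (T n) ==> d (n + 1) (d n x) = \<zero>[T (n + 1 + 1)]"
  and F_submodule: "submodule (F p n) R (T n)"
  and F_Suc: "F (p + 1) n \<subseteq> F p n"
  and F_low: "p \<le> 0 ==> F p n = carrier (T n)"
  and F_high: "n < p ==> F p n = {\<zero>[T n]}"
  and d_F: "x : F p n ==> d n x : F p (n + 1)"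
begin

definition cyc :: "nat => int => int => 't set" where
 "cyc r p n = {x : F p n. d n x : F (p + int r) (n + 1)}"

text \<open>Writing \<open>Z_r^p\<close> for \<open>cyc r p\<close>, this is
  \<open>d(Z_{r-1}^{p-r+1}) + Z_{r-1}^{p+1}\<close> for \<open>r \<ge> 1\<close>, the usual
  denominator of \<open>E_r^p\<close>: the conditions on \<open>d w\<close> and on the remainder say
  that \<open>w\<close> and the remainder lie in these two groups.\<close>

definition bnd :: "nat => int => int => 't set" where
 "bnd r p n = {x : cyc r p n. \<exists>w\<in>F (p - int r + 1) (n - 1).
  d (n - 1) w : F p n \<and> x -[T n] d (n - 1) w : F (p + 1) n}"

lemma d': "d (n - 1) : mod_hom R (T (n - 1)) (T n)"
 using d[of "n - 1"] by simp

lemma d_d': "x : carrier (T (n - 1)) ==> d n (d (n - 1) x) = \<zero>[T (n + 1)]"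
 using d_d[of x "n - 1"] by simp

lemma F_antimono: "p \<le> p' ==> x : F p' n ==> x : F p n"
proof (induction p' rule: int_ge_induct)
 case (step i)
 thus ?case using F_Suc by blast
qed

lemma F_carrier: "x : F p n ==> x : carrier (T n)"
 using submodule_subset[OF F_submodule] by blast

lemmas F_add = submodule_add[OF F_submodule]
lemmas F_minus = submodule_minus[OF T F_submodule]

lemma d_closed: "x : carrier (T n) ==> d n x : carrier (T (n + 1))"
 using hom_closed[OF d] .

lemma d_closed': "x : carrier (T (n - 1)) ==> d (n - 1) x : carrier (T n)"
 using hom_closed[OF d'] .

lemma d_minus: "x : carrier (T n) ==> y : carrier (T n) ==> d n (x -[T n] y) = d n x -[T (n + 1)] d n y"
 using hom_minus[OF T T d] .

lemma d_zero: "d n \<zero>[T n] = \<zero>[T (n + 1)]"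
 using hom_zero[OF T T d] .

lemma d_zero': "d (n - 1) \<zero>[T (n - 1)] = \<zero>[T n]"
 using hom_zero[OF T T d'] .

lemma cycD: "x : cyc r p n ==> x : F p n" "x : cyc r p n ==> d n x : F (p + int r) (n + 1)"
 by (auto simp: cyc_def)

lemma cyc_carrier: "x : cyc r p n ==> x : carrier (T n)"
 using cycD F_carrier by blast

lemma cyc_submodule: "submodule (cyc r p n) R (T n)"
 by (rule submoduleI'[OF T]) (auto simp: cyc_def F_carrier submodule_zero[OF F_submodule] d_zero
  F_add submodule_smult[OF F_submodule] hom_add[OF d] hom_smult[OF d])

lemma cyc_module: "module R (T n <| cyc r p n)"
 by (rule submodule_module[OF T cyc_submodule])

lemma cyc_antimono: "r \<le> s ==> x : cyc s p n ==> x : cyc r p n"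
 using F_antimono[of "p + int r" "p + int s"] by (auto simp: cyc_def)

lemma bndI:
 "x : cyc r p n ==> w : F (p - int r + 1) (n - 1) ==> d (n - 1) w : F p n ==>
  x -[T n] d (n - 1) w : F (p + 1) n ==> x : bnd r p n"
 by (auto simp: bnd_def)

lemma bnd_cyc: "x : bnd r p n ==> x : cyc r p n"
 by (auto simp: bnd_def)

lemma bndE:
 assumes "x : bnd r p n"
 obtains w where "w : F (p - int r + 1) (n - 1)" "d (n - 1) w : F p n"
  "x -[T n] d (n - 1) w : F (p + 1) n"
 using assms by (auto simp: bnd_def)

text \<open>These elements are the summand of the denominator that has deeper filtration; the
  witness is zero.\<close>

lemma bnd_F:
 assumes "x : cyc r p n" "x : F (p + 1) n"
 shows "x : bnd r p n"
proof -
 interpret T: module R "T n" by (rule T)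
 have "x -[T n] \<zero>[T n] = x" using F_carrier[OF assms(2)] by algebra
 thus ?thesis
  by (intro bndI[of _ _ _ _ "\<zero>[T (n - 1)]"])
   (insert assms submodule_zero[OF F_submodule], simp_all add: d_zero')
qed

lemma bnd_submodule: "submodule (bnd r p n) R (T n <| cyc r p n)"
proof (rule submoduleI'[OF cyc_module])
 interpret T: module R "T n" by (rule T)
 interpret T': module R "T (n - 1)" by (rule T)
 show "\<zero>[T n <| cyc r p n] : bnd r p n"
  using bnd_F[of "\<zero>[T n]"] submodule_zero[OF F_submodule] submodule_zero[OF cyc_submodule] by simp
 show "x +[T n <| cyc r p n] y : bnd r p n" if "x : bnd r p n" "y : bnd r p n" for x y
 proof -
  from that(1) obtain v where v: "v : F (p - int r + 1) (n - 1)" "d (n - 1) v : F p n"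
   "x -[T n] d (n - 1) v : F (p + 1) n" by (rule bndE)
  from that(2) obtain w where w: "w : F (p - int r + 1) (n - 1)" "d (n - 1) w : F p n"
   "y -[T n] d (n - 1) w : F (p + 1) n" by (rule bndE)
  have c: "x : carrier (T n)" "y : carrier (T n)" "d (n - 1) v : carrier (T n)" "d (n - 1) w : carrier (T n)"
   using that bnd_cyc cyc_carrier v w F_carrier by blast+
  have "d (n - 1) (v +[T (n - 1)] w) = d (n - 1) v +[T n] d (n - 1) w"
   using hom_add[OF d'] v w F_carrier by blast
  moreover have "(x +[T n] y) -[T n] (d (n - 1) v +[T n] d (n - 1) w) =
    (x -[T n] d (n - 1) v) +[T n] (y -[T n] d (n - 1) w)"
   using c by algebra
  ultimately have "x +[T n] y : bnd r p n"
   using v w that bnd_cyc submodule_add[OF cyc_submodule] F_add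
   by (intro bndI[of _ _ _ _ "v +[T (n - 1)] w"]) auto
  thus ?thesis by simp
 qed
 show "a *[T n <| cyc r p n] x : bnd r p n" if "a : carrier R" "x : bnd r p n" for a x
 proof -
  from that(2) obtain v where v: "v : F (p - int r + 1) (n - 1)" "d (n - 1) v : F p n"
   "x -[T n] d (n - 1) v : F (p + 1) n" by (rule bndE)
  have c: "x : carrier (T n)" "d (n - 1) v : carrier (T n)" "v : carrier (T (n - 1))"
   using that bnd_cyc cyc_carrier v F_carrier by blast+
  have "d (n - 1) (a *[T (n - 1)] v) = a *[T n] d (n - 1) v"
   using hom_smult[OF d' that(1)] c by blast
  moreover have "(a *[T n] x) -[T n] (a *[T n] d (n - 1) v) = a *[T n] (x -[T n] d (n - 1) v)"
   using c that(1) by (simp add: a_minus_def T.smult_r_distr T.smult_r_minus)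
  ultimately have "a *[T n] x : bnd r p n"
   using v that bnd_cyc submodule_smult[OF cyc_submodule] submodule_smult[OF F_submodule]
   by (intro bndI[of _ _ _ _ "a *[T (n - 1)] v"]) auto
  thus ?thesis by simp
 qed
qed (auto intro: bnd_cyc)

lemma d_cyc: "x : cyc r p n ==> d n x : cyc s (p + int r) (n + 1)"
 using submodule_zero[OF F_submodule] by (auto simp: cyc_def d_d F_carrier)

lemma d_cyc_hom:
 "d n : mod_hom R (T n <| cyc r p n) (T (n + 1) <| cyc s (p + int r) (n + 1))"
 by (rule mod_homI) (auto intro: d_cyc hom_add[OF d] hom_smult[OF d] cyc_carrier)

text \<open>Replacing \<open>x\<close> by \<open>x - d w\<close> does not change its differential,
  and the new element lies in \<open>F (p + 1) n\<close>. This is exactly the depth that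
  \<open>bnd\<close> requires of a witness at \<open>p + r\<close>.\<close>

lemma d_bnd:
 assumes "x : bnd r p n" shows "d n x : bnd r (p + int r) (n + 1)"
proof -
 interpret T1: module R "T (n + 1)" by (rule T)
 interpret T: module R "T n" by (rule T)
 from assms obtain w where w: "w : F (p - int r + 1) (n - 1)" "d (n - 1) w : F p n"
  "x -[T n] d (n - 1) w : F (p + 1) n" by (rule bndE)
 let ?y = "x -[T n] d (n - 1) w"
 have c: "x : carrier (T n)" "w : carrier (T (n - 1))" using assms bnd_cyc cyc_carrier w F_carrier by blast+
 have e: "d n ?y = d n x"
  using d_minus[OF c(1) d_closed'[OF c(2)]] d_closed[OF c(1)] d_d'[OF c(2)] by algebra
 show ?thesis
  by (rule bndI[of _ _ _ _ ?y])
   (insert assms w c e bnd_cyc d_cyc cycD submodule_zero[OF F_submodule] d_closed, auto simp: a_minus_def T1.M.r_neg)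
qed

text \<open>If the class of \<open>x\<close> is killed by the differential of the page, then
  \<open>d x\<close> agrees, up to one step deeper, with \<open>d w\<close> for some
  \<open>w\<close> of depth \<open>p + 1\<close>. So \<open>x - w\<close> lies in the next cycle
  group and has the same class as \<open>x\<close>. Hence the next cycle group maps onto the
  homology of the page, and it remains to see that the kernel is the next boundary group.\<close>

lemma page_homology:
 assumes q0: "quotient_map R (T (n - 1) <| cyc r (p - int r) (n - 1)) (bnd r (p - int r) (n - 1)) \<kappa>\<^sub>0 E0"
  and q1: "quotient_map R (T n <| cyc r p n) (bnd r p n) \<kappa>\<^sub>1 E1"
  and q2: "quotient_map R (T (n + 1) <| cyc r (p + int r) (n + 1)) (bnd r (p + int r) (n + 1)) \<kappa>\<^sub>2 E2"
  and q': "quotient_map R (T n <| cyc (Suc r) p n) (bnd (Suc r) p n) \<kappa>' E'"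
  and d0: "d\<^sub>0 : mod_hom R E0 E1" "!!x. x : cyc r (p - int r) (n - 1) ==> d\<^sub>0 (\<kappa>\<^sub>0 x) = \<kappa>\<^sub>1 (d (n - 1) x)"
  and d1: "d\<^sub>1 : mod_hom R E1 E2" "!!x. x : cyc r p n ==> d\<^sub>1 (\<kappa>\<^sub>1 x) = \<kappa>\<^sub>2 (d n x)"
 shows "mod_isomorphic R E' (quot_mod (E1 <| mod_ker E1 E2 d\<^sub>1) (d\<^sub>0 ` carrier E0))"
proof -
 interpret T: module R "T n" by (rule T)
 note Q0 = quotD[OF q0] note Q1 = quotD[OF q1] note Q2 = quotD[OF q2]
 interpret E0: module R E0 by (rule Q0)
 interpret E1: module R E1 by (rule Q1)
 interpret E2: module R E2 by (rule Q2)
 let ?K = "mod_ker E1 E2 d\<^sub>1" let ?I = "d\<^sub>0 ` carrier E0"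
 have k1: "\<kappa>\<^sub>1 x : carrier E1" if "x : cyc r p n" for x using hom_closed[OF Q1(3)] that by simp
 have I: "?I = (%x. \<kappa>\<^sub>1 (d (n - 1) x)) ` cyc r (p - int r) (n - 1)"
  unfolding Q0(4)[symmetric] image_image by (intro image_cong) (simp_all add: d0(2))
 have K: "submodule ?K R E1"
  by (rule submoduleI') (auto simp: mod_ker_def E1.module_axioms hom_zero[OF Q1(2) Q2(2) d1(1)]
    hom_add[OF d1(1)] hom_smult[OF d1(1)])
 have cyc_mono: "x : cyc r p n" if "x : cyc (Suc r) p n" for x using cyc_antimono[of r "Suc r"] that by simp
 have d_in: "d (n - 1) v : cyc s p n" if "v : cyc r (p - int r) (n - 1)" for v s
  using d_cyc[OF that] by simp
 have sub_I: "submodule ?I R (E1 <| ?K)"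
 proof (rule submoduleI'[OF submodule_module[OF Q1(2) K]])
  have "\<kappa>\<^sub>1 (d (n - 1) v) : ?K" if v: "v : cyc r (p - int r) (n - 1)" for v
  proof -
   have "d n (d (n - 1) v) = \<zero>[T (n + 1)]" using v cyc_carrier d_d' by blast
   hence "d\<^sub>1 (\<kappa>\<^sub>1 (d (n - 1) v)) = \<zero>[E2]"
    using d1(2)[OF d_in[OF v]] hom_zero[OF Q2(1-3)] by simp
   thus ?thesis using k1[OF d_in[OF v]] by (simp add: mod_ker_def)
  qed
  thus "?I \<subseteq> carrier (E1 <| ?K)" unfolding I by auto
  show "\<zero>[E1 <| ?K] : ?I"
   using hom_zero[OF Q0(2) Q1(2) d0(1)] by (auto intro!: image_eqI[of _ _ "\<zero>[E0]"])
  show "x +[E1 <| ?K] y : ?I" if "x : ?I" "y : ?I" for x y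
   using that by (auto simp: hom_add[OF d0(1), symmetric])
  show "a *[E1 <| ?K] x : ?I" if "a : carrier R" "x : ?I" for a x
   using that by (auto simp: hom_smult[OF d0(1), symmetric])
 qed
 note qI = quotient_map_quot_mod[OF submodule_module[OF Q1(2) K] sub_I]
 have "quotient_map R (T n <| cyc (Suc r) p n) (bnd (Suc r) p n)
  (%x. ?I +>\<^bsub>E1 <| ?K\<^esub> \<kappa>\<^sub>1 x) (quot_mod (E1 <| ?K) ?I)"
 proof (rule quotient_map_precomp[OF qI cyc_module])
  have "d\<^sub>1 (\<kappa>\<^sub>1 x) = \<zero>[E2]" if x: "x : cyc (Suc r) p n" for x
  proof -
   have "d n x : F (p + int r + 1) (n + 1)" using cycD(2)[OF x] by (simp add: algebra_simps)
   hence "d n x : bnd r (p + int r) (n + 1)" using bnd_F d_cyc[OF cyc_mono[OF x]] by blast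
   thus ?thesis using d1(2)[OF cyc_mono[OF x]] Q2(5) bnd_cyc by simp
  qed
  thus "\<kappa>\<^sub>1 : mod_hom R (T n <| cyc (Suc r) p n) (E1 <| ?K)"
   using k1 cyc_mono hom_add[OF Q1(3)] hom_smult[OF Q1(3)]
   by (intro mod_homI) (auto simp: mod_ker_def)
 next
  fix u assume "u : carrier (E1 <| ?K)"
  hence u: "u : carrier E1" "d\<^sub>1 u = \<zero>[E2]" by (auto simp: mod_ker_def)
  obtain x where x: "x : cyc r p n" "u = \<kappa>\<^sub>1 x" using quotient_map_surj[OF q1 u(1)] by auto
  have "d n x : bnd r (p + int r) (n + 1)" using u d1(2)[OF x(1)] x Q2(5) d_cyc[OF x(1)] by simp
  then obtain w where w: "w : F (p + 1) n" "d n w : F (p + int r) (n + 1)"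
   "d n x -[T (n + 1)] d n w : F (p + int r + 1) (n + 1)"
   by (rule bndE) simp
  have wc: "w : cyc r p n" using w F_Suc by (auto simp: cyc_def)
  have c: "x : carrier (T n)" "w : carrier (T n)" using x wc cyc_carrier by blast+
  have "x -[T n] w : cyc (Suc r) p n"
   using F_minus[OF cycD(1)[OF x(1)] cycD(1)[OF wc]] w(3) d_minus[OF c] by (simp add: cyc_def add.assoc add.commute[of 1])
  moreover have "\<kappa>\<^sub>1 (x -[T n] w) = \<kappa>\<^sub>1 x"
  proof -
   have xw: "x -[T n] w : cyc r p n" using submodule_minus[OF T cyc_submodule x(1) wc] .
   have "x -[T n] (x -[T n] w) = w" using c by algebra
   thus ?thesis
    using quotient_restrict_eq_iff[OF q1 T cyc_submodule x(1) xw] bnd_F[OF wc w(1)] by simp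
  qed
  ultimately show "\<exists>y\<in>carrier (T n <| cyc (Suc r) p n).
    ?I +>\<^bsub>E1 <| ?K\<^esub> \<kappa>\<^sub>1 y = ?I +>\<^bsub>E1 <| ?K\<^esub> u"
   using x by (intro bexI[of _ "x -[T n] w"]) auto
 next
  fix x assume "x : carrier (T n <| cyc (Suc r) p n)"
  hence x: "x : cyc (Suc r) p n" by simp
  show "\<kappa>\<^sub>1 x : ?I \<longleftrightarrow> x : bnd (Suc r) p n"
  proof
   assume "\<kappa>\<^sub>1 x : ?I"
   then obtain v where v: "v : cyc r (p - int r) (n - 1)" "\<kappa>\<^sub>1 x = \<kappa>\<^sub>1 (d (n - 1) v)" unfolding I by auto
   have "x -[T n] d (n - 1) v : bnd r p n"
    using quotient_restrict_eq_iff[OF q1 T cyc_submodule cyc_mono[OF x] d_in[OF v(1)]] v(2) by simp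
   then obtain w where w: "w : F (p - int r + 1) (n - 1)" "d (n - 1) w : F p n"
    "x -[T n] d (n - 1) v -[T n] d (n - 1) w : F (p + 1) n" by (auto elim: bndE)
   have c: "v : carrier (T (n - 1))" "w : carrier (T (n - 1))" "x : carrier (T n)"
    using v(1) w(1) x cyc_carrier F_carrier by blast+
   have "w : F (p - int r) (n - 1)" using F_antimono[OF _ w(1)] by simp
   \<comment> \<open>Up to deeper filtration \<open>x\<close> is \<open>d v + d w\<close>, with
     \<open>v\<close> from the differential of the page and \<open>w\<close> from its boundaries.
     The sum \<open>v + w\<close> has depth \<open>p - r\<close>, which is what \<open>bnd\<close>
     allows for the exponent \<open>r + 1\<close>.\<close>
   hence "v +[T (n - 1)] w : F (p - int r) (n - 1)" using cycD(1)[OF v(1)] F_add by blast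
   moreover have e: "d (n - 1) (v +[T (n - 1)] w) = d (n - 1) v +[T n] d (n - 1) w"
    using hom_add[OF d'] c by blast
   moreover have "d (n - 1) v +[T n] d (n - 1) w : F p n"
    using w(2) d_in[OF v(1)] cycD(1) F_add by blast
   moreover have "x -[T n] (d (n - 1) v +[T n] d (n - 1) w) = x -[T n] d (n - 1) v -[T n] d (n - 1) w"
    using c(3) d_closed'[OF c(1)] d_closed'[OF c(2)] by algebra
   ultimately show "x : bnd (Suc r) p n"
    using w(3) x by (intro bndI[of _ _ _ _ "v +[T (n - 1)] w"]) (auto simp: algebra_simps)
  next
   assume "x : bnd (Suc r) p n"
   then obtain v where v: "v : F (p - int r) (n - 1)" "d (n - 1) v : F p n"
    "x -[T n] d (n - 1) v : F (p + 1) n" by (rule bndE) (simp add: algebra_simps)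
   have vc: "v : cyc r (p - int r) (n - 1)" using v by (simp add: cyc_def)
   let ?y = "d (n - 1) v"
   have y: "?y : cyc r p n" using d_in[OF vc] .
   have m: "x -[T n] ?y : cyc r p n" using submodule_minus[OF T cyc_submodule cyc_mono[OF x] y] .
   hence "\<kappa>\<^sub>1 x = \<kappa>\<^sub>1 ?y"
    using quotient_restrict_eq_iff[OF q1 T cyc_submodule cyc_mono[OF x] y] bnd_F[OF m v(3)] by simp
   thus "\<kappa>\<^sub>1 x : ?I" unfolding I using vc by blast
  qed
 qed
 thus ?thesis using quotient_map_isomorphic[OF q'] by blast
qed

text \<open>The differential of each page is induced by \<open>d\<close> on representatives, and all
  its properties are read off from that.\<close>

theorem spectral_sequence:
 assumes q: "!!r p q. 2 \<le> r ==>
  quotient_map R (T (p + q) <| cyc r p (p + q)) (bnd r p (p + q)) (\<kappa> r p q) (E r p q)"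
 obtains \<delta> where "first_quadrant_spectral_sequence R E \<delta>"
proof -
 have idx: "p + int r + (q - int r + 1) = p + q + 1" "p - int r + (q + int r - 1) = p + q - 1" for p q r
  by auto
 have "\<exists>g\<in>mod_hom R (E r p q) (E r (p + int r) (q - int r + 1)).
   \<forall>x\<in>cyc r p (p + q). g (\<kappa> r p q x) = \<kappa> r (p + int r) (q - int r + 1) (d (p + q) x)"
  if r: "2 \<le> r" for r p q
 proof -
  note q1 = q[OF r, of p q] and q2 = q[OF r, of "p + int r" "q - int r + 1", unfolded idx]
  show ?thesis
  proof (rule quotient_map_descend[OF q1 quotD(2)[OF q2] hom_comp[OF d_cyc_hom quotD(3)[OF q2]]])
   show "\<kappa> r (p + int r) (q - int r + 1) (d (p + q) x) = \<zero>[E r (p + int r) (q - int r + 1)]"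
    if "x : bnd r p (p + q)" for x
    using quotD(5)[OF q2] d_bnd[OF that] bnd_cyc by simp
  qed auto
 qed
 then obtain \<delta> where \<delta>: "!!r p q. 2 \<le> r ==> \<delta> r p q : mod_hom R (E r p q) (E r (p + int r) (q - int r + 1))"
  "!!r p q x. 2 \<le> r ==> x : cyc r p (p + q) ==>
   \<delta> r p q (\<kappa> r p q x) = \<kappa> r (p + int r) (q - int r + 1) (d (p + q) x)"
  by metis
 have "first_quadrant_spectral_sequence R E \<delta>"
  unfolding first_quadrant_spectral_sequence_def
 proof (intro allI impI conjI ballI)
  fix r p q assume r: "(2::nat) \<le> r"
  note q1 = q[OF r, of p q] and q2 = q[OF r, of "p + int r" "q - int r + 1", unfolded idx]
   and q0 = q[OF r, of "p - int r" "q + int r - 1", unfolded idx]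
  show "module R (E r p q)" using quotD(2)[OF q1] .
  show "\<delta> r p q : mod_hom R (E r p q) (E r (p + int r) (q - int r + 1))" using \<delta>(1)[OF r] .
  {
   assume pq: "p < 0 \<or> q < 0"
   \<comment> \<open>For \<open>p < 0\<close> the step \<open>F (p + 1)\<close> is still everything,
     and for \<open>q < 0\<close> the step \<open>F p\<close> is already zero in degree
     \<open>p + q\<close>; in both cases every cycle has depth \<open>p + 1\<close>.\<close>
   have "x : bnd r p (p + q)" if "x : cyc r p (p + q)" for x
   proof (rule bnd_F[OF that])
    show "x : F (p + 1) (p + q)"
    proof (cases "p < 0")
     case True
     thus ?thesis using F_low[of "p + 1"] cyc_carrier[OF that] by simp
    next
     case False
     thus ?thesis
      using pq F_high[of "p + q" p] cycD(1)[OF that] submodule_zero[OF F_submodule] by auto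
    qed
   qed
   thus "carrier (E r p q) = {\<zero>[E r p q]}"
    using quotD(5)[OF q1] quotient_map_surj[OF q1] zero_mem[OF quotD(2)[OF q1]]
    by auto
  }
  {
   fix u assume "u : carrier (E r p q)"
   then obtain x where x: "x : cyc r p (p + q)" "u = \<kappa> r p q x" using quotient_map_surj[OF q1] by auto
   note q3 = q[OF r, of "p + int r + int r" "q - int r + 1 - int r + 1"]
   have "d (p + q) x : cyc r (p + int r) (p + int r + (q - int r + 1))" using d_cyc[OF x(1)] by (simp add: idx)
   moreover have "d (p + q + 1) (d (p + q) x) = \<zero>[T (p + int r + int r + (q - int r + 1 - int r + 1))]"
    using d_d[OF cyc_carrier[OF x(1)]] by (simp add: algebra_simps)
   ultimately show "\<delta> r (p + int r) (q - int r + 1) (\<delta> r p q u) = \<zero>[E r (p + int r + int r) (q - int r + 1 - int r + 1)]"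
    using x \<delta>(2)[OF r] hom_zero[OF quotD(1-3)[OF q3]] by (simp add: idx)
  }
  have "(p - int r) + int r = p" "(q + int r - 1) - int r + 1 = q" by auto
  with \<delta>(1)[OF r, of "p - int r" "q + int r - 1"]
  have \<delta>0: "\<delta> r (p - int r) (q + int r - 1) : mod_hom R (E r (p - int r) (q + int r - 1)) (E r p q)"
   "!!x. x : cyc r (p - int r) (p + q - 1) ==>
    \<delta> r (p - int r) (q + int r - 1) (\<kappa> r (p - int r) (q + int r - 1) x) = \<kappa> r p q (d (p + q - 1) x)"
   using \<delta>(2)[OF r, of _ "p - int r" "q + int r - 1"] by (simp_all add: idx)
  show "mod_isomorphic R (E (Suc r) p q) (quot_mod
      ((E r p q) <| mod_ker (E r p q) (E r (p + int r) (q - int r + 1)) (\<delta> r p q))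
      (\<delta> r (p - int r) (q + int r - 1) ` carrier (E r (p - int r) (q + int r - 1))))"
   by (rule page_homology[OF q0 q1 q2 q[of "Suc r"] \<delta>0 \<delta>(1)[OF r] \<delta>(2)[OF r]]) (use r in auto)
 qed
 thus thesis by (rule that)
qed

section \<open>Convergence to the cohomology of the filtered complex\<close>

definition cocyc :: "int => 't set" where "cocyc n = {x : carrier (T n). d n x = \<zero>[T (n + 1)]}"

lemma cocyc_sub: "submodule (cocyc n) R (T n)"
proof -
 interpret T: module R "T n" by (rule T)
 interpret T': module R "T (n + 1)" by (rule T)
 show ?thesis
  by (rule submoduleI'[OF T]) (auto simp: cocyc_def d_zero hom_add[OF d] hom_smult[OF d])
qed

lemma convergence:
 assumes q: "!!r p q. 2 \<le> r ==>
  quotient_map R (T (p + q) <| cyc r p (p + q)) (bnd r p (p + q)) (\<kappa> r p q) (E r p q)"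
  and h: "!!n. quotient_map R (T (int n) <| cocyc (int n)) (d (int n - 1) ` carrier (T (int n - 1))) (\<eta> n) (H n)"
 shows "converges_to R E H"
 unfolding converges_to_def
proof (intro allI)
 fix n
 note D = quotD[OF h[of n]]
 interpret T: module R "T (int n)" by (rule T)
 define G where "G p = cocyc (int n) \<inter> F (int p) (int n)" for p
 define Fil where "Fil p = \<eta> n ` G p" for p
 have G_sub: "submodule (G p) R (T (int n))" for p
  by (rule submoduleI'[OF T]) (auto simp: G_def F_carrier submodule_zero[OF F_submodule] F_add
   submodule_smult[OF F_submodule] submodule_zero[OF cocyc_sub] submodule_add[OF cocyc_sub] submodule_smult[OF cocyc_sub])
 have G_cocyc: "x : cocyc (int n)" if "x : G p" for x p using that by (simp add: G_def)
 have G_carrier: "x : carrier (T (int n))" if "x : G p" for x p using that by (simp add: G_def cocyc_def)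
 have Fil_sub: "submodule (Fil p) R (H n)" for p
  unfolding Fil_def
 proof (rule submoduleI'[OF D(2)])
  show "\<eta> n ` G p \<subseteq> carrier (H n)" using D(4) G_cocyc by auto
  show "\<zero>[H n] : \<eta> n ` G p"
   using hom_zero[OF D(1-3)] submodule_zero[OF G_sub] by (intro image_eqI[of _ _ "\<zero>[T (int n)]"]) auto
  show "x +[H n] y : \<eta> n ` G p" if xy: "x : \<eta> n ` G p" "y : \<eta> n ` G p" for x y
  proof -
   from xy obtain a b where "a : G p" "b : G p" "x = \<eta> n a" "y = \<eta> n b" by auto
   thus ?thesis using hom_add[OF D(3), of a b] G_cocyc submodule_add[OF G_sub]
    by (intro image_eqI[of _ _ "a +[T (int n)] b"]) auto
  qed
  show "c *[H n] x : \<eta> n ` G p" if cx: "c : carrier R" "x : \<eta> n ` G p" for c x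
  proof -
   from cx obtain a where "a : G p" "x = \<eta> n a" by auto
   thus ?thesis using hom_smult[OF D(3) cx(1), of a] G_cocyc submodule_smult[OF G_sub] cx(1)
    by (intro image_eqI[of _ _ "c *[T (int n)] a"]) auto
  qed
 qed
 have G_Suc: "G (Suc p) \<subseteq> G p" for p using F_Suc[of "int p" "int n"] by (auto simp: G_def add.commute)
 have Fil_Suc: "Fil (Suc p) \<subseteq> Fil p" for p using G_Suc[of p] by (auto simp: Fil_def)
 have Fil_0: "Fil 0 = carrier (H n)"
 proof -
  have "G 0 = cocyc (int n)" using F_low[of 0 "int n"] by (auto simp: G_def cocyc_def)
  thus ?thesis using D(4) by (simp add: Fil_def)
 qed
 have Fil_top: "Fil (Suc n) = {\<zero>[H n]}"
 proof -
  have "G (Suc n) = {\<zero>[T (int n)]}" using F_high[of "int n" "int (Suc n)"] d_zero by (auto simp: G_def cocyc_def)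
  thus ?thesis using hom_zero[OF D(1-3)] by (simp add: Fil_def)
 qed
 have graded: "mod_isomorphic R (quot_mod ((H n) <| Fil p) (Fil (Suc p))) (E r (int p) (int q))"
  if pqr: "p + q = n \<and> 2 \<le> r \<and> p < r \<and> q + 1 < r" for p q r
 proof -
  have n: "int p + int q = int n" using pqr by linarith
  have cyc: "cyc r (int p) (int n) = G p"
  proof -
   have "F (int p + int r) (int n + 1) = {\<zero>[T (int n + 1)]}" using pqr by (intro F_high) linarith
   thus ?thesis using F_carrier by (auto simp: cyc_def G_def cocyc_def)
  qed
  have low: "F (int p - int r + 1) (int n - 1) = carrier (T (int n - 1))" using pqr by (intro F_low) linarith
  have mG: "module R (T (int n) <| G p)" using submodule_module[OF T G_sub] .
  have FS: "submodule (Fil (Suc p)) R (H n <| Fil p)"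
   by (rule submoduleI'[OF submodule_module[OF D(2) Fil_sub]])
    (use Fil_Suc submodule_zero[OF Fil_sub] submodule_add[OF Fil_sub] submodule_smult[OF Fil_sub] in auto)
  note qF = quotient_map_quot_mod[OF submodule_module[OF D(2) Fil_sub] FS]
  have "quotient_map R (T (int n) <| G p) (bnd r (int p) (int n))
   (%x. Fil (Suc p) +>\<^bsub>H n <| Fil p\<^esub> \<eta> n x) (quot_mod (H n <| Fil p) (Fil (Suc p)))"
  proof (rule quotient_map_precomp[OF qF mG])
   show "\<eta> n : mod_hom R (T (int n) <| G p) (H n <| Fil p)"
    using hom_add[OF D(3)] hom_smult[OF D(3)] G_cocyc by (intro mod_homI) (auto simp: Fil_def)
   show "\<exists>y\<in>carrier (T (int n) <| G p). Fil (Suc p) +>\<^bsub>H n <| Fil p\<^esub> \<eta> n y =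
     Fil (Suc p) +>\<^bsub>H n <| Fil p\<^esub> u" if "u : carrier (H n <| Fil p)" for u
    using that by (auto simp: Fil_def)
   fix x assume "x : carrier (T (int n) <| G p)"
   hence x: "x : G p" by simp
   show "\<eta> n x : Fil (Suc p) \<longleftrightarrow> x : bnd r (int p) (int n)"
   proof
    assume "\<eta> n x : Fil (Suc p)"
    then obtain y where y: "y : G (Suc p)" "\<eta> n x = \<eta> n y" by (auto simp: Fil_def)
    let ?m = "x -[T (int n)] y"
    have yp: "y : G p" using y(1) G_Suc by blast
    have m: "?m : G p" using submodule_minus[OF T G_sub x yp] .
    obtain w where w: "w : carrier (T (int n - 1))" "?m = d (int n - 1) w"
     using quotient_restrict_eq_iff[OF h T cocyc_sub G_cocyc[OF x] G_cocyc[OF yp]] y(2) by auto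
    \<comment> \<open>\<open>x\<close> and the deeper cocycle \<open>y\<close> have the same class,
      hence differ by \<open>d w\<close>; this \<open>w\<close> is the witness, its depth being no
      restriction here.\<close>
    have "x -[T (int n)] d (int n - 1) w = y"
     unfolding w(2)[symmetric] using G_carrier[OF x] G_carrier[OF yp] by algebra
    thus "x : bnd r (int p) (int n)"
     using x y(1) w m low by (intro bndI[of _ _ _ _ w]) (auto simp: cyc G_def add.commute)
   next
    assume b: "x : bnd r (int p) (int n)"
    then obtain w where w: "w : carrier (T (int n - 1))" "d (int n - 1) w : F (int p) (int n)"
     "x -[T (int n)] d (int n - 1) w : F (int p + 1) (int n)" using low by (auto elim: bndE)
    let ?y = "d (int n - 1) w" let ?m = "x -[T (int n)] ?y"
    have y: "?y : cocyc (int n)" using w d_closed' d_d' by (auto simp: cocyc_def)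
    hence yG: "?y : G p" using w by (simp add: G_def)
    have m: "?m : G (Suc p)"
     using w(3) submodule_minus[OF T G_sub x yG] by (auto simp: G_def add.commute)
    have "x -[T (int n)] ?m = ?y" using G_carrier[OF x] G_carrier[OF yG] by algebra
    hence "\<eta> n x = \<eta> n ?m"
     using quotient_restrict_eq_iff[OF h T cocyc_sub G_cocyc[OF x] G_cocyc[OF m]] w(1) by simp
    thus "\<eta> n x : Fil (Suc p)" using m by (auto simp: Fil_def)
   qed
  qed
  moreover have "quotient_map R (T (int n) <| G p) (bnd r (int p) (int n)) (\<kappa> r (int p) (int q)) (E r (int p) (int q))"
   using q[of r "int p" "int q"] pqr cyc n by simp
  ultimately show ?thesis by (rule quotient_map_isomorphic)
 qed
 show "\<exists>Fil. (\<forall>p. submodule (Fil p) R (H n)) \<and> (\<forall>p. Fil (Suc p) \<subseteq> Fil p) \<and>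
    Fil 0 = carrier (H n) \<and> Fil (Suc n) = {\<zero>[H n]} \<and>
    (\<forall>p q r. p + q = n \<and> 2 \<le> r \<and> p < r \<and> q + 1 < r -->
     mod_isomorphic R (quot_mod ((H n) <| Fil p) (Fil (Suc p))) (E r (int p) (int q)))"
  using Fil_sub Fil_Suc Fil_0 Fil_top graded by (intro exI[of _ Fil] conjI) blast+
qed

text \<open>For \<open>r > 2\<close> the cycles and boundaries of page \<open>r\<close> form a
  subquotient of the second page, so \<open>small_quotient\<close> finds a model whose elements have
  the type of the prescribed second page.\<close>

theorem spectral_sequence_from_second_page:
 fixes E2 :: "int => int => ('r, 'e) module"
 assumes q: "!!p q. quotient_map R (T (p + q) <| cyc 2 p (p + q)) (bnd 2 p (p + q)) (\<kappa> p q) (E2 p q)"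
  and h: "!!n. quotient_map R (T (int n) <| cocyc (int n)) (d (int n - 1) ` carrier (T (int n - 1))) (\<eta> n) (H n)"
 obtains E \<delta> where "first_quadrant_spectral_sequence R E \<delta>" "!!p q. E 2 p q = E2 p q" "converges_to R E H"
proof -
 have "\<exists>k. quotient_map R (T (p + q) <| cyc r p (p + q)) (bnd r p (p + q)) (fst k) (snd k) \<and>
  (r = 2 --> snd k = E2 p q)" if r: "2 \<le> r" for r p q
 proof (cases "r = 2")
  case True
  thus ?thesis using q by (intro exI[of _ "(\<kappa> p q, E2 p q)"]) simp
 next
  case False
  let ?T = "T (p + q) <| cyc 2 p (p + q)"
  have Z: "submodule (cyc r p (p + q)) R ?T"
   by (rule submoduleI'[OF cyc_module]) (use r cyc_antimono submodule_zero[OF cyc_submodule]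
    submodule_add[OF cyc_submodule] submodule_smult[OF cyc_submodule] in auto)
  have N: "submodule (bnd r p (p + q)) R (?T <| cyc r p (p + q))"
   using bnd_submodule by simp
  \<comment> \<open>A larger \<open>r\<close> admits more witnesses, so a boundary of page 2 that is
    a cycle for \<open>r\<close> is a boundary for \<open>r\<close>.\<close>
  have "bnd 2 p (p + q) \<inter> cyc r p (p + q) \<subseteq> bnd r p (p + q)"
   using F_antimono[of "p - int r + 1" "p - int 2 + 1"] r by (auto simp: bnd_def)
  from q Z N this obtain k and E :: "('r, 'e) module" where
   "quotient_map R (?T <| cyc r p (p + q)) (bnd r p (p + q)) k E" by (rule small_quotient)
  thus ?thesis using False by (intro exI[of _ "(k, E)"]) simp
 qed
 then obtain k where k: "!!r p q. 2 \<le> r ==>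
  quotient_map R (T (p + q) <| cyc r p (p + q)) (bnd r p (p + q)) (fst (k r p q)) (snd (k r p q)) \<and>
  (r = 2 --> snd (k r p q) = E2 p q)"
  by metis
 let ?E = "%r p q. snd (k r p q)"
 have qk: "!!r p q. 2 \<le> r ==>
  quotient_map R (T (p + q) <| cyc r p (p + q)) (bnd r p (p + q)) (fst (k r p q)) (?E r p q)"
  using k by blast
 obtain \<delta> where "first_quadrant_spectral_sequence R ?E \<delta>" using spectral_sequence[OF qk] .
 moreover have "converges_to R ?E H" by (rule convergence[OF qk h])
 ultimately show thesis using that k by blast
qed

end

section \<open>Free modules\<close>

text \<open>Functions live on the whole type and vanish outside \<open>I\<close>, so free modules on
  different index sets share their operations and are nested; \<open>lin\<close> accordingly does
  not mention \<open>I\<close>.\<close>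

definition free_module :: "'r ring => 'i set => ('r, 'i => 'r) module" where
 "free_module R I = \<lparr>carrier = {s. (\<forall>i. s i : carrier R) \<and> finite {i. s i \<noteq> \<zero>[R]} \<and> (\<forall>i. i \<notin> I --> s i = \<zero>[R])},
  monoid.mult = (%_ _ _. \<zero>[R]), one = (%_. \<zero>[R]), ring.zero = (%_. \<zero>[R]),
  ring.add = (%s t i. s i +[R] t i), module.smult = (%a s i. a \<otimes>\<^bsub>R\<^esub> s i)\<rparr>"

definition single :: "'r ring => 'i => 'i => 'r" where
 "single R i = (%j. if j = i then \<one>\<^bsub>R\<^esub> else \<zero>[R])"

definition lin :: "'r ring => ('r, 'x) module => ('i => 'x) => ('i => 'r) => 'x" where
 "lin R M e s = (\<Oplus>\<^bsub>M\<^esub>i\<in>{i. s i \<noteq> \<zero>[R]}. s i *[M] e i)"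

lemma free_simps:
 "s : carrier (free_module R I) \<longleftrightarrow>
  (\<forall>i. s i : carrier R) \<and> finite {i. s i \<noteq> \<zero>[R]} \<and> (\<forall>i. i \<notin> I --> s i = \<zero>[R])"
 "\<zero>[free_module R I] = (%_. \<zero>[R])"
 "s +[free_module R I] t = (%i. s i +[R] t i)"
 "a *[free_module R I] s = (%i. a \<otimes>\<^bsub>R\<^esub> s i)"
 by (simp_all add: free_module_def)

lemma free_is_module:
 assumes "cring R" shows "module R (free_module R I)"
proof -
 interpret cring R by fact
 have fin_add: "finite {i. s i +[R] t i \<noteq> \<zero>[R]}"
  if "finite {i. s i \<noteq> \<zero>[R]}" "finite {i. t i \<noteq> \<zero>[R]}" for s t :: "'b => 'a"
  by (rule finite_subset[OF _ finite_UnI[OF that]]) auto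
 have fin_mult: "finite {i. a \<otimes>\<^bsub>R\<^esub> s i \<noteq> \<zero>[R]}"
  if "finite {i. s i \<noteq> \<zero>[R]}" "a : carrier R" for s :: "'b => 'a" and a
  by (rule finite_subset[OF _ that(1)]) (use that in auto)
 have grp: "abelian_group (free_module R I)"
 proof (rule abelian_groupI)
  show "\<exists>t\<in>carrier (free_module R I). t +[free_module R I] s = \<zero>[free_module R I]"
   if s: "s : carrier (free_module R I)" for s
  proof
   show "(%i. \<ominus>\<^bsub>R\<^esub> s i) +[free_module R I] s = \<zero>[free_module R I]"
    using s by (simp add: free_simps l_neg)
   have "{i. \<ominus>\<^bsub>R\<^esub> s i \<noteq> \<zero>[R]} \<subseteq> {i. s i \<noteq> \<zero>[R]}" by (auto simp: neg_zero)
   thus "(%i. \<ominus>\<^bsub>R\<^esub> s i) : carrier (free_module R I)"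
    using s finite_subset by (auto simp: free_simps neg_zero)
  qed
 qed (simp_all add: free_simps fin_add a_ac)
 show ?thesis
  by (rule moduleI[OF assms grp]) (simp_all add: free_simps fin_mult l_distr r_distr m_assoc)
qed

lemma single_closed: "cring R ==> i : I ==> single R i : carrier (free_module R I)"
 using ring.ring_simprules(6)[OF cring.axioms(1)] ring.ring_simprules(2)[OF cring.axioms(1)]
 by (auto simp: free_simps single_def)

text \<open>Induction on the support, splitting off one coefficient at a time.\<close>

lemma free_module_induct [consumes 2, case_names zero add]:
 assumes R: "cring R" and s: "s : carrier (free_module R I)"
  and zero: "P \<zero>[free_module R I]"
  and add: "!!a i t. a : carrier R ==> i : I ==> t : carrier (free_module R I) ==> P t ==>
   P (a *[free_module R I] single R i +[free_module R I] t)"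
 shows "P s"
proof -
 interpret cring R by fact
 have "finite {i. s i \<noteq> \<zero>[R]}" using s by (simp add: free_simps)
 thus ?thesis using s
 proof (induction "{i. s i \<noteq> \<zero>[R]}" arbitrary: s rule: finite_induct)
  case empty
  hence "s = \<zero>[free_module R I]" by (auto simp: free_simps)
  thus ?case using zero by simp
 next
  case (insert i J)
  let ?t = "s(i := \<zero>[R])"
  have J: "J = {j. ?t j \<noteq> \<zero>[R]}" using insert(2,4) by auto
  have "s i \<noteq> \<zero>[R]" using insert(4) by auto
  hence i: "i : I" "s i : carrier R" using insert(5) by (auto simp: free_simps)
  have t: "?t : carrier (free_module R I)"
   using insert(1,5) J by (auto simp: free_simps)
  have e: "s i *[free_module R I] single R i +[free_module R I] ?t = s"
   using insert(5) by (auto simp: free_simps single_def)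
  have "P ?t" using insert(3)[OF J t] .
  from add[OF i(2,1) t this] show ?case unfolding e .
 qed
qed

lemma free_hom_ext:
 assumes "cring R" "module R M" "f : mod_hom R (free_module R I) M" "g : mod_hom R (free_module R I) M"
  and "!!i. i : I ==> f (single R i) = g (single R i)" and "s : carrier (free_module R I)"
 shows "f s = g s"
 using assms(1,6)
proof (induction rule: free_module_induct)
 case zero
 show ?case
  using hom_zero[OF free_is_module[OF assms(1)] assms(2,3)]
   hom_zero[OF free_is_module[OF assms(1)] assms(2,4)] by simp
next
 case (add a i t)
 interpret F: module R "free_module R I" by (rule free_is_module[OF assms(1)])
 have "single R i : carrier (free_module R I)" using single_closed[OF assms(1) add(2)] .
 thus ?case using add assms(5)
  by (simp add: hom_add[OF assms(3)] hom_add[OF assms(4)] hom_smult[OF assms(3)] hom_smult[OF assms(4)])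
qed

text \<open>Lets sums over different supports be compared on a common finite set, as the additivity
  of \<open>lin\<close> requires.\<close>

lemma lin_superset:
 assumes "module R M" "e : I \<rightarrow> carrier M" "s : carrier (free_module R I)"
  "finite A" "{i. s i \<noteq> \<zero>[R]} \<subseteq> A" "A \<subseteq> I"
 shows "lin R M e s = (\<Oplus>\<^bsub>M\<^esub>i\<in>A. s i *[M] e i)"
proof -
 interpret module R M by fact
 show ?thesis unfolding lin_def
  by (rule M.add.finprod_mono_neutral_cong_left) (insert assms, auto simp: free_simps Pi_iff)
qed

lemma lin_single:
 assumes "module R M" "e : I \<rightarrow> carrier M" "i : I"
 shows "lin R M e (single R i) = e i"
proof -
 interpret module R M by fact
 have "e i : carrier M" using assms by blast
 moreover have "lin R M e (single R i) = (\<Oplus>\<^bsub>M\<^esub>j\<in>{i}. single R i j *[M] e j)"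
  by (rule lin_superset[OF assms(1,2)]) (insert assms single_closed R.is_cring, auto simp: single_def)
 ultimately show ?thesis by (simp add: single_def)
qed

lemma lin_hom:
 assumes "module R M" "e : I \<rightarrow> carrier M"
 shows "lin R M e : mod_hom R (free_module R I) M"
proof -
 interpret module R M by fact
 interpret F: module R "free_module R I" by (rule free_is_module) (rule R.is_cring)
 have sup: "finite {i. s i \<noteq> \<zero>[R]}" "{i. s i \<noteq> \<zero>[R]} \<subseteq> I" "!!i. s i : carrier R"
  if "s : carrier (free_module R I)" for s using that by (auto simp: free_simps)
 have e: "e i : carrier M" if "i : I" for i using assms that by blast
 show ?thesis
 proof (rule mod_homI)
  fix s assume s: "s : carrier (free_module R I)"
  show "lin R M e s : carrier M" unfolding lin_def
   by (rule M.finsum_closed) (use sup[OF s] e in auto)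
  show "lin R M e (a *[free_module R I] s) = a *[M] lin R M e s" if a: "a : carrier R" for a
  proof -
   let ?A = "{i. s i \<noteq> \<zero>[R]}"
   have "lin R M e (a *[free_module R I] s) = (\<Oplus>\<^bsub>M\<^esub>i\<in>?A. (a *[free_module R I] s) i *[M] e i)"
    by (rule lin_superset[OF assms]) (insert sup[OF s] F.smult_closed[OF a s] a, auto simp: free_simps(4))
   also have "\<dots> = (\<Oplus>\<^bsub>M\<^esub>i\<in>?A. a *[M] (s i *[M] e i))"
    by (rule M.add.finprod_cong') (insert sup[OF s] e a, auto simp: free_simps(4) smult_assoc1)
   also have "\<dots> = a *[M] (\<Oplus>\<^bsub>M\<^esub>i\<in>?A. s i *[M] e i)"
    by (rule finsum_smult_ldistr[symmetric]) (use sup[OF s] e a in auto)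
   finally show ?thesis by (simp add: lin_def)
  qed
  show "lin R M e (s +[free_module R I] t) = lin R M e s +[M] lin R M e t"
   if t: "t : carrier (free_module R I)" for t
  proof -
   let ?A = "{i. s i \<noteq> \<zero>[R]} \<union> {i. t i \<noteq> \<zero>[R]}"
   have A: "finite ?A" "?A \<subseteq> I" using sup[OF s] sup[OF t] by auto
   have "lin R M e (s +[free_module R I] t) = (\<Oplus>\<^bsub>M\<^esub>i\<in>?A. (s +[free_module R I] t) i *[M] e i)"
    by (rule lin_superset[OF assms F.M.a_closed[OF s t] A(1) _ A(2)]) (auto simp: free_simps(3))
   also have "\<dots> = (\<Oplus>\<^bsub>M\<^esub>i\<in>?A. s i *[M] e i +[M] t i *[M] e i)"
    by (rule M.add.finprod_cong')
     (insert sup(3)[OF s] sup(3)[OF t] A e, auto simp: free_simps(3) smult_l_distr)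
   also have "\<dots> = (\<Oplus>\<^bsub>M\<^esub>i\<in>?A. s i *[M] e i) +[M] (\<Oplus>\<^bsub>M\<^esub>i\<in>?A. t i *[M] e i)"
    by (rule M.finsum_addf) (use sup(3)[OF s] sup(3)[OF t] A e in auto)
   also have "\<dots> = lin R M e s +[M] lin R M e t"
    using lin_superset[OF assms s A(1) _ A(2)] lin_superset[OF assms t A(1) _ A(2)] by auto
   finally show ?thesis .
  qed
 qed
qed

section \<open>Modules over categories\<close>

lemma categoryD:
 assumes "category C"
 shows Ident_Hom: "x : Obj C ==> Ident C x : Hom C x x"
  and Comp_Hom: "x : Obj C ==> y : Obj C ==> z : Obj C ==> f : Hom C x y ==> g : Hom C y z ==>
   Comp C x y z g f : Hom C x z"
  and Comp_Ident_right: "x : Obj C ==> y : Obj C ==> f : Hom C x y ==> Comp C x x y f (Ident C x) = f"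
  and Comp_Ident_left: "x : Obj C ==> y : Obj C ==> f : Hom C x y ==> Comp C x y y (Ident C y) f = f"
  and Comp_assoc: "w : Obj C ==> x : Obj C ==> y : Obj C ==> z : Obj C ==> f : Hom C w x ==>
   g : Hom C x y ==> h : Hom C y z ==> Comp C w y z h (Comp C w x y g f) = Comp C w x z (Comp C x y z h g) f"
 using assms unfolding category_def by simp_all

lemma functorD:
 assumes "is_functor C D \<Phi> \<phi>"
 shows functor_Obj: "x : Obj C ==> \<Phi> x : Obj D"
  and functor_Hom: "x : Obj C ==> y : Obj C ==> f : Hom C x y ==> \<phi> x y f : Hom D (\<Phi> x) (\<Phi> y)"
  and functor_Ident: "x : Obj C ==> \<phi> x x (Ident C x) = Ident D (\<Phi> x)"
  and functor_Comp: "x : Obj C ==> y : Obj C ==> z : Obj C ==> f : Hom C x y ==> g : Hom C y z ==>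
   \<phi> x z (Comp C x y z g f) = Comp D (\<Phi> x) (\<Phi> y) (\<Phi> z) (\<phi> y z g) (\<phi> x y f)"
 using assms unfolding is_functor_def by simp_all

lemma right_moduleD:
 assumes "right_module R C M"
 shows val_module: "x : Obj C ==> module R (val M x)"
  and act_hom: "x : Obj C ==> y : Obj C ==> f : Hom C x y ==> act M x y f : mod_hom R (val M y) (val M x)"
  and act_Ident: "x : Obj C ==> m : el M x ==> act M x x (Ident C x) m = m"
  and act_Comp: "x : Obj C ==> y : Obj C ==> z : Obj C ==> f : Hom C x y ==> g : Hom C y z ==>
   m : el M z ==> act M x z (Comp C x y z g f) m = act M x y f (act M y z g m)"
 using assms unfolding right_module_def by simp_all

lemma act_closed:
 "right_module R C M ==> x : Obj C ==> y : Obj C ==> f : Hom C x y ==> m : el M y ==>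
  act M x y f m : el M x"
 by (rule hom_closed[OF act_hom])

lemma right_moduleI:
 assumes "!!x. x : Obj C ==> module R (val M x)"
  and "!!x y f. x : Obj C ==> y : Obj C ==> f : Hom C x y ==> act M x y f : mod_hom R (val M y) (val M x)"
  and "!!x m. x : Obj C ==> m : el M x ==> act M x x (Ident C x) m = m"
  and "!!x y z f g m. x : Obj C ==> y : Obj C ==> z : Obj C ==> f : Hom C x y ==> g : Hom C y z ==>
   m : el M z ==> act M x z (Comp C x y z g f) m = act M x y f (act M y z g m)"
 shows "right_module R C M"
 using assms unfolding right_module_def by simp

lemma restrict_module:
 assumes "is_functor C D \<Phi> \<phi>" "right_module R D M"
 shows "right_module R C (restrict_mod \<Phi> \<phi> M)"
proof (rule right_moduleI)
 note F = functorD[OF assms(1)] and M = right_moduleD[OF assms(2)]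
 show "module R (val (restrict_mod \<Phi> \<phi> M) x)" if "x : Obj C" for x
  using M F that by (simp add: restrict_mod_def)
 show "act (restrict_mod \<Phi> \<phi> M) x y f : mod_hom R (val (restrict_mod \<Phi> \<phi> M) y) (val (restrict_mod \<Phi> \<phi> M) x)"
  if "x : Obj C" "y : Obj C" "f : Hom C x y" for x y f
  using M F that by (simp add: restrict_mod_def)
 show "act (restrict_mod \<Phi> \<phi> M) x x (Ident C x) m = m" if "x : Obj C" "m : el (restrict_mod \<Phi> \<phi> M) x" for x m
  using M F that by (simp add: restrict_mod_def)
 show "act (restrict_mod \<Phi> \<phi> M) x z (Comp C x y z g f) m = act (restrict_mod \<Phi> \<phi> M) x y f (act (restrict_mod \<Phi> \<phi> M) y z g m)"
  if "x : Obj C" "y : Obj C" "z : Obj C" "f : Hom C x y" "g : Hom C y z"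
   "m : el (restrict_mod \<Phi> \<phi> M) z" for x y z f g m
  using M F that by (simp add: restrict_mod_def)
qed

lemma nat_transD:
 assumes "\<eta> : nat_trans R C A B"
 shows nat_hom: "x : Obj C ==> \<eta> x : mod_hom R (val A x) (val B x)"
  and nat_act: "x : Obj C ==> y : Obj C ==> f : Hom C x y ==> a : el A y ==>
   \<eta> x (act A x y f a) = act B x y f (\<eta> y a)"
 using assms unfolding nat_trans_def by auto

lemma
 assumes "\<eta> : nat_trans R C A B" "x : Obj C"
 shows nat_closed: "a : el A x ==> \<eta> x a : el B x"
  and nat_add: "a : el A x ==> b : el A x ==>
   \<eta> x (a +[val A x] b) = \<eta> x a +[val B x] \<eta> x b"
  and nat_smult: "r : carrier R ==> a : el A x ==> \<eta> x (r *[val A x] a) = r *[val B x] \<eta> x a"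
 using nat_hom[OF assms] by (auto simp: mod_hom_def)

lemma
 assumes "\<eta> : nat_trans R C A B" "x : Obj C" "right_module R C A" "right_module R C B"
 shows nat_zero: "\<eta> x \<zero>[val A x] = \<zero>[val B x]"
  and nat_minus: "a : el A x ==> b : el A x ==>
   \<eta> x (a -[val A x] b) = \<eta> x a -[val B x] \<eta> x b"
 using hom_zero[OF val_module[OF assms(3,2)] val_module[OF assms(4,2)] nat_hom[OF assms(1,2)]]
  hom_minus[OF val_module[OF assms(3,2)] val_module[OF assms(4,2)] nat_hom[OF assms(1,2)]] by simp_all

lemma pointwise_at [simp]: "x : Obj C ==> a : el A x ==> pointwise C A t x a = t x a"
 by (simp add: pointwise_def)

text \<open>\<open>pointwise\<close> supplies the extensionality built into
  \<open>nat_trans\<close>, so that only the two mathematical conditions remain to be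
  checked.\<close>

lemma nat_transI:
 assumes A: "right_module R C A"
  and hom: "!!x. x : Obj C ==> t x : mod_hom R (val A x) (val B x)"
  and nat: "!!x y f a. x : Obj C ==> y : Obj C ==> f : Hom C x y ==> a : el A y ==>
   t x (act A x y f a) = act B x y f (t y a)"
 shows "pointwise C A t : nat_trans R C A B"
 unfolding nat_trans_def
proof (intro CollectI conjI ballI)
 show "pointwise C A t : extensional (Obj C)" by (simp add: pointwise_def)
 fix x assume x: "x : Obj C"
 have "pointwise C A t x : mod_hom R (val A x) (val B x)"
  by (rule mod_hom_cong[OF val_module[OF A x] hom[OF x]]) (simp add: x)
 thus "pointwise C A t x : mod_hom R (val A x) (val B x) \<inter> extensional (el A x)"
  using x by (simp add: pointwise_def)
 show "pointwise C A t x (act A x y f a) = act B x y f (pointwise C A t y a)"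
  if "y : Obj C" "f : Hom C x y" "a : el A y" for y f a
  using x that nat by (simp add: act_closed[OF A])
qed

lemma nat_eqI:
 assumes "\<eta> : nat_trans R C A B" "\<theta> : nat_trans R C A B'"
  and "!!x a. x : Obj C ==> a : el A x ==> \<eta> x a = \<theta> x a"
 shows "\<eta> = \<theta>"
proof (rule extensionalityI[of _ "Obj C"])
 show "\<eta> : extensional (Obj C)" "\<theta> : extensional (Obj C)" using assms by (auto simp: nat_trans_def)
 fix x assume "x : Obj C"
 thus "\<eta> x = \<theta> x"
  using assms by (intro extensionalityI[of _ "el A x"]) (auto simp: nat_trans_def)
qed

lemma nat_comp:
 assumes A: "right_module R C A" and "\<eta> : nat_trans R C A B" "\<theta> : nat_trans R C B D"
 shows "pointwise C A (%x a. \<theta> x (\<eta> x a)) : nat_trans R C A D"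
 using hom_comp[OF nat_hom[OF assms(2)] nat_hom[OF assms(3)]]
 by (intro nat_transI[OF A]) (simp_all add: nat_act[OF assms(2)] nat_act[OF assms(3)] nat_closed[OF assms(2)])

lemma nat_trans_add:
 assumes A: "right_module R C A" and B: "right_module R C B"
  and "\<eta> : nat_trans R C A B" "\<theta> : nat_trans R C A B"
 shows "pointwise C A (%x a. \<eta> x a +[val B x] \<theta> x a) : nat_trans R C A B"
proof (rule nat_transI[OF A])
 show "(%a. \<eta> x a +[val B x] \<theta> x a) : mod_hom R (val A x) (val B x)" if x: "x : Obj C" for x
 proof -
  interpret B: module R "val B x" by (rule val_module[OF B x])
  note c = nat_closed[OF assms(3) x] nat_closed[OF assms(4) x]
  show ?thesis
  proof (rule mod_homI)
   fix a b assume ab: "a : el A x" "b : el A x"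
   note c = c[OF ab(1)] c[OF ab(2)]
   have "(\<eta> x a +[val B x] \<eta> x b) +[val B x] (\<theta> x a +[val B x] \<theta> x b) =
    (\<eta> x a +[val B x] \<theta> x a) +[val B x] (\<eta> x b +[val B x] \<theta> x b)"
    using c by algebra
   thus "\<eta> x (a +[val A x] b) +[val B x] \<theta> x (a +[val A x] b) =
    (\<eta> x a +[val B x] \<theta> x a) +[val B x] (\<eta> x b +[val B x] \<theta> x b)"
    using nat_add[OF assms(3) x ab] nat_add[OF assms(4) x ab] by simp
  qed (simp_all add: c nat_smult[OF assms(3) x] nat_smult[OF assms(4) x] B.smult_r_distr)
 qed
 show "\<eta> x (act A x y f a) +[val B x] \<theta> x (act A x y f a) = act B x y f (\<eta> y a +[val B y] \<theta> y a)"
  if "x : Obj C" "y : Obj C" "f : Hom C x y" "a : el A y" for x y f a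
  using that hom_add[OF act_hom[OF B that(1-3)]]
  by (simp add: nat_act[OF assms(3)] nat_act[OF assms(4)] nat_closed[OF assms(3)] nat_closed[OF assms(4)])
qed

lemma nat_trans_smult:
 assumes A: "right_module R C A" and B: "right_module R C B" and "\<eta> : nat_trans R C A B" "r : carrier R"
 shows "pointwise C A (%x a. r *[val B x] \<eta> x a) : nat_trans R C A B"
proof (rule nat_transI[OF A])
 show "(%a. r *[val B x] \<eta> x a) : mod_hom R (val A x) (val B x)" if x: "x : Obj C" for x
 proof -
  interpret B: module R "val B x" by (rule val_module[OF B x])
  note c = nat_closed[OF assms(3) x]
  show ?thesis
  proof (rule mod_homI)
   fix s a assume "s : carrier R" "a : el A x"
   thus "r *[val B x] \<eta> x (s *[val A x] a) = s *[val B x] (r *[val B x] \<eta> x a)"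
    using c assms(4) by (simp add: nat_smult[OF assms(3) x] B.smult_assoc1[symmetric] B.R.m_comm)
  qed (simp_all add: c assms(4) nat_add[OF assms(3) x] B.smult_r_distr)
 qed
 show "r *[val B x] \<eta> x (act A x y f a) = act B x y f (r *[val B y] \<eta> y a)"
  if "x : Obj C" "y : Obj C" "f : Hom C x y" "a : el A y" for x y f a
  using that hom_smult[OF act_hom[OF B that(1-3)] assms(4)]
  by (simp add: nat_act[OF assms(3)] nat_closed[OF assms(3)])
qed

lemma nat_trans_zero:
 assumes A: "right_module R C A" and B: "right_module R C B"
 shows "pointwise C A (%x a. \<zero>[val B x]) : nat_trans R C A B"
 using hom_zero[OF val_module[OF B] val_module[OF B] act_hom[OF B]] module_zero_hom[OF val_module[OF A] val_module[OF B]]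
 by (intro nat_transI[OF A]) simp_all

lemma hom_simps:
 "carrier (hom_mod R C A B) = nat_trans R C A B"
 "\<zero>[hom_mod R C A B] = pointwise C A (%x a. \<zero>[val B x])"
 "\<eta> +[hom_mod R C A B] \<theta> = pointwise C A (%x a. \<eta> x a +[val B x] \<theta> x a)"
 "r *[hom_mod R C A B] \<eta> = pointwise C A (%x a. r *[val B x] \<eta> x a)"
 by (simp_all add: hom_mod_def)

lemma hom_mod_module:
 assumes R: "cring R" and A: "right_module R C A" and B: "right_module R C B"
 shows "module R (hom_mod R C A B)"
proof -
 interpret R: cring R by fact
 let ?H = "hom_mod R C A B"
 have c: "f x a : el B x" if "f : carrier ?H" "x : Obj C" "a : el A x" for f x a
  using nat_closed[of f R C A B x a] that by (simp add: hom_simps)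
 have cl: "\<zero>[?H] : carrier ?H" "!!f g. f : carrier ?H ==> g : carrier ?H ==> f +[?H] g : carrier ?H"
  "!!r f. r : carrier R ==> f : carrier ?H ==> r *[?H] f : carrier ?H"
  by (simp_all add: hom_simps nat_trans_add[OF A B] nat_trans_smult[OF A B] nat_trans_zero[OF A B])
 have ap: "\<zero>[?H] x a = \<zero>[val B x]" "(f +[?H] g) x a = f x a +[val B x] g x a" "(r *[?H] f) x a = r *[val B x] f x a"
  if "x : Obj C" "a : el A x" for r f g x a
  using that by (simp_all add: hom_simps)
 have eq: "f = g" if "f : carrier ?H" "g : carrier ?H"
  "!!x a. x : Obj C ==> a : el A x ==> f x a = g x a" for f g
  using nat_eqI[of f R C A B g B] that by (simp add: hom_simps)
 note m = val_module[OF B]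
 note g = abelian_group.abelian_simprules(5,6,8)[OF module.axioms(2)[OF m]]
 have grp: "abelian_group ?H"
 proof (rule abelian_groupI)
  fix f assume f: "f : carrier ?H"
  show "\<exists>h\<in>carrier ?H. h +[?H] f = \<zero>[?H]"
  proof (rule bexI, rule eq)
   show n: "(\<ominus>\<^bsub>R\<^esub> \<one>\<^bsub>R\<^esub>) *[?H] f : carrier ?H" using f cl by simp
   fix x a assume x: "x : Obj C" "a : el A x"
   interpret B: module R "val B x" by (rule m[OF x(1)])
   show "((\<ominus>\<^bsub>R\<^esub> \<one>\<^bsub>R\<^esub>) *[?H] f +[?H] f) x a = \<zero>[?H] x a"
    using c[OF f x] by (simp add: ap[OF x] B.smult_l_minus B.M.l_neg)
  qed (use f cl in simp_all)
 qed (simp_all add: cl, (rule eq; simp add: cl ap c g)+)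
 show ?thesis
  by (rule moduleI[OF R grp]; (rule eq)?;
   simp add: cl ap c module.smult_l_distr[OF m] module.smult_r_distr[OF m] module.smult_assoc1[OF m] module.smult_one[OF m])
qed

text \<open>The free module on generators \<open>g : G y\<close> at \<open>y\<close>; its basis at \<open>x\<close> consists of the \<open>mk (y, f, g)\<close>
 with \<open>f : x \<rightarrow> y\<close>.\<close>

definition basis :: "('o, 'm) cat => ('o \<times> 'm \<times> 'g => 'i) => ('o => 'g set) => 'o => 'i set" where
 "basis C mk G x = {mk (y, f, g) | y f g. y : Obj C \<and> f : Hom C x y \<and> g : G y}"

definition pre :: "('o, 'm) cat => ('o \<times> 'm \<times> 'g => 'i) => 'o => 'o => 'm => 'i => 'i" where
 "pre C mk x y f i = (case inv_into UNIV mk i of (z, h, g) => mk (z, Comp C x y z h f, g))"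

definition free_cmod ::
 "'r ring => ('o, 'm) cat => ('o \<times> 'm \<times> 'g => 'i) => ('o => 'g set) => ('o, 'm, 'r, 'i => 'r) cmod" where
 "free_cmod R C mk G = \<lparr>val = (%x. free_module R (basis C mk G x)),
  act = (%x y f. lin R (free_module R (basis C mk G x)) (%i. single R (pre C mk x y f i)))\<rparr>"

text \<open>\<open>mk\<close> encodes a basis element. It is a parameter because two encodings
  occur: the triple itself, for a free cover of a module, and the list with \<open>(y, f)\<close> in
  front, for the terms of the bar resolution.\<close>

locale free_setup =
 fixes R :: "'r ring" and C :: "('o, 'm) cat" and mk :: "'o \<times> 'm \<times> 'g => 'i" and G :: "'o => 'g set"
 assumes R: "cring R" and C: "category C" and mk: "inj mk"
begin

abbreviation "FM \<equiv> free_cmod R C mk G"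

lemma pre_mk: "pre C mk x y f (mk (z, h, g)) = mk (z, Comp C x y z h f, g)"
 using mk by (simp add: pre_def)

lemma basisI: "y : Obj C ==> f : Hom C x y ==> g : G y ==> mk (y, f, g) : basis C mk G x"
 by (auto simp: basis_def)

lemma basisE:
 assumes "i : basis C mk G x"
 obtains y f g where "i = mk (y, f, g)" "y : Obj C" "f : Hom C x y" "g : G y"
 using assms by (auto simp: basis_def)

lemma pre_basis:
 assumes "x : Obj C" "y : Obj C" "f : Hom C x y" "i : basis C mk G y"
 shows "pre C mk x y f i : basis C mk G x"
 using assms(4) by (rule basisE) (insert assms(1-3) Comp_Hom[OF C], auto simp: pre_mk intro!: basisI)

lemma FM_val: "val FM x = free_module R (basis C mk G x)"
 by (simp add: free_cmod_def)

lemma FM_val_module: "module R (val FM x)"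
 by (simp add: FM_val free_is_module R)

lemma single_FM: "i : basis C mk G x ==> single R i : el FM x"
 by (simp add: FM_val single_closed R)

lemma FM_act_single:
 assumes "x : Obj C" "y : Obj C" "f : Hom C x y" "i : basis C mk G y"
 shows "act FM x y f (single R i) = single R (pre C mk x y f i)"
proof -
 have "(%i. single R (pre C mk x y f i)) : basis C mk G y \<rightarrow> carrier (free_module R (basis C mk G x))"
  by (rule Pi_I, rule single_closed[OF R], rule pre_basis[OF assms(1-3)])
 from lin_single[OF free_is_module[OF R] this assms(4)] show ?thesis by (simp add: free_cmod_def)
qed

lemma FM_act_hom:
 assumes "x : Obj C" "y : Obj C" "f : Hom C x y"
 shows "act FM x y f : mod_hom R (val FM y) (val FM x)"
proof -
 have "(%i. single R (pre C mk x y f i)) : basis C mk G y \<rightarrow> carrier (free_module R (basis C mk G x))"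
  by (rule Pi_I, rule single_closed[OF R], rule pre_basis[OF assms])
 from lin_hom[OF free_is_module[OF R] this] show ?thesis by (simp add: free_cmod_def)
qed

lemma FM_hom_ext:
 assumes "module R M" "f : mod_hom R (val FM x) M" "g : mod_hom R (val FM x) M"
  and "!!i. i : basis C mk G x ==> f (single R i) = g (single R i)" and "s : el FM x"
 shows "f s = g s"
 by (rule free_hom_ext[OF R assms(1) assms(2,3)[unfolded FM_val] assms(4) assms(5)[unfolded FM_val]])

lemma FM_right_module: "right_module R C FM"
proof (rule right_moduleI)
 show "act FM x x (Ident C x) m = m" if x: "x : Obj C" and m: "m : el FM x" for x m
 proof (rule FM_hom_ext[OF FM_val_module FM_act_hom[OF x x Ident_Hom[OF C x]] mod_hom_id _ m])
  fix i assume i: "i : basis C mk G x"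
  hence "pre C mk x x (Ident C x) i = i"
   by (rule basisE) (simp add: pre_mk Comp_Ident_right[OF C x])
  thus "act FM x x (Ident C x) (single R i) = single R i"
   using FM_act_single[OF x x Ident_Hom[OF C x] i] by simp
 qed
 show "act FM x z (Comp C x y z g f) m = act FM x y f (act FM y z g m)"
  if *: "x : Obj C" "y : Obj C" "z : Obj C" "f : Hom C x y" "g : Hom C y z" and m: "m : el FM z"
  for x y z f g m
 proof (rule FM_hom_ext[OF FM_val_module FM_act_hom[OF *(1,3) Comp_Hom[OF C *]]
    hom_comp[OF FM_act_hom[OF *(2,3,5)] FM_act_hom[OF *(1,2,4)]] _ m])
  fix i assume i: "i : basis C mk G z"
  hence "pre C mk x z (Comp C x y z g f) i = pre C mk x y f (pre C mk y z g i)"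
   by (rule basisE) (insert *, simp add: pre_mk Comp_assoc[OF C])
  thus "act FM x z (Comp C x y z g f) (single R i) = act FM x y f (act FM y z g (single R i))"
   using i * by (simp add: FM_act_single pre_basis Comp_Hom[OF C])
 qed
qed (simp_all add: FM_val_module FM_act_hom)

lemma single_act:
 assumes "x : Obj C" "y : Obj C" "f : Hom C x y" "g : G y"
 shows "single R (mk (y, f, g)) = act FM x y f (single R (mk (y, Ident C y, g)))"
 using assms FM_act_single[OF assms(1-3) basisI[OF assms(2) Ident_Hom[OF C assms(2)] assms(4)]]
 by (simp add: pre_mk Comp_Ident_left[OF C])

text \<open>The Yoneda principle: the basis element for \<open>(y, f, g)\<close> is the image under
  \<open>f\<close> of the generator with identity morphism, so values at these generators can be
  prescribed at will and determine the map.\<close>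

lemma FM_lift:
 assumes A: "right_module R C A" and c: "!!y g. y : Obj C ==> g : G y ==> c y g : el A y"
 obtains k where "k : nat_trans R C FM A"
  "!!x y f g. x : Obj C ==> y : Obj C ==> f : Hom C x y ==> g : G y ==>
   k x (single R (mk (y, f, g))) = act A x y f (c y g)"
proof -
 define e where "e x i = (case inv_into UNIV mk i of (y, f, g) => act A x y f (c y g))" for x i
 have e_mk: "e x (mk (y, f, g)) = act A x y f (c y g)" for x y f g using mk by (simp add: e_def)
 have e: "e x : basis C mk G x \<rightarrow> el A x" if "x : Obj C" for x
  using that c act_closed[OF A] by (auto simp: e_mk elim!: basisE)
 define k where "k = pointwise C FM (%x. lin R (val A x) (e x))"
 have single: "lin R (val A x) (e x) (single R (mk (y, f, g))) = act A x y f (c y g)"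
  if "x : Obj C" "y : Obj C" "f : Hom C x y" "g : G y" for x y f g
  using lin_single[OF val_module[OF A] e basisI] that by (simp add: e_mk)
 have hom: "lin R (val A x) (e x) : mod_hom R (val FM x) (val A x)" if "x : Obj C" for x
  using lin_hom[OF val_module[OF A that] e[OF that]] by (simp add: FM_val)
 have "k : nat_trans R C FM A" unfolding k_def
 proof (rule nat_transI[OF FM_right_module hom])
  fix x y f a assume *: "x : Obj C" "y : Obj C" "f : Hom C x y" and a: "a : el FM y"
  show "lin R (val A x) (e x) (act FM x y f a) = act A x y f (lin R (val A y) (e y) a)"
  proof (rule FM_hom_ext[OF val_module[OF A *(1)] hom_comp[OF FM_act_hom[OF *] hom[OF *(1)]]
     hom_comp[OF hom[OF *(2)] act_hom[OF A *]] _ a])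
   fix i assume i: "i : basis C mk G y"
   then obtain z h g where z: "i = mk (z, h, g)" "z : Obj C" "h : Hom C y z" "g : G z" by (rule basisE)
   have "lin R (val A x) (e x) (act FM x y f (single R i)) = act A x z (Comp C x y z h f) (c z g)"
    using FM_act_single[OF * i] single[OF *(1) z(2) Comp_Hom[OF C *(1,2) z(2) *(3) z(3)] z(4)]
    by (simp add: z(1) pre_mk)
   also have "\<dots> = act A x y f (act A y z h (c z g))" using act_Comp[OF A *(1,2) z(2) *(3) z(3)] c z by simp
   also have "\<dots> = act A x y f (lin R (val A y) (e y) (single R i))" using single[OF *(2)] z by simp
   finally show "lin R (val A x) (e x) (act FM x y f (single R i)) = act A x y f (lin R (val A y) (e y) (single R i))" .
  qed
 qed
 thus thesis
  using that[of k] single by (simp add: k_def single_FM basisI)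
qed

lemma FM_ext:
 assumes A: "right_module R C A" and k: "k : nat_trans R C FM A" "k' : nat_trans R C FM A"
  and "!!y g. y : Obj C ==> g : G y ==> k y (single R (mk (y, Ident C y, g))) = k' y (single R (mk (y, Ident C y, g)))"
  and x: "x : Obj C" "a : el FM x"
 shows "k x a = k' x a"
proof (rule FM_hom_ext[OF val_module[OF A x(1)] nat_hom[OF k(1) x(1)] nat_hom[OF k(2) x(1)] _ x(2)])
 fix i assume "i : basis C mk G x"
 then obtain y f g where y: "i = mk (y, f, g)" "y : Obj C" "f : Hom C x y" "g : G y" by (rule basisE)
 have s: "single R (mk (y, Ident C y, g)) : el FM y"
  using single_FM[OF basisI[OF y(2) Ident_Hom[OF C y(2)] y(4)]] .
 show "k x (single R i) = k' x (single R i)"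
  unfolding y(1) single_act[OF x(1) y(2-4)]
  using nat_act[OF k(1) x(1) y(2,3) s] nat_act[OF k(2) x(1) y(2,3) s] assms(4)[OF y(2,4)] by simp
qed

text \<open>Instead of surjectivity of \<open>g\<close>, only the values of \<open>h\<close> are
  required to lie in its image; in this form exactness at a single place feeds the construction of
  chain maps.\<close>

lemma FM_lifts:
 assumes A: "right_module R C A" and B: "right_module R C B" and g: "g : nat_trans R C A B"
  and h: "h : nat_trans R C FM B"
  and im: "!!x a. x : Obj C ==> a : el FM x ==> h x a : g x ` el A x"
 obtains k where "k : nat_trans R C FM A" "!!x a. x : Obj C ==> a : el FM x ==> g x (k x a) = h x a"
proof -
 let ?s = "%y u. single R (mk (y, Ident C y, u))"
 have s: "?s y u : el FM y" if "y : Obj C" "u : G y" for y u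
  using single_FM[OF basisI[OF that(1) Ident_Hom[OF C that(1)] that(2)]] .
 have "\<exists>b. b : el A y \<and> g y b = h y (?s y u)" if "y : Obj C" "u : G y" for y u
  using im[OF that(1) s[OF that]] by (metis imageE)
 then obtain c where c: "!!y u. y : Obj C ==> u : G y ==> c y u : el A y"
  "!!y u. y : Obj C ==> u : G y ==> g y (c y u) = h y (?s y u)" by metis
 obtain k where k: "k : nat_trans R C FM A"
  "!!x y f u. x : Obj C ==> y : Obj C ==> f : Hom C x y ==> u : G y ==>
   k x (single R (mk (y, f, u))) = act A x y f (c y u)" by (rule FM_lift[where c = c, OF A c(1)]) (assumption+, rule that, assumption, simp)
 have gk: "pointwise C FM (%x a. g x (k x a)) : nat_trans R C FM B"
  using nat_comp[OF FM_right_module k(1) g] .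
 have "pointwise C FM (%x a. g x (k x a)) x a = h x a" if "x : Obj C" "a : el FM x" for x a
 proof (rule FM_ext[OF B gk h _ that])
  fix y u assume y: "y : Obj C" "u : G y"
  thus "pointwise C FM (%x a. g x (k x a)) y (?s y u) = h y (?s y u)"
   using k(2)[OF y(1) y(1) Ident_Hom[OF C y(1)] y(2)] c by (simp add: s act_Ident[OF A])
 qed
 thus thesis using that[OF k(1)] by simp
qed

lemma FM_projective: "projective R C FM"
 unfolding projective_def
proof (intro conjI allI impI FM_right_module)
 fix A :: "('o, 'm, 'r, 'o \<times> 'm \<times> ('i => 'r) => 'r) cmod" and B :: "('o, 'm, 'r, 'i => 'r) cmod" and g h
 assume *: "right_module R C A \<and> right_module R C B \<and> g : nat_trans R C A B \<and>
  objectwise_surj C A B g \<and> h : nat_trans R C FM B"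
 hence "h x a : g x ` el A x" if "x : Obj C" "a : el FM x" for x a
  using that nat_closed[of h R C FM B x a] by (simp add: objectwise_surj_def)
 with * obtain k where "k : nat_trans R C FM A" "!!x a. x : Obj C ==> a : el FM x ==> g x (k x a) = h x a"
  using FM_lifts[of A B g h] by blast
 thus "\<exists>k\<in>nat_trans R C FM A. \<forall>x\<in>Obj C. \<forall>a\<in>el FM x. g x (k x a) = h x a" by blast
qed

end

text \<open>The definition of projectivity fixes element types; a free cover of \<open>P\<close> removes the restriction.\<close>

lemma projective_lifts:
 fixes R :: "'r ring" and C :: "('o, 'm) cat" and P :: "('o, 'm, 'r, 'x) cmod"
 assumes R: "cring R" and C: "category C" and P: "projective R C P"
  and A: "right_module R C A" and B: "right_module R C B" and g: "g : nat_trans R C A B"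
  and h: "h : nat_trans R C P B"
  and im: "!!x a. x : Obj C ==> a : el P x ==> h x a : g x ` el A x"
 obtains k where "k : nat_trans R C P A" "!!x a. x : Obj C ==> a : el P x ==> g x (k x a) = h x a"
proof -
 interpret F: free_setup R C "%t. t" "%y. el P y" by (rule free_setup.intro[OF R C]) simp
 have Pm: "right_module R C P" using P by (simp add: projective_def)
 obtain p where p: "p : nat_trans R C F.FM P"
  "!!x y f b. x : Obj C ==> y : Obj C ==> f : Hom C x y ==> b : el P y ==>
   p x (single R (y, f, b)) = act P x y f b" by (rule F.FM_lift[where c = "%y b. b", OF Pm]) simp_all
 have surj: "objectwise_surj C F.FM P p"
  unfolding objectwise_surj_def
 proof (intro ballI equalityI subsetI)
  fix x b assume x: "x : Obj C" "b : el P x"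
  have "p x (single R (x, Ident C x, b)) = b"
   using p(2)[OF x(1) x(1) Ident_Hom[OF C x(1)] x(2)] act_Ident[OF Pm x] by simp
  moreover have "single R (x, Ident C x, b) : el F.FM x"
   using F.single_FM[OF F.basisI[OF x(1) Ident_Hom[OF C x(1)] x(2)]] .
  ultimately show "b : p x ` el F.FM x" by force
 qed (use nat_closed[OF p(1)] in auto)
 have idP: "pointwise C P (%x a. a) : nat_trans R C P P"
  by (rule nat_transI[OF Pm mod_hom_id]) auto
 \<comment> \<open>Projectivity is invoked only at the types fixed by its definition, to split the
   free cover \<open>p\<close>.\<close>
 from P have ex: "\<exists>k\<in>nat_trans R C P A. \<forall>x\<in>Obj C. \<forall>a\<in>el P x. g x (k x a) = h x a"
  if "right_module R C A" "right_module R C B" "g : nat_trans R C A B" "objectwise_surj C A B g" "h : nat_trans R C P B"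
  for A :: "('o, 'm, 'r, 'o \<times> 'm \<times> 'x => 'r) cmod" and B :: "('o, 'm, 'r, 'x) cmod" and g h
  using that unfolding projective_def by blast
 obtain s where s: "s : nat_trans R C P F.FM"
  "!!x a. x : Obj C ==> a : el P x ==> p x (s x a) = a"
  using ex[OF F.FM_right_module Pm p(1) surj idP] by auto
 \<comment> \<open>For arbitrary element types the lift exists on the free cover; composed with the
   section \<open>s\<close> it becomes a lift on \<open>P\<close>.\<close>
 have hp: "pointwise C F.FM (%x a. h x (p x a)) : nat_trans R C F.FM B"
  using nat_comp[OF F.FM_right_module p(1) h] .
 have "pointwise C F.FM (%x a. h x (p x a)) x a : g x ` el A x"
  if "x : Obj C" "a : el F.FM x" for x a
  using im[OF that(1) nat_closed[OF p(1) that]] that by simp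
 then obtain k where k: "k : nat_trans R C F.FM A"
  "!!x a. x : Obj C ==> a : el F.FM x ==> g x (k x a) = pointwise C F.FM (%x a. h x (p x a)) x a"
  using F.FM_lifts[OF A B g hp] by blast
 show thesis
 proof (rule that[OF nat_comp[OF Pm s(1) k(1)]])
  show "g x (pointwise C P (%x a. k x (s x a)) x a) = h x a" if "x : Obj C" "a : el P x" for x a
   using that k(2)[OF that(1) nat_closed[OF s(1) that]] nat_closed[OF s(1) that] s(2)[OF that]
   by simp
 qed
qed

section \<open>The comparison theorem\<close>

text \<open>A resolution without projectivity, which is what the target of a comparison has to
  satisfy. Restriction along a functor preserves this property but in general not
  projectivity.\<close>

definition resolves ::
 "'r ring => ('o, 'm) cat => ('o, 'm, 'r, 'y) cmod => ('o, 'm, 'r, 'x, 'y) resolution => bool" where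
 "resolves R C A X \<longleftrightarrow> right_module R C A \<and>
  (\<forall>n. right_module R C (Term X n)) \<and>
  (\<forall>n. Bd X n : nat_trans R C (Term X (Suc n)) (Term X n)) \<and>
  Aug X : nat_trans R C (Term X 0) A \<and>
  objectwise_surj C (Term X 0) A (Aug X) \<and>
  (\<forall>x\<in>Obj C. mod_ker (val (Term X 0) x) (val A x) (Aug X x) =
    Bd X 0 x ` el (Term X 1) x) \<and>
  (\<forall>n. \<forall>x\<in>Obj C. mod_ker (val (Term X (Suc n)) x) (val (Term X n) x) (Bd X n x) =
    Bd X (Suc n) x ` el (Term X (Suc (Suc n))) x)"

lemma projective_resolves:
 "right_module R C A ==> projective_resolution R C A X ==> resolves R C A X"
 by (auto simp: projective_resolution_def resolves_def projective_def)

lemma resolvesD: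
 assumes "resolves R C A X"
 shows resolves_target: "right_module R C A"
  and Term_module: "right_module R C (Term X n)"
  and Bd_nat: "Bd X n : nat_trans R C (Term X (Suc n)) (Term X n)"
  and Aug_nat: "Aug X : nat_trans R C (Term X 0) A"
 using assms by (auto simp: resolves_def)

lemma Aug_surj:
 assumes "resolves R C A X" "x : Obj C" "b : el A x"
 obtains a where "a : el (Term X 0) x" "Aug X x a = b"
proof -
 have "b : Aug X x ` el (Term X 0) x" using assms(1-3) by (simp add: resolves_def objectwise_surj_def)
 thus thesis using that by blast
qed

lemma Aug_exact:
 assumes "resolves R C A X" "x : Obj C" "a : el (Term X 0) x" "Aug X x a = \<zero>[val A x]"
 shows "a : Bd X 0 x ` el (Term X (Suc 0)) x"
proof -
 have "a : mod_ker (val (Term X 0) x) (val A x) (Aug X x)" using assms by (simp add: mod_ker_def)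
 thus ?thesis using assms(1,2) by (simp add: resolves_def)
qed

lemma Bd_exact:
 assumes "resolves R C A X" "x : Obj C" "a : el (Term X (Suc n)) x"
  "Bd X n x a = \<zero>[val (Term X n) x]"
 shows "a : Bd X (Suc n) x ` el (Term X (Suc (Suc n))) x"
proof -
 have "a : mod_ker (val (Term X (Suc n)) x) (val (Term X n) x) (Bd X n x)" using assms by (simp add: mod_ker_def)
 thus ?thesis using assms(1,2) by (simp add: resolves_def)
qed

lemma Aug_Bd:
 assumes "resolves R C A X" "x : Obj C" "a : el (Term X (Suc 0)) x"
 shows "Aug X x (Bd X 0 x a) = \<zero>[val A x]"
proof -
 have "Bd X 0 x a : mod_ker (val (Term X 0) x) (val A x) (Aug X x)" using assms by (simp add: resolves_def)
 thus ?thesis by (simp add: mod_ker_def)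
qed

lemma Bd_Bd:
 assumes "resolves R C A X" "x : Obj C" "a : el (Term X (Suc (Suc n))) x"
 shows "Bd X n x (Bd X (Suc n) x a) = \<zero>[val (Term X n) x]"
proof -
 have "Bd X (Suc n) x a : mod_ker (val (Term X (Suc n)) x) (val (Term X n) x) (Bd X n x)"
  using assms by (simp add: resolves_def)
 thus ?thesis by (simp add: mod_ker_def)
qed

lemma Bd_closed:
 assumes "resolves R C A X" "x : Obj C" "a : el (Term X (Suc n)) x"
 shows "Bd X n x a : el (Term X n) x"
 using nat_closed[OF Bd_nat[OF assms(1)] assms(2,3)] .

definition chain_map ::
 "'r ring => ('o, 'm) cat => ('o, 'm, 'r, 'x, 'v) resolution => ('o, 'm, 'r, 'y, 'v) resolution =>
  (nat => 'o => 'x => 'y) => bool" where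
 "chain_map R C X Z \<tau> \<longleftrightarrow>
  (\<forall>n. \<tau> n : nat_trans R C (Term X n) (Term Z n)) \<and>
  (\<forall>n. \<forall>x\<in>Obj C. \<forall>a\<in>el (Term X (Suc n)) x. \<tau> n x (Bd X n x a) = Bd Z n x (\<tau> (Suc n) x a)) \<and>
  (\<forall>x\<in>Obj C. \<forall>a\<in>el (Term X 0) x. Aug Z x (\<tau> 0 x a) = Aug X x a)"

lemma chain_mapD:
 assumes "chain_map R C X Z \<tau>"
 shows "\<tau> n : nat_trans R C (Term X n) (Term Z n)"
  "x : Obj C ==> a : el (Term X (Suc n)) x ==> \<tau> n x (Bd X n x a) = Bd Z n x (\<tau> (Suc n) x a)"
  "x : Obj C ==> a : el (Term X 0) x ==> Aug Z x (\<tau> 0 x a) = Aug X x a"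
 using assms by (auto simp: chain_map_def)

lemma resolution_projective: "projective_resolution R C A X ==> projective R C (Term X n)"
 by (simp add: projective_resolution_def)

lemma chain_map_exists:
 assumes R: "cring R" and C: "category C" and X: "projective_resolution R C A X" and Z: "resolves R C A Z"
 obtains \<tau> where "chain_map R C X Z \<tau>"
proof -
 note X' = projective_resolves[OF resolves_target[OF Z] X]
 note pX = resolution_projective[OF X]
 \<comment> \<open>\<open>P\<close> carries along what makes the next step possible: the composite
   of \<open>t\<close> with the boundary of \<open>X\<close> lands in the image of the next boundary
   of \<open>Z\<close>. \<open>Q\<close> relates consecutive components.\<close>
 define P where "P n t \<longleftrightarrow> t : nat_trans R C (Term X n) (Term Z n) \<and>
  (n = 0 --> (\<forall>x\<in>Obj C. \<forall>a\<in>el (Term X 0) x. Aug Z x (t x a) = Aug X x a)) \<and>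
  (\<forall>x\<in>Obj C. \<forall>a\<in>el (Term X (Suc n)) x. t x (Bd X n x a) : Bd Z n x ` el (Term Z (Suc n)) x)" for n t
 define Q where "Q n t t' \<longleftrightarrow> (\<forall>x\<in>Obj C. \<forall>a\<in>el (Term X (Suc n)) x.
   t x (Bd X n x a) = Bd Z n x (t' x a))" for n t t'
 have "\<exists>\<tau>. \<forall>n. P n (\<tau> n) \<and> Q n (\<tau> n) (\<tau> (Suc n))"
 proof (rule dependent_nat_choice)
  have "Aug X x a : Aug Z x ` el (Term Z 0) x" if "x : Obj C" "a : el (Term X 0) x" for x a
   using Aug_surj[OF Z that(1) nat_closed[OF Aug_nat[OF X'] that]] by (metis image_eqI)
  then obtain t where t: "t : nat_trans R C (Term X 0) (Term Z 0)"
   "!!x a. x : Obj C ==> a : el (Term X 0) x ==> Aug Z x (t x a) = Aug X x a"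
   using projective_lifts[OF R C pX Term_module[OF Z] resolves_target[OF Z] Aug_nat[OF Z] Aug_nat[OF X']] by blast
  have "t x (Bd X 0 x a) : Bd Z 0 x ` el (Term Z (Suc 0)) x"
   if "x : Obj C" "a : el (Term X (Suc 0)) x" for x a
   using t(2)[OF that(1) Bd_closed[OF X' that]] Aug_Bd[OF X' that]
   by (intro Aug_exact[OF Z that(1)] nat_closed[OF t(1) that(1)] Bd_closed[OF X' that]) simp
  thus "\<exists>t. P 0 t" using t unfolding P_def by blast
 next
  fix t n assume P: "P n t"
  hence t: "t : nat_trans R C (Term X n) (Term Z n)"
   and im: "!!x a. x : Obj C ==> a : el (Term X (Suc n)) x ==>
    t x (Bd X n x a) : Bd Z n x ` el (Term Z (Suc n)) x" by (auto simp: P_def)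
  let ?h = "pointwise C (Term X (Suc n)) (%x a. t x (Bd X n x a))"
  have h: "?h : nat_trans R C (Term X (Suc n)) (Term Z n)"
   using nat_comp[OF Term_module[OF X'] Bd_nat[OF X'] t] .
  have "?h x a : Bd Z n x ` el (Term Z (Suc n)) x"
   if "x : Obj C" "a : el (Term X (Suc n)) x" for x a
   using im that by simp
  then obtain t' where t': "t' : nat_trans R C (Term X (Suc n)) (Term Z (Suc n))"
   "!!x a. x : Obj C ==> a : el (Term X (Suc n)) x ==> Bd Z n x (t' x a) = ?h x a"
   using projective_lifts[OF R C pX Term_module[OF Z] Term_module[OF Z] Bd_nat[OF Z] h] by blast
  have "t' x (Bd X (Suc n) x a) : Bd Z (Suc n) x ` el (Term Z (Suc (Suc n))) x"
   if xa: "x : Obj C" "a : el (Term X (Suc (Suc n))) x" for x a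
  proof (rule Bd_exact[OF Z xa(1)])
   show "t' x (Bd X (Suc n) x a) : el (Term Z (Suc n)) x"
    using nat_closed[OF t'(1) xa(1) Bd_closed[OF X' xa]] .
   show "Bd Z n x (t' x (Bd X (Suc n) x a)) = \<zero>[val (Term Z n) x]"
    using t'(2)[OF xa(1) Bd_closed[OF X' xa]] Bd_Bd[OF X' xa]
     nat_zero[OF t xa(1) Term_module[OF X'] Term_module[OF Z]] Bd_closed[OF X' xa]
    by (simp add: xa)
  qed
  hence "P (Suc n) t'" using t' by (simp add: P_def)
  moreover have "Q n t t'" using t'(2) by (simp add: Q_def)
  ultimately show "\<exists>t'. P (Suc n) t' \<and> Q n t t'" by blast
 qed
 then obtain \<tau> where "!!n. P n (\<tau> n)" "!!n. Q n (\<tau> n) (\<tau> (Suc n))" by blast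
 hence "chain_map R C X Z \<tau>" unfolding chain_map_def P_def Q_def by blast
 thus thesis by (rule that)
qed

lemma nat_trans_minus:
 assumes A: "right_module R C A" and B: "right_module R C B"
  and "\<eta> : nat_trans R C A B" "\<theta> : nat_trans R C A B"
 shows "pointwise C A (%x a. \<eta> x a -[val B x] \<theta> x a) : nat_trans R C A B"
proof (rule nat_transI[OF A])
 show "(%a. \<eta> x a -[val B x] \<theta> x a) : mod_hom R (val A x) (val B x)" if x: "x : Obj C" for x
 proof -
  interpret B: module R "val B x" by (rule val_module[OF B x])
  note c = nat_closed[OF assms(3) x] nat_closed[OF assms(4) x]
  show ?thesis
  proof (rule mod_homI)
   fix a b assume ab: "a : el A x" "b : el A x"
   note c = c[OF ab(1)] c[OF ab(2)]
   have "(\<eta> x a +[val B x] \<eta> x b) -[val B x] (\<theta> x a +[val B x] \<theta> x b) =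
    (\<eta> x a -[val B x] \<theta> x a) +[val B x] (\<eta> x b -[val B x] \<theta> x b)"
    using c by algebra
   thus "\<eta> x (a +[val A x] b) -[val B x] \<theta> x (a +[val A x] b) =
    (\<eta> x a -[val B x] \<theta> x a) +[val B x] (\<eta> x b -[val B x] \<theta> x b)"
    using nat_add[OF assms(3) x ab] nat_add[OF assms(4) x ab] by simp
  qed (simp_all add: c nat_smult[OF assms(3) x] nat_smult[OF assms(4) x] a_minus_def B.smult_r_distr B.smult_r_minus)
 qed
 show "\<eta> x (act A x y f a) -[val B x] \<theta> x (act A x y f a) = act B x y f (\<eta> y a -[val B y] \<theta> y a)"
  if "x : Obj C" "y : Obj C" "f : Hom C x y" "a : el A y" for x y f a
  using that hom_minus[OF val_module[OF B] val_module[OF B] act_hom[OF B that(1-3)]]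
  by (simp add: nat_act[OF assms(3)] nat_act[OF assms(4)] nat_closed[OF assms(3)] nat_closed[OF assms(4)])
qed

text \<open>The difference of the two chain maps is bounded degree by degree: each obstruction is a
  cycle of the exact complex \<open>Z\<close>, and projectivity lifts it through the
  boundary.\<close>

lemma chain_map_homotopy:
 assumes R: "cring R" and C: "category C" and X: "projective_resolution R C A X" and Z: "resolves R C A Z"
  and \<tau>: "chain_map R C X Z \<tau>" and \<sigma>: "chain_map R C X Z \<sigma>"
 obtains s where "!!n. s n : nat_trans R C (Term X n) (Term Z (Suc n))"
  "!!x a. x : Obj C ==> a : el (Term X 0) x ==>
   \<tau> 0 x a -[val (Term Z 0) x] \<sigma> 0 x a = Bd Z 0 x (s 0 x a)"
  "!!n x a. x : Obj C ==> a : el (Term X (Suc n)) x ==>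
   \<tau> (Suc n) x a -[val (Term Z (Suc n)) x] \<sigma> (Suc n) x a =
   Bd Z (Suc n) x (s (Suc n) x a) +[val (Term Z (Suc n)) x] s n x (Bd X n x a)"
proof -
 note X' = projective_resolves[OF resolves_target[OF Z] X]
 note pX = resolution_projective[OF X]
 note XM = Term_module[OF X'] and ZM = Term_module[OF Z]
 define D where "D n = pointwise C (Term X n) (%x a. \<tau> n x a -[val (Term Z n) x] \<sigma> n x a)" for n
 have D: "D n : nat_trans R C (Term X n) (Term Z n)" for n
  unfolding D_def using nat_trans_minus[OF XM ZM chain_mapD(1)[OF \<tau>] chain_mapD(1)[OF \<sigma>]] .
 have DBd: "D n x (Bd X n x a) = Bd Z n x (D (Suc n) x a)"
  if "x : Obj C" "a : el (Term X (Suc n)) x" for n x a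
  using that chain_mapD(2)[OF \<tau> that] chain_mapD(2)[OF \<sigma> that] Bd_closed[OF X' that]
   nat_minus[OF Bd_nat[OF Z] that(1) ZM ZM] nat_closed[OF chain_mapD(1)[OF \<tau>] that] nat_closed[OF chain_mapD(1)[OF \<sigma>] that]
  by (simp add: D_def)
 \<comment> \<open>The element that the next component of the homotopy has to bound: the difference
   in degree \<open>n + 1\<close> minus the part already accounted for by \<open>t\<close>.\<close>
 define E where "E n t = pointwise C (Term X (Suc n)) (%x a. D (Suc n) x a -[val (Term Z (Suc n)) x] t x (Bd X n x a))" for n t
 define P where "P n t \<longleftrightarrow> t : nat_trans R C (Term X n) (Term Z (Suc n)) \<and>
  (n = 0 --> (\<forall>x\<in>Obj C. \<forall>a\<in>el (Term X 0) x. D 0 x a = Bd Z 0 x (t x a))) \<and>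
  (\<forall>x\<in>Obj C. \<forall>a\<in>el (Term X (Suc n)) x. E n t x a : Bd Z (Suc n) x ` el (Term Z (Suc (Suc n))) x)" for n t
 define Q where "Q n t t' \<longleftrightarrow> (\<forall>x\<in>Obj C. \<forall>a\<in>el (Term X (Suc n)) x. E n t x a = Bd Z (Suc n) x (t' x a))" for n t t'
 have E: "E n t : nat_trans R C (Term X (Suc n)) (Term Z (Suc n))"
  if t: "t : nat_trans R C (Term X n) (Term Z (Suc n))" for n t
 proof -
  have "E n t = pointwise C (Term X (Suc n)) (%x a. D (Suc n) x a \<ominus>\<^bsub>val (Term Z (Suc n)) x\<^esub>
   pointwise C (Term X (Suc n)) (%x a. t x (Bd X n x a)) x a)"
   unfolding E_def by (auto simp: pointwise_def fun_eq_iff)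
  thus ?thesis using nat_trans_minus[OF XM ZM D nat_comp[OF XM Bd_nat[OF X'] t]] by simp
 qed
 have Ebd: "E n t x a : Bd Z (Suc n) x ` el (Term Z (Suc (Suc n))) x"
  if t: "t : nat_trans R C (Term X n) (Term Z (Suc n))"
   and e: "!!x a. x : Obj C ==> a : el (Term X (Suc n)) x ==>
    Bd Z n x (t x (Bd X n x a)) = D n x (Bd X n x a)"
   and xa: "x : Obj C" "a : el (Term X (Suc n)) x" for n t x a
 proof (rule Bd_exact[OF Z xa(1) nat_closed[OF E[OF t] xa]])
  interpret Zn: module R "val (Term Z n) x" by (rule val_module[OF ZM xa(1)])
  have c: "D (Suc n) x a : el (Term Z (Suc n)) x" "t x (Bd X n x a) : el (Term Z (Suc n)) x"
   using nat_closed[OF D xa] nat_closed[OF t xa(1) Bd_closed[OF X' xa]] .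
  have "Bd Z n x (E n t x a) = Bd Z n x (D (Suc n) x a) -[val (Term Z n) x] Bd Z n x (t x (Bd X n x a))"
   using nat_minus[OF Bd_nat[OF Z] xa(1) ZM ZM c] by (simp add: E_def xa)
  also have "\<dots> = \<zero>[val (Term Z n) x]"
   using DBd[OF xa] e[OF xa] Bd_closed[OF Z xa(1) c(1)] by (simp add: Zn.M.minus_zero_iff)
  finally show "Bd Z n x (E n t x a) = \<zero>[val (Term Z n) x]" .
 qed
 have "\<exists>s. \<forall>n. P n (s n) \<and> Q n (s n) (s (Suc n))"
 proof (rule dependent_nat_choice)
  have "D 0 x a : Bd Z 0 x ` el (Term Z (Suc 0)) x" if xa: "x : Obj C" "a : el (Term X 0) x" for x a
  proof (rule Aug_exact[OF Z xa(1) nat_closed[OF D xa]])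
   interpret A: module R "val A x" by (rule val_module[OF resolves_target[OF Z] xa(1)])
   show "Aug Z x (D 0 x a) = \<zero>[val A x]"
    using nat_minus[OF Aug_nat[OF Z] xa(1) ZM resolves_target[OF Z]] nat_closed[OF chain_mapD(1)[OF \<tau>] xa]
     nat_closed[OF chain_mapD(1)[OF \<sigma>] xa] chain_mapD(3)[OF \<tau> xa] chain_mapD(3)[OF \<sigma> xa]
     nat_closed[OF Aug_nat[OF X'] xa]
    by (simp add: D_def xa A.M.minus_zero_iff)
  qed
  then obtain t where t: "t : nat_trans R C (Term X 0) (Term Z (Suc 0))"
   "!!x a. x : Obj C ==> a : el (Term X 0) x ==> Bd Z 0 x (t x a) = D 0 x a"
   using projective_lifts[OF R C pX ZM ZM Bd_nat[OF Z] D] by blast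
  have "P 0 t" unfolding P_def using t Ebd[OF t(1) t(2)[OF _ Bd_closed[OF X']]] by simp
  thus "\<exists>t. P 0 t" by blast
 next
  fix t n assume P: "P n t"
  hence t: "t : nat_trans R C (Term X n) (Term Z (Suc n))"
   and im: "!!x a. x : Obj C ==> a : el (Term X (Suc n)) x ==>
    E n t x a : Bd Z (Suc n) x ` el (Term Z (Suc (Suc n))) x" by (auto simp: P_def)
  then obtain t' where t': "t' : nat_trans R C (Term X (Suc n)) (Term Z (Suc (Suc n)))"
   "!!x a. x : Obj C ==> a : el (Term X (Suc n)) x ==> Bd Z (Suc n) x (t' x a) = E n t x a"
   using projective_lifts[OF R C pX ZM ZM Bd_nat[OF Z] E[OF t] im] by blast
  have "Bd Z (Suc n) x (t' x (Bd X (Suc n) x a)) = D (Suc n) x (Bd X (Suc n) x a)"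
   if xa: "x : Obj C" "a : el (Term X (Suc (Suc n))) x" for x a
  proof -
   interpret Zn: module R "val (Term Z (Suc n)) x" by (rule val_module[OF ZM xa(1)])
   note b = Bd_closed[OF X' xa]
   have "D (Suc n) x (Bd X (Suc n) x a) -[val (Term Z (Suc n)) x] \<zero>[val (Term Z (Suc n)) x] = D (Suc n) x (Bd X (Suc n) x a)"
    using nat_closed[OF D xa(1) b] by algebra
   thus ?thesis
    using t'(2)[OF xa(1) b] Bd_Bd[OF X' xa] nat_zero[OF t xa(1) XM ZM] b by (simp add: E_def xa)
  qed
  hence "P (Suc n) t'" unfolding P_def using t' Ebd[OF t'(1)] by simp
  moreover have "Q n t t'" using t'(2) by (simp add: Q_def)
  ultimately show "\<exists>t'. P (Suc n) t' \<and> Q n t t'" by blast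
 qed
 then obtain s where s: "!!n. P n (s n)" "!!n. Q n (s n) (s (Suc n))" by blast
 have sn: "s n : nat_trans R C (Term X n) (Term Z (Suc n))" for n using s(1)[of n] by (simp add: P_def)
 show thesis
 proof (rule that[OF sn])
  show "\<tau> 0 x a -[val (Term Z 0) x] \<sigma> 0 x a = Bd Z 0 x (s 0 x a)"
   if "x : Obj C" "a : el (Term X 0) x" for x a
   using s(1)[of 0] that by (simp add: P_def D_def)
  fix n x a assume xa: "x : Obj C" "a : el (Term X (Suc n)) x"
  interpret Zn: module R "val (Term Z (Suc n)) x" by (rule val_module[OF ZM xa(1)])
  have c: "D (Suc n) x a : el (Term Z (Suc n)) x" "s n x (Bd X n x a) : el (Term Z (Suc n)) x"
   using nat_closed[OF D xa] nat_closed[OF sn xa(1) Bd_closed[OF X' xa]] .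
  have "Bd Z (Suc n) x (s (Suc n) x a) = D (Suc n) x a -[val (Term Z (Suc n)) x] s n x (Bd X n x a)"
   using s(2)[of n] xa by (simp add: Q_def E_def)
  moreover have "(D (Suc n) x a -[val (Term Z (Suc n)) x] s n x (Bd X n x a)) +[val (Term Z (Suc n)) x] s n x (Bd X n x a) = D (Suc n) x a"
   using c by algebra
  ultimately show "\<tau> (Suc n) x a -[val (Term Z (Suc n)) x] \<sigma> (Suc n) x a =
   Bd Z (Suc n) x (s (Suc n) x a) +[val (Term Z (Suc n)) x] s n x (Bd X n x a)"
   using xa by (simp add: D_def)
 qed
qed

section \<open>Cohomology classes\<close>

definition cls ::
 "'r ring => ('o, 'm) cat => ('o, 'm, 'r, 'x, 'y) resolution => ('o, 'm, 'r, 'z) cmod => nat =>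
  ('o => 'x => 'z) => ('o => 'x => 'z) set" where
 "cls R C X M n f = coboundaries R C X M n +>\<^bsub>hom_mod R C (Term X n) M\<^esub> f"

abbreviation cochains where
 "cochains R C X M n \<equiv> (hom_mod R C (Term X n) M) <| cocycles R C X M n"

lemma (in abelian_group) add_minus_cancel:
 assumes "x : carrier G" "y : carrier G"
 shows "(x \<oplus> y) \<ominus> y = x"
 using assms by algebra

text \<open>Subtraction in the record \<open>hom_mod\<close> is defined through abstract negatives;
  cancellation shows that it is pointwise.\<close>

lemma hom_mod_minus:
 assumes R: "cring R" and A: "right_module R C A" and B: "right_module R C B"
  and f: "f : nat_trans R C A B" and g: "g : nat_trans R C A B"
 shows "f -[hom_mod R C A B] g = pointwise C A (%x a. f x a -[val B x] g x a)"
proof -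
 interpret H: module R "hom_mod R C A B" by (rule hom_mod_module[OF R A B])
 let ?d = "pointwise C A (%x a. f x a -[val B x] g x a)"
 note d = nat_trans_minus[OF A B f g]
 have "?d +[hom_mod R C A B] g = f"
  unfolding hom_simps
 proof (rule nat_eqI[OF nat_trans_add[OF A B d g] f])
  fix x a assume x: "x : Obj C" "a : el A x"
  interpret B: module R "val B x" by (rule val_module[OF B x(1)])
  have "(f x a -[val B x] g x a) +[val B x] g x a = f x a"
   using nat_closed[OF f x] nat_closed[OF g x] by algebra
  thus "pointwise C A (%x a. ?d x a +[val B x] g x a) x a = f x a"
   using x by simp
 qed
 thus ?thesis using H.M.add_minus_cancel[of ?d g] d g by (simp add: hom_simps(1))
qed

lemma coboundariesI:
 "f : nat_trans R C (Term X n) M ==>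
  pointwise C (Term X (Suc n)) (%x a. f x (Bd X n x a)) : coboundaries R C X M (Suc n)"
 by (auto simp: coboundaries_def)

lemma coboundariesE:
 assumes "u : coboundaries R C X M (Suc n)"
 obtains f where "f : nat_trans R C (Term X n) M"
  "u = pointwise C (Term X (Suc n)) (%x a. f x (Bd X n x a))"
 using assms by (auto simp: coboundaries_def)

lemma coboundaries_0: "coboundaries R C X M 0 = {pointwise C (Term X 0) (%x a. \<zero>[val M x])}"
 by (simp add: coboundaries_def hom_simps)

locale cochain_setup =
 fixes R :: "'r ring" and C :: "('o, 'm) cat" and A :: "('o, 'm, 'r, 'y) cmod"
  and X :: "('o, 'm, 'r, 'x, 'y) resolution" and M :: "('o, 'm, 'r, 'z) cmod"
 assumes R: "cring R" and X: "resolves R C A X" and M: "right_module R C M"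
begin

lemmas XM = Term_module[OF X] and XBd = Bd_nat[OF X]

lemma cocycles_nat: "f : cocycles R C X M n ==> f : nat_trans R C (Term X n) M"
 by (simp add: cocycles_def)

lemma cocycles_Bd: "f : cocycles R C X M n ==> x : Obj C ==> a : el (Term X (Suc n)) x ==>
 f x (Bd X n x a) = \<zero>[val M x]"
 by (simp add: cocycles_def)

lemma cobound: "f : nat_trans R C (Term X n) M ==>
 pointwise C (Term X (Suc n)) (%x a. f x (Bd X n x a)) : cocycles R C X M (Suc n)"
 using nat_comp[OF XM XBd] nat_zero[OF _ _ XM M]
 by (simp add: cocycles_def Bd_closed[OF X] Bd_Bd[OF X])

lemma coboundaries_cocycles: "coboundaries R C X M n \<subseteq> cocycles R C X M n"
proof (cases n)
 case 0
 thus ?thesis using nat_trans_zero[OF XM M]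
  by (simp add: coboundaries_def cocycles_def hom_simps Bd_closed[OF X])
next
 case (Suc m)
 thus ?thesis using cobound by (auto simp: coboundaries_def)
qed

lemma cocycles_submodule: "submodule (cocycles R C X M n) R (hom_mod R C (Term X n) M)"
proof (rule submoduleI'[OF hom_mod_module[OF R XM M]])
 have mm: "module R (val M x)" if "x : Obj C" for x using val_module[OF M that] .
 show "\<zero>[hom_mod R C (Term X n) M] : cocycles R C X M n"
  using nat_trans_zero[OF XM M] by (simp add: cocycles_def hom_simps Bd_closed[OF X])
 show "f +[hom_mod R C (Term X n) M] g : cocycles R C X M n"
  if "f : cocycles R C X M n" "g : cocycles R C X M n" for f g
  using that nat_trans_add[OF XM M] abelian_group.abelian_simprules(2,6)[OF module.axioms(2)[OF mm]]
  by (simp add: cocycles_def hom_simps Bd_closed[OF X])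
 show "r *[hom_mod R C (Term X n) M] f : cocycles R C X M n"
  if "r : carrier R" "f : cocycles R C X M n" for r f
  using that nat_trans_smult[OF XM M] module.smult_r_null[OF mm]
  by (simp add: cocycles_def hom_simps Bd_closed[OF X])
qed (auto simp: hom_simps cocycles_nat)

lemma cochains_module: "module R (cochains R C X M n)"
 by (rule submodule_module[OF hom_mod_module[OF R XM M] cocycles_submodule])

lemma coboundaries_submodule: "submodule (coboundaries R C X M n) R (cochains R C X M n)"
proof (rule submoduleI'[OF cochains_module])
 show "coboundaries R C X M n \<subseteq> carrier (cochains R C X M n)" using coboundaries_cocycles by simp
 interpret H: module R "hom_mod R C (Term X n) M" by (rule hom_mod_module[OF R XM M])
 let ?b = "%m f. pointwise C (Term X (Suc m)) (%x a. f x (Bd X m x a))"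
 have mm: "module R (val M x)" if "x : Obj C" for x using val_module[OF M that] .
 show "\<zero>[cochains R C X M n] : coboundaries R C X M n"
 proof (cases n)
  case (Suc m)
  have "?b m (pointwise C (Term X m) (%x a. \<zero>[val M x])) = pointwise C (Term X n) (%x a. \<zero>[val M x])"
   unfolding Suc by (rule nat_eqI[OF nat_comp[OF XM XBd nat_trans_zero[OF XM M]] nat_trans_zero[OF XM M]])
    (simp add: Bd_closed[OF X])
  thus ?thesis
   using coboundariesI[OF nat_trans_zero[OF XM M, of m]] Suc by (simp add: hom_simps)
 qed (simp add: coboundaries_def)
 show "u +[cochains R C X M n] v : coboundaries R C X M n"
  if uv: "u : coboundaries R C X M n" "v : coboundaries R C X M n" for u v
 proof (cases n)
  case 0
  thus ?thesis using uv H.M.l_zero[OF H.M.zero_closed] by (simp add: coboundaries_def)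
 next
  case (Suc m)
  then obtain f g where *: "f : nat_trans R C (Term X m) M" "g : nat_trans R C (Term X m) M" "u = ?b m f" "v = ?b m g"
   using uv by (auto simp: coboundaries_def)
  have "?b m (pointwise C (Term X m) (%x a. f x a +[val M x] g x a)) = pointwise C (Term X (Suc m)) (%x a. u x a +[val M x] v x a)"
   unfolding *(3,4)
   by (rule nat_eqI[OF nat_comp[OF XM XBd nat_trans_add[OF XM M *(1,2)]]
      nat_trans_add[OF XM M nat_comp[OF XM XBd *(1)] nat_comp[OF XM XBd *(2)]]])
    (simp add: Bd_closed[OF X])
  thus ?thesis using coboundariesI[OF nat_trans_add[OF XM M *(1,2)]] Suc by (simp add: hom_simps)
 qed
 show "r *[cochains R C X M n] u : coboundaries R C X M n"
  if ru: "r : carrier R" "u : coboundaries R C X M n" for r u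
 proof (cases n)
  case 0
  thus ?thesis using ru H.smult_r_null[OF ru(1)] by (simp add: coboundaries_def)
 next
  case (Suc m)
  then obtain f where *: "f : nat_trans R C (Term X m) M" "u = ?b m f"
   using ru by (auto simp: coboundaries_def)
  have "?b m (pointwise C (Term X m) (%x a. r *[val M x] f x a)) = pointwise C (Term X (Suc m)) (%x a. r *[val M x] u x a)"
   unfolding *(2)
   by (rule nat_eqI[OF nat_comp[OF XM XBd nat_trans_smult[OF XM M *(1) ru(1)]]
      nat_trans_smult[OF XM M nat_comp[OF XM XBd *(1)] ru(1)]])
    (simp add: Bd_closed[OF X])
  thus ?thesis using coboundariesI[OF nat_trans_smult[OF XM M *(1) ru(1)]] Suc by (simp add: hom_simps)
 qed
qed

lemma Ext_quotient_map:
 "quotient_map R (cochains R C X M n) (coboundaries R C X M n) (cls R C X M n) (Ext_via R C X M n)"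
 using quotient_map_quot_mod[OF cochains_module coboundaries_submodule]
 by (simp add: Ext_via_def cls_def[abs_def] a_r_coset_def r_coset_def)

lemma cls_eq_iff:
 assumes "f : cocycles R C X M n" "g : cocycles R C X M n"
 shows "cls R C X M n f = cls R C X M n g \<longleftrightarrow>
  pointwise C (Term X n) (%x a. f x a -[val M x] g x a) : coboundaries R C X M n"
 using quotient_restrict_eq_iff[OF Ext_quotient_map hom_mod_module[OF R XM M] cocycles_submodule assms]
  hom_mod_minus[OF R XM M cocycles_nat[OF assms(1)] cocycles_nat[OF assms(2)]] by simp

lemma cls_mem:
 assumes "f : cocycles R C X M n" "g : cls R C X M n f"
 shows "g : cocycles R C X M n" "cls R C X M n g = cls R C X M n f"
proof -
 interpret H: module R "hom_mod R C (Term X n) M" by (rule hom_mod_module[OF R XM M])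
 obtain c where c: "c : coboundaries R C X M n" "g = c +[hom_mod R C (Term X n) M] f"
  using assms(2) by (auto simp: cls_def a_r_coset_def')
 have cc: "c : cocycles R C X M n" using c coboundaries_cocycles by blast
 show g: "g : cocycles R C X M n" using c(2) submodule_add[OF cocycles_submodule cc assms(1)] by simp
 have "g -[hom_mod R C (Term X n) M] f = c"
  unfolding c(2) using submodule_subset[OF cocycles_submodule cc] submodule_subset[OF cocycles_submodule assms(1)]
  by algebra
 thus "cls R C X M n g = cls R C X M n f"
  using quotient_restrict_eq_iff[OF Ext_quotient_map hom_mod_module[OF R XM M] cocycles_submodule g assms(1)] c(1)
  by simp
qed

lemma cls_self: "f : cocycles R C X M n ==> f : cls R C X M n f"
proof -
 assume f: "f : cocycles R C X M n"
 interpret H: module R "hom_mod R C (Term X n) M" by (rule hom_mod_module[OF R XM M])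
 have "f = \<zero>[hom_mod R C (Term X n) M] +[hom_mod R C (Term X n) M] f"
  using submodule_subset[OF cocycles_submodule f] by simp
 moreover have "\<zero>[hom_mod R C (Term X n) M] : coboundaries R C X M n"
  using submodule_zero[OF coboundaries_submodule] by simp
 ultimately show ?thesis unfolding cls_def a_r_coset_def' by blast
qed

end

section \<open>Functoriality of cohomology\<close>

definition restrict_res ::
 "('o, 'm) cat => ('o => 'u) => ('o => 'o => 'm => 'n) => ('u, 'n, 'r, 'x, 'y) resolution =>
  ('o, 'm, 'r, 'x, 'y) resolution" where
 "restrict_res C \<Phi> \<phi> Y = \<lparr>Term = (%n. restrict_mod \<Phi> \<phi> (Term Y n)),
  Bd = (%n. pointwise C (restrict_mod \<Phi> \<phi> (Term Y (Suc n))) (%x. Bd Y n (\<Phi> x))),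
  Aug = pointwise C (restrict_mod \<Phi> \<phi> (Term Y 0)) (%x. Aug Y (\<Phi> x))\<rparr>"

lemma restrict_simps [simp]:
 "val (restrict_mod \<Phi> \<phi> M) x = val M (\<Phi> x)"
 "act (restrict_mod \<Phi> \<phi> M) x y f = act M (\<Phi> x) (\<Phi> y) (\<phi> x y f)"
 by (simp_all add: restrict_mod_def)

lemma restrict_mod_const: "restrict_mod \<Phi> \<phi> (const_mod R) = const_mod R"
 by (simp add: restrict_mod_def const_mod_def)

lemma restrict_mod_comp:
 "restrict_mod \<Phi> \<phi> (restrict_mod \<Psi> \<psi> M) = restrict_mod (%x. \<Psi> (\<Phi> x)) (%x y f. \<psi> (\<Phi> x) (\<Phi> y) (\<phi> x y f)) M"
 by (simp add: restrict_mod_def)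

lemma restrict_mod_id: "restrict_mod (%x. x) (%_ _ f. f) M = M"
 by (simp add: restrict_mod_def)

lemma const_mod_module: "cring R ==> right_module R C (const_mod R)"
proof -
 assume "cring R"
 then interpret cring R .
 have "module R (regular_mod R)"
  by (rule moduleI[OF is_cring])
   (auto simp: regular_mod_def l_distr r_distr m_assoc a_ac intro!: abelian_groupI bexI[of _ "\<ominus>\<^bsub>R\<^esub> _"] l_neg)
 thus ?thesis
  by (intro right_moduleI) (simp_all add: const_mod_def mod_hom_id)
qed

lemma functor_id: "is_functor C C (%x. x) (%_ _ f. f)"
 by (simp add: is_functor_def)

lemma functor_comp:
 assumes "is_functor C D \<Phi> \<phi>" "is_functor D E \<Psi> \<psi>"
 shows "is_functor C E (%x. \<Psi> (\<Phi> x)) (%x y f. \<psi> (\<Phi> x) (\<Phi> y) (\<phi> x y f))"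
 using functorD[OF assms(1)] functorD[OF assms(2)] by (simp add: is_functor_def)

lemma restrict_nat:
 assumes F: "is_functor C D \<Phi> \<phi>" and A: "right_module R D A" and \<eta>: "\<eta> : nat_trans R D A B"
 shows "pointwise C (restrict_mod \<Phi> \<phi> A) (%x. \<eta> (\<Phi> x)) : nat_trans R C (restrict_mod \<Phi> \<phi> A) (restrict_mod \<Phi> \<phi> B)"
 by (rule nat_transI[OF restrict_module[OF F A]])
  (simp_all add: nat_hom[OF \<eta>] nat_act[OF \<eta>] functorD[OF F])

text \<open>Exactness is a condition at each object, so it survives restriction along any
  functor.\<close>

lemma restrict_res_resolves:
 assumes F: "is_functor C D \<Phi> \<phi>" and Y: "resolves R D A Y"
 shows "resolves R C (restrict_mod \<Phi> \<phi> A) (restrict_res C \<Phi> \<phi> Y)"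
 unfolding resolves_def
proof (intro conjI allI ballI)
 note FO = functor_Obj[OF F]
 let ?Z = "restrict_res C \<Phi> \<phi> Y"
 have T: "Term ?Z n = restrict_mod \<Phi> \<phi> (Term Y n)" for n by (simp add: restrict_res_def)
 have B: "Bd ?Z n x a = Bd Y n (\<Phi> x) a" if "x : Obj C" "a : el (Term Y (Suc n)) (\<Phi> x)" for n x a
  using that by (simp add: restrict_res_def)
 have Bimg: "Bd ?Z n x ` el (Term ?Z (Suc n)) x = Bd Y n (\<Phi> x) ` el (Term Y (Suc n)) (\<Phi> x)"
  if "x : Obj C" for n x
  using B[OF that] by (simp add: T)
 have Au: "Aug ?Z x a = Aug Y (\<Phi> x) a" if "x : Obj C" "a : el (Term Y 0) (\<Phi> x)" for x a
  using that by (simp add: restrict_res_def)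
 show "right_module R C (restrict_mod \<Phi> \<phi> A)" by (rule restrict_module[OF F resolves_target[OF Y]])
 show "right_module R C (Term ?Z n)" for n unfolding T by (rule restrict_module[OF F Term_module[OF Y]])
 show "Bd ?Z n : nat_trans R C (Term ?Z (Suc n)) (Term ?Z n)" for n
  using restrict_nat[OF F Term_module[OF Y] Bd_nat[OF Y]] by (simp add: restrict_res_def)
 show "Aug ?Z : nat_trans R C (Term ?Z 0) (restrict_mod \<Phi> \<phi> A)"
  using restrict_nat[OF F Term_module[OF Y] Aug_nat[OF Y]] by (simp add: restrict_res_def)
 show "objectwise_surj C (Term ?Z 0) (restrict_mod \<Phi> \<phi> A) (Aug ?Z)"
  using Y FO Au by (auto simp: objectwise_surj_def T resolves_def)
 fix x assume x: "x : Obj C"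
 show "mod_ker (val (Term ?Z 0) x) (val (restrict_mod \<Phi> \<phi> A) x) (Aug ?Z x) = Bd ?Z 0 x ` el (Term ?Z 1) x"
 proof -
  have "mod_ker (val (Term ?Z 0) x) (val (restrict_mod \<Phi> \<phi> A) x) (Aug ?Z x) =
   mod_ker (val (Term Y 0) (\<Phi> x)) (val A (\<Phi> x)) (Aug Y (\<Phi> x))"
   using Au[OF x] by (auto simp: mod_ker_def T)
  thus ?thesis using Bimg[OF x, of 0] Y FO[OF x] by (simp add: resolves_def)
 qed
 show "mod_ker (val (Term ?Z (Suc n)) x) (val (Term ?Z n) x) (Bd ?Z n x) = Bd ?Z (Suc n) x ` el (Term ?Z (Suc (Suc n))) x" for n
 proof -
  have "mod_ker (val (Term ?Z (Suc n)) x) (val (Term ?Z n) x) (Bd ?Z n x) =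
   mod_ker (val (Term Y (Suc n)) (\<Phi> x)) (val (Term Y n) (\<Phi> x)) (Bd Y n (\<Phi> x))"
   using B[OF x] by (auto simp: mod_ker_def T)
  thus ?thesis using Bimg[OF x, of "Suc n"] Y FO[OF x] by (simp add: resolves_def)
 qed
qed

section \<open>Pulling cochains back along a functor\<close>

lemma compareD:
 assumes "comparison_map R C X Y \<Phi> \<phi> \<tau>"
 shows comparison_nat: "\<tau> n : nat_trans R C (Term X n) (restrict_mod \<Phi> \<phi> (Term Y n))"
  and comparison_Bd: "x : Obj C ==> a : el (Term X (Suc n)) x ==>
   \<tau> n x (Bd X n x a) = Bd Y n (\<Phi> x) (\<tau> (Suc n) x a)"
  and comparison_Aug: "x : Obj C ==> a : el (Term X 0) x ==> Aug Y (\<Phi> x) (\<tau> 0 x a) = Aug X x a"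
 using assms by (auto simp: comparison_map_def)

lemma compare_closed:
 assumes "comparison_map R C X Y \<Phi> \<phi> \<tau>" "x : Obj C" "a : el (Term X n) x"
 shows "\<tau> n x a : el (Term Y n) (\<Phi> x)"
 using nat_closed[OF comparison_nat[OF assms(1)] assms(2,3)] by simp

text \<open>Seen over \<open>C\<close>, a comparison along \<open>\<Phi>\<close> is a chain map into
  the restricted resolution, so existence and uniqueness up to homotopy carry over.\<close>

lemma comparison_map_iff: "comparison_map R C X Y \<Phi> \<phi> \<tau> \<longleftrightarrow> chain_map R C X (restrict_res C \<Phi> \<phi> Y) \<tau>"
proof -
 have "x : Obj C ==> a : el (Term X n) x ==> \<tau> n x a : el (Term Y n) (\<Phi> x)"
  if "\<forall>n. \<tau> n : nat_trans R C (Term X n) (restrict_mod \<Phi> \<phi> (Term Y n))" for x a n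
  using that nat_closed[of "\<tau> n" R C "Term X n" "restrict_mod \<Phi> \<phi> (Term Y n)" x a] by simp
 thus ?thesis
  by (auto simp: comparison_map_def chain_map_def restrict_res_def)
qed

text \<open>Only the source \<open>X\<close> is projective. The restriction of \<open>Y\<close>
  along \<open>\<Phi>\<close> again resolves the constant functor, because that functor restricts to
  itself.\<close>

locale comparison_setup =
 fixes R :: "'r ring" and C :: "('o, 'm) cat" and D :: "('u, 'n) cat"
  and \<Phi> :: "'o => 'u" and \<phi> :: "'o => 'o => 'm => 'n"
  and X :: "('o, 'm, 'r, 'x, 'r) resolution" and Y :: "('u, 'n, 'r, 'y, 'r) resolution"
 assumes R: "cring R" and C: "category C" and F: "is_functor C D \<Phi> \<phi>"
  and X: "projective_resolution R C (const_mod R) X" and Y: "resolves R D (const_mod R) Y"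
begin

lemma X_resolves: "resolves R C (const_mod R) X"
 by (rule projective_resolves[OF const_mod_module[OF R] X])

lemma Y_restrict: "resolves R C (const_mod R) (restrict_res C \<Phi> \<phi> Y)"
 using restrict_res_resolves[OF F Y] by (simp add: restrict_mod_const)

lemma comparison_exists: obtains \<tau> where "comparison_map R C X Y \<Phi> \<phi> \<tau>"
 using chain_map_exists[OF R C X Y_restrict] by (auto simp: comparison_map_iff)

text \<open>Restriction along \<open>\<Phi>\<close>, a comparison \<open>\<tau>\<close> of
  resolutions and a change of coefficients \<open>\<eta>\<close> are treated as one operation, which
  covers functoriality in the category, in the resolution and in the coefficients together.\<close>

lemma pull_nat:
 assumes \<tau>: "\<tau> : nat_trans R C A (restrict_mod \<Phi> \<phi> B)" and A: "right_module R C A"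
  and f: "f : nat_trans R D B N" and \<eta>: "\<eta> : nat_trans R C (restrict_mod \<Phi> \<phi> N) M"
 shows "pointwise C A (%x a. \<eta> x (f (\<Phi> x) (\<tau> x a))) : nat_trans R C A M"
proof (rule nat_transI[OF A])
 note FO = functor_Obj[OF F] and FH = functor_Hom[OF F]
 note t = nat_closed[OF \<tau>, unfolded restrict_simps] and e = nat_hom[OF \<eta>, unfolded restrict_simps]
 show "(%a. \<eta> x (f (\<Phi> x) (\<tau> x a))) : mod_hom R (val A x) (val M x)" if "x : Obj C" for x
  using hom_comp[OF hom_comp[OF nat_hom[OF \<tau> that, unfolded restrict_simps] nat_hom[OF f FO[OF that]]] e[OF that]] .
 show "\<eta> x (f (\<Phi> x) (\<tau> x (act A x y h a))) = act M x y h (\<eta> y (f (\<Phi> y) (\<tau> y a)))"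
  if *: "x : Obj C" "y : Obj C" "h : Hom C x y" "a : el A y" for x y h a
  using nat_act[OF \<tau> *] nat_act[OF f FO[OF *(1)] FO[OF *(2)] FH[OF *(1-3)] t[OF *(2,4)]]
   nat_act[OF \<eta> *(1-3), of "f (\<Phi> y) (\<tau> y a)"] nat_closed[OF f FO[OF *(2)] t[OF *(2,4)]]
  by simp
qed

context
 fixes N :: "('u, 'n, 'r, 'z) cmod" and M :: "('o, 'm, 'r, 'w) cmod" and \<eta>
 assumes N: "right_module R D N" and M: "right_module R C M"
  and \<eta>: "\<eta> : nat_trans R C (restrict_mod \<Phi> \<phi> N) M"
begin

interpretation CX: cochain_setup R C "const_mod R" X M
 by (rule cochain_setup.intro[OF R X_resolves M])

interpretation DY: cochain_setup R D "const_mod R" Y N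
 by (rule cochain_setup.intro[OF R Y N])

abbreviation "pull \<tau> n f \<equiv> pointwise C (Term X n) (%x a. \<eta> x (f (\<Phi> x) (\<tau> n x a)))"

lemma \<eta>_hom: "x : Obj C ==> \<eta> x : mod_hom R (val N (\<Phi> x)) (val M x)"
 using nat_hom[OF \<eta>] by simp

lemma \<eta>_zero: "x : Obj C ==> \<eta> x \<zero>[val N (\<Phi> x)] = \<zero>[val M x]"
 using hom_zero[OF val_module[OF N functor_Obj[OF F]] val_module[OF M] \<eta>_hom] .

lemma pull_cochain:
 assumes \<tau>: "comparison_map R C X Y \<Phi> \<phi> \<tau>" and f: "f : nat_trans R D (Term Y n) N"
 shows "pull \<tau> n f : nat_trans R C (Term X n) M"
 by (rule pull_nat[OF comparison_nat[OF \<tau>] CX.XM f \<eta>])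

lemma pull_cocycle:
 assumes \<tau>: "comparison_map R C X Y \<Phi> \<phi> \<tau>" and f: "f : cocycles R D Y N n"
 shows "pull \<tau> n f : cocycles R C X M n"
 using pull_cochain[OF \<tau> DY.cocycles_nat[OF f]]
 by (simp add: cocycles_def Bd_closed[OF X_resolves] comparison_Bd[OF \<tau>] DY.cocycles_Bd[OF f]
   functor_Obj[OF F] compare_closed[OF \<tau>] \<eta>_zero)

lemma pull_coboundary:
 assumes \<tau>: "comparison_map R C X Y \<Phi> \<phi> \<tau>" and f: "f : coboundaries R D Y N n"
 shows "pull \<tau> n f : coboundaries R C X M n"
proof (cases n)
 case 0
 hence "f = pointwise D (Term Y 0) (%x a. \<zero>[val N x])" using f by (simp add: coboundaries_0)
 hence "pull \<tau> 0 f = pointwise C (Term X 0) (%x a. \<zero>[val M x])"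
  using pull_cochain[OF \<tau> nat_trans_zero[OF DY.XM N]]
  by (intro nat_eqI[OF _ nat_trans_zero[OF CX.XM M]])
   (simp_all add: functor_Obj[OF F] compare_closed[OF \<tau>] \<eta>_zero)
 thus ?thesis using 0 by (simp add: coboundaries_0)
next
 case (Suc m)
 then obtain g where g: "g : nat_trans R D (Term Y m) N"
  "f = pointwise D (Term Y (Suc m)) (%x a. g x (Bd Y m x a))" using f by (auto elim: coboundariesE)
 have fn: "f : nat_trans R D (Term Y (Suc m)) N" unfolding g(2) by (rule nat_comp[OF DY.XM DY.XBd g(1)])
 have "pull \<tau> (Suc m) f = pointwise C (Term X (Suc m)) (%x a. pull \<tau> m g x (Bd X m x a))"
  by (rule nat_eqI[OF pull_cochain[OF \<tau> fn] nat_comp[OF CX.XM CX.XBd pull_cochain[OF \<tau> g(1)]]])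
   (simp add: g(2) Bd_closed[OF X_resolves] comparison_Bd[OF \<tau>] functor_Obj[OF F] compare_closed[OF \<tau>])
 thus ?thesis using coboundariesI[OF pull_cochain[OF \<tau> g(1)]] Suc by simp
qed

lemma pull_hom:
 assumes \<tau>: "comparison_map R C X Y \<Phi> \<phi> \<tau>"
 shows "pull \<tau> n : mod_hom R (cochains R D Y N n) (cochains R C X M n)"
proof (rule mod_homI)
 note c = nat_closed[OF DY.cocycles_nat functor_Obj[OF F] compare_closed[OF \<tau>]]
 fix f assume "f : carrier (cochains R D Y N n)"
 hence f: "f : cocycles R D Y N n" by simp
 show "pull \<tau> n f : carrier (cochains R C X M n)" using pull_cocycle[OF \<tau> f] by simp
 show "pull \<tau> n (r *[cochains R D Y N n] f) = r *[cochains R C X M n] pull \<tau> n f" if r: "r : carrier R" for r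
  using pull_cochain[OF \<tau> nat_trans_smult[OF DY.XM N DY.cocycles_nat[OF f] r]]
   nat_trans_smult[OF CX.XM M pull_cochain[OF \<tau> DY.cocycles_nat[OF f]] r]
  by (auto intro!: nat_eqI simp: hom_simps functor_Obj[OF F] compare_closed[OF \<tau>]
    c[OF f] hom_smult[OF \<eta>_hom] r)
 fix g assume "g : carrier (cochains R D Y N n)"
 hence g: "g : cocycles R D Y N n" by simp
 show "pull \<tau> n (f +[cochains R D Y N n] g) = pull \<tau> n f +[cochains R C X M n] pull \<tau> n g"
  using pull_cochain[OF \<tau> nat_trans_add[OF DY.XM N DY.cocycles_nat[OF f] DY.cocycles_nat[OF g]]]
   nat_trans_add[OF CX.XM M pull_cochain[OF \<tau> DY.cocycles_nat[OF f]] pull_cochain[OF \<tau> DY.cocycles_nat[OF g]]]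
  by (auto intro!: nat_eqI simp: hom_simps functor_Obj[OF F] compare_closed[OF \<tau>]
    c[OF f] c[OF g] hom_add[OF \<eta>_hom])
qed

text \<open>The maps on cohomology are defined as unions over all representatives of a class; this
  makes the members of such a union equal.\<close>

lemma pull_cls_cong:
 assumes \<tau>: "comparison_map R C X Y \<Phi> \<phi> \<tau>" and f: "f : cocycles R D Y N n" and g: "g : cls R D Y N n f"
 shows "cls R C X M n (pull \<tau> n g) = cls R C X M n (pull \<tau> n f)"
proof -
 note gc = DY.cls_mem[OF f g]
 let ?d = "pointwise D (Term Y n) (%x a. g x a -[val N x] f x a)"
 have d: "?d : coboundaries R D Y N n" using DY.cls_eq_iff[OF gc(1) f] gc(2) by simp
 note nf = DY.cocycles_nat[OF f] and ng = DY.cocycles_nat[OF gc(1)]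
 have "pull \<tau> n ?d = pointwise C (Term X n) (%x a. pull \<tau> n g x a -[val M x] pull \<tau> n f x a)"
  using pull_cochain[OF \<tau> nat_trans_minus[OF DY.XM N ng nf]]
   nat_trans_minus[OF CX.XM M pull_cochain[OF \<tau> ng] pull_cochain[OF \<tau> nf]]
  by (auto intro!: nat_eqI simp: functor_Obj[OF F] compare_closed[OF \<tau>]
   hom_minus[OF val_module[OF N functor_Obj[OF F]] val_module[OF M] \<eta>_hom]
   nat_closed[OF nf functor_Obj[OF F] compare_closed[OF \<tau>]] nat_closed[OF ng functor_Obj[OF F] compare_closed[OF \<tau>]])
 thus ?thesis
  using CX.cls_eq_iff[OF pull_cocycle[OF \<tau> gc(1)] pull_cocycle[OF \<tau> f]] pull_coboundary[OF \<tau> d] by simp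
qed

text \<open>Two comparison maps are homotopic, and a cocycle turns the homotopy into a
  coboundary.\<close>

lemma pull_unique:
 assumes \<tau>: "comparison_map R C X Y \<Phi> \<phi> \<tau>" and \<sigma>: "comparison_map R C X Y \<Phi> \<phi> \<sigma>" and f: "f : cocycles R D Y N n"
 shows "cls R C X M n (pull \<tau> n f) = cls R C X M n (pull \<sigma> n f)"
proof -
 let ?Z = "restrict_res C \<Phi> \<phi> Y"
 note nf = DY.cocycles_nat[OF f] and FO = functor_Obj[OF F]
 obtain s where s: "!!n. s n : nat_trans R C (Term X n) (Term ?Z (Suc n))"
  "!!x a. x : Obj C ==> a : el (Term X 0) x ==>
   \<tau> 0 x a -[val (Term ?Z 0) x] \<sigma> 0 x a = Bd ?Z 0 x (s 0 x a)"
  "!!n x a. x : Obj C ==> a : el (Term X (Suc n)) x ==>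
   \<tau> (Suc n) x a -[val (Term ?Z (Suc n)) x] \<sigma> (Suc n) x a =
   Bd ?Z (Suc n) x (s (Suc n) x a) +[val (Term ?Z (Suc n)) x] s n x (Bd X n x a)"
  using chain_map_homotopy[OF R C X Y_restrict \<tau>[unfolded comparison_map_iff] \<sigma>[unfolded comparison_map_iff]] by blast
 have T: "Term ?Z n = restrict_mod \<Phi> \<phi> (Term Y n)" for n by (simp add: restrict_res_def)
 have sn: "s n : nat_trans R C (Term X n) (restrict_mod \<Phi> \<phi> (Term Y (Suc n)))" for n using s(1) by (simp add: T)
 have sc: "s n x a : el (Term Y (Suc n)) (\<Phi> x)" if "x : Obj C" "a : el (Term X n) x" for n x a
  using nat_closed[OF sn that] by simp
 have B: "Bd ?Z n x a = Bd Y n (\<Phi> x) a" if "x : Obj C" "a : el (Term Y (Suc n)) (\<Phi> x)" for n x a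
  using that by (simp add: restrict_res_def)
 let ?d = "pointwise C (Term X n) (%x a. pull \<tau> n f x a -[val M x] pull \<sigma> n f x a)"
 have dn: "?d : nat_trans R C (Term X n) M"
  using nat_trans_minus[OF CX.XM M pull_cochain[OF \<tau> nf] pull_cochain[OF \<sigma> nf]] .
 have dx: "?d x a = \<eta> x (f (\<Phi> x) (\<tau> n x a -[val (Term Y n) (\<Phi> x)] \<sigma> n x a))"
  if xa: "x : Obj C" "a : el (Term X n) x" for x a
  using xa by (simp add: nat_minus[OF nf FO[OF xa(1)] DY.XM N] compare_closed[OF \<tau>] compare_closed[OF \<sigma>]
   hom_minus[OF val_module[OF N functor_Obj[OF F]] val_module[OF M] \<eta>_hom]
   nat_closed[OF nf FO compare_closed[OF \<tau>]] nat_closed[OF nf FO compare_closed[OF \<sigma>]])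
 have "?d : coboundaries R C X M n"
 proof (cases n)
  case 0
  have "?d = pointwise C (Term X n) (%x a. \<zero>[val M x])"
  proof (rule nat_eqI[OF dn nat_trans_zero[OF CX.XM M]])
   fix x a assume xa: "x : Obj C" "a : el (Term X n) x"
   have "\<tau> n x a -[val (Term Y n) (\<Phi> x)] \<sigma> n x a = Bd Y 0 (\<Phi> x) (s 0 x a)"
    using s(2)[OF xa(1)] xa B[OF xa(1) sc[OF xa(1)]] 0 by (simp add: T)
   thus "?d x a = pointwise C (Term X n) (%x a. \<zero>[val M x]) x a"
    unfolding dx[OF xa] using DY.cocycles_Bd[OF f FO[OF xa(1)]] sc[OF xa(1)] xa 0 \<eta>_zero by simp
  qed
  thus ?thesis using 0 by (simp add: coboundaries_0)
 next
  case (Suc m)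
  \<comment> \<open>Of the two terms in the homotopy formula, the one through the boundary of
    \<open>Y\<close> is annihilated by the cocycle \<open>f\<close>; the other one is the coboundary
    of \<open>?g\<close>.\<close>
  let ?g = "pointwise C (Term X m) (%x a. \<eta> x (f (\<Phi> x) (s m x a)))"
  have g: "?g : nat_trans R C (Term X m) M"
   using pull_nat[OF sn CX.XM _ \<eta>] nf Suc by simp
  have "?d = pointwise C (Term X (Suc m)) (%x a. ?g x (Bd X m x a))"
  proof (rule nat_eqI[OF dn])
   show "pointwise C (Term X (Suc m)) (%x a. ?g x (Bd X m x a)) : nat_trans R C (Term X n) M"
    using nat_comp[OF CX.XM CX.XBd g] Suc by simp
   fix x a assume xa: "x : Obj C" "a : el (Term X n) x"
   interpret N: module R "val N (\<Phi> x)" by (rule val_module[OF N FO[OF xa(1)]])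
   note xa' = xa(1) xa(2)[unfolded Suc]
   have b: "Bd X m x a : el (Term X m) x" using Bd_closed[OF X_resolves xa'] .
   have bs: "Bd Y n (\<Phi> x) (s n x a) : el (Term Y n) (\<Phi> x)" using Bd_closed[OF Y FO[OF xa(1)] sc[OF xa]] .
   have sm: "s m x (Bd X m x a) : el (Term Y n) (\<Phi> x)" using sc[OF xa(1) b] Suc by simp
   have "\<tau> n x a -[val (Term Y n) (\<Phi> x)] \<sigma> n x a =
     Bd Y n (\<Phi> x) (s n x a) +[val (Term Y n) (\<Phi> x)] s m x (Bd X m x a)"
    using s(3)[OF xa'] B[OF xa(1) sc[OF xa]] Suc by (simp add: T)
   hence "f (\<Phi> x) (\<tau> n x a -[val (Term Y n) (\<Phi> x)] \<sigma> n x a) = f (\<Phi> x) (s m x (Bd X m x a))"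
    using nat_add[OF nf FO[OF xa(1)] bs sm] DY.cocycles_Bd[OF f FO[OF xa(1)] sc[OF xa]]
     nat_closed[OF nf FO[OF xa(1)] sm] by simp
   thus "?d x a = pointwise C (Term X (Suc m)) (%x a. ?g x (Bd X m x a)) x a"
    unfolding dx[OF xa] using xa' b by simp
  qed
  thus ?thesis using coboundariesI[OF g] Suc by simp
 qed
 thus ?thesis using CX.cls_eq_iff[OF pull_cocycle[OF \<tau> f] pull_cocycle[OF \<sigma> f]] by simp
qed

end

end

section \<open>Composition of comparisons, natural transformations and retractions\<close>

lemma comparison_id:
 assumes "resolves R C (const_mod R) X"
 shows "comparison_map R C X X (%x. x) (%_ _ f. f) (%n. pointwise C (Term X n) (%x a. a))"
 unfolding comparison_map_def restrict_mod_id
 by (intro conjI allI ballI nat_transI[OF Term_module[OF assms] mod_hom_id]) (simp_all add: Bd_closed[OF assms])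

lemma comparison_comp:
 assumes F: "is_functor C D \<Phi> \<phi>" and X: "resolves R C (const_mod R) X"
  and \<tau>: "comparison_map R C X Y \<Phi> \<phi> \<tau>" and \<sigma>: "comparison_map R D Y Z \<Psi> \<psi> \<sigma>"
 shows "comparison_map R C X Z (%x. \<Psi> (\<Phi> x)) (%x y f. \<psi> (\<Phi> x) (\<Phi> y) (\<phi> x y f))
  (%n. pointwise C (Term X n) (%x a. \<sigma> n (\<Phi> x) (\<tau> n x a)))"
 unfolding comparison_map_def restrict_mod_comp[symmetric]
proof (intro conjI allI ballI)
 note FO = functor_Obj[OF F] and FH = functor_Hom[OF F]
 note t = compare_closed[OF \<tau>]
 show "pointwise C (Term X n) (%x a. \<sigma> n (\<Phi> x) (\<tau> n x a)) \<in>
  nat_trans R C (Term X n) (restrict_mod \<Phi> \<phi> (restrict_mod \<Psi> \<psi> (Term Z n)))" for n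
 proof (rule nat_transI[OF Term_module[OF X]])
  show "(%a. \<sigma> n (\<Phi> x) (\<tau> n x a)) : mod_hom R (val (Term X n) x) (val (restrict_mod \<Phi> \<phi> (restrict_mod \<Psi> \<psi> (Term Z n))) x)"
   if "x : Obj C" for x
   using hom_comp[OF nat_hom[OF comparison_nat[OF \<tau>] that] nat_hom[OF comparison_nat[OF \<sigma>] FO[OF that], folded restrict_simps(1)[of \<Phi> \<phi>]]]
   by simp
  show "\<sigma> n (\<Phi> x) (\<tau> n x (act (Term X n) x y f a)) = act (restrict_mod \<Phi> \<phi> (restrict_mod \<Psi> \<psi> (Term Z n))) x y f (\<sigma> n (\<Phi> y) (\<tau> n y a))"
   if "x : Obj C" "y : Obj C" "f : Hom C x y" "a : el (Term X n) y" for x y f a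
   using that nat_act[OF comparison_nat[OF \<tau>] that] nat_act[OF comparison_nat[OF \<sigma>] FO FO FH t]
   by simp
 qed
 show "pointwise C (Term X n) (%x a. \<sigma> n (\<Phi> x) (\<tau> n x a)) x (Bd X n x a) =
  Bd Z n (\<Psi> (\<Phi> x)) (pointwise C (Term X (Suc n)) (%x a. \<sigma> (Suc n) (\<Phi> x) (\<tau> (Suc n) x a)) x a)"
  if "x : Obj C" "a : el (Term X (Suc n)) x" for n x a
  using that by (simp add: Bd_closed[OF X] comparison_Bd[OF \<tau>] comparison_Bd[OF \<sigma>] FO t)
 show "Aug Z (\<Psi> (\<Phi> x)) (pointwise C (Term X 0) (%x a. \<sigma> 0 (\<Phi> x) (\<tau> 0 x a)) x a) = Aug X x a"
  if "x : Obj C" "a : el (Term X 0) x" for x a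
  using that by (simp add: comparison_Aug[OF \<tau>] comparison_Aug[OF \<sigma>] FO t)
qed

text \<open>Composites of functors agree with the identity only on objects and morphisms of the
  category, not as functions on the types.\<close>

lemma comparison_cong:
 assumes "comparison_map R C X Y \<Phi> \<phi> \<tau>" "!!x. x : Obj C ==> \<Phi>' x = \<Phi> x"
  "!!x y f. x : Obj C ==> y : Obj C ==> f : Hom C x y ==> \<phi>' x y f = \<phi> x y f"
 shows "comparison_map R C X Y \<Phi>' \<phi>' \<tau>"
 using assms by (simp add: comparison_map_def nat_trans_def)

definition natural_in ::
 "('o, 'm) cat => ('u, 'n) cat => ('o => 'u) => ('o => 'o => 'm => 'n) => ('o => 'u) => ('o => 'o => 'm => 'n) =>
  ('o => 'n) => bool" where
 "natural_in C D \<Phi> \<phi> \<Psi> \<psi> \<theta> \<longleftrightarrow> (\<forall>x\<in>Obj C. \<theta> x : Hom D (\<Phi> x) (\<Psi> x)) \<and>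
  (\<forall>x\<in>Obj C. \<forall>y\<in>Obj C. \<forall>f\<in>Hom C x y.
    Comp D (\<Phi> x) (\<Psi> x) (\<Psi> y) (\<psi> x y f) (\<theta> x) = Comp D (\<Phi> x) (\<Phi> y) (\<Psi> y) (\<theta> y) (\<phi> x y f))"

text \<open>Right modules are contravariant, so a transformation from \<open>\<Phi>\<close> to
  \<open>\<Psi>\<close> induces a map from the restriction along \<open>\<Psi>\<close> to the
  restriction along \<open>\<Phi>\<close>.\<close>

lemma twist_nat:
 assumes F: "is_functor C D \<Phi> \<phi>" and G: "is_functor C D \<Psi> \<psi>" and \<theta>: "natural_in C D \<Phi> \<phi> \<Psi> \<psi> \<theta>"
  and A: "right_module R D A"
 shows "pointwise C (restrict_mod \<Psi> \<psi> A) (%x. act A (\<Phi> x) (\<Psi> x) (\<theta> x)) \<in>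
  nat_trans R C (restrict_mod \<Psi> \<psi> A) (restrict_mod \<Phi> \<phi> A)"
proof (rule nat_transI[OF restrict_module[OF G A]])
 note FO = functor_Obj[OF F] functor_Obj[OF G] and FH = functor_Hom[OF F] functor_Hom[OF G]
 have th: "\<theta> x : Hom D (\<Phi> x) (\<Psi> x)" if "x : Obj C" for x using \<theta> that by (simp add: natural_in_def)
 show "act A (\<Phi> x) (\<Psi> x) (\<theta> x) : mod_hom R (val (restrict_mod \<Psi> \<psi> A) x) (val (restrict_mod \<Phi> \<phi> A) x)"
  if "x : Obj C" for x
  using act_hom[OF A FO(1)[OF that] FO(2)[OF that] th[OF that]] by simp
 show "act A (\<Phi> x) (\<Psi> x) (\<theta> x) (act (restrict_mod \<Psi> \<psi> A) x y f a) = act (restrict_mod \<Phi> \<phi> A) x y f (act A (\<Phi> y) (\<Psi> y) (\<theta> y) a)"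
  if *: "x : Obj C" "y : Obj C" "f : Hom C x y" "a : el (restrict_mod \<Psi> \<psi> A) y" for x y f a
 proof -
  have a: "a : el A (\<Psi> y)" using * by simp
  have "act A (\<Phi> x) (\<Psi> x) (\<theta> x) (act A (\<Psi> x) (\<Psi> y) (\<psi> x y f) a) = act A (\<Phi> x) (\<Psi> y) (Comp D (\<Phi> x) (\<Psi> x) (\<Psi> y) (\<psi> x y f) (\<theta> x)) a"
   using act_Comp[OF A FO(1)[OF *(1)] FO(2)[OF *(1)] FO(2)[OF *(2)] th[OF *(1)] FH(2)[OF *(1-3)] a] by simp
  also have "\<dots> = act A (\<Phi> x) (\<Psi> y) (Comp D (\<Phi> x) (\<Phi> y) (\<Psi> y) (\<theta> y) (\<phi> x y f)) a"
   using \<theta> * by (simp add: natural_in_def)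
  also have "\<dots> = act A (\<Phi> x) (\<Phi> y) (\<phi> x y f) (act A (\<Phi> y) (\<Psi> y) (\<theta> y) a)"
   using act_Comp[OF A FO(1)[OF *(1)] FO(1)[OF *(2)] FO(2)[OF *(2)] FH(1)[OF *(1-3)] th[OF *(2)] a] by simp
  finally show ?thesis by simp
 qed
qed

text \<open>Acting with \<open>\<theta>\<close> on the resolution \<open>Y\<close> turns a
  comparison over \<open>\<Psi>\<close> into one over \<open>\<Phi>\<close>; the augmentation is
  unaffected since morphisms act trivially on the constant functor.\<close>

lemma comparison_twist:
 assumes F: "is_functor C D \<Phi> \<phi>" and G: "is_functor C D \<Psi> \<psi>" and \<theta>: "natural_in C D \<Phi> \<phi> \<Psi> \<psi> \<theta>"
  and X: "resolves R C (const_mod R) X" and Y: "resolves R D (const_mod R) Y" and \<tau>: "comparison_map R C X Y \<Psi> \<psi> \<tau>"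
 shows "comparison_map R C X Y \<Phi> \<phi> (%n. pointwise C (Term X n) (%x a. act (Term Y n) (\<Phi> x) (\<Psi> x) (\<theta> x) (\<tau> n x a)))"
 unfolding comparison_map_def
proof (intro conjI allI ballI)
 note FO = functor_Obj[OF F] functor_Obj[OF G]
 have th: "\<theta> x : Hom D (\<Phi> x) (\<Psi> x)" if "x : Obj C" for x using \<theta> that by (simp add: natural_in_def)
 note t = compare_closed[OF \<tau>]
 show "pointwise C (Term X n) (%x a. act (Term Y n) (\<Phi> x) (\<Psi> x) (\<theta> x) (\<tau> n x a)) \<in>
  nat_trans R C (Term X n) (restrict_mod \<Phi> \<phi> (Term Y n))" for n
 proof -
  have "pointwise C (Term X n) (%x a. pointwise C (restrict_mod \<Psi> \<psi> (Term Y n)) (%x. act (Term Y n) (\<Phi> x) (\<Psi> x) (\<theta> x)) x (\<tau> n x a)) \<in>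
   nat_trans R C (Term X n) (restrict_mod \<Phi> \<phi> (Term Y n))"
   by (rule nat_comp[OF Term_module[OF X] comparison_nat[OF \<tau>] twist_nat[OF F G \<theta> Term_module[OF Y]]])
  moreover have "pointwise C (Term X n) (%x a. pointwise C (restrict_mod \<Psi> \<psi> (Term Y n)) (%x. act (Term Y n) (\<Phi> x) (\<Psi> x) (\<theta> x)) x (\<tau> n x a)) =
   pointwise C (Term X n) (%x a. act (Term Y n) (\<Phi> x) (\<Psi> x) (\<theta> x) (\<tau> n x a))"
   using t by (intro ext) (simp add: pointwise_def)
  ultimately show ?thesis by simp
 qed
 show "pointwise C (Term X n) (%x a. act (Term Y n) (\<Phi> x) (\<Psi> x) (\<theta> x) (\<tau> n x a)) x (Bd X n x a) =
  Bd Y n (\<Phi> x) (pointwise C (Term X (Suc n)) (%x a. act (Term Y (Suc n)) (\<Phi> x) (\<Psi> x) (\<theta> x) (\<tau> (Suc n) x a)) x a)"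
  if "x : Obj C" "a : el (Term X (Suc n)) x" for n x a
  using that by (simp add: Bd_closed[OF X] comparison_Bd[OF \<tau>] t FO th nat_act[OF Bd_nat[OF Y]])
 show "Aug Y (\<Phi> x) (pointwise C (Term X 0) (%x a. act (Term Y 0) (\<Phi> x) (\<Psi> x) (\<theta> x) (\<tau> 0 x a)) x a) = Aug X x a"
  if "x : Obj C" "a : el (Term X 0) x" for x a
  using that nat_act[OF Aug_nat[OF Y] FO th t] comparison_Aug[OF \<tau> that]
  by (simp add: const_mod_def)
qed

text \<open>A retraction \<open>r\<close> of \<open>i\<close> with a natural transformation \<open>1 \<rightarrow> i r\<close> makes restriction along \<open>i\<close>
 an isomorphism on cohomology.\<close>

lemma retract_quotient_map:
 fixes R :: "'r ring" and C :: "('o, 'm) cat" and G :: "('u, 'n) cat" and N :: "('o, 'm, 'r, 'z) cmod"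
  and X :: "('o, 'm, 'r, 'x, 'r) resolution" and Y :: "('u, 'n, 'r, 'y, 'r) resolution"
 assumes R: "cring R" and C: "category C" and G: "category G"
  and X: "projective_resolution R C (const_mod R) X" and Y: "projective_resolution R G (const_mod R) Y"
  and i: "is_functor G C i ih" and r: "is_functor C G r rh"
  and ri: "!!y. y : Obj G ==> r (i y) = y"
   "!!y z g. y : Obj G ==> z : Obj G ==> g : Hom G y z ==> rh (i y) (i z) (ih y z g) = g"
  and \<theta>: "natural_in C C (%x. x) (%_ _ f. f) (%x. i (r x)) (%x y f. ih (r x) (r y) (rh x y f)) \<theta>"
   "!!y. y : Obj G ==> \<theta> (i y) = Ident C (i y)"
  and N: "right_module R C N" and \<tau>: "comparison_map R G Y X i ih \<tau>"
 shows "quotient_map R (cochains R C X N n) (coboundaries R C X N n)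
  (%f. cls R G Y (restrict_mod i ih N) n (pointwise G (Term Y n) (%y a. f (i y) (\<tau> n y a))))
  (Ext_via R G Y (restrict_mod i ih N) n)"
proof -
 note X' = projective_resolves[OF const_mod_module[OF R] X]
 note Y' = projective_resolves[OF const_mod_module[OF R] Y]
 note ir = functor_comp[OF r i] and riF = functor_comp[OF i r]
 let ?N = "restrict_mod i ih N"
 have iN: "right_module R G ?N" by (rule restrict_module[OF i N])
 interpret GC: comparison_setup R G C i ih Y X by (rule comparison_setup.intro[OF R G i Y X'])
 interpret CG: comparison_setup R C G r rh X Y by (rule comparison_setup.intro[OF R C r X Y'])
 interpret CC: comparison_setup R C C "%x. x" "%_ _ f. f" X X by (rule comparison_setup.intro[OF R C functor_id X X'])
 interpret GG: comparison_setup R G G "%x. x" "%_ _ f. f" Y Y by (rule comparison_setup.intro[OF R G functor_id Y Y'])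
 interpret KY: cochain_setup R G "const_mod R" Y ?N by (rule cochain_setup.intro[OF R Y' iN])
 interpret KX: cochain_setup R C "const_mod R" X N by (rule cochain_setup.intro[OF R X' N])
 obtain \<sigma> where \<sigma>: "comparison_map R C X Y r rh \<sigma>" by (rule CG.comparison_exists)
 have iO: "i y : Obj C" if "y : Obj G" for y using functor_Obj[OF i that] .
 have rO: "r x : Obj G" if "x : Obj C" for x using functor_Obj[OF r that] .
 have th: "\<theta> x : Hom C x (i (r x))" if "x : Obj C" for x using \<theta>(1) that by (simp add: natural_in_def)
 let ?idN = "%M. pointwise G M (%x a. a)"
 \<comment> \<open>On coefficients, \<open>\<theta>\<close> leads back from the value of
   \<open>N\<close> at \<open>i (r x)\<close> to its value at \<open>x\<close>.\<close>
 define \<eta> where "\<eta> = pointwise C (restrict_mod r rh ?N) (%x. act N x (i (r x)) (\<theta> x))"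
 have \<eta>: "\<eta> : nat_trans R C (restrict_mod r rh ?N) N"
  using twist_nat[OF functor_id ir \<theta>(1) N] unfolding \<eta>_def restrict_mod_comp by (simp add: restrict_mod_id)
 have \<eta>_apply: "\<eta> x m = act N x (i (r x)) (\<theta> x) m" if "x : Obj C" "m : el N (i (r x))" for x m
  using that by (simp add: \<eta>_def)
 have idG: "pointwise G ?N (%x a. a) : nat_trans R G (restrict_mod i ih N) ?N"
  by (rule nat_transI[OF iN mod_hom_id]) auto
 define P where "P f = pointwise G (Term Y n) (%y a. f (i y) (\<tau> n y a))" for f :: "'o => 'x => 'z"
 have P_eq: "pointwise G (Term Y n) (%y a. pointwise G ?N (%x a. a) y (f (i y) (\<tau> n y a))) = P f"
  if "f : cocycles R C X N n" for f
  using nat_closed[OF KX.cocycles_nat[OF that] iO compare_closed[OF \<tau>]]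
  by (intro ext) (simp add: P_def pointwise_def)
 have Pcoc: "P f : cocycles R G Y ?N n" if "f : cocycles R C X N n" for f
  using GC.pull_cocycle[OF N iN idG \<tau> that] P_eq[OF that] by simp
 have Pcob: "P f : coboundaries R G Y ?N n" if "f : coboundaries R C X N n" for f
  using GC.pull_coboundary[OF N iN idG \<tau> that] P_eq[of f] subsetD[OF KX.coboundaries_cocycles that] by simp
 have Phom: "P : mod_hom R (cochains R C X N n) (cochains R G Y ?N n)"
  by (rule mod_hom_cong[OF KX.cochains_module GC.pull_hom[OF N iN idG \<tau>, of n]]) (simp add: P_eq)
 \<comment> \<open>The inverse of \<open>P\<close> on cohomology: pull back along \<open>r\<close>,
   then return to the coefficients \<open>N\<close> by \<open>\<eta>\<close>.\<close>
 define Q where "Q g = pointwise C (Term X n) (%x b. \<eta> x (g (r x) (\<sigma> n x b)))" for g :: "'u => 'y => 'z"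
 have Qcoc: "Q g : cocycles R C X N n" if "g : cocycles R G Y ?N n" for g
  unfolding Q_def using CG.pull_cocycle[OF iN N \<eta> \<sigma> that] .
 have Qcob: "Q g : coboundaries R C X N n" if "g : coboundaries R G Y ?N n" for g
  unfolding Q_def using CG.pull_coboundary[OF iN N \<eta> \<sigma> that] .
 \<comment> \<open>At the objects \<open>i y\<close> the component of \<open>\<theta>\<close> is an
   identity, so \<open>P (Q g)\<close> is \<open>g\<close> pulled back along a comparison map over
   the identity functor, hence cohomologous to \<open>g\<close>.\<close>
 have PQ: "cls R G Y ?N n (P (Q g)) = cls R G Y ?N n g" if g: "g : cocycles R G Y ?N n" for g
 proof -
  let ?\<rho> = "%n. pointwise G (Term Y n) (%y a. \<sigma> n (i y) (\<tau> n y a))"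
  have \<rho>: "comparison_map R G Y Y (%x. x) (%_ _ f. f) ?\<rho>"
   by (rule comparison_cong[OF comparison_comp[OF i Y' \<tau> \<sigma>]]) (simp_all add: ri)
  have idG': "pointwise G ?N (%x a. a) : nat_trans R G (restrict_mod (%x. x) (%_ _ f. f) ?N) ?N"
   unfolding restrict_mod_id by (rule nat_transI[OF iN mod_hom_id]) auto
  have gc: "g y a : el N (i y)" if "y : Obj G" "a : el (Term Y n) y" for y a
   using nat_closed[OF KY.cocycles_nat[OF g] that] by simp
  have \<rho>c: "?\<rho> n y a : el (Term Y n) y" if "y : Obj G" "a : el (Term Y n) y" for y a
   using compare_closed[OF \<rho> that] .
  have "P (Q g) = pointwise G (Term Y n) (%y a. pointwise G ?N (%x a. a) y (g y (?\<rho> n y a)))"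
  proof (rule nat_eqI[OF KY.cocycles_nat[OF Pcoc[OF Qcoc[OF g]]] KY.cocycles_nat[OF GG.pull_cocycle[OF iN iN idG' \<rho> g]]])
   fix y a assume ya: "y : Obj G" "a : el (Term Y n) y"
   have s: "\<sigma> n (i y) (\<tau> n y a) : el (Term Y n) y"
    using \<rho>c[OF ya] ya by simp
   have "P (Q g) y a = \<eta> (i y) (g y (\<sigma> n (i y) (\<tau> n y a)))"
    using ya iO[OF ya(1)] compare_closed[OF \<tau> ya] by (simp add: P_def Q_def ri)
   also have "\<dots> = g y (\<sigma> n (i y) (\<tau> n y a))"
    using \<eta>_apply[OF iO[OF ya(1)], of "g y (\<sigma> n (i y) (\<tau> n y a))"] gc[OF ya(1) s] ya
    by (simp add: ri \<theta>(2) act_Ident[OF N iO])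
   finally show "P (Q g) y a = pointwise G (Term Y n) (%y a. pointwise G ?N (%x a. a) y (g y (?\<rho> n y a))) y a"
    using ya gc[OF ya(1) s] by simp
  qed
  moreover have "pointwise G (Term Y n) (%y a. pointwise G ?N (%x a. a) y (g y (pointwise G (Term Y n) (%x a. a) y a))) = g"
   by (rule nat_eqI[OF KY.cocycles_nat[OF GG.pull_cocycle[OF iN iN idG' comparison_id[OF Y'] g]] KY.cocycles_nat[OF g]])
    (simp add: gc)
  ultimately show ?thesis using GG.pull_unique[OF iN iN idG' \<rho> comparison_id[OF Y'] g] by simp
 qed
 \<comment> \<open>Naturality of \<open>f\<close> moves the action of \<open>\<theta>\<close> from
   the coefficients into the resolution, where \<open>comparison_twist\<close> makes it part of a
   comparison map over the identity functor.\<close>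
 have QP: "cls R C X N n (Q (P f)) = cls R C X N n f" if f: "f : cocycles R C X N n" for f
 proof -
  note nf = KX.cocycles_nat[OF f]
  let ?cmp = "%n. pointwise C (Term X n) (%x b. \<tau> n (r x) (\<sigma> n x b))"
  let ?\<rho> = "%n. pointwise C (Term X n) (%x a. act (Term X n) x (i (r x)) (\<theta> x) (?cmp n x a))"
  have cmp: "comparison_map R C X X (%x. i (r x)) (%x y f. ih (r x) (r y) (rh x y f)) ?cmp"
   by (rule comparison_comp[OF r X' \<sigma> \<tau>])
  have \<rho>: "comparison_map R C X X (%x. x) (%_ _ f. f) ?\<rho>"
   by (rule comparison_twist[OF functor_id ir \<theta>(1) X' X' cmp])
  have idC: "pointwise C N (%x a. a) : nat_trans R C (restrict_mod (%x. x) (%_ _ f. f) N) N"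
   unfolding restrict_mod_id by (rule nat_transI[OF N mod_hom_id]) auto
  have "Q (P f) = pointwise C (Term X n) (%x a. pointwise C N (%x a. a) x (f x (?\<rho> n x a)))"
  proof (rule nat_eqI[OF KX.cocycles_nat[OF Qcoc[OF Pcoc[OF f]]] KX.cocycles_nat[OF CC.pull_cocycle[OF N N idC \<rho> f]]])
   fix x b assume xb: "x : Obj C" "b : el (Term X n) x"
   have ts: "\<tau> n (r x) (\<sigma> n x b) : el (Term X n) (i (r x))"
    using compare_closed[OF \<tau> rO[OF xb(1)] compare_closed[OF \<sigma> xb]] .
   have "Q (P f) x b = act N x (i (r x)) (\<theta> x) (f (i (r x)) (\<tau> n (r x) (\<sigma> n x b)))"
    using \<eta>_apply[OF xb(1)] xb rO compare_closed[OF \<sigma> xb] nat_closed[OF nf iO[OF rO[OF xb(1)]] ts]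
    by (simp add: Q_def P_def)
   also have "\<dots> = f x (act (Term X n) x (i (r x)) (\<theta> x) (\<tau> n (r x) (\<sigma> n x b)))"
    using nat_act[OF nf xb(1) iO[OF rO[OF xb(1)]] th[OF xb(1)] ts] by simp
   finally show "Q (P f) x b = pointwise C (Term X n) (%x a. pointwise C N (%x a. a) x (f x (?\<rho> n x a))) x b"
    using xb nat_closed[OF nf xb(1) compare_closed[OF \<rho> xb]] by simp
  qed
  moreover have "pointwise C (Term X n) (%x a. pointwise C N (%x a. a) x (f x (pointwise C (Term X n) (%x a. a) x a))) = f"
   by (rule nat_eqI[OF KX.cocycles_nat[OF CC.pull_cocycle[OF N N idC comparison_id[OF X'] f]] nf])
    (simp add: nat_closed[OF nf])
  ultimately show ?thesis using CC.pull_unique[OF N N idC \<rho> comparison_id[OF X'] f] by simp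
 qed
 have "quotient_map R (cochains R C X N n) (coboundaries R C X N n) (%f. cls R G Y ?N n (P f)) (Ext_via R G Y ?N n)"
 proof (rule quotient_map_precomp[OF KY.Ext_quotient_map KX.cochains_module Phom])
  show "\<exists>f\<in>carrier (cochains R C X N n). cls R G Y ?N n (P f) = cls R G Y ?N n g"
   if "g : carrier (cochains R G Y ?N n)" for g
   using that Qcoc[of g] PQ[of g] by (intro bexI[of _ "Q g"]) simp_all
  fix f assume "f : carrier (cochains R C X N n)"
  hence f: "f : cocycles R C X N n" by simp
  show "P f : coboundaries R G Y ?N n \<longleftrightarrow> f : coboundaries R C X N n"
  proof
   assume "P f : coboundaries R G Y ?N n"
   hence "Q (P f) : coboundaries R C X N n" by (rule Qcob)
   thus "f : coboundaries R C X N n"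
    using QP[OF f] quotD(5)[OF KX.Ext_quotient_map, of f n] quotD(5)[OF KX.Ext_quotient_map, of "Q (P f)" n]
     f Qcoc[OF Pcoc[OF f]] by simp
  qed (rule Pcob)
 qed
 thus ?thesis by (simp add: P_def)
qed

text \<open>The identity functor is a retraction of itself, with identities as the natural
  transformation.\<close>

lemma resolution_indep:
 assumes R: "cring R" and C: "category C" and N: "right_module R C N"
  and X: "projective_resolution R C (const_mod R) X" and Y: "projective_resolution R C (const_mod R) Y"
 obtains \<xi> where "quotient_map R (cochains R C X N n) (coboundaries R C X N n) \<xi> (Ext_via R C Y N n)"
proof -
 interpret S: comparison_setup R C C "%x. x" "%_ _ f. f" Y X
  by (rule comparison_setup.intro[OF R C functor_id Y projective_resolves[OF const_mod_module[OF R] X]])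
 obtain \<tau> where \<tau>: "comparison_map R C Y X (%x. x) (%_ _ f. f) \<tau>" by (rule S.comparison_exists)
 have "natural_in C C (%x. x) (%_ _ f. f) (%x. x) (%x y f. f) (Ident C)"
  by (simp add: natural_in_def Ident_Hom[OF C] Comp_Ident_left[OF C] Comp_Ident_right[OF C])
 from retract_quotient_map[OF R C C X Y functor_id functor_id refl refl this refl N \<tau>, unfolded restrict_mod_id]
 show thesis by (rule that)
qed

section \<open>The bar resolution\<close>

text \<open>A list \<open>(y\<^sub>0, f\<^sub>0), \<dots>, (y\<^sub>n, f\<^sub>n)\<close> is a chain \<open>x \<rightarrow> y\<^sub>0 \<rightarrow> \<dots> \<rightarrow> y\<^sub>n\<close>. The empty list
 is the basis of the constant functor in degree \<open>-1\<close>.\<close>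

fun path :: "('o, 'm) cat => 'o => ('o \<times> 'm) list => bool" where
 "path C x [] \<longleftrightarrow> True"
| "path C x ((y, f) # l) \<longleftrightarrow> y : Obj C \<and> f : Hom C x y \<and> path C y l"

text \<open>Only the first arrow of a chain involves its source, so nothing else changes. The empty
  chain is fixed, in accordance with the constant functor in degree -1.\<close>

fun precomp :: "('o, 'm) cat => 'o => 'o => 'm => ('o \<times> 'm) list => ('o \<times> 'm) list" where
 "precomp C x y f [] = []"
| "precomp C x y f ((z, g) # l) = (z, Comp C x y z g f) # l"

definition paths :: "('o, 'm) cat => nat => 'o => ('o \<times> 'm) list set" where
 "paths C n x = {l. length l = n \<and> path C x l}"

text \<open>The map of free modules induced by a map of basis elements; its target is the free
  module on the whole type, so that index sets need not be carried along.\<close>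

definition push :: "'r ring => ('i => 'j) => ('i => 'r) => 'j => 'r" where
 "push R g = lin R (free_module R UNIV) (%i. single R (g i))"

lemma free_module_UNIV: "s : carrier (free_module R I) ==> s : carrier (free_module R UNIV)"
 by (simp add: free_simps)

text \<open>The free module on \<open>J\<close> has the same operations as the one on the whole
  type, so a linear combination of its elements may be formed in either.\<close>

lemma lin_UNIV_hom:
 assumes R: "cring R" and e: "!!i. i : I ==> e i : carrier (free_module R J)"
 shows "lin R (free_module R UNIV) e : mod_hom R (free_module R I) (free_module R J)"
proof -
 let ?U = "free_module R UNIV" and ?J = "free_module R J"
 have eU: "e : I \<rightarrow> carrier ?U" using e free_module_UNIV by blast
 have eJ: "e : I \<rightarrow> carrier ?J" using e by blast
 note mU = free_is_module[OF R, of UNIV] and mJ = free_is_module[OF R, of J]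
 have hJ: "lin R ?J e : mod_hom R (free_module R I) ?J" by (rule lin_hom[OF mJ eJ])
 have hJU: "lin R ?J e : mod_hom R (free_module R I) ?U"
  using hJ free_module_UNIV[of _ R J] by (auto simp: mod_hom_def free_simps(3,4) Pi_iff)
 have "lin R ?U e s = lin R ?J e s" if "s : carrier (free_module R I)" for s
  by (rule free_hom_ext[OF R mU lin_hom[OF mU eU] hJU _ that])
   (simp add: lin_single[OF mU eU] lin_single[OF mJ eJ])
 thus ?thesis by (rule mod_hom_cong[OF free_is_module[OF R] hJ])
qed

lemma lin_UNIV_single:
 assumes "cring R" "e i : carrier (free_module R J)"
 shows "lin R (free_module R UNIV) e (single R i) = e i"
 using lin_single[OF free_is_module[OF assms(1)], of e "{i}" UNIV i] assms(2) free_module_UNIV by blast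

lemma push_hom:
 assumes "cring R" "!!i. i : I ==> g i : J"
 shows "push R g : mod_hom R (free_module R I) (free_module R J)"
 unfolding push_def by (rule lin_UNIV_hom[OF assms(1)]) (simp add: single_closed assms)

lemma push_single: "cring R ==> push R g (single R i) = single R (g i)"
 unfolding push_def by (rule lin_UNIV_single[where J = UNIV]) (simp_all add: single_closed)

locale bar =
 fixes R :: "'r ring" and C :: "('o, 'm) cat"
 assumes R: "cring R" and C: "category C"
begin

abbreviation "FU \<equiv> free_module R (UNIV :: ('o \<times> 'm) list set)"
abbreviation "Ch n x \<equiv> free_module R (paths C n x)"

text \<open>The alternating sum of the faces of a chain, by recursion: the first face drops the
  first object by composing two arrows, and the others are the faces of the tail with opposite sign.
  A chain of length one has the empty chain as its only face, so the augmentation is an instance of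
  the same formula.\<close>

fun face :: "'o => ('o \<times> 'm) list => ('o \<times> 'm) list => 'r" where
 "face x [] = \<zero>[FU]"
| "face x ((y, f) # l) = single R (precomp C x y f l) -[FU] push R ((#) (y, f)) (face y l)"

definition boundary :: "'o => (('o \<times> 'm) list => 'r) => ('o \<times> 'm) list => 'r" where
 "boundary x = lin R FU (face x)"

lemma FU: "module R FU" by (rule free_is_module[OF R])

lemma Ch_module: "module R (Ch n x)" by (rule free_is_module[OF R])

text \<open>Identities between chains are stated in \<open>FU\<close>, the free module on all lists,
  so that subtraction does not depend on the degree or on the object.\<close>

lemma Ch_minus: "s : carrier (Ch n x) ==> t : carrier (Ch n x) ==> s -[Ch n x] t = s -[FU] t"
proof -
 assume *: "s : carrier (Ch n x)" "t : carrier (Ch n x)"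
 interpret F: module R FU by (rule FU)
 interpret Cn: module R "Ch n x" by (rule Ch_module)
 have "\<ominus>\<^bsub>FU\<^esub> t = (\<ominus>\<^bsub>R\<^esub> \<one>\<^bsub>R\<^esub>) *[FU] t"
  using free_module_UNIV[OF *(2)] F.smult_l_minus[of "\<one>\<^bsub>R\<^esub>" t] by simp
 moreover have "\<ominus>\<^bsub>Ch n x\<^esub> t = (\<ominus>\<^bsub>R\<^esub> \<one>\<^bsub>R\<^esub>) *[Ch n x] t"
  using * Cn.smult_l_minus[of "\<one>\<^bsub>R\<^esub>" t] by simp
 ultimately show ?thesis by (simp add: a_minus_def free_simps(3,4))
qed

lemma Ch_minus_closed: "s : carrier (Ch n x) ==> t : carrier (Ch n x) ==> s -[FU] t : carrier (Ch n x)"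
proof -
 assume *: "s : carrier (Ch n x)" "t : carrier (Ch n x)"
 interpret Cn: module R "Ch n x" by (rule Ch_module)
 have "s -[Ch n x] t : carrier (Ch n x)" using * by simp
 thus ?thesis using Ch_minus[OF *] by simp
qed

lemma hom_Ch_minus:
 assumes f: "f : mod_hom R (Ch n x) (Ch m y)" and "s : carrier (Ch n x)" "t : carrier (Ch n x)"
 shows "f (s -[FU] t) = f s -[FU] f t"
 using hom_minus[OF Ch_module Ch_module assms] Ch_minus[OF assms(2,3)]
  Ch_minus[OF hom_closed[OF f assms(2)] hom_closed[OF f assms(3)]] by simp

lemma minus_hom:
 assumes f: "f : mod_hom R A (Ch n x)" and g: "g : mod_hom R A (Ch n x)" and A: "module R A"
 shows "(%s. f s -[FU] g s) : mod_hom R A (Ch n x)"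
proof (rule mod_homI)
 interpret F: module R FU by (rule FU)
 note cl = hom_closed[OF f] hom_closed[OF g]
 fix s assume s: "s : carrier A"
 show "f s -[FU] g s : carrier (Ch n x)" by (rule Ch_minus_closed[OF cl[OF s]])
 have U: "f t : carrier FU" "g t : carrier FU" if "t : carrier A" for t using cl[OF that] free_module_UNIV by blast+
 have op: "u +[Ch n x] v = u +[FU] v" "a *[Ch n x] u = a *[FU] u" for u v a by (simp_all add: free_simps)
 show "f (a *[A] s) -[FU] g (a *[A] s) = a *[Ch n x] (f s -[FU] g s)" if "a : carrier R" for a
  unfolding op hom_smult[OF f that s] hom_smult[OF g that s]
  using that U[OF s] by (simp add: a_minus_def F.smult_r_distr F.smult_r_minus)
 fix t assume t: "t : carrier A"
 show "f (s +[A] t) -[FU] g (s +[A] t) = (f s -[FU] g s) +[Ch n x] (f t -[FU] g t)"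
  unfolding op hom_add[OF f s t] hom_add[OF g s t] using U[OF s] U[OF t] by algebra
qed

lemma path_precomp: "x : Obj C ==> y : Obj C ==> f : Hom C x y ==> path C y l ==> path C x (precomp C x y f l)"
 by (cases l) (auto simp: Comp_Hom[OF C])

lemma length_precomp [simp]: "length (precomp C x y f l) = length l"
 by (cases l) auto

lemma precomp_paths:
 "x : Obj C ==> y : Obj C ==> f : Hom C x y ==> l : paths C n y ==> precomp C x y f l : paths C n x"
 by (auto simp: paths_def path_precomp)

lemma precomp_precomp:
 "w : Obj C ==> x : Obj C ==> y : Obj C ==> f : Hom C w x ==> g : Hom C x y ==> path C y l ==>
  precomp C w x f (precomp C x y g l) = precomp C w y (Comp C w x y g f) l"
 by (cases l) (auto simp: Comp_assoc[OF C])

lemma precomp_Ident: "x : Obj C ==> path C x l ==> precomp C x x (Ident C x) l = l"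
 by (cases l) (auto simp: Comp_Ident_right[OF C])

lemma cons_paths: "y : Obj C ==> f : Hom C x y ==> l : paths C n y ==> (y, f) # l : paths C (Suc n) x"
 by (auto simp: paths_def)

lemma paths_SucE:
 assumes "l : paths C (Suc n) x"
 obtains y f l' where "l = (y, f) # l'" "y : Obj C" "f : Hom C x y" "l' : paths C n y"
 using assms by (cases l) (auto simp: paths_def)

lemma paths_0: "paths C 0 x = {[]}"
 by (auto simp: paths_def)

lemma push_precomp_hom:
 assumes "x : Obj C" "y : Obj C" "f : Hom C x y"
 shows "push R (precomp C x y f) : mod_hom R (Ch n y) (Ch n x)"
 by (rule push_hom[OF R]) (rule precomp_paths[OF assms])

lemma push_cons_hom:
 assumes "y : Obj C" "f : Hom C x y"
 shows "push R ((#) (y, f)) : mod_hom R (Ch n y) (Ch (Suc n) x)"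
 by (rule push_hom[OF R]) (rule cons_paths[OF assms])

lemma face_closed: "x : Obj C ==> l : paths C (Suc n) x ==> face x l : carrier (Ch n x)"
proof (induction l arbitrary: x n)
 case Nil
 thus ?case by (simp add: paths_def)
next
 case (Cons p l)
 obtain y f where p: "p = (y, f)" by (cases p)
 hence y: "y : Obj C" "f : Hom C x y" "l : paths C n y" using Cons.prems by (auto simp: paths_def)
 have 1: "single R (precomp C x y f l) : carrier (Ch n x)"
  by (rule single_closed[OF R precomp_paths[OF Cons.prems(1) y]])
 have 2: "push R ((#) (y, f)) (face y l) : carrier (Ch n x)"
 proof (cases n)
  case 0
  hence "face y l = \<zero>[FU]" using y by (simp add: paths_def)
  moreover have "push R ((#) (y, f)) \<zero>[FU] = \<zero>[FU]"
   using hom_zero[OF FU FU push_hom[OF R, of UNIV "(#) (y, f)" UNIV]] by simp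
  ultimately show ?thesis using zero_mem[OF Ch_module[of n x]] by (simp add: free_simps(2))
 next
  case (Suc m)
  thus ?thesis using hom_closed[OF push_cons_hom[OF y(1,2)] Cons.IH[OF y(1), of m]] y by simp
 qed
 show ?case using Ch_minus_closed[OF 1 2] by (simp add: p)
qed

lemma boundary_hom: "x : Obj C ==> boundary x : mod_hom R (Ch (Suc n) x) (Ch n x)"
 unfolding boundary_def by (rule lin_UNIV_hom[OF R face_closed])

lemma boundary_single: "x : Obj C ==> l : paths C (Suc n) x ==> boundary x (single R l) = face x l"
 unfolding boundary_def by (rule lin_UNIV_single[where e = "face x" and J = "paths C n x", OF R face_closed])

lemma push_zero: "push R g (%_. \<zero>[R]) = (%_. \<zero>[R])"
 using hom_zero[OF free_is_module[OF R] free_is_module[OF R] push_hom[OF R, of UNIV g UNIV]]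
 by (simp add: free_simps(2))

lemma boundary_0:
 assumes "s : carrier (Ch 0 x)" shows "boundary x s = \<zero>[FU]"
proof -
 have h: "boundary x : mod_hom R (Ch 0 x) FU"
  unfolding boundary_def using lin_UNIV_hom[OF R, of "paths C 0 x" "face x" UNIV] zero_mem[OF FU]
  by (simp add: paths_0)
 show ?thesis
 proof (rule free_hom_ext[OF R FU h module_zero_hom[OF Ch_module FU] _ assms])
  fix l assume "l : paths C 0 x"
  hence "l = []" by (simp add: paths_0)
  thus "boundary x (single R l) = \<zero>[FU]"
   unfolding boundary_def using lin_UNIV_single[OF R, of "face x" "[]" UNIV] zero_mem[OF FU] by simp
 qed
qed

lemma push_push:
 assumes "s : carrier (free_module R I)"
 shows "push R g (push R h s) = push R (%i. g (h i)) s"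
 by (rule free_hom_ext[OF R free_is_module[OF R, of UNIV]
    hom_comp[OF push_hom[OF R, of I h UNIV] push_hom[OF R, of UNIV g UNIV]] push_hom[OF R] _ assms])
  (simp_all add: push_single[OF R])

lemma push_cong:
 assumes "s : carrier (free_module R I)" "!!i. i : I ==> g i = h i"
 shows "push R g s = push R h s"
 by (rule free_hom_ext[OF R free_is_module[OF R, of UNIV] push_hom[OF R] push_hom[OF R] _ assms(1)])
  (simp_all add: push_single[OF R] assms(2))

lemma push_id:
 assumes "s : carrier (free_module R I)" "!!i. i : I ==> g i = i"
 shows "push R g s = s"
 by (rule free_hom_ext[OF R free_is_module[OF R, of I] push_hom[OF R] mod_hom_id _ assms(1)])
  (simp_all add: push_single[OF R] assms(2))

lemma face_precomp:
 assumes "x : Obj C" "y : Obj C" "f : Hom C x y" "l : paths C (Suc n) y"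
 shows "face x (precomp C x y f l) = push R (precomp C x y f) (face y l)"
proof -
 from assms(4) obtain z g l' where l: "l = (z, g) # l'" "z : Obj C" "g : Hom C y z" "l' : paths C n z"
  by (rule paths_SucE)
 have gf: "Comp C x y z g f : Hom C x z" using Comp_Hom[OF C assms(1,2) l(2) assms(3) l(3)] .
 have 1: "single R (precomp C y z g l') : carrier (Ch n y)"
  by (rule single_closed[OF R precomp_paths[OF assms(2) l(2-4)]])
 show ?thesis
 proof (cases n)
  case 0
  hence "l' = []" using l by (simp add: paths_def)
  interpret F: module R FU by (rule FU)
  have s: "single R [] : carrier (Ch 0 y)" "single R [] : carrier FU"
   by (simp_all add: paths_0 single_closed[OF R])
  have "single R [] -[FU] \<zero>[FU] = single R []" using s(2) by algebra
  thus ?thesis using \<open>l' = []\<close> by (simp add: l(1) free_simps(2) push_zero push_single[OF R])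
 next
  case (Suc m)
  have fz: "face z l' : carrier (Ch m z)" using face_closed[OF l(2)] l(4) Suc by simp
  have 2: "push R ((#) (z, g)) (face z l') : carrier (Ch n y)"
   using hom_closed[OF push_cons_hom[OF l(2,3)] fz] Suc by simp
  have "push R (precomp C x y f) (face y l) =
    push R (precomp C x y f) (single R (precomp C y z g l')) -[FU] push R (precomp C x y f) (push R ((#) (z, g)) (face z l'))"
   using hom_Ch_minus[OF push_precomp_hom[OF assms(1-3)] 1 2] by (simp add: l(1))
  also have "push R (precomp C x y f) (single R (precomp C y z g l')) = single R (precomp C x z (Comp C x y z g f) l')"
   using precomp_precomp[OF assms(1,2) l(2) assms(3) l(3)] l(4) by (simp add: push_single[OF R] paths_def)
  also have "push R (precomp C x y f) (push R ((#) (z, g)) (face z l')) = push R ((#) (z, Comp C x y z g f)) (face z l')"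
   unfolding push_push[OF fz] by (rule push_cong[OF fz]) simp
  finally show ?thesis by (simp add: l(1))
 qed
qed

lemma boundary_precomp:
 assumes "x : Obj C" "y : Obj C" "f : Hom C x y" "s : carrier (Ch (Suc n) y)"
 shows "boundary x (push R (precomp C x y f) s) = push R (precomp C x y f) (boundary y s)"
 by (rule free_hom_ext[OF R Ch_module hom_comp[OF push_precomp_hom[OF assms(1-3)] boundary_hom[OF assms(1)]]
    hom_comp[OF boundary_hom[OF assms(2)] push_precomp_hom[OF assms(1-3)]] _ assms(4)])
  (simp add: push_single[OF R] boundary_single[OF assms(1) precomp_paths[OF assms(1-3)], of _ n] boundary_single[OF assms(2), of _ n]
   face_precomp[OF assms(1-3), of _ n])

text \<open>The recursion for \<open>face\<close>, extended linearly. With an identity for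
  \<open>f\<close> it becomes the formula for the contracting homotopy, and in general it is the
  inductive step for the boundary squaring to zero.\<close>

lemma boundary_cons:
 assumes "x : Obj C" "y : Obj C" "f : Hom C x y" "s : carrier (Ch (Suc n) y)"
 shows "boundary x (push R ((#) (y, f)) s) =
  push R (precomp C x y f) s -[FU] push R ((#) (y, f)) (boundary y s)"
 by (rule free_hom_ext[OF R Ch_module hom_comp[OF push_cons_hom[OF assms(2,3)] boundary_hom[OF assms(1)]]
    minus_hom[OF push_precomp_hom[OF assms(1-3)] hom_comp[OF boundary_hom[OF assms(2)] push_cons_hom[OF assms(2,3)]] Ch_module] _ assms(4)])
  (simp add: push_single[OF R] boundary_single[OF assms(1) cons_paths[OF assms(2,3)], of _ "Suc n"] boundary_single[OF assms(2), of _ n])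

lemma boundary_boundary:
 assumes "x : Obj C" "s : carrier (Ch (Suc (Suc n)) x)"
 shows "boundary x (boundary x s) = \<zero>[FU]"
proof -
 interpret F: module R FU by (rule FU)
 have ff: "boundary x (face x l) = \<zero>[FU]" if "x : Obj C" "l : paths C (Suc n) x" for x l n
  using that
 proof (induction l arbitrary: x n)
  case Nil
  thus ?case by (simp add: paths_def)
 next
  case (Cons p l)
  obtain y f where p: "p = (y, f)" by (cases p)
  hence y: "y : Obj C" "f : Hom C x y" "l : paths C n y" using Cons.prems by (auto simp: paths_def)
  show ?case
  proof (cases n)
   case 0
   thus ?thesis using boundary_0[OF face_closed[of x "p # l" 0]] Cons.prems by simp
  next
   case (Suc m)
   have l: "l : paths C (Suc m) y" using y Suc by simp
   have fl: "face y l : carrier (Ch m y)" by (rule face_closed[OF y(1) l])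
   have 1: "single R (precomp C x y f l) : carrier (Ch (Suc m) x)"
    by (rule single_closed[OF R precomp_paths[OF Cons.prems(1) y(1,2) l]])
   have 2: "push R ((#) (y, f)) (face y l) : carrier (Ch (Suc m) x)"
    by (rule hom_closed[OF push_cons_hom[OF y(1,2)] fl])
   have "boundary x (face x (p # l)) =
    boundary x (single R (precomp C x y f l)) -[FU] boundary x (push R ((#) (y, f)) (face y l))"
    using hom_Ch_minus[OF boundary_hom[OF Cons.prems(1)] 1 2] by (simp add: p)
   also have "boundary x (single R (precomp C x y f l)) = push R (precomp C x y f) (face y l)"
    using boundary_single[OF Cons.prems(1) precomp_paths[OF Cons.prems(1) y(1,2) l]] face_precomp[OF Cons.prems(1) y(1,2) l]
    by simp
   also have "boundary x (push R ((#) (y, f)) (face y l)) = push R (precomp C x y f) (face y l)"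
   proof (cases m)
    case 0
    interpret C0: module R "Ch 0 y" by (rule Ch_module)
    have p1: "(y, f) # [] : paths C (Suc 0) x" using y by (auto simp: paths_def)
    have h: "(%s. boundary x (push R ((#) (y, f)) s)) : mod_hom R (Ch 0 y) (Ch 0 x)"
     by (rule hom_comp[OF push_cons_hom[OF y(1,2)] boundary_hom[OF Cons.prems(1)]])
    have fc: "face x [(y, f)] = single R []"
    proof -
     have "single R [] : carrier FU" by (rule single_closed[OF R]) simp
     hence "single R [] -[FU] \<zero>[FU] = single R []" by algebra
     thus ?thesis by (simp add: free_simps(2) push_zero)
    qed
    show ?thesis
     by (rule free_hom_ext[OF R Ch_module h push_precomp_hom[OF Cons.prems(1) y(1,2)] _ fl[unfolded 0]])
      (simp add: paths_0 push_single[OF R] boundary_single[OF Cons.prems(1) p1] fc del: face.simps)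
   next
    case (Suc k)
    have "boundary y (face y l) = \<zero>[FU]" by (rule Cons.IH[OF y(1) l])
    moreover have "push R (precomp C x y f) (face y l) : carrier FU"
     using hom_closed[OF push_precomp_hom[OF Cons.prems(1) y(1,2)] fl] free_module_UNIV by blast
    hence "push R (precomp C x y f) (face y l) -[FU] \<zero>[FU] = push R (precomp C x y f) (face y l)" by algebra
    ultimately show ?thesis
     using boundary_cons[OF Cons.prems(1) y(1,2) fl[unfolded Suc]] by (simp add: free_simps(2) push_zero)
   qed
   also have "push R (precomp C x y f) (face y l) -[FU] push R (precomp C x y f) (face y l) = \<zero>[FU]"
    using free_module_UNIV[OF hom_closed[OF push_precomp_hom[OF Cons.prems(1) y(1,2)] fl]] F.M.minus_zero_iff by blast
   finally show ?thesis .
  qed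
 qed
 show ?thesis
 proof (cases n)
  case 0
  show ?thesis using boundary_0 hom_closed[OF boundary_hom[OF assms(1)] assms(2)]
   free_hom_ext[OF R Ch_module hom_comp[OF boundary_hom[OF assms(1)] boundary_hom[OF assms(1)]] module_zero_hom[OF Ch_module Ch_module] _ assms(2)]
   boundary_single[OF assms(1)] ff[OF assms(1)] by (simp add: free_simps(2))
 next
  case (Suc m)
  show ?thesis using free_hom_ext[OF R Ch_module hom_comp[OF boundary_hom[OF assms(1)] boundary_hom[OF assms(1)]] module_zero_hom[OF Ch_module Ch_module] _ assms(2)]
   boundary_single[OF assms(1)] ff[OF assms(1)] by (simp add: free_simps(2))
 qed
qed

text \<open>The extra degeneracy. It is linear at each \<open>x\<close> but not natural in
  \<open>x\<close>, so it contracts the resolution only objectwise.\<close>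

definition homotopy :: "'o => (('o \<times> 'm) list => 'r) => ('o \<times> 'm) list => 'r" where
 "homotopy x = push R ((#) (x, Ident C x))"

lemma homotopy_hom: "x : Obj C ==> homotopy x : mod_hom R (Ch n x) (Ch (Suc n) x)"
 unfolding homotopy_def by (rule push_cons_hom[OF _ Ident_Hom[OF C]])

lemma boundary_homotopy:
 assumes x: "x : Obj C" and s: "s : carrier (Ch (Suc n) x)"
 shows "boundary x (homotopy x s) = s -[FU] homotopy x (boundary x s)"
 using boundary_cons[OF x x Ident_Hom[OF C x] s] push_id[OF s, of "precomp C x x (Ident C x)"] precomp_Ident[OF x]
 by (simp add: homotopy_def paths_def)

lemma boundary_homotopy_0:
 assumes x: "x : Obj C" and s: "s : carrier (Ch 0 x)"
 shows "boundary x (homotopy x s) = s"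
proof (rule free_hom_ext[OF R Ch_module hom_comp[OF homotopy_hom[OF x] boundary_hom[OF x]] mod_hom_id _ s])
 fix l assume "l : paths C 0 x"
 hence l: "l = []" by (simp add: paths_0)
 interpret F: module R FU by (rule FU)
 have "single R [] : carrier FU" by (rule single_closed[OF R]) simp
 hence "single R [] -[FU] \<zero>[FU] = single R []" by algebra
 moreover have "[(x, Ident C x)] : paths C (Suc 0) x" using x Ident_Hom[OF C x] by (simp add: paths_def)
 ultimately show "boundary x (homotopy x (single R l)) = single R l"
  by (simp add: l homotopy_def push_zero push_single[OF R] boundary_single[OF x, of _ 0] free_simps(2))
qed

lemma boundary_exact:
 assumes x: "x : Obj C" and s: "s : carrier (Ch (Suc n) x)" and "boundary x s = \<zero>[FU]"
 shows "boundary x (homotopy x s) = s"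
proof -
 interpret F: module R FU by (rule FU)
 have "s -[FU] \<zero>[FU] = s" using free_module_UNIV[OF s] by algebra
 thus ?thesis using boundary_homotopy[OF x s] assms(3) by (simp add: homotopy_def free_simps(2) push_zero)
qed

text \<open>Chains in degree \<open>n\<close> have length \<open>n + 1\<close>: the leading arrow
  belongs to the free module, and the remaining list of length \<open>n\<close> is its
  generator.\<close>

definition term_at :: "nat => ('o, 'm, 'r, ('o \<times> 'm) list => 'r) cmod" where
 "term_at n = free_cmod R C (%(y, f, l). (y, f) # l) (paths C n)"

sublocale F: free_setup R C "%(y, f, l). (y, f) # l" "paths C n" for n
 by (rule free_setup.intro[OF R C]) (auto simp: inj_def)

lemma basis_paths: "basis C (%(y, f, l). (y, f) # l) (paths C n) x = paths C (Suc n) x"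
 by (auto simp: basis_def paths_def length_Suc_conv)

lemma val_term_at: "val (term_at n) x = Ch (Suc n) x"
 by (simp add: term_at_def F.FM_val basis_paths)

lemma pre_precomp: "pre C (%(y, f, l). (y, f) # l) x y f ((z, g) # l) = precomp C x y f ((z, g) # l)"
 using F.pre_mk[of x y f z g l] by simp

lemma term_at_module: "right_module R C (term_at n)"
 using F.FM_right_module by (simp add: term_at_def)

lemma act_term_at:
 assumes "x : Obj C" "y : Obj C" "f : Hom C x y" "s : carrier (Ch (Suc n) y)"
 shows "act (term_at n) x y f s = push R (precomp C x y f) s"
proof (rule free_hom_ext[OF R Ch_module _ push_precomp_hom[OF assms(1-3)] _ assms(4)])
 show "act (term_at n) x y f : mod_hom R (Ch (Suc n) y) (Ch (Suc n) x)"
  using act_hom[OF term_at_module assms(1-3)] by (simp add: val_term_at)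
 fix l assume l: "l : paths C (Suc n) y"
 then obtain z g l' where "l = (z, g) # l'" by (rule paths_SucE)
 thus "act (term_at n) x y f (single R l) = push R (precomp C x y f) (single R l)"
  using F.FM_act_single[OF assms(1-3), unfolded basis_paths, OF l] by (simp add: push_single[OF R] term_at_def pre_precomp)
qed

text \<open>The augmentation reads off the coefficient of the empty chain, the only basis element in
  degree -1.\<close>

definition resolution :: "('o, 'm, 'r, ('o \<times> 'm) list => 'r, 'r) resolution" where
 "resolution = \<lparr>Term = term_at, Bd = (%n. pointwise C (term_at (Suc n)) boundary),
  Aug = pointwise C (term_at 0) (%x s. boundary x s [])\<rparr>"

lemma res_simps:
 "Term resolution = term_at"
 "x : Obj C ==> s : carrier (Ch (Suc (Suc n)) x) ==> Bd resolution n x s = boundary x s"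
 "x : Obj C ==> s : carrier (Ch (Suc 0) x) ==> Aug resolution x s = boundary x s []"
 by (simp_all add: resolution_def val_term_at)

lemma contraction:
 assumes x: "x : Obj C"
 shows "homotopy x : mod_hom R (val (Term resolution n) x) (val (Term resolution (Suc n)) x)"
  and "a : el (Term resolution (Suc n)) x ==>
   Bd resolution (Suc n) x (homotopy x a) +[val (Term resolution (Suc n)) x] homotopy x (Bd resolution n x a) = a"
proof -
 show "homotopy x : mod_hom R (val (Term resolution n) x) (val (Term resolution (Suc n)) x)"
  using homotopy_hom[OF x] by (simp add: res_simps(1) val_term_at)
 assume "a : el (Term resolution (Suc n)) x"
 hence a: "a : carrier (Ch (Suc (Suc n)) x)" by (simp add: res_simps(1) val_term_at)
 interpret F: module R FU by (rule FU)
 note h = hom_closed[OF homotopy_hom[OF x]] and b = hom_closed[OF boundary_hom[OF x] a]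
 have "(a -[FU] homotopy x (boundary x a)) +[FU] homotopy x (boundary x a) = a"
  using free_module_UNIV[OF a] free_module_UNIV[OF h[OF b]] by algebra
 thus "Bd resolution (Suc n) x (homotopy x a) +[val (Term resolution (Suc n)) x] homotopy x (Bd resolution n x a) = a"
  by (simp add: res_simps(2)[OF x h[OF a]] res_simps(2)[OF x a] boundary_homotopy[OF x a] res_simps(1)
   val_term_at free_simps(3))
qed

lemma projective_resolution: "projective_resolution R C (const_mod R) resolution"
proof -
 have vc: "val (const_mod R) x = regular_mod R" for x by (simp add: const_mod_def)
 have ev: "(%t. t []) : mod_hom R (Ch 0 x) (regular_mod R)" for x
  by (rule mod_homI) (simp_all add: free_simps regular_mod_def)
 \<comment> \<open>In degree -1 an element is determined by its coefficient at the empty chain, so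
   the kernel of the augmentation is the kernel of \<open>boundary\<close>.\<close>
 have Ch0: "t = \<zero>[FU]" if "t : carrier (Ch 0 x)" "t [] = \<zero>[R]" for t x
 proof -
  have "t i = \<zero>[R]" for i using that by (cases "i = []") (simp_all add: free_simps paths_0)
  thus ?thesis by (simp add: free_simps(2) fun_eq_iff)
 qed
 have "Bd resolution n x ` carrier (Ch (Suc (Suc n)) x) = {s : carrier (Ch (Suc n) x). boundary x s = \<zero>[FU]}"
  if x: "x : Obj C" for x n
 proof (intro equalityI subsetI)
  fix s assume "s : Bd resolution n x ` carrier (Ch (Suc (Suc n)) x)"
  thus "s : {s : carrier (Ch (Suc n) x). boundary x s = \<zero>[FU]}"
   using boundary_boundary[OF x] hom_closed[OF boundary_hom[OF x]] by (auto simp: res_simps x)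
 next
  fix s assume "s : {s : carrier (Ch (Suc n) x). boundary x s = \<zero>[FU]}"
  thus "s : Bd resolution n x ` carrier (Ch (Suc (Suc n)) x)"
   using boundary_exact[OF x, of s n] hom_closed[OF homotopy_hom[OF x], of s "Suc n"]
   by (intro image_eqI[of _ _ "homotopy x s"]) (auto simp: res_simps x)
 qed
 moreover have "mod_ker (Ch (Suc 0) x) (regular_mod R) (Aug resolution x) = {s : carrier (Ch (Suc 0) x). boundary x s = \<zero>[FU]}"
  if x: "x : Obj C" for x
 proof -
  have "Aug resolution x s = \<zero>[regular_mod R] \<longleftrightarrow> boundary x s = \<zero>[FU]" if s: "s : carrier (Ch (Suc 0) x)" for s
   using Ch0[OF hom_closed[OF boundary_hom[OF x] s]]
   by (auto simp: res_simps(3)[OF x s] regular_mod_def free_simps(2))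
  thus ?thesis unfolding mod_ker_def by blast
 qed
 moreover have "mod_ker (Ch (Suc (Suc n)) x) (Ch (Suc n) x) (Bd resolution n x) = {s : carrier (Ch (Suc (Suc n)) x). boundary x s = \<zero>[FU]}"
  if x: "x : Obj C" for x n
  by (auto simp: mod_ker_def res_simps x free_simps(2))
 moreover have "Bd resolution n : nat_trans R C (term_at (Suc n)) (term_at n)" for n
  unfolding resolution_def resolution.simps
  by (rule nat_transI[OF term_at_module])
   (simp_all add: val_term_at boundary_hom act_term_at boundary_precomp hom_closed[OF boundary_hom])
 moreover have "Aug resolution : nat_trans R C (term_at 0) (const_mod R)"
  unfolding resolution_def resolution.simps
 proof (rule nat_transI[OF term_at_module])
  show "(%s. boundary x s []) : mod_hom R (val (term_at 0) x) (val (const_mod R) x)" if "x : Obj C" for x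
   using hom_comp[OF boundary_hom[OF that] ev] by (simp add: val_term_at vc)
  show "boundary x (act (term_at 0) x y f s) [] = act (const_mod R) x y f (boundary y s [])"
   if "x : Obj C" "y : Obj C" "f : Hom C x y" "s : el (term_at 0) y" for x y f s
  proof -
   have s: "s : carrier (Ch (Suc 0) y)" using that by (simp add: val_term_at)
   have "push R (precomp C x y f) (boundary y s) = boundary y s"
    by (rule push_id[OF hom_closed[OF boundary_hom[OF that(2)] s]]) (simp add: paths_0)
   thus ?thesis using boundary_precomp[OF that(1-3) s] act_term_at[OF that(1-3) s] by (simp add: const_mod_def)
  qed
 qed
 moreover have "objectwise_surj C (term_at 0) (const_mod R) (Aug resolution)"
  unfolding objectwise_surj_def val_term_at vc
 proof (intro ballI equalityI subsetI)
  fix x r assume x: "x : Obj C"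
  {
   assume "r : Aug resolution x ` carrier (Ch (Suc 0) x)"
   thus "r : carrier (regular_mod R)"
    using hom_closed[OF hom_comp[OF boundary_hom[OF x] ev]] by (auto simp: res_simps x)
  }
  assume "r : carrier (regular_mod R)"
  hence r: "r : carrier R" by (simp add: regular_mod_def)
  interpret R: cring R by (rule R)
  interpret C0: module R "Ch 0 x" by (rule Ch_module)
  have "single R [] : carrier (Ch 0 x)" by (rule single_closed[OF R]) (simp add: paths_0)
  hence t: "r *[Ch 0 x] single R [] : carrier (Ch 0 x)" using r by simp
  show "r : Aug resolution x ` carrier (Ch (Suc 0) x)"
   using boundary_homotopy_0[OF x t] hom_closed[OF homotopy_hom[OF x] t] r
   by (intro image_eqI[of _ _ "homotopy x (r *[Ch 0 x] single R [])"])
    (simp_all add: res_simps x, simp add: free_simps(4) single_def)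
 qed
 ultimately show ?thesis
  using F.FM_projective by (simp add: projective_resolution_def res_simps(1) val_term_at vc term_at_def[symmetric])
qed

end

text \<open>The bar resolution has the element type over which the choice ranges, so the choice is
  not vacuous.\<close>

lemma chosen_resolution:
 assumes "cring R" "category C"
 shows "projective_resolution R C (const_mod R) (chosen_resolution R C)"
 unfolding chosen_resolution_def
 using bar.projective_resolution[OF bar.intro[OF assms]] by (rule someI)

section \<open>Double complexes\<close>

lemma quotient_map_postcomp:
 assumes q: "quotient_map R A N \<kappa> E" and E': "module R E'" and h: "h : mod_hom R E E'" "bij_betw h (carrier E) (carrier E')"
 shows "quotient_map R A N (%x. h (\<kappa> x)) E'"
proof -
 note D = quotD[OF q]
 have "h (\<kappa> x) = \<zero>[E'] \<longleftrightarrow> x : N" if "x : carrier A" for x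
 proof -
  have "h (\<kappa> x) = h \<zero>[E] \<longleftrightarrow> \<kappa> x = \<zero>[E]"
   using h(2) hom_closed[OF D(3) that] zero_mem[OF D(2)]
   by (intro inj_on_eq_iff[of h "carrier E"]) (auto simp: bij_betw_def)
  thus ?thesis using hom_zero[OF D(2) E' h(1)] D(5)[OF that] by simp
 qed
 moreover have "(%x. h (\<kappa> x)) ` carrier A = carrier E'"
  using D(4) h(2) by (simp add: bij_betw_def image_image[symmetric])
 ultimately show ?thesis using D(1) E' hom_comp[OF D(3) h(1)] by (simp add: quotient_map_def)
qed

text \<open>The differentials anticommute, so their sum squares to zero without further signs.
  Integer indices with zero modules at negative places spare the boundary cases of the first
  quadrant.\<close>

locale double_complex =
 fixes R :: "'r ring" and A :: "int => int => ('r, 'a) module"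
  and dh :: "int => int => 'a => 'a" and dv :: "int => int => 'a => 'a"
 assumes A: "module R (A p q)"
  and dh: "dh p q : mod_hom R (A p q) (A (p + 1) q)"
  and dv: "dv p q : mod_hom R (A p q) (A p (q + 1))"
  and dh_dh: "a : carrier (A p q) ==> dh (p + 1) q (dh p q a) = \<zero>[A (p + 1 + 1) q]"
  and dv_dv: "a : carrier (A p q) ==> dv p (q + 1) (dv p q a) = \<zero>[A p (q + 1 + 1)]"
  and anticommute: "a : carrier (A p q) ==>
   dh p (q + 1) (dv p q a) +[A (p + 1) (q + 1)] dv (p + 1) q (dh p q a) = \<zero>[A (p + 1) (q + 1)]"
  and negative: "p < 0 \<or> q < 0 ==> carrier (A p q) = {\<zero>[A p q]}"
begin

text \<open>Families over all integers \<open>p\<close>; by \<open>negative\<close> only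
  \<open>0 \<le> p \<le> n\<close> contributes, so the product is also the direct sum.\<close>

definition Tot :: "int => ('r, int => 'a) module" where
 "Tot n = \<lparr>carrier = {x. \<forall>p. x p : carrier (A p (n - p))}, monoid.mult = (%_ _ p. \<zero>[A p (n - p)]),
  one = (%p. \<zero>[A p (n - p)]), ring.zero = (%p. \<zero>[A p (n - p)]),
  ring.add = (%x y p. x p +[A p (n - p)] y p), module.smult = (%r x p. r *[A p (n - p)] x p)\<rparr>"

definition D :: "int => (int => 'a) => int => 'a" where
 "D n x = (%p. dh (p - 1) (n + 1 - p) (x (p - 1)) +[A p (n + 1 - p)] dv p (n - p) (x p))"

definition Fil :: "int => int => (int => 'a) set" where
 "Fil p n = {x : carrier (Tot n). \<forall>p'<p. x p' = \<zero>[A p' (n - p')]}"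

lemma Tot_simps:
 "x : carrier (Tot n) \<longleftrightarrow> (\<forall>p. x p : carrier (A p (n - p)))"
 "\<zero>[Tot n] = (%p. \<zero>[A p (n - p)])"
 "x +[Tot n] y = (%p. x p +[A p (n - p)] y p)"
 "r *[Tot n] x = (%p. r *[A p (n - p)] x p)"
 by (simp_all add: Tot_def)

lemma cringR: "cring R" using A module_def by blast

lemma zero_A: "\<zero>[A p q] : carrier (A p q)" by (rule zero_mem[OF A])

lemma A_zero: "a : carrier (A p q) ==> a +[A p q] \<zero>[A p q] = a"
 "a : carrier (A p q) ==> \<zero>[A p q] +[A p q] a = a"
 using abelian_group.abelian_simprules(6,9)[OF module.axioms(2)[OF A]] by blast+

lemma Tot_module: "module R (Tot n)"
proof -
 note ab = module.axioms(2)[OF A]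
 note s = abelian_group.abelian_simprules[OF ab]
 have grp: "abelian_group (Tot n)"
 proof (rule abelian_groupI)
  show "\<exists>y\<in>carrier (Tot n). y +[Tot n] x = \<zero>[Tot n]" if x: "x : carrier (Tot n)" for x
   using x by (intro bexI[of _ "%p. \<ominus>\<^bsub>A p (n - p)\<^esub> x p"]) (simp_all add: Tot_simps s(3,7))
 qed (simp_all add: Tot_simps s(1,2,5,6,8,9,16))
 show ?thesis
  by (rule moduleI[OF cringR grp])
   (simp_all add: Tot_simps module.smult_closed[OF A] module.smult_l_distr[OF A] module.smult_r_distr[OF A]
    module.smult_assoc1[OF A] module.smult_one[OF A])
qed

lemma Tot_minus:
 assumes "x : carrier (Tot n)" "y : carrier (Tot n)"
 shows "(x -[Tot n] y) p = x p -[A p (n - p)] y p"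
proof -
 have "(%x. x p) : mod_hom R (Tot n) (A p (n - p))" by (rule mod_homI) (simp_all add: Tot_simps)
 from hom_minus[OF Tot_module A this assms] show ?thesis .
qed

lemma dh': "dh (p - 1) q : mod_hom R (A (p - 1) q) (A p q)"
 using dh[of "p - 1" q] by simp

lemma dv': "dv p (n - p) : mod_hom R (A p (n - p)) (A p (n + 1 - p))"
 using dv[of p "n - p"] by (simp add: algebra_simps)

lemma Tot_at: "x : carrier (Tot n) ==> x p : carrier (A p (n - p))"
 by (simp add: Tot_simps)

lemma Tot_at': "x : carrier (Tot n) ==> x (p - 1) : carrier (A (p - 1) (n + 1 - p))"
 using Tot_at[of x n "p - 1"] by (simp add: algebra_simps)

lemmas dh_zero = hom_zero[OF A A dh'] and dv_zero = hom_zero[OF A A dv']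

lemma D_closed: "x : carrier (Tot n) ==> D n x : carrier (Tot (n + 1))"
 using hom_closed[OF dh' Tot_at'] hom_closed[OF dv' Tot_at]
 by (simp add: Tot_simps(1)[of _ "n + 1"] D_def abelian_group.abelian_simprules(1)[OF module.axioms(2)[OF A]])

lemma D_hom: "D n : mod_hom R (Tot n) (Tot (n + 1))"
proof (rule mod_homI_linear[OF Tot_module Tot_module D_closed])
 fix a x y assume a: "a : carrier R" and xy: "x : carrier (Tot n)" "y : carrier (Tot n)"
 show "D n (a *[Tot n] x +[Tot n] y) = a *[Tot (n + 1)] D n x +[Tot (n + 1)] D n y"
 proof
  fix p
  interpret M: module R "A p (n + 1 - p)" by (rule A)
  interpret M0: module R "A (p - 1) (n + 1 - p)" by (rule A)
  interpret M1: module R "A p (n - p)" by (rule A)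
  have e: "n - (p - 1) = n + 1 - p" by simp
  let ?a = "dh (p - 1) (n + 1 - p) (x (p - 1))" let ?b = "dv p (n - p) (x p)"
  let ?c = "dh (p - 1) (n + 1 - p) (y (p - 1))" let ?d = "dv p (n - p) (y p)"
  have c: "?a : carrier (A p (n + 1 - p))" "?b : carrier (A p (n + 1 - p))"
   "?c : carrier (A p (n + 1 - p))" "?d : carrier (A p (n + 1 - p))"
   using hom_closed[OF dh' Tot_at'] hom_closed[OF dv' Tot_at] xy by blast+
  have "D n (a *[Tot n] x +[Tot n] y) p = (a *[A p (n + 1 - p)] ?a +[A p (n + 1 - p)] ?c) +[A p (n + 1 - p)] (a *[A p (n + 1 - p)] ?b +[A p (n + 1 - p)] ?d)"
   using a Tot_at'[OF xy(1)] Tot_at'[OF xy(2)] Tot_at[OF xy(1)] Tot_at[OF xy(2)]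
   by (simp add: D_def Tot_simps(3,4) e hom_add[OF dh'] hom_smult[OF dh'] hom_add[OF dv'] hom_smult[OF dv'])
  also have "\<dots> = (a *[A p (n + 1 - p)] ?a +[A p (n + 1 - p)] a *[A p (n + 1 - p)] ?b) +[A p (n + 1 - p)] (?c +[A p (n + 1 - p)] ?d)"
   using M.smult_closed[OF a c(1)] M.smult_closed[OF a c(2)] c(3,4) by algebra
  also have "\<dots> = (a *[Tot (n + 1)] D n x +[Tot (n + 1)] D n y) p"
   using a c by (simp add: D_def Tot_simps(3,4) M.smult_r_distr)
  finally show "D n (a *[Tot n] x +[Tot n] y) p = (a *[Tot (n + 1)] D n x +[Tot (n + 1)] D n y) p" .
 qed
qed

lemma D_D: "x : carrier (Tot n) ==> D (n + 1) (D n x) = \<zero>[Tot (n + 1 + 1)]"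
proof
 fix p assume x: "x : carrier (Tot n)"
 let ?q = "n - p"
 interpret M: module R "A p (n + 2 - p)" by (rule A)
 have e: "n + 1 - (p - 1) = n + 2 - p" "n + 1 + 1 - p = n + 2 - p" "p - 1 - 1 = p - 2" "p - 2 + 1 = p - 1"
  "p - 1 + 1 = p" "n - (p - 1) = n + 1 - p" "n + 1 - p + 1 = n + 2 - p" "n - p + 1 = n + 1 - p" "n - (p - 2) = n + 2 - p"
  by simp_all
 have x2: "x (p - 2) : carrier (A (p - 2) (n + 2 - p))" using Tot_at[OF x, of "p - 2"] by (simp add: e)
 note x1 = Tot_at'[OF x, of p] and x0 = Tot_at[OF x, of p]
 let ?hh = "dh (p - 1) (n + 2 - p) (dh (p - 2) (n + 2 - p) (x (p - 2)))"
 let ?hv = "dh (p - 1) (n + 2 - p) (dv (p - 1) (n + 1 - p) (x (p - 1)))"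
 let ?vh = "dv p (n + 1 - p) (dh (p - 1) (n + 1 - p) (x (p - 1)))"
 let ?vv = "dv p (n + 1 - p) (dv p (n - p) (x p))"
 have h2: "dh (p - 2) (n + 2 - p) (x (p - 2)) : carrier (A (p - 1) (n + 2 - p))"
  using hom_closed[OF dh x2] by (simp add: e)
 have v1: "dv (p - 1) (n + 1 - p) (x (p - 1)) : carrier (A (p - 1) (n + 2 - p))"
  using hom_closed[OF dv x1] by (simp add: e)
 have h1: "dh (p - 1) (n + 1 - p) (x (p - 1)) : carrier (A p (n + 1 - p))" using hom_closed[OF dh' x1] .
 have v0: "dv p (n - p) (x p) : carrier (A p (n + 1 - p))" using hom_closed[OF dv' x0] .
 have dv2: "dv p (n + 1 - p) : mod_hom R (A p (n + 1 - p)) (A p (n + 2 - p))" using dv[of p "n + 1 - p"] by (simp add: e)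
 have "D (n + 1) (D n x) p = (?hh +[A p (n + 2 - p)] ?hv) +[A p (n + 2 - p)] (?vh +[A p (n + 2 - p)] ?vv)"
  by (simp only: D_def e hom_add[OF dh' h2 v1] hom_add[OF dv2 h1 v0])
 moreover have "?hh = \<zero>[A p (n + 2 - p)]" using dh_dh[OF x2] by (simp add: e)
 moreover have "?vv = \<zero>[A p (n + 2 - p)]" using dv_dv[OF x0] by (simp add: e)
 moreover have "?hv +[A p (n + 2 - p)] ?vh = \<zero>[A p (n + 2 - p)]" using anticommute[OF x1] by (simp add: e)
 moreover have "?hv : carrier (A p (n + 2 - p))" "?vh : carrier (A p (n + 2 - p))"
  using hom_closed[OF dh' v1] hom_closed[OF dv2 h1] .
 ultimately have "D (n + 1) (D n x) p = \<zero>[A p (n + 2 - p)]" by simp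
 thus "D (n + 1) (D n x) p = \<zero>[Tot (n + 1 + 1)] p" by (simp only: Tot_simps(2) e)
qed

sublocale FC: filtered_complex R Tot D Fil
proof (rule filtered_complex.intro)
 show "submodule (Fil p n) R (Tot n)" for p n
  by (rule submoduleI'[OF Tot_module])
   (auto simp: Fil_def Tot_simps zero_A abelian_group.abelian_simprules(1,6)[OF module.axioms(2)[OF A]]
    module.smult_closed[OF A] module.smult_r_null[OF A])
 show "Fil (p + 1) n \<subseteq> Fil p n" for p n by (auto simp: Fil_def)
 show "Fil p n = carrier (Tot n)" if "p \<le> 0" for p n
 proof -
  have "x p' = \<zero>[A p' (n - p')]" if "x : carrier (Tot n)" "p' < p" for x p'
   using Tot_at[OF that(1), of p'] negative[of p' "n - p'"] that(2) \<open>p \<le> 0\<close> by simp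
  thus ?thesis unfolding Fil_def by blast
 qed
 show "Fil p n = {\<zero>[Tot n]}" if "n < p" for p n
 proof -
  have "x p' = \<zero>[A p' (n - p')]" if "x : Fil p n" for x p'
  proof (cases "p' < p")
   case False
   hence "n - p' < 0" using \<open>n < p\<close> by simp
   thus ?thesis using Tot_at[of x n p'] negative[of p' "n - p'"] that by (simp add: Fil_def)
  qed (insert that, simp add: Fil_def)
  hence "Fil p n \<subseteq> {\<zero>[Tot n]}" unfolding Tot_simps(2) by (intro subsetI singletonI ext CollectI) blast
  moreover have "\<zero>[Tot n] : Fil p n" by (simp add: Fil_def Tot_simps zero_A)
  ultimately show ?thesis by blast
 qed
 show "D n x : Fil p (n + 1)" if x: "x : Fil p n" for x p n
 proof -
  have xT: "x : carrier (Tot n)" using x by (simp add: Fil_def)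
  have "D n x p' = \<zero>[A p' (n + 1 - p')]" if p': "p' < p" for p'
  proof -
   have "x p' = \<zero>[A p' (n - p')]" "x (p' - 1) = \<zero>[A (p' - 1) (n - (p' - 1))]"
    using x p' by (simp_all add: Fil_def)
   thus ?thesis
    using dh_zero[of p' "n + 1 - p'"] dv_zero[of p' n] zero_A abelian_group.abelian_simprules(6)[OF module.axioms(2)[OF A]]
    by (simp add: D_def algebra_simps)
  qed
  thus ?thesis using D_closed[OF xT] by (simp add: Fil_def)
 qed
qed (simp_all add: Tot_module D_hom D_D)

section \<open>The second page of the filtration by columns\<close>

lemma FilD: "x : Fil p n ==> p' < p ==> x p' = \<zero>[A p' (n - p')]" "x : Fil p n ==> x : carrier (Tot n)"
 by (simp_all add: Fil_def)

lemma D_at_first: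
 assumes "x : Fil p n" shows "D n x p = dv p (n - p) (x p)"
proof -
 interpret M: module R "A p (n + 1 - p)" by (rule A)
 have "x (p - 1) = \<zero>[A (p - 1) (n + 1 - p)]" using FilD(1)[OF assms, of "p - 1"] by (simp add: algebra_simps)
 thus ?thesis using dh_zero hom_closed[OF dv' Tot_at[OF FilD(2)[OF assms]]] by (simp add: D_def)
qed

lemma D_at_next: "D n x (p + 1) = dh p (n - p) (x p) +[A (p + 1) (n - p)] dv (p + 1) (n - p - 1) (x (p + 1))"
proof -
 have "n + 1 - (p + 1) = n - p" "n - (p + 1) = n - p - 1" "p + 1 - 1 = p" by simp_all
 thus ?thesis by (simp only: D_def)
qed

text \<open>Membership in the cycles of page 2 involves only the components in columns
  \<open>p\<close> and \<open>p + 1\<close>, so representatives with these two components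
  suffice.\<close>

definition supp2 :: "int => int => 'a => 'a => int => 'a" where
 "supp2 n p a b = (%p'. if p' = p then a else if p' = p + 1 then b else \<zero>[A p' (n - p')])"

lemma supp2_Fil:
 assumes "a : carrier (A p (n - p))" "b : carrier (A (p + 1) (n - p - 1))"
 shows "supp2 n p a b : Fil p n"
proof -
 show ?thesis using assms by (simp add: Fil_def Tot_simps supp2_def zero_A diff_diff_eq)
qed

lemma Fil_Suc_iff: "x : Fil (p + 1) n \<longleftrightarrow> x : Fil p n \<and> x p = \<zero>[A p (n - p)]"
proof -
 have "p' < p + 1 \<longleftrightarrow> p' < p \<or> p' = p" for p' by auto
 thus ?thesis by (auto simp: Fil_def)
qed

text \<open>Vertical cocycles whose horizontal image is a vertical coboundary. Together with
  \<open>B2\<close> this describes the horizontal cohomology of the vertical cohomology without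
  forming the inner quotient.\<close>

definition Z2 :: "int => int => 'a set" where
 "Z2 p q = {a : carrier (A p q). dv p q a = \<zero>[A p (q + 1)] \<and>
  (\<exists>b\<in>carrier (A (p + 1) (q - 1)). dh p q a +[A (p + 1) q] dv (p + 1) (q - 1) b = \<zero>[A (p + 1) q])}"

definition B2 :: "int => int => 'a set" where
 "B2 p q = {a : carrier (A p q). \<exists>c\<in>carrier (A (p - 1) q). \<exists>e\<in>carrier (A p (q - 1)).
  dv (p - 1) q c = \<zero>[A (p - 1) (q + 1)] \<and> a = dh (p - 1) q c +[A p q] dv p (q - 1) e}"

lemma cyc2_iff:
 "x : FC.cyc 2 p (p + q) \<longleftrightarrow> x : Fil p (p + q) \<and> dv p q (x p) = \<zero>[A p (q + 1)] \<and>
  dh p q (x p) +[A (p + 1) q] dv (p + 1) (q - 1) (x (p + 1)) = \<zero>[A (p + 1) q]"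
proof -
 have e: "p + q - p = q" "p + q - p - 1 = q - 1" "p + q + 1 - p = q + 1" "p + q + 1 - (p + 1) = q" by simp_all
 have "D (p + q) x : Fil (p + 2) (p + q + 1) \<longleftrightarrow> D (p + q) x p = \<zero>[A p (q + 1)] \<and> D (p + q) x (p + 1) = \<zero>[A (p + 1) q]"
  if x: "x : Fil p (p + q)"
  using Fil_Suc_iff[of "D (p + q) x" "p + 1" "p + q + 1"] Fil_Suc_iff[of "D (p + q) x" p "p + q + 1"] FC.d_F[OF x]
  unfolding e by (simp add: add.assoc)
 thus ?thesis
  using D_at_first[of x p "p + q"] D_at_next[of "p + q" x p] unfolding e by (auto simp: FC.cyc_def)
qed

text \<open>The component in column \<open>p\<close> carries the whole class: the later components
  can be filled in from the element \<open>b\<close> of \<open>Z2\<close>, and the freedom in them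
  lies in deeper filtration.\<close>

lemma second_page:
 assumes k: "quotient_map R (A p q <| Z2 p q) (B2 p q) k E"
 shows "quotient_map R (Tot (p + q) <| FC.cyc 2 p (p + q)) (FC.bnd 2 p (p + q)) (%x. k (x p)) E"
proof (rule quotient_map_precomp[OF k FC.cyc_module])
 have e: "p + q - p = q" "p + q - p - 1 = q - 1" "p + q - 1 - p = q - 1" "p + q - 1 - (p - 1) = q"
  "p + q - 1 - (p - 1) - 1 = q - 1" "p - 1 + 1 = p" "p + q - 1 + 1 = p + q" "p + q - 1 + 1 - (p - 1) = q + 1"
  by simp_all
 have at: "x p : carrier (A p q)" "x (p + 1) : carrier (A (p + 1) (q - 1))" if "x : Fil p (p + q)" for x
  using Tot_at[OF FilD(2)[OF that], of p] Tot_at[OF FilD(2)[OF that], of "p + 1"] by (simp_all add: algebra_simps)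
 show "(%x. x p) : mod_hom R (Tot (p + q) <| FC.cyc 2 p (p + q)) (A p q <| Z2 p q)"
 proof (rule mod_homI)
  fix x assume "x : carrier (Tot (p + q) <| FC.cyc 2 p (p + q))"
  hence "x : FC.cyc 2 p (p + q)" by simp
  thus "x p : carrier (A p q <| Z2 p q)"
   unfolding cyc2_iff using at[of x] by (auto simp: Z2_def)
 qed (simp_all add: Tot_simps(3,4))
 show "\<exists>y\<in>carrier (Tot (p + q) <| FC.cyc 2 p (p + q)). k (y p) = k a"
  if a: "a : carrier (A p q <| Z2 p q)" for a
 proof -
  from a obtain b where b: "a : carrier (A p q)" "dv p q a = \<zero>[A p (q + 1)]" "b : carrier (A (p + 1) (q - 1))"
   "dh p q a +[A (p + 1) q] dv (p + 1) (q - 1) b = \<zero>[A (p + 1) q]" by (auto simp: Z2_def)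
  have "supp2 (p + q) p a b : FC.cyc 2 p (p + q)"
   unfolding cyc2_iff using supp2_Fil[of a p "p + q" b] b by (simp add: supp2_def)
  thus ?thesis by (intro bexI[of _ "supp2 (p + q) p a b"]) (simp_all add: supp2_def)
 qed
 fix x assume "x : carrier (Tot (p + q) <| FC.cyc 2 p (p + q))"
 hence x: "x : FC.cyc 2 p (p + q)" by simp
 hence xF: "x : Fil p (p + q)" by (simp add: cyc2_iff)
 have xT: "x : carrier (Tot (p + q))" using xF by (simp add: Fil_def)
 interpret M: module R "A p q" by (rule A)
 have key: "D (p + q - 1) w p = dh (p - 1) q (w (p - 1)) +[A p q] dv p (q - 1) (w p)" for w
  using D_at_next[of "p + q - 1" w "p - 1"] unfolding e .
 have first: "D (p + q - 1) w (p - 1) = dv (p - 1) q (w (p - 1))" if "w : Fil (p - 1) (p + q - 1)" for w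
  using D_at_first[OF that] unfolding e .
 have mem: "x -[Tot (p + q)] D (p + q - 1) w : Fil (p + 1) (p + q) \<longleftrightarrow> x p = D (p + q - 1) w p"
  if w: "D (p + q - 1) w : Fil p (p + q)" for w
  using Fil_Suc_iff[of "x -[Tot (p + q)] D (p + q - 1) w" p "p + q"] FC.F_minus[OF xF w]
   Tot_minus[OF xT FilD(2)[OF w], of p] M.M.minus_zero_iff[OF at(1)[OF xF] at(1)[OF w]] unfolding e by simp
 have up: "D (p + q - 1) w : Fil p (p + q) \<longleftrightarrow> dv (p - 1) q (w (p - 1)) = \<zero>[A (p - 1) (q + 1)]"
  if w: "w : Fil (p - 1) (p + q - 1)" for w
  using Fil_Suc_iff[of "D (p + q - 1) w" "p - 1" "p + q - 1 + 1"] FC.d_F[OF w] first[OF w] unfolding e by simp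
 show "x p : B2 p q \<longleftrightarrow> x : FC.bnd 2 p (p + q)"
 proof
  assume "x p : B2 p q"
  then obtain c f where cf: "c : carrier (A (p - 1) q)" "f : carrier (A p (q - 1))"
   "dv (p - 1) q c = \<zero>[A (p - 1) (q + 1)]" "x p = dh (p - 1) q c +[A p q] dv p (q - 1) f" by (auto simp: B2_def)
  let ?w = "supp2 (p + q - 1) (p - 1) c f"
  have w: "?w : Fil (p - 1) (p + q - 1)" using supp2_Fil[of c "p - 1" "p + q - 1" f] cf unfolding e by simp
  have "?w (p - 1) = c" "?w p = f" by (simp_all add: supp2_def)
  thus "x : FC.bnd 2 p (p + q)"
   using w x up[OF w] mem[of ?w] key[of ?w] cf by (intro FC.bndI[of _ _ _ _ ?w]) simp_all
 next
  assume "x : FC.bnd 2 p (p + q)"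
  then obtain w where w: "w : Fil (p - 1) (p + q - 1)" "D (p + q - 1) w : Fil p (p + q)"
   "x -[Tot (p + q)] D (p + q - 1) w : Fil (p + 1) (p + q)" by (rule FC.bndE) simp
  have wat: "w (p - 1) : carrier (A (p - 1) q)" "w p : carrier (A p (q - 1))"
   using Tot_at[OF FilD(2)[OF w(1)], of "p - 1"] Tot_at[OF FilD(2)[OF w(1)], of p] unfolding e .
  show "x p : B2 p q"
   unfolding B2_def mem_Collect_eq
  proof (intro conjI bexI)
   show "dv (p - 1) q (w (p - 1)) = \<zero>[A (p - 1) (q + 1)]" using up[OF w(1)] w(2) by simp
   show "x p = dh (p - 1) q (w (p - 1)) +[A p q] dv p (q - 1) (w p)"
    using w(3) mem[OF w(2)] key[of w] by simp
  qed (use at(1)[OF xF] wat in auto)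
 qed
qed

text \<open>The zigzag from right to left: once all components beyond column \<open>k\<close> are
  gone, the equation for \<open>D\<close> forces the one in column \<open>k\<close> to be a
  horizontal cocycle, and exactness of the row supplies an element of column \<open>k - 1\<close>
  whose image is subtracted.\<close>

lemma kill_rows:
 assumes exact: "!!p q a. 1 \<le> p ==> a : carrier (A p q) ==> dh p q a = \<zero>[A (p + 1) q] ==>
   \<exists>c\<in>carrier (A (p - 1) q). a = dh (p - 1) q c"
  and z: "z : carrier (Tot n)" and Dz: "!!p. 1 \<le> p ==> D n z p = \<zero>[A p (n + 1 - p)]"
 obtains w where "w : carrier (Tot (n - 1))" "!!p. 1 \<le> p ==> (z -[Tot n] D (n - 1) w) p = \<zero>[A p (n - p)]"
proof -
 interpret T: module R "Tot n" by (rule Tot_module)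
 interpret T1: module R "Tot (n + 1)" by (rule Tot_module)
 interpret T0: module R "Tot (n - 1)" by (rule Tot_module)
 \<comment> \<open>Columns beyond \<open>max n 0\<close> contribute nothing, so the descending
   induction starts there; it ends at 0 because column 0 is not assumed exact.\<close>
 have "\<exists>w\<in>carrier (Tot (n - 1)). \<forall>p>k. (z -[Tot n] D (n - 1) w) p = \<zero>[A p (n - p)]" if "0 \<le> k" "k \<le> max n 0" for k
  using that(2,1)
 proof (induction k rule: int_le_induct)
  case base
  have c: "z -[Tot n] D (n - 1) \<zero>[Tot (n - 1)] : carrier (Tot n)"
   using z FC.d_closed'[OF T0.M.zero_closed] by simp
  have "(z -[Tot n] D (n - 1) \<zero>[Tot (n - 1)]) p = \<zero>[A p (n - p)]" if "max n 0 < p" for p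
   using Tot_at[OF c, of p] negative[of p "n - p"] that by simp
  thus ?case by (intro bexI[of _ "\<zero>[Tot (n - 1)]"]) auto
 next
  case (step k)
  then obtain w where w: "w : carrier (Tot (n - 1))" "!!p. k < p ==> (z -[Tot n] D (n - 1) w) p = \<zero>[A p (n - p)]"
   by auto
  let ?y = "z -[Tot n] D (n - 1) w"
  have Dw: "D (n - 1) w : carrier (Tot n)" using FC.d_closed'[OF w(1)] .
  have y: "?y : carrier (Tot n)" using z Dw by simp
  have Dy: "D n ?y = D n z"
   using FC.d_minus[OF z Dw] FC.d_d'[OF w(1)] D_closed[OF z] by (simp add: a_minus_def T1.M.neg_zero)
  have "dh k (n - k) (?y k) = \<zero>[A (k + 1) (n - k)]"
  proof -
   interpret M: module R "A (k + 1) (n - k)" by (rule A)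
   have e: "n + 1 - (k + 1) = n - k" "n - (k + 1) = n - k - 1" by simp_all
   have "?y (k + 1) = \<zero>[A (k + 1) (n - (k + 1))]" using w(2)[of "k + 1"] by simp
   hence "D n ?y (k + 1) = dh k (n - k) (?y k)"
    using D_at_next[of n ?y k] dv_zero[of "k + 1" n] hom_closed[OF dh Tot_at[OF y]] unfolding e by simp
   thus ?thesis using Dz[of "k + 1"] step(3,1) unfolding Dy e by simp
  qed
  then obtain c where c: "c : carrier (A (k - 1) (n - k))" "?y k = dh (k - 1) (n - k) c"
   using exact[OF _ Tot_at[OF y, of k]] step by auto
  have e2: "n - 1 - (k - 1) = n - k" "n - 1 + 1 = n" "n - 1 - p = n - p - 1" for p by simp_all
  define v where "v = (%p. if p = k - 1 then c else \<zero>[A p (n - 1 - p)])"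
  have v: "v : carrier (Tot (n - 1))" using c(1) zero_A by (simp add: Tot_simps v_def)
  have Dv: "D (n - 1) v : carrier (Tot n)" using FC.d_closed'[OF v] .
  have vp: "(?y -[Tot n] D (n - 1) v) p = \<zero>[A p (n - p)]" if p: "k - 1 < p" for p
  proof -
   interpret M: module R "A p (n - p)" by (rule A)
   have v0: "dv p (n - 1 - p) (v p) = \<zero>[A p (n - p)]"
    using dv_zero[of p "n - 1"] p by (simp add: v_def)
   have "D (n - 1) v p = ?y p"
   proof (cases "p = k")
    case True
    thus ?thesis using v0 c hom_closed[OF dh' c(1)] by (simp add: D_def v_def A_zero)
   next
    case False
    hence "v (p - 1) = \<zero>[A (p - 1) (n - p)]" by (simp add: v_def)
    hence "D (n - 1) v p = \<zero>[A p (n - p)]" using v0 dh_zero[of p "n - p"] by (simp add: D_def)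
    thus ?thesis using w(2)[of p] False p by simp
   qed
   thus ?thesis using Tot_minus[OF y Dv, of p] Tot_at[OF y, of p] by (simp add: M.M.minus_zero_iff)
  qed
  have "D (n - 1) (w +[Tot (n - 1)] v) = D (n - 1) w +[Tot n] D (n - 1) v"
   using hom_add[OF FC.d' w(1) v] .
  moreover have "z -[Tot n] (D (n - 1) w +[Tot n] D (n - 1) v) = ?y -[Tot n] D (n - 1) v"
   using z Dw Dv by algebra
  ultimately show ?case using vp w(1) v by (intro bexI[of _ "w +[Tot (n - 1)] v"]) auto
 qed
 from this[of 0] obtain w where "w : carrier (Tot (n - 1))" "!!p. 0 < p ==> (z -[Tot n] D (n - 1) w) p = \<zero>[A p (n - p)]"
  by auto
 thus thesis using that by simp
qed

definition edge :: "int => 'a => int => 'a" where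
 "edge n a = (%p. if p = 0 then a else \<zero>[A p (n - p)])"

text \<open>\<open>Zedge\<close> and \<open>Bedge\<close> are the cocycles and coboundaries of the
  complex formed by the horizontal cocycles in column 0.\<close>

definition Zedge :: "int => 'a set" where
 "Zedge n = {a : carrier (A 0 n). dh 0 n a = \<zero>[A 1 n] \<and> dv 0 n a = \<zero>[A 0 (n + 1)]}"

definition Bedge :: "int => 'a set" where
 "Bedge n = {dv 0 (n - 1) b | b. b : carrier (A 0 (n - 1)) \<and> dh 0 (n - 1) b = \<zero>[A 1 (n - 1)]}"

lemma edge_Tot: "a : carrier (A 0 n) ==> edge n a : carrier (Tot n)"
 using zero_A by (simp add: edge_def Tot_simps)

lemma edge_hom: "edge n : mod_hom R (A 0 n) (Tot n)"
proof (rule mod_homI)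
 show "edge n (a +[A 0 n] b) = edge n a +[Tot n] edge n b" for a b
 proof
  fix p
  interpret M: module R "A p (n - p)" by (rule A)
  show "edge n (a +[A 0 n] b) p = (edge n a +[Tot n] edge n b) p" by (simp add: edge_def Tot_simps(3))
 qed
 show "edge n (r *[A 0 n] a) = r *[Tot n] edge n a" if "r : carrier R" for r a
  using module.smult_r_null[OF A that] by (auto simp: edge_def Tot_simps(4))
qed (rule edge_Tot)

lemma D_edge:
 assumes a: "a : carrier (A 0 n)"
 shows "D n (edge n a) = (%p. if p = 0 then dv 0 n a else if p = 1 then dh 0 n a else \<zero>[A p (n + 1 - p)])"
proof
 fix p
 interpret M: module R "A p (n + 1 - p)" by (rule A)
 have v: "dv p (n - p) (edge n a p) = \<zero>[A p (n + 1 - p)]" if "p \<noteq> 0"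
  using dv_zero[of p n] that by (simp add: edge_def)
 have h: "dh (p - 1) (n + 1 - p) (edge n a (p - 1)) = \<zero>[A p (n + 1 - p)]" if "p \<noteq> 1"
  using dh_zero[of p "n + 1 - p"] that by (simp add: edge_def algebra_simps)
 show "D n (edge n a) p = (if p = 0 then dv 0 n a else if p = 1 then dh 0 n a else \<zero>[A p (n + 1 - p)])"
  using v h hom_closed[OF dv a] hom_closed[OF dh a]
  by (simp add: D_def) (auto simp: edge_def add.commute A_zero)
qed

lemma concentrated:
 assumes "z : carrier (Tot n)" "!!p. 1 \<le> p ==> z p = \<zero>[A p (n - p)]"
 shows "z = edge n (z 0)"
proof
 fix p
 show "z p = edge n (z 0) p"
  using Tot_at[OF assms(1), of p] negative[of p "n - p"] assms(2)[of p] by (cases "p < 0") (auto simp: edge_def)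
qed

text \<open>By \<open>kill_rows\<close> every total cocycle is cohomologous to one in column 0.
  Applied once more, to a cochain with boundary in column 0, it shows that this boundary already
  comes from a horizontal cocycle of column 0.\<close>

lemma total_cohomology:
 assumes exact: "!!p q a. 1 \<le> p ==> a : carrier (A p q) ==> dh p q a = \<zero>[A (p + 1) q] ==>
   \<exists>c\<in>carrier (A (p - 1) q). a = dh (p - 1) q c"
  and \<eta>: "quotient_map R (A 0 n <| Zedge n) (Bedge n) \<eta> H"
 obtains \<zeta> where "quotient_map R (Tot n <| FC.cocyc n) (D (n - 1) ` carrier (Tot (n - 1))) \<zeta> H"
proof -
 let ?Z = "Tot n <| FC.cocyc n" and ?B = "D (n - 1) ` carrier (Tot (n - 1))"
 interpret T: module R "Tot n" by (rule Tot_module)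
 interpret T0: module R "Tot (n - 1)" by (rule Tot_module)
 have mZ: "module R ?Z" by (rule submodule_module[OF Tot_module FC.cocyc_sub])
 have BZ: "?B \<subseteq> FC.cocyc n" using FC.d_closed' FC.d_d' by (auto simp: FC.cocyc_def)
 have B: "submodule ?B R ?Z"
 proof (rule submoduleI'[OF mZ])
  show "?B \<subseteq> carrier ?Z" using BZ by simp
  show "\<zero>[?Z] : ?B" using FC.d_zero'[of n] by (auto intro!: image_eqI[of _ _ "\<zero>[Tot (n - 1)]"])
  show "x +[?Z] y : ?B" if "x : ?B" "y : ?B" for x y
   using that by (auto simp: hom_add[OF FC.d', symmetric])
  show "a *[?Z] x : ?B" if "a : carrier R" "x : ?B" for a x
   using that by (auto simp: hom_smult[OF FC.d', symmetric])
 qed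
 note q = quotient_map_quot_mod[OF mZ B]
 have edge_cocyc: "edge n a : FC.cocyc n \<longleftrightarrow> a : Zedge n" if a: "a : carrier (A 0 n)" for a
 proof -
  have "D n (edge n a) = \<zero>[Tot (n + 1)] \<longleftrightarrow> dv 0 n a = \<zero>[A 0 (n + 1)] \<and> dh 0 n a = \<zero>[A 1 n]"
  proof
   assume "D n (edge n a) = \<zero>[Tot (n + 1)]"
   from fun_cong[OF this, of 0] fun_cong[OF this, of 1]
   show "dv 0 n a = \<zero>[A 0 (n + 1)] \<and> dh 0 n a = \<zero>[A 1 n]"
    by (simp add: D_edge[OF a] Tot_simps(2))
  qed (simp add: D_edge[OF a] Tot_simps(2) fun_eq_iff)
  thus ?thesis using edge_Tot[OF a] a by (auto simp: FC.cocyc_def Zedge_def)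
 qed
 have "quotient_map R (A 0 n <| Zedge n) (Bedge n) (%a. ?B +>\<^bsub>?Z\<^esub> edge n a) (quot_mod ?Z ?B)"
 proof (rule quotient_map_precomp[OF q quotD(1)[OF \<eta>]])
  show "edge n : mod_hom R (A 0 n <| Zedge n) ?Z"
   using edge_cocyc hom_add[OF edge_hom] hom_smult[OF edge_hom]
   by (intro mod_homI) (auto simp: Zedge_def)
  show "\<exists>a\<in>carrier (A 0 n <| Zedge n). ?B +>\<^bsub>?Z\<^esub> edge n a = ?B +>\<^bsub>?Z\<^esub> z" if "z : carrier ?Z" for z
  proof -
   have z: "z : carrier (Tot n)" "D n z = \<zero>[Tot (n + 1)]" using that by (auto simp: FC.cocyc_def)
   obtain w where w: "w : carrier (Tot (n - 1))" "!!p. 1 \<le> p ==> (z -[Tot n] D (n - 1) w) p = \<zero>[A p (n - p)]"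
    by (rule kill_rows[OF exact z(1)]) (simp_all add: z(2) Tot_simps(2))
   let ?y = "z -[Tot n] D (n - 1) w"
   have Dw: "D (n - 1) w : ?B" using w(1) by blast
   have zc: "z : FC.cocyc n" using that by simp
   have yc: "?y : FC.cocyc n" using submodule_minus[OF Tot_module FC.cocyc_sub zc] Dw BZ by blast
   hence yT: "?y : carrier (Tot n)" by (simp add: FC.cocyc_def)
   have y: "?y = edge n (?y 0)" by (rule concentrated[OF yT w(2)])
   have y0: "?y 0 : carrier (A 0 n)" using Tot_at[OF yT, of 0] by simp
   have "?y 0 : Zedge n" using edge_cocyc[OF y0] yc y by simp
   moreover have "?B +>\<^bsub>?Z\<^esub> edge n (?y 0) = ?B +>\<^bsub>?Z\<^esub> z"
   proof -
    have "z -[Tot n] ?y = D (n - 1) w" using z(1) FC.d_closed'[OF w(1)] by algebra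
    thus ?thesis
     using quotient_restrict_eq_iff[OF q Tot_module FC.cocyc_sub zc yc] Dw y by simp
   qed
   ultimately show ?thesis by (intro bexI[of _ "?y 0"]) simp_all
  qed
  fix a assume "a : carrier (A 0 n <| Zedge n)"
  hence a: "a : carrier (A 0 n)" by (simp add: Zedge_def)
  show "edge n a : ?B \<longleftrightarrow> a : Bedge n"
  proof
   assume "edge n a : ?B"
   then obtain y where y: "y : carrier (Tot (n - 1))" "D (n - 1) y = edge n a" by auto
   obtain w where w: "w : carrier (Tot (n - 1 - 1))" "!!p. 1 \<le> p ==> (y -[Tot (n - 1)] D (n - 1 - 1) w) p = \<zero>[A p (n - 1 - p)]"
    by (rule kill_rows[OF exact y(1)]) (simp_all add: y(2) edge_def)
   let ?y = "y -[Tot (n - 1)] D (n - 1 - 1) w"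
   have Dw: "D (n - 1 - 1) w : carrier (Tot (n - 1))" using FC.d_closed'[OF w(1)] .
   hence yT: "?y : carrier (Tot (n - 1))" using y(1) by simp
   have ye: "?y = edge (n - 1) (?y 0)" by (rule concentrated[OF yT w(2)])
   have y0: "?y 0 : carrier (A 0 (n - 1))" using Tot_at[OF yT, of 0] by simp
   have "D (n - 1) ?y = D (n - 1) y -[Tot n] D (n - 1) (D (n - 1 - 1) w)"
    using hom_minus[OF Tot_module Tot_module FC.d' y(1) Dw] .
   also have "D (n - 1) (D (n - 1 - 1) w) = \<zero>[Tot n]" using FC.d_d'[OF w(1)] by simp
   also have "D (n - 1) y -[Tot n] \<zero>[Tot n] = edge n a" unfolding y(2) using edge_Tot[OF a] by algebra
   finally have "edge n a = D (n - 1) (edge (n - 1) (?y 0))" using ye by simp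
   hence E: "edge n a p = (if p = 0 then dv 0 (n - 1) (?y 0) else if p = 1 then dh 0 (n - 1) (?y 0) else \<zero>[A p (n - p)])" for p
    unfolding D_edge[OF y0] by simp
   have "a = dv 0 (n - 1) (?y 0)" "dh 0 (n - 1) (?y 0) = \<zero>[A 1 (n - 1)]"
    using E[of 0] E[of 1] by (simp_all add: edge_def)
   thus "a : Bedge n" using y0 unfolding Bedge_def by blast
  next
   assume "a : Bedge n"
   then obtain b where b: "b : carrier (A 0 (n - 1))" "dh 0 (n - 1) b = \<zero>[A 1 (n - 1)]" "a = dv 0 (n - 1) b"
    by (auto simp: Bedge_def)
   have "edge n a = D (n - 1) (edge (n - 1) b)" unfolding D_edge[OF b(1)] using b(2,3) by (auto simp: edge_def)
   thus "edge n a : ?B" using edge_Tot[OF b(1)] by blast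
  qed
 qed
 then obtain h where h: "h : mod_hom R (quot_mod ?Z ?B) H" "bij_betw h (carrier (quot_mod ?Z ?B)) (carrier H)"
  using quotient_map_iso[OF _ \<eta>] by blast
 show thesis using that[OF quotient_map_postcomp[OF q quotD(2)[OF \<eta>] h]] .
qed

end

section \<open>The spectral sequence of a complex of coefficient modules\<close>

lemma zero_submodule:
 assumes "module R M" shows "submodule {\<zero>[M]} R M"
proof -
 interpret module R M by fact
 show ?thesis by (rule submoduleI'[OF assms]) simp_all
qed

definition sub_cmod :: "('o, 'm, 'r, 'x) cmod => ('o => 'x set) => ('o, 'm, 'r, 'x) cmod" where
 "sub_cmod M Z = \<lparr>val = (%x. val M x <| Z x), act = act M\<rparr>"

lemma sub_cmod_module:
 assumes M: "right_module R C M" and Z: "!!x. x : Obj C ==> submodule (Z x) R (val M x)"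
  and act: "!!x y f m. x : Obj C ==> y : Obj C ==> f : Hom C x y ==> m : Z y ==> act M x y f m : Z x"
 shows "right_module R C (sub_cmod M Z)"
proof (rule right_moduleI)
 have c: "m : el M x" if "x : Obj C" "m : Z x" for x m using submodule_subset[OF Z] that by blast
 show "module R (val (sub_cmod M Z) x)" if "x : Obj C" for x
  using submodule_module[OF val_module[OF M that] Z[OF that]] by (simp add: sub_cmod_def)
 show "act (sub_cmod M Z) x y f : mod_hom R (val (sub_cmod M Z) y) (val (sub_cmod M Z) x)"
  if "x : Obj C" "y : Obj C" "f : Hom C x y" for x y f
  using act[OF that] hom_add[OF act_hom[OF M that]] hom_smult[OF act_hom[OF M that]] c[OF that(2)]
  by (intro mod_homI) (simp_all add: sub_cmod_def)
qed (simp_all add: sub_cmod_def act_Ident[OF M] act_Comp[OF M] submodule_subset[OF Z])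

lemma nat_trans_sub_cmod:
 assumes A: "right_module R C A" and Z: "!!x. x : Obj C ==> Z x \<subseteq> el M x"
 shows "\<eta> : nat_trans R C A (sub_cmod M Z) \<longleftrightarrow>
  \<eta> : nat_trans R C A M \<and> (\<forall>x\<in>Obj C. \<forall>a\<in>el A x. \<eta> x a : Z x)"
proof -
 have "\<eta> x : mod_hom R (val A x) (val M x <| Z x) \<longleftrightarrow>
  \<eta> x : mod_hom R (val A x) (val M x) \<and> (\<forall>a\<in>el A x. \<eta> x a : Z x)" if "x : Obj C" for x
  using Z[OF that] by (auto simp: mod_hom_def Pi_iff)
 thus ?thesis by (auto simp: nat_trans_def sub_cmod_def)
qed

definition sgn :: "int => ('r, 'x) module => 'x => 'x" where
 "sgn p M v = (if even p then v else \<ominus>\<^bsub>M\<^esub> v)"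

lemma sgn_props:
 assumes "module R M"
 shows sgn_closed: "v : carrier M ==> sgn p M v : carrier M"
  and sgn_sgn: "v : carrier M ==> sgn p M (sgn p M v) = v"
  and sgn_zero: "sgn p M \<zero>[M] = \<zero>[M]"
  and sgn_add: "u : carrier M ==> v : carrier M ==> sgn p M (u +[M] v) = sgn p M u +[M] sgn p M v"
  and sgn_smult: "a : carrier R ==> v : carrier M ==> sgn p M (a *[M] v) = a *[M] sgn p M v"
  and sgn_cancel: "v : carrier M ==> sgn p M v +[M] sgn (p + 1) M v = \<zero>[M]"
proof -
 interpret module R M by fact
 show "v : carrier M ==> sgn p M v : carrier M" "v : carrier M ==> sgn p M (sgn p M v) = v"
  "sgn p M \<zero>[M] = \<zero>[M]" "v : carrier M ==> sgn p M v +[M] sgn (p + 1) M v = \<zero>[M]"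
  "a : carrier R ==> v : carrier M ==> sgn p M (a *[M] v) = a *[M] sgn p M v"
  by (simp_all add: sgn_def M.neg_zero M.r_neg M.l_neg smult_r_minus)
 show "u : carrier M ==> v : carrier M ==> sgn p M (u +[M] v) = sgn p M u +[M] sgn p M v"
  by (simp add: sgn_def M.minus_add)
qed

lemma sgn_hom: "module R M ==> sgn p M : mod_hom R M M"
 by (rule mod_homI) (simp_all add: sgn_closed sgn_add sgn_smult)

lemma hom_sgn:
 "module R A ==> module R B ==> f : mod_hom R A B ==> v : carrier A ==> f (sgn p A v) = sgn p B (f v)"
 by (simp add: sgn_def mod_hom_neg)

lemma nat_trans_sgn:
 assumes A: "right_module R C A" and B: "right_module R C B" and \<eta>: "\<eta> : nat_trans R C A B"
 shows "pointwise C A (%x a. sgn p (val B x) (\<eta> x a)) : nat_trans R C A B"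
proof (rule nat_transI[OF A])
 show "(%a. sgn p (val B x) (\<eta> x a)) : mod_hom R (val A x) (val B x)" if "x : Obj C" for x
  by (rule hom_comp[OF nat_hom[OF \<eta> that] sgn_hom[OF val_module[OF B that]]])
 show "sgn p (val B x) (\<eta> x (act A x y f a)) = act B x y f (sgn p (val B y) (\<eta> y a))"
  if *: "x : Obj C" "y : Obj C" "f : Hom C x y" "a : el A y" for x y f a
  using nat_act[OF \<eta> *] hom_sgn[OF val_module[OF B *(2)] val_module[OF B *(1)] act_hom[OF B *(1-3)] nat_closed[OF \<eta> *(2,4)]]
  by simp
qed

text \<open>\<open>K\<close> is a complex of modules over \<open>D\<close> with cohomology
  \<open>H\<close> and projections \<open>\<kappa>\<close>. The hypothesis \<open>rows\<close>
  stands in for injectivity of the \<open>K q\<close>: exactness of the maps from \<open>Y\<close>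
  to \<open>K q\<close> in positive degrees.\<close>

locale coefficient_complex =
 fixes R :: "'r ring" and D :: "('o, 'm) cat" and Y :: "('o, 'm, 'r, 'y, 'r) resolution"
  and K :: "nat => ('o, 'm, 'r, 'k) cmod" and \<delta> :: "nat => 'o => 'k => 'k"
  and H :: "nat => ('o, 'm, 'r, 'h) cmod" and \<kappa> :: "nat => 'o => 'k => 'h"
 assumes R: "cring R" and D: "category D" and Y: "projective_resolution R D (const_mod R) Y"
  and K: "right_module R D (K q)" and \<delta>: "\<delta> q : nat_trans R D (K q) (K (Suc q))"
  and \<delta>_\<delta>: "x : Obj D ==> u : el (K q) x ==> \<delta> (Suc q) x (\<delta> q x u) = \<zero>[val (K (Suc (Suc q))) x]"
  and H: "right_module R D (H q)"
  and \<kappa>: "x : Obj D ==> quotient_map R (val (K q) x <| {u : el (K q) x. \<delta> q x u = \<zero>[val (K (Suc q)) x]})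
   (case q of 0 => {\<zero>[val (K 0) x]} | Suc m => \<delta> m x ` el (K m) x) (\<kappa> q x) (val (H q) x)"
  and \<kappa>_act: "x : Obj D ==> y : Obj D ==> f : Hom D x y ==> u : el (K q) y ==>
   \<delta> q y u = \<zero>[val (K (Suc q)) y] ==> \<kappa> q x (act (K q) x y f u) = act (H q) x y f (\<kappa> q y u)"
  and rows: "g : nat_trans R D (Term Y (Suc p)) (K q) ==>
   (!!x a. x : Obj D ==> a : el (Term Y (Suc (Suc p))) x ==> g x (Bd Y (Suc p) x a) = \<zero>[val (K q) x]) ==>
   \<exists>g'\<in>nat_trans R D (Term Y p) (K q). g = pointwise D (Term Y (Suc p)) (%x a. g' x (Bd Y p x a))"
begin

lemma Y': "resolves R D (const_mod R) Y"
 by (rule projective_resolves[OF const_mod_module[OF R] Y])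

lemmas YM = Term_module[OF Y'] and Yn = Bd_nat[OF Y']

abbreviation "Zc q x \<equiv> {u : el (K q) x. \<delta> q x u = \<zero>[val (K (Suc q)) x]}"
abbreviation "Bc q x \<equiv> (case q of 0 => {\<zero>[val (K 0) x]} | Suc m => \<delta> m x ` el (K m) x)"

lemma \<kappa>_hom: "x : Obj D ==> \<kappa> q x : mod_hom R (val (K q) x <| Zc q x) (val (H q) x)"
 using quotD(3)[OF \<kappa>] .

lemma Zc_submodule: "x : Obj D ==> submodule (Zc q x) R (val (K q) x)"
proof -
 assume x: "x : Obj D"
 interpret K0: module R "val (K q) x" by (rule val_module[OF K x])
 interpret K1: module R "val (K (Suc q)) x" by (rule val_module[OF K x])
 show ?thesis
  by (rule submoduleI'[OF K0.module_axioms])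
   (auto simp: nat_zero[OF \<delta> x K K] nat_add[OF \<delta> x] nat_smult[OF \<delta> x])
qed

lemma Bc_Zc: "x : Obj D ==> u : Bc q x ==> u : Zc q x"
 using submodule_zero[OF Zc_submodule, of x 0] by (cases q) (auto simp: \<delta>_\<delta> nat_closed[OF \<delta>])

lemma \<kappa>_zero_iff: "x : Obj D ==> u : Zc q x ==> \<kappa> q x u = \<zero>[val (H q) x] \<longleftrightarrow> u : Bc q x"
 using quotD(5)[OF \<kappa>] by simp

abbreviation "KZ q \<equiv> sub_cmod (K q) (Zc q)"

lemma KZ: "right_module R D (KZ q)"
 by (rule sub_cmod_module[OF K Zc_submodule])
  (auto simp: act_closed[OF K] nat_act[OF \<delta>] hom_zero[OF val_module[OF K] val_module[OF K] act_hom[OF K]])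

lemma KZ_nat:
 "right_module R D A ==> \<eta> : nat_trans R D A (KZ q) \<longleftrightarrow>
  \<eta> : nat_trans R D A (K q) \<and> (\<forall>x\<in>Obj D. \<forall>a\<in>el A x. \<eta> x a : Zc q x)"
 by (rule nat_trans_sub_cmod) auto

lemma \<kappa>_nat: "pointwise D (KZ q) (\<kappa> q) : nat_trans R D (KZ q) (H q)"
 by (rule nat_transI[OF KZ]) (simp_all add: sub_cmod_def \<kappa>_hom \<kappa>_act)

text \<open>The cocycles \<open>KZ q\<close> map onto \<open>H q\<close>, and the terms of
  \<open>Y\<close> are projective.\<close>

lemma lift_\<kappa>:
 assumes g: "g : nat_trans R D (Term Y n) (H q)"
 obtains k where "k : nat_trans R D (Term Y n) (K q)"
  "!!x a. x : Obj D ==> a : el (Term Y n) x ==> k x a : Zc q x"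
  "!!x a. x : Obj D ==> a : el (Term Y n) x ==> \<kappa> q x (k x a) = g x a"
proof -
 have v: "el (KZ q) x = Zc q x" for x by (simp add: sub_cmod_def)
 have "g x a : pointwise D (KZ q) (\<kappa> q) x ` el (KZ q) x"
  if "x : Obj D" "a : el (Term Y n) x" for x a
 proof -
  from quotient_map_surj[OF \<kappa>[OF that(1)] nat_closed[OF g that]]
  obtain u where "u : Zc q x" "g x a = \<kappa> q x u" by auto
  thus ?thesis using that by (intro image_eqI[of _ _ u]) (simp_all add: v)
 qed
 then obtain k where k: "k : nat_trans R D (Term Y n) (KZ q)"
  "!!x a. x : Obj D ==> a : el (Term Y n) x ==> pointwise D (KZ q) (\<kappa> q) x (k x a) = g x a"
  using projective_lifts[OF R D resolution_projective[OF Y] KZ H \<kappa>_nat g] by blast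
 have k': "k : nat_trans R D (Term Y n) (K q)" "!!x a. x : Obj D ==> a : el (Term Y n) x ==> k x a : Zc q x"
  using k(1) unfolding KZ_nat[OF YM] by blast+
 show thesis
 proof (rule that[OF k'])
  show "\<kappa> q x (k x a) = g x a" if "x : Obj D" "a : el (Term Y n) x" for x a
   using k(2)[OF that] k'(2)[OF that] that(1) by (simp add: v)
 qed
qed

abbreviation "ok p q \<equiv> 0 \<le> (p::int) \<and> 0 \<le> (q::int)"

definition zero_hom :: "int => int => 'o => 'y => 'k" where
 "zero_hom p q = \<zero>[hom_mod R D (Term Y (nat p)) (K (nat q))]"

text \<open>\<open>nat\<close> sends negative indices to 0, so outside the first quadrant the module
  has to be cut down to zero explicitly.\<close>

definition A :: "int => int => ('r, 'o => 'y => 'k) module" where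
 "A p q = (hom_mod R D (Term Y (nat p)) (K (nat q)))
   <| (if ok p q then nat_trans R D (Term Y (nat p)) (K (nat q)) else {zero_hom p q})"

definition dh :: "int => int => ('o => 'y => 'k) => 'o => 'y => 'k" where
 "dh p q a = (if ok p q then pointwise D (Term Y (Suc (nat p))) (%x y. a x (Bd Y (nat p) x y)) else zero_hom (p + 1) q)"

text \<open>The sign depends on the column \<open>p\<close>; it makes the two differentials
  anticommute instead of commute.\<close>

definition dv :: "int => int => ('o => 'y => 'k) => 'o => 'y => 'k" where
 "dv p q a = (if ok p q then pointwise D (Term Y (nat p))
  (%x y. sgn p (val (K (Suc (nat q))) x) (\<delta> (nat q) x (a x y))) else zero_hom p (q + 1))"

lemma A_simps:
 "carrier (A p q) = (if ok p q then nat_trans R D (Term Y (nat p)) (K (nat q)) else {zero_hom p q})"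
 "\<zero>[A p q] = zero_hom p q"
 "a +[A p q] b = pointwise D (Term Y (nat p)) (%x y. a x y +[val (K (nat q)) x] b x y)"
 "r *[A p q] a = pointwise D (Term Y (nat p)) (%x y. r *[val (K (nat q)) x] a x y)"
 by (simp_all add: A_def zero_hom_def hom_simps)

lemma zero_hom_apply: "x : Obj D ==> y : el (Term Y (nat p)) x ==> zero_hom p q x y = \<zero>[val (K (nat q)) x]"
 by (simp add: zero_hom_def hom_simps)

lemma zero_hom_nat: "zero_hom p q : nat_trans R D (Term Y (nat p)) (K (nat q))"
 by (simp add: zero_hom_def hom_simps nat_trans_zero[OF YM K])

lemma Hm: "module R (hom_mod R D (Term Y n) (K q))"
 by (rule hom_mod_module[OF R YM K])

lemma A_submodule: "submodule (carrier (A p q)) R (hom_mod R D (Term Y (nat p)) (K (nat q)))"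
proof -
 interpret M: module R "hom_mod R D (Term Y (nat p)) (K (nat q))" by (rule Hm)
 show ?thesis
 proof (cases "ok p q")
  case True
  thus ?thesis using M.carrier_is_submodule by (simp add: A_simps hom_simps(1))
 next
  case False
  hence "carrier (A p q) = {\<zero>[hom_mod R D (Term Y (nat p)) (K (nat q))]}"
   by (simp only: A_simps(1) if_False zero_hom_def)
  thus ?thesis using zero_submodule[OF Hm] by simp
 qed
qed

lemma A_module: "module R (A p q)"
 using submodule_module[OF Hm A_submodule] by (simp add: A_def)

lemma A_nat: "a : carrier (A p q) ==> a : nat_trans R D (Term Y (nat p)) (K (nat q))"
 using zero_hom_nat by (auto simp: A_simps split: if_splits)

lemma nat_Suc: "0 \<le> p ==> nat (p + 1) = Suc (nat p)"
 by (simp add: nat_add_distrib)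

lemma dh_nat: "ok p q ==> a : nat_trans R D (Term Y (nat p)) (K (nat q)) ==>
 dh p q a : nat_trans R D (Term Y (Suc (nat p))) (K (nat q))"
 by (simp add: dh_def nat_comp[OF YM Yn])

lemma \<delta>_comp_nat: "a : nat_trans R D (Term Y n) (K q) ==>
 pointwise D (Term Y n) (%x y. sgn p (val (K (Suc q)) x) (\<delta> q x (a x y))) : nat_trans R D (Term Y n) (K (Suc q))"
proof -
 assume a: "a : nat_trans R D (Term Y n) (K q)"
 note n = nat_trans_sgn[OF YM K nat_comp[OF YM a \<delta>], of p]
 have "pointwise D (Term Y n) (%x y. sgn p (val (K (Suc q)) x) (pointwise D (Term Y n) (%x y. \<delta> q x (a x y)) x y)) =
  pointwise D (Term Y n) (%x y. sgn p (val (K (Suc q)) x) (\<delta> q x (a x y)))"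
  by (auto simp: pointwise_def fun_eq_iff)
 thus ?thesis using n by simp
qed

lemma dv_nat: "ok p q ==> a : nat_trans R D (Term Y (nat p)) (K (nat q)) ==>
 dv p q a : nat_trans R D (Term Y (nat p)) (K (Suc (nat q)))"
 by (simp add: dv_def \<delta>_comp_nat)

lemma dh_apply: "ok p q ==> x : Obj D ==> y : el (Term Y (Suc (nat p))) x ==>
 dh p q a x y = a x (Bd Y (nat p) x y)"
 by (simp add: dh_def)

lemma dv_apply: "ok p q ==> x : Obj D ==> y : el (Term Y (nat p)) x ==>
 dv p q a x y = sgn p (val (K (Suc (nat q))) x) (\<delta> (nat q) x (a x y))"
 by (simp add: dv_def)

lemma dh_hom: "dh p q : mod_hom R (A p q) (A (p + 1) q)"
proof (cases "ok p q")
 case True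
 hence ok': "ok (p + 1) q" by simp
 note S = nat_Suc[OF conjunct1[OF True]]
 have cl: "dh p q a : carrier (A (p + 1) q)" if "a : carrier (A p q)" for a
  using dh_nat[OF True A_nat[OF that]] ok' by (simp add: A_simps S)
 show ?thesis
 proof (rule mod_homI[OF cl])
  interpret M: module R "A p q" by (rule A_module)
  interpret M': module R "A (p + 1) q" by (rule A_module)
  show "dh p q (a +[A p q] b) = dh p q a +[A (p + 1) q] dh p q b" if ab: "a : carrier (A p q)" "b : carrier (A p q)" for a b
   by (rule nat_eqI[OF A_nat[OF cl[OF M.M.a_closed[OF ab]]] A_nat[OF M'.M.a_closed[OF cl[OF ab(1)] cl[OF ab(2)]]]])
    (simp add: S dh_apply True A_simps(3) Bd_closed[OF Y'])
  show "dh p q (r *[A p q] a) = r *[A (p + 1) q] dh p q a" if ra: "r : carrier R" "a : carrier (A p q)" for r a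
   by (rule nat_eqI[OF A_nat[OF cl[OF M.smult_closed[OF ra]]] A_nat[OF M'.smult_closed[OF ra(1) cl[OF ra(2)]]]])
    (simp add: S dh_apply True A_simps(4) Bd_closed[OF Y'])
 qed
next
 case False
 hence "dh p q = (%a. \<zero>[A (p + 1) q])" by (auto simp: dh_def A_simps(2))
 thus ?thesis using module_zero_hom[OF A_module A_module] by simp
qed

lemma dv_hom: "dv p q : mod_hom R (A p q) (A p (q + 1))"
proof (cases "ok p q")
 case True
 hence ok': "ok p (q + 1)" by simp
 note S = nat_Suc[OF conjunct2[OF True]]
 have cl: "dv p q a : carrier (A p (q + 1))" if "a : carrier (A p q)" for a
  using dv_nat[OF True A_nat[OF that]] ok' by (simp add: A_simps S)
 note sg = sgn_add[OF val_module[OF K]] sgn_smult[OF val_module[OF K]]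
 show ?thesis
 proof (rule mod_homI[OF cl])
  interpret M: module R "A p q" by (rule A_module)
  interpret M': module R "A p (q + 1)" by (rule A_module)
  show "dv p q (a +[A p q] b) = dv p q a +[A p (q + 1)] dv p q b" if ab: "a : carrier (A p q)" "b : carrier (A p q)" for a b
   by (rule nat_eqI[OF A_nat[OF cl[OF M.M.a_closed[OF ab]]] A_nat[OF M'.M.a_closed[OF cl[OF ab(1)] cl[OF ab(2)]]]])
    (simp add: S dv_apply True A_simps(3) nat_closed[OF A_nat[OF ab(1)]] nat_closed[OF A_nat[OF ab(2)]]
     nat_add[OF \<delta>] nat_closed[OF \<delta>] sg)
  show "dv p q (r *[A p q] a) = r *[A p (q + 1)] dv p q a" if ra: "r : carrier R" "a : carrier (A p q)" for r a
   by (rule nat_eqI[OF A_nat[OF cl[OF M.smult_closed[OF ra]]] A_nat[OF M'.smult_closed[OF ra(1) cl[OF ra(2)]]]])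
    (simp add: S dv_apply True A_simps(4) nat_closed[OF A_nat[OF ra(2)]] ra(1)
     nat_smult[OF \<delta>] nat_closed[OF \<delta>] sg)
 qed
next
 case False
 hence "dv p q = (%a. \<zero>[A p (q + 1)])" by (auto simp: dv_def A_simps(2))
 thus ?thesis using module_zero_hom[OF A_module A_module] by simp
qed

sublocale DC: double_complex R A dh dv
proof (rule double_complex.intro)
 show "module R (A p q)" "dh p q : mod_hom R (A p q) (A (p + 1) q)" "dv p q : mod_hom R (A p q) (A p (q + 1))" for p q
  by (rule A_module dh_hom dv_hom)+
 note dh0 = hom_zero[OF A_module A_module dh_hom] and dv0 = hom_zero[OF A_module A_module dv_hom]
 have neg: "dh p q a = \<zero>[A (p + 1) q]" "dv p q a = \<zero>[A p (q + 1)]" if "\<not> ok p q" for p q a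
  using that by (simp_all only: dh_def dv_def A_simps(2) if_False)
 fix p q a assume a: "a : carrier (A p q)"
 note n = A_nat[OF a]
 show "dh (p + 1) q (dh p q a) = \<zero>[A (p + 1 + 1) q]"
 proof (cases "ok p q")
  case True
  have ok1: "ok (p + 1) q" using True by simp
  have S: "nat (p + 1 + 1) = Suc (Suc (nat p))" "nat (p + 1) = Suc (nat p)" using True nat_Suc[of p] nat_Suc[of "p + 1"] by simp_all
  have n2: "dh (p + 1) q (dh p q a) : nat_trans R D (Term Y (Suc (Suc (nat p)))) (K (nat q))"
   using dh_nat[OF ok1, of "dh p q a"] dh_nat[OF True n] by (simp add: S)
  show ?thesis unfolding A_simps(2)
  proof (rule nat_eqI[OF n2])
   show "zero_hom (p + 1 + 1) q : nat_trans R D (Term Y (Suc (Suc (nat p)))) (K (nat q))"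
    using zero_hom_nat[of "p + 1 + 1" q] unfolding S .
   fix x y assume xy: "x : Obj D" "y : el (Term Y (Suc (Suc (nat p)))) x"
   have "dh (p + 1) q (dh p q a) x y = a x (Bd Y (nat p) x (Bd Y (Suc (nat p)) x y))"
    using dh_apply[OF ok1 xy(1)] dh_apply[OF True xy(1)] Bd_closed[OF Y' xy] xy(2) by (simp add: S)
   also have "\<dots> = \<zero>[val (K (nat q)) x]" using Bd_Bd[OF Y' xy] nat_zero[OF n xy(1) YM K] by simp
   finally show "dh (p + 1) q (dh p q a) x y = zero_hom (p + 1 + 1) q x y"
    using zero_hom_apply[of x y "p + 1 + 1" q] xy unfolding S by simp
  qed
 next
  case False
  show ?thesis by (simp only: neg(1)[OF False] dh0)
 qed
 show "dv p (q + 1) (dv p q a) = \<zero>[A p (q + 1 + 1)]"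
 proof (cases "ok p q")
  case True
  have ok1: "ok p (q + 1)" using True by simp
  have S: "nat (q + 1 + 1) = Suc (Suc (nat q))" "nat (q + 1) = Suc (nat q)" using True nat_Suc[of q] nat_Suc[of "q + 1"] by simp_all
  have n2: "dv p (q + 1) (dv p q a) : nat_trans R D (Term Y (nat p)) (K (Suc (Suc (nat q))))"
   using dv_nat[OF ok1, of "dv p q a"] dv_nat[OF True n] by (simp add: S)
  show ?thesis unfolding A_simps(2)
  proof (rule nat_eqI[OF n2])
   show "zero_hom p (q + 1 + 1) : nat_trans R D (Term Y (nat p)) (K (Suc (Suc (nat q))))"
    using zero_hom_nat[of p "q + 1 + 1"] unfolding S .
   fix x y assume xy: "x : Obj D" "y : el (Term Y (nat p)) x"
   have c: "a x y : el (K (nat q)) x" using nat_closed[OF n xy] .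
   have "dv p (q + 1) (dv p q a) x y =
    sgn p (val (K (Suc (Suc (nat q)))) x) (sgn p (val (K (Suc (Suc (nat q)))) x) (\<delta> (Suc (nat q)) x (\<delta> (nat q) x (a x y))))"
    using dv_apply[OF ok1 xy] dv_apply[OF True xy]
     hom_sgn[OF val_module[OF K xy(1)] val_module[OF K xy(1)] nat_hom[OF \<delta> xy(1)] nat_closed[OF \<delta> xy(1) c]] by (simp add: S)
   also have "\<dots> = \<zero>[val (K (Suc (Suc (nat q)))) x]"
    using \<delta>_\<delta>[OF xy(1) c] sgn_zero[OF val_module[OF K xy(1)]] by simp
   finally show "dv p (q + 1) (dv p q a) x y = zero_hom p (q + 1 + 1) x y"
    using zero_hom_apply[of x y p "q + 1 + 1"] xy unfolding S by simp
  qed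
 next
  case False
  show ?thesis by (simp only: neg(2)[OF False] dv0)
 qed
 show "dh p (q + 1) (dv p q a) +[A (p + 1) (q + 1)] dv (p + 1) q (dh p q a) = \<zero>[A (p + 1) (q + 1)]"
 proof (cases "ok p q")
  case True
  have ok1: "ok p (q + 1)" "ok (p + 1) q" using True by simp_all
  note S = nat_Suc[OF conjunct1[OF True]] nat_Suc[OF conjunct2[OF True]]
  have c1: "dh p (q + 1) (dv p q a) : carrier (A (p + 1) (q + 1))" "dv (p + 1) q (dh p q a) : carrier (A (p + 1) (q + 1))"
   using hom_closed[OF dh_hom hom_closed[OF dv_hom a]] hom_closed[OF dv_hom hom_closed[OF dh_hom a]] .
  interpret M: module R "A (p + 1) (q + 1)" by (rule A_module)
  show ?thesis
  proof (rule nat_eqI[OF A_nat[OF M.M.a_closed[OF c1]] A_nat[OF M.M.zero_closed]])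
   fix x y assume xy: "x : Obj D" "y : el (Term Y (nat (p + 1))) x"
   have y: "y : el (Term Y (Suc (nat p))) x" using xy by (simp add: S)
   note b = Bd_closed[OF Y' xy(1) y]
   have c: "\<delta> (nat q) x (a x (Bd Y (nat p) x y)) : el (K (Suc (nat q))) x"
    using nat_closed[OF \<delta> xy(1) nat_closed[OF n xy(1) b]] .
   have "dh p (q + 1) (dv p q a) x y = sgn p (val (K (Suc (nat q))) x) (\<delta> (nat q) x (a x (Bd Y (nat p) x y)))"
    using dh_apply[OF ok1(1) xy(1) y] dv_apply[OF True xy(1) b] by simp
   moreover have "dv (p + 1) q (dh p q a) x y = sgn (p + 1) (val (K (Suc (nat q))) x) (\<delta> (nat q) x (a x (Bd Y (nat p) x y)))"
    using dv_apply[OF ok1(2) xy] dh_apply[OF True xy(1) y] by simp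
   ultimately show "(dh p (q + 1) (dv p q a) +[A (p + 1) (q + 1)] dv (p + 1) q (dh p q a)) x y = \<zero>[A (p + 1) (q + 1)] x y"
    using sgn_cancel[OF val_module[OF K xy(1)] c] zero_hom_apply[OF xy] xy by (simp add: A_simps(2,3) S)
  qed
 next
  case False
  interpret M: module R "A (p + 1) (q + 1)" by (rule A_module)
  show ?thesis by (simp only: neg[OF False] dh0 dv0 M.M.l_zero M.M.zero_closed)
 qed
next
 show "carrier (A p q) = {\<zero>[A p q]}" if "p < 0 \<or> q < 0" for p q
  using that by (auto simp: A_simps)
qed

lemma dv_zero_iff:
 assumes "ok p q" "a : carrier (A p q)"
 shows "dv p q a = \<zero>[A p (q + 1)] \<longleftrightarrow> (\<forall>x\<in>Obj D. \<forall>y\<in>el (Term Y (nat p)) x. a x y : Zc (nat q) x)"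
proof -
 have S: "nat (q + 1) = Suc (nat q)" using assms(1) by (simp add: nat_Suc)
 note n = A_nat[OF assms(2)]
 have "sgn p (val (K (Suc (nat q))) x) u = \<zero>[val (K (Suc (nat q))) x] \<longleftrightarrow> u = \<zero>[val (K (Suc (nat q))) x]"
  if "x : Obj D" "u : el (K (Suc (nat q))) x" for x u
  using sgn_sgn[OF val_module[OF K that(1)] that(2), of p] sgn_zero[OF val_module[OF K that(1)], of p "Suc (nat q)"] by metis
 hence iff: "dv p q a x y = \<zero>[A p (q + 1)] x y \<longleftrightarrow> a x y : Zc (nat q) x"
  if "x : Obj D" "y : el (Term Y (nat p)) x" for x y
  using dv_apply[OF assms(1) that] zero_hom_apply[OF that, of "q + 1"] nat_closed[OF n that] nat_closed[OF \<delta> that(1)] that(1)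
  by (simp add: A_simps(2) S)
 have "dv p q a = \<zero>[A p (q + 1)]" if "\<forall>x\<in>Obj D. \<forall>y\<in>el (Term Y (nat p)) x. a x y : Zc (nat q) x"
  by (rule nat_eqI[OF A_nat[OF hom_closed[OF dv_hom assms(2)]] A_nat[OF zero_mem[OF A_module]]])
   (use that iff in blast)
 thus ?thesis using iff by auto
qed

text \<open>Values that are coboundaries at every point come from one cochain, because the terms of
  \<open>Y\<close> are projective. For \<open>q = 0\<close> the map \<open>r\<close> is zero and the
  witness is the zero of the module at \<open>q = -1\<close>.\<close>

lemma lift_Bc:
 assumes "ok p q" and r: "r : nat_trans R D (Term Y (nat p)) (K (nat q))"
  and B: "!!x y. x : Obj D ==> y : el (Term Y (nat p)) x ==> r x y : Bc (nat q) x"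
 obtains e where "e : carrier (A p (q - 1))" "dv p (q - 1) e = r"
proof (cases "nat q")
 case 0
 hence q: "q = 0" using assms(1) by simp
 have "dv p (q - 1) (zero_hom p (q - 1)) = r"
 proof -
  have "zero_hom p q = r"
   by (rule nat_eqI[OF zero_hom_nat r]) (insert B q, simp add: zero_hom_apply)
  thus ?thesis using q by (simp add: dv_def)
 qed
 thus thesis using that[of "zero_hom p (q - 1)"] q by (simp add: A_simps)
next
 case (Suc m)
 hence m: "nat (q - 1) = m" "ok p (q - 1)" using assms(1) by simp_all
 let ?h = "pointwise D (Term Y (nat p)) (%x y. sgn p (val (K (Suc m)) x) (r x y))"
 have h: "?h : nat_trans R D (Term Y (nat p)) (K (Suc m))" using nat_trans_sgn[OF YM K r] Suc by simp
 have "?h x y : \<delta> m x ` el (K m) x" if "x : Obj D" "y : el (Term Y (nat p)) x" for x y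
 proof -
  from B[OF that] obtain u where u: "u : el (K m) x" "r x y = \<delta> m x u" using Suc by auto
  have "?h x y = \<delta> m x (sgn p (val (K m) x) u)"
   using u hom_sgn[OF val_module[OF K that(1)] val_module[OF K that(1)] nat_hom[OF \<delta> that(1)] u(1)] that by simp
  thus ?thesis using sgn_closed[OF val_module[OF K that(1)] u(1)] by simp
 qed
 then obtain e where e: "e : nat_trans R D (Term Y (nat p)) (K m)"
  "!!x y. x : Obj D ==> y : el (Term Y (nat p)) x ==> \<delta> m x (e x y) = ?h x y"
  using projective_lifts[OF R D resolution_projective[OF Y] K K \<delta> h] by blast
 have eA: "e : carrier (A p (q - 1))" using e(1) m by (simp add: A_simps)
 have "dv p (q - 1) e = r"
 proof (rule nat_eqI[OF dv_nat[OF m(2)] r])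
  show "e : nat_trans R D (Term Y (nat p)) (K (nat (q - 1)))" using e(1) m by simp
  fix x y assume xy: "x : Obj D" "y : el (Term Y (nat p)) x"
  have "r x y : el (K (Suc m)) x" using nat_closed[OF r xy] Suc by simp
  thus "dv p (q - 1) e x y = r x y"
   using dv_apply[OF m(2) xy, of e] e(2)[OF xy] sgn_sgn[OF val_module[OF K xy(1)]] xy by (simp add: m)
 qed
 thus thesis using that eA by blast
qed

lemma dv_Bc:
 assumes "ok p q" "e : carrier (A p (q - 1))" "x : Obj D" "y : el (Term Y (nat p)) x"
 shows "dv p (q - 1) e x y : Bc (nat q) x"
proof (cases "nat q")
 case 0
 hence "q = 0" using assms(1) by simp
 thus ?thesis using zero_hom_apply[OF assms(3,4), of 0] by (simp add: dv_def)
next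
 case (Suc m)
 hence m: "nat (q - 1) = m" "ok p (q - 1)" using assms(1) by simp_all
 have c: "e x y : el (K m) x" using nat_closed[OF A_nat[OF assms(2)] assms(3,4)] m by simp
 have "dv p (q - 1) e x y = \<delta> m x (sgn p (val (K m) x) (e x y))"
  using dv_apply[OF m(2) assms(3,4), of e] m hom_sgn[OF val_module[OF K assms(3)] val_module[OF K assms(3)] nat_hom[OF \<delta> assms(3)] c]
  by simp
 thus ?thesis using Suc sgn_closed[OF val_module[OF K assms(3)] c] by simp
qed

text \<open>Reduction of a cocycle-valued cochain to its classes in \<open>H\<close>; it has nothing
  to do with the locale of the same name.\<close>

definition bar :: "nat => nat => ('o => 'y => 'k) => 'o => 'y => 'h" where
 "bar p q a = pointwise D (Term Y p) (%x y. \<kappa> q x (a x y))"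

lemma bar_nat:
 assumes a: "a : nat_trans R D (Term Y p) (K q)"
  and Z: "!!x y. x : Obj D ==> y : el (Term Y p) x ==> a x y : Zc q x"
 shows "bar p q a : nat_trans R D (Term Y p) (H q)"
proof -
 have "a : nat_trans R D (Term Y p) (KZ q)" unfolding KZ_nat[OF YM] using a Z by blast
 hence "pointwise D (Term Y p) (%x y. pointwise D (KZ q) (\<kappa> q) x (a x y)) : nat_trans R D (Term Y p) (H q)"
  using nat_comp[OF YM _ \<kappa>_nat] by blast
 moreover have "pointwise D (Term Y p) (%x y. pointwise D (KZ q) (\<kappa> q) x (a x y)) = bar p q a"
  unfolding bar_def pointwise_def using Z by (intro ext) (simp add: sub_cmod_def)
 ultimately show ?thesis by simp
qed

lemma \<kappa>_add: "x : Obj D ==> u : Zc q x ==> v : Zc q x ==>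
 \<kappa> q x (u +[val (K q) x] v) = \<kappa> q x u +[val (H q) x] \<kappa> q x v"
 using hom_add[OF \<kappa>_hom, of x u q v] by simp

lemma \<kappa>_smult: "x : Obj D ==> r : carrier R ==> u : Zc q x ==>
 \<kappa> q x (r *[val (K q) x] u) = r *[val (H q) x] \<kappa> q x u"
 using hom_smult[OF \<kappa>_hom, of x r u q] by simp

lemma \<kappa>_closed: "x : Obj D ==> u : Zc q x ==> \<kappa> q x u : el (H q) x"
 using hom_closed[OF \<kappa>_hom, of x u q] by simp

lemma Z2_submodule: "submodule (DC.Z2 p q) R (A p q)"
proof -
 interpret M: module R "A p q" by (rule A_module)
 interpret M1: module R "A p (q + 1)" by (rule A_module)
 interpret M2: module R "A (p + 1) q" by (rule A_module)
 interpret M3: module R "A (p + 1) (q - 1)" by (rule A_module)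
 have v: "dv (p + 1) (q - 1) : mod_hom R (A (p + 1) (q - 1)) (A (p + 1) q)" using dv_hom[of "p + 1" "q - 1"] by simp
 note v0 = hom_zero[OF M3.module_axioms M2.module_axioms v]
 show ?thesis
 proof (rule submoduleI'[OF A_module])
  show "\<zero>[A p q] : DC.Z2 p q"
   using hom_zero[OF A_module A_module dv_hom, of p q] hom_zero[OF A_module A_module dh_hom, of p q] v0
   by (auto simp: DC.Z2_def intro!: bexI[of _ "\<zero>[A (p + 1) (q - 1)]"])
  show "a +[A p q] b : DC.Z2 p q" if ab: "a : DC.Z2 p q" "b : DC.Z2 p q" for a b
  proof -
   from ab obtain u v' where *: "a : carrier (A p q)" "b : carrier (A p q)" "dv p q a = \<zero>[A p (q + 1)]" "dv p q b = \<zero>[A p (q + 1)]"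
    "u : carrier (A (p + 1) (q - 1))" "v' : carrier (A (p + 1) (q - 1))"
    "dh p q a +[A (p + 1) q] dv (p + 1) (q - 1) u = \<zero>[A (p + 1) q]"
    "dh p q b +[A (p + 1) q] dv (p + 1) (q - 1) v' = \<zero>[A (p + 1) q]" unfolding DC.Z2_def by blast
   have c: "dh p q a : carrier (A (p + 1) q)" "dh p q b : carrier (A (p + 1) q)"
    "dv (p + 1) (q - 1) u : carrier (A (p + 1) q)" "dv (p + 1) (q - 1) v' : carrier (A (p + 1) q)"
    using hom_closed[OF dh_hom] hom_closed[OF v] * by blast+
   have "(dh p q a +[A (p + 1) q] dh p q b) +[A (p + 1) q] (dv (p + 1) (q - 1) u +[A (p + 1) q] dv (p + 1) (q - 1) v') =
    (dh p q a +[A (p + 1) q] dv (p + 1) (q - 1) u) +[A (p + 1) q] (dh p q b +[A (p + 1) q] dv (p + 1) (q - 1) v')"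
    using c by algebra
   thus ?thesis
    unfolding DC.Z2_def using * hom_add[OF dv_hom *(1,2)] hom_add[OF dh_hom *(1,2)] hom_add[OF v *(5,6)]
    by (auto intro!: bexI[of _ "u +[A (p + 1) (q - 1)] v'"])
  qed
  show "r *[A p q] a : DC.Z2 p q" if ra: "r : carrier R" "a : DC.Z2 p q" for r a
  proof -
   from ra obtain u where *: "a : carrier (A p q)" "dv p q a = \<zero>[A p (q + 1)]" "u : carrier (A (p + 1) (q - 1))"
    "dh p q a +[A (p + 1) q] dv (p + 1) (q - 1) u = \<zero>[A (p + 1) q]" unfolding DC.Z2_def by blast
   have "r *[A (p + 1) q] dh p q a +[A (p + 1) q] r *[A (p + 1) q] dv (p + 1) (q - 1) u = \<zero>[A (p + 1) q]"
    using M2.smult_r_distr[OF ra(1) hom_closed[OF dh_hom *(1)] hom_closed[OF v *(3)]] *(4) ra(1) by simp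
   thus ?thesis
    unfolding DC.Z2_def using * ra(1) hom_smult[OF dv_hom ra(1) *(1)] hom_smult[OF dh_hom ra(1) *(1)] hom_smult[OF v ra(1) *(3)]
    by (auto intro!: bexI[of _ "r *[A (p + 1) (q - 1)] u"])
  qed
 qed (auto simp: DC.Z2_def)
qed

end

section \<open>The second page as cohomology with coefficients in \<open>H\<close>\<close>

context coefficient_complex
begin

lemma Ext_cochains: "cochain_setup R D (const_mod R) Y (H q)"
 by (rule cochain_setup.intro[OF R Y' H])

text \<open>The horizontal image of \<open>a\<close> is, up to sign, a vertical image, so its values
  are coboundaries of \<open>K\<close> and have zero class; this is what makes \<open>bar\<close> of
  \<open>a\<close> a cocycle.\<close>

lemma Z2D:
 assumes "ok p q" "a : DC.Z2 p q"
 shows "a : nat_trans R D (Term Y (nat p)) (K (nat q))"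
  and "!!x y. x : Obj D ==> y : el (Term Y (nat p)) x ==> a x y : Zc (nat q) x"
  and "!!x y. x : Obj D ==> y : el (Term Y (Suc (nat p))) x ==>
   \<kappa> (nat q) x (a x (Bd Y (nat p) x y)) = \<zero>[val (H (nat q)) x]"
proof -
 from assms(2) obtain b where *: "a : carrier (A p q)" "dv p q a = \<zero>[A p (q + 1)]" "b : carrier (A (p + 1) (q - 1))"
  "dh p q a +[A (p + 1) q] dv (p + 1) (q - 1) b = \<zero>[A (p + 1) q]" unfolding DC.Z2_def by blast
 show "a : nat_trans R D (Term Y (nat p)) (K (nat q))" by (rule A_nat[OF *(1)])
 show Z: "a x y : Zc (nat q) x" if "x : Obj D" "y : el (Term Y (nat p)) x" for x y
  using dv_zero_iff[OF assms(1) *(1)] *(2) that by blast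
 fix x y assume xy: "x : Obj D" "y : el (Term Y (Suc (nat p))) x"
 interpret Hx: module R "val (H (nat q)) x" by (rule val_module[OF H xy(1)])
 note S = nat_Suc[OF conjunct1[OF assms(1)]]
 have y: "y : el (Term Y (nat (p + 1))) x" using xy(2) S by simp
 have ok1: "ok (p + 1) q" using assms(1) by simp
 let ?u = "a x (Bd Y (nat p) x y)" let ?v = "dv (p + 1) (q - 1) b x y"
 have u: "?u : Zc (nat q) x" using Z[OF xy(1) Bd_closed[OF Y' xy]] .
 have vB: "?v : Bc (nat q) x" by (rule dv_Bc[OF ok1 *(3) xy(1) y])
 have v: "?v : Zc (nat q) x" by (rule Bc_Zc[OF xy(1) vB])
 have "(dh p q a +[A (p + 1) q] dv (p + 1) (q - 1) b) x y = zero_hom (p + 1) q x y" using *(4) by (simp add: A_simps(2))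
 hence uv: "?u +[val (K (nat q)) x] ?v = \<zero>[val (K (nat q)) x]"
  using dh_apply[OF assms(1) xy] zero_hom_apply[OF xy(1) y] xy(1) y by (simp add: A_simps(3))
 have "\<kappa> (nat q) x \<zero>[val (K (nat q)) x] = \<zero>[val (H (nat q)) x]"
  using hom_zero[OF submodule_module[OF val_module[OF K xy(1)] Zc_submodule[OF xy(1)]] Hx.module_axioms \<kappa>_hom[OF xy(1)]] by simp
 hence "\<kappa> (nat q) x ?u +[val (H (nat q)) x] \<kappa> (nat q) x ?v = \<zero>[val (H (nat q)) x]"
  using \<kappa>_add[OF xy(1) u v] uv by simp
 moreover have "\<kappa> (nat q) x ?v = \<zero>[val (H (nat q)) x]" using \<kappa>_zero_iff[OF xy(1) v] vB by simp
 ultimately show "\<kappa> (nat q) x ?u = \<zero>[val (H (nat q)) x]" using \<kappa>_closed[OF xy(1) u] by simp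
qed

lemma bar_apply: "x : Obj D ==> y : el (Term Y p) x ==> bar p q a x y = \<kappa> q x (a x y)"
 by (simp add: bar_def)

lemma bar_hom:
 assumes "ok p q"
 shows "bar (nat p) (nat q) : mod_hom R (A p q <| DC.Z2 p q) (cochains R D Y (H (nat q)) (nat p))"
proof -
 interpret E: cochain_setup R D "const_mod R" Y "H (nat q)" by (rule Ext_cochains)
 interpret M: module R "A p q" by (rule A_module)
 have cl: "bar (nat p) (nat q) a : cocycles R D Y (H (nat q)) (nat p)" if a: "a : DC.Z2 p q" for a
  using bar_nat[OF Z2D(1,2)[OF assms a]] Z2D(3)[OF assms a] by (simp add: cocycles_def bar_apply Bd_closed[OF Y'])
 show ?thesis
 proof (rule mod_homI)
  fix a assume "a : carrier (A p q <| DC.Z2 p q)"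
  hence a: "a : DC.Z2 p q" by simp
  show "bar (nat p) (nat q) a : carrier (cochains R D Y (H (nat q)) (nat p))" using cl[OF a] by simp
  show "bar (nat p) (nat q) (r *[A p q <| DC.Z2 p q] a) = r *[cochains R D Y (H (nat q)) (nat p)] bar (nat p) (nat q) a"
   if r: "r : carrier R" for r
  proof -
   have "bar (nat p) (nat q) (r *[A p q] a) = pointwise D (Term Y (nat p)) (%x y. r *[val (H (nat q)) x] bar (nat p) (nat q) a x y)"
    by (rule nat_eqI[OF E.cocycles_nat[OF cl[OF submodule_smult[OF Z2_submodule r a]]]
       nat_trans_smult[OF YM H E.cocycles_nat[OF cl[OF a]] r]])
     (insert Z2D(2)[OF assms a] r, simp add: bar_apply A_simps(4) \<kappa>_smult)
   thus ?thesis by (simp add: hom_simps)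
  qed
  fix b assume "b : carrier (A p q <| DC.Z2 p q)"
  hence b: "b : DC.Z2 p q" by simp
  have "bar (nat p) (nat q) (a +[A p q] b) =
    pointwise D (Term Y (nat p)) (%x y. bar (nat p) (nat q) a x y +[val (H (nat q)) x] bar (nat p) (nat q) b x y)"
   by (rule nat_eqI[OF E.cocycles_nat[OF cl[OF submodule_add[OF Z2_submodule a b]]]
      nat_trans_add[OF YM H E.cocycles_nat[OF cl[OF a]] E.cocycles_nat[OF cl[OF b]]]])
    (insert Z2D(2)[OF assms a] Z2D(2)[OF assms b], simp add: bar_apply A_simps(3) \<kappa>_add)
  thus "bar (nat p) (nat q) (a +[A p q <| DC.Z2 p q] b) =
    bar (nat p) (nat q) a +[cochains R D Y (H (nat q)) (nat p)] bar (nat p) (nat q) b"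
   by (simp add: hom_simps)
 qed
qed

text \<open>A cocycle \<open>g\<close> with values in \<open>H\<close> lifts to some
  \<open>k\<close> with values in the cocycles of \<open>K\<close>. The horizontal image of
  \<open>k\<close> has zero class, so its negative has values in coboundaries and is the vertical
  image of a cochain \<open>b\<close>, as membership in \<open>Z2\<close> demands.\<close>

lemma bar_surj:
 assumes "ok p q" and g: "g : cocycles R D Y (H (nat q)) (nat p)"
 obtains a where "a : DC.Z2 p q" "bar (nat p) (nat q) a = g"
proof -
 interpret E: cochain_setup R D "const_mod R" Y "H (nat q)" by (rule Ext_cochains)
 note gn = E.cocycles_nat[OF g] and S = nat_Suc[OF conjunct1[OF assms(1)]]
 have ok1: "ok (p + 1) q" using assms(1) by simp
 interpret M: module R "A (p + 1) q" by (rule A_module)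
 obtain k where k: "k : nat_trans R D (Term Y (nat p)) (K (nat q))"
  "!!x y. x : Obj D ==> y : el (Term Y (nat p)) x ==> k x y : Zc (nat q) x"
  "!!x y. x : Obj D ==> y : el (Term Y (nat p)) x ==> \<kappa> (nat q) x (k x y) = g x y"
  by (rule lift_\<kappa>[OF gn]) (rule that; simp)
 have kA: "k : carrier (A p q)" using k(1) assms(1) by (simp add: A_simps)
 let ?r = "\<ominus>\<^bsub>A (p + 1) q\<^esub> dh p q k"
 have dk: "dh p q k : carrier (A (p + 1) q)" by (rule hom_closed[OF dh_hom kA])
 have r: "?r : nat_trans R D (Term Y (nat (p + 1))) (K (nat q))" using A_nat[OF M.M.a_inv_closed[OF dk]] .
 have "?r x y : Bc (nat q) x" if xy: "x : Obj D" "y : el (Term Y (nat (p + 1))) x" for x y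
 proof -
  interpret Kx: module R "val (K (nat q)) x" by (rule val_module[OF K xy(1)])
  interpret Hx: module R "val (H (nat q)) x" by (rule val_module[OF H xy(1)])
  interpret Zx: module R "val (K (nat q)) x <| Zc (nat q) x" by (rule submodule_module[OF Kx.module_axioms Zc_submodule[OF xy(1)]])
  have y: "y : el (Term Y (Suc (nat p))) x" using xy(2) S by simp
  note b = Bd_closed[OF Y' xy(1) y]
  let ?u = "k x (Bd Y (nat p) x y)"
  have u: "?u : Zc (nat q) x" using k(2)[OF xy(1) b] .
  have "(?r +[A (p + 1) q] dh p q k) x y = zero_hom (p + 1) q x y" using M.M.l_neg[OF dk] by (simp add: A_simps(2))
  hence "?r x y +[val (K (nat q)) x] ?u = \<zero>[val (K (nat q)) x]"
   using dh_apply[OF assms(1) xy(1) y] zero_hom_apply[OF xy] xy by (simp add: A_simps(3))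
  moreover have rc: "?r x y : el (K (nat q)) x" using nat_closed[OF r xy] .
  ultimately have re: "?r x y = \<ominus>\<^bsub>val (K (nat q)) x\<^esub> ?u" using Kx.M.minus_equality u by (metis (no_types, lifting) mem_Collect_eq)
  have rZ: "?r x y : Zc (nat q) x" unfolding re by (rule submodule_neg[OF Kx.module_axioms Zc_submodule[OF xy(1)] u])
  have "\<kappa> (nat q) x ?u = \<zero>[val (H (nat q)) x]" using k(3)[OF xy(1) b] E.cocycles_Bd[OF g xy(1) y] by simp
  moreover have "\<kappa> (nat q) x (?r x y) +[val (H (nat q)) x] \<kappa> (nat q) x ?u = \<kappa> (nat q) x \<zero>[val (K (nat q)) x]"
   using \<kappa>_add[OF xy(1) rZ u] \<open>?r x y +[val (K (nat q)) x] ?u = \<zero>[val (K (nat q)) x]\<close> by simp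
  moreover have "\<kappa> (nat q) x \<zero>[val (K (nat q)) x] = \<zero>[val (H (nat q)) x]"
   using hom_zero[OF Zx.module_axioms Hx.module_axioms \<kappa>_hom[OF xy(1)]] by simp
  ultimately have "\<kappa> (nat q) x (?r x y) = \<zero>[val (H (nat q)) x]" using \<kappa>_closed[OF xy(1) rZ] by simp
  thus ?thesis using \<kappa>_zero_iff[OF xy(1) rZ] by simp
 qed
 then obtain b where b: "b : carrier (A (p + 1) (q - 1))" "dv (p + 1) (q - 1) b = ?r" by (rule lift_Bc[OF ok1 r])
 have "dv p q k = \<zero>[A p (q + 1)]" using dv_zero_iff[OF assms(1) kA] k(2) by blast
 moreover have "dh p q k +[A (p + 1) q] dv (p + 1) (q - 1) b = \<zero>[A (p + 1) q]" unfolding b(2) using M.M.r_neg[OF dk] .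
 ultimately have "k : DC.Z2 p q" using kA b(1) unfolding DC.Z2_def by blast
 moreover have "bar (nat p) (nat q) k = g"
  by (rule nat_eqI[OF bar_nat[OF k(1,2)] gn]) (simp_all add: bar_apply k(3))
 ultimately show thesis by (rule that)
qed

lemma bar_coboundary_iff:
 assumes "ok p q" and a: "a : DC.Z2 p q"
 shows "bar (nat p) (nat q) a : coboundaries R D Y (H (nat q)) (nat p) \<longleftrightarrow> a : DC.B2 p q"
proof
 interpret E: cochain_setup R D "const_mod R" Y "H (nat q)" by (rule Ext_cochains)
 interpret M: module R "A p q" by (rule A_module)
 have aA: "a : carrier (A p q)" using a by (simp add: DC.Z2_def)
 note aZ = Z2D(2)[OF assms]
 note mm = zero_mem[OF A_module]
 {
  assume b: "bar (nat p) (nat q) a : coboundaries R D Y (H (nat q)) (nat p)"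
  \<comment> \<open>For \<open>p = 0\<close> column -1 is zero, and so is \<open>c\<close>.
    Otherwise \<open>c\<close> is a cocycle-valued lift of the cochain that has
    \<open>bar (nat p) (nat q) a\<close> as its coboundary.\<close>
  have "\<exists>c\<in>carrier (A (p - 1) q). dv (p - 1) q c = \<zero>[A (p - 1) (q + 1)] \<and>
   (\<forall>x\<in>Obj D. \<forall>y\<in>el (Term Y (nat p)) x. dh (p - 1) q c x y : Zc (nat q) x \<and>
    \<kappa> (nat q) x (a x y) = \<kappa> (nat q) x (dh (p - 1) q c x y))"
  proof (cases "nat p")
   case 0
   hence p: "p = 0" using assms(1) by simp
   have dz: "dh (p - 1) q (zero_hom (p - 1) q) = zero_hom p q" "dv (p - 1) q (zero_hom (p - 1) q) = zero_hom (p - 1) (q + 1)"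
    using p by (simp_all add: dh_def dv_def)
   show ?thesis
   proof (intro bexI conjI ballI)
    show "zero_hom (p - 1) q : carrier (A (p - 1) q)" using mm by (simp add: A_simps(2))
    show "dv (p - 1) q (zero_hom (p - 1) q) = \<zero>[A (p - 1) (q + 1)]" by (simp add: dz A_simps(2))
    fix x y assume xy: "x : Obj D" "y : el (Term Y (nat p)) x"
    have z: "\<zero>[val (K (nat q)) x] : Zc (nat q) x" by (rule submodule_zero[OF Zc_submodule[OF xy(1)]])
    show "dh (p - 1) q (zero_hom (p - 1) q) x y : Zc (nat q) x" using z zero_hom_apply[OF xy, of q] by (simp add: dz)
    have "\<kappa> (nat q) x \<zero>[val (K (nat q)) x] = \<zero>[val (H (nat q)) x]"
     using hom_zero[OF submodule_module[OF val_module[OF K xy(1)] Zc_submodule[OF xy(1)]] val_module[OF H xy(1)] \<kappa>_hom[OF xy(1)]] by simp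
    moreover have "bar (nat p) (nat q) a = pointwise D (Term Y (nat p)) (%x y. \<zero>[val (H (nat q)) x])"
     using b 0 by (simp add: coboundaries_0)
    hence "bar (nat p) (nat q) a x y = \<zero>[val (H (nat q)) x]" using xy by simp
    ultimately show "\<kappa> (nat q) x (a x y) = \<kappa> (nat q) x (dh (p - 1) q (zero_hom (p - 1) q) x y)"
     using bar_apply[OF xy, of "nat q" a] zero_hom_apply[OF xy, of q] by (simp add: dz)
   qed
  next
   case (Suc m)
   hence m: "nat (p - 1) = m" "ok (p - 1) q" using assms(1) by simp_all
   obtain g where g: "g : nat_trans R D (Term Y m) (H (nat q))"
    "bar (nat p) (nat q) a = pointwise D (Term Y (Suc m)) (%x a. g x (Bd Y m x a))"
    using b Suc by (auto elim: coboundariesE)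
   obtain c where c: "c : nat_trans R D (Term Y m) (K (nat q))"
    "!!x y. x : Obj D ==> y : el (Term Y m) x ==> c x y : Zc (nat q) x"
    "!!x y. x : Obj D ==> y : el (Term Y m) x ==> \<kappa> (nat q) x (c x y) = g x y"
    by (rule lift_\<kappa>[OF g(1)]) (rule that; simp)
   have cA: "c : carrier (A (p - 1) q)" using c(1) m by (simp add: A_simps)
   show ?thesis
   proof (intro bexI[OF _ cA] conjI ballI)
    show "dv (p - 1) q c = \<zero>[A (p - 1) (q + 1)]" using dv_zero_iff[OF m(2) cA] c(2) m(1) by simp
    fix x y assume xy: "x : Obj D" "y : el (Term Y (nat p)) x"
    have y: "y : el (Term Y (Suc m)) x" using xy(2) Suc by simp
    have d: "dh (p - 1) q c x y = c x (Bd Y m x y)" using dh_apply[OF m(2) xy(1), of y c] y m(1) by simp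
    note bc = Bd_closed[OF Y' xy(1) y]
    show "dh (p - 1) q c x y : Zc (nat q) x" unfolding d using c(2)[OF xy(1) bc] .
    show "\<kappa> (nat q) x (a x y) = \<kappa> (nat q) x (dh (p - 1) q c x y)"
     using bar_apply[OF xy, of "nat q" a] g(2) c(3)[OF xy(1) bc] xy(1) y unfolding d by simp
   qed
  qed
  then obtain c where c: "c : carrier (A (p - 1) q)" "dv (p - 1) q c = \<zero>[A (p - 1) (q + 1)]"
   "!!x y. x : Obj D ==> y : el (Term Y (nat p)) x ==> dh (p - 1) q c x y : Zc (nat q) x"
   "!!x y. x : Obj D ==> y : el (Term Y (nat p)) x ==> \<kappa> (nat q) x (a x y) = \<kappa> (nat q) x (dh (p - 1) q c x y)"
   by blast
  let ?d = "dh (p - 1) q c" let ?r = "a -[A p q] ?d"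
  have dA: "?d : carrier (A p q)" using hom_closed[OF dh_hom c(1)] by simp
  have rA: "?r : carrier (A p q)" using aA dA by simp
  \<comment> \<open>\<open>a\<close> and \<open>?d\<close> have the same classes at every point, so
    their difference has values in coboundaries and is a vertical image by
    \<open>lift_Bc\<close>.\<close>
  have "?r x y : Bc (nat q) x" if xy: "x : Obj D" "y : el (Term Y (nat p)) x" for x y
  proof -
   have "?r = pointwise D (Term Y (nat p)) (%x y. a x y -[val (K (nat q)) x] ?d x y)"
    using minus_restrict_carrier[OF Hm A_submodule dA, of a] hom_mod_minus[OF R YM K A_nat[OF aA] A_nat[OF dA]]
    by (simp add: A_def)
   hence "?r x y = a x y -[val (K (nat q)) x] ?d x y" using xy by simp
   thus ?thesis
    using quotient_restrict_eq_iff[OF \<kappa>[OF xy(1)] val_module[OF K xy(1)] Zc_submodule[OF xy(1)] aZ[OF xy] c(3)[OF xy]] c(4)[OF xy]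
    by simp
  qed
  then obtain e where e: "e : carrier (A p (q - 1))" "dv p (q - 1) e = ?r" by (rule lift_Bc[OF assms(1) A_nat[OF rA]])
  have "a = ?d +[A p q] dv p (q - 1) e" unfolding e(2) using aA dA by algebra
  thus "a : DC.B2 p q" unfolding DC.B2_def using aA c(1,2) e(1) by blast
 }
 assume "a : DC.B2 p q"
 then obtain c e where ce: "c : carrier (A (p - 1) q)" "e : carrier (A p (q - 1))"
  "dv (p - 1) q c = \<zero>[A (p - 1) (q + 1)]" "a = dh (p - 1) q c +[A p q] dv p (q - 1) e" unfolding DC.B2_def by blast
 let ?d = "dh (p - 1) q c"
 note bn = bar_nat[OF Z2D(1)[OF assms] aZ]
 have key: "bar (nat p) (nat q) a x y = \<kappa> (nat q) x (?d x y)"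
  if xy: "x : Obj D" "y : el (Term Y (nat p)) x" and d: "?d x y : Zc (nat q) x" for x y
 proof -
  interpret Hx: module R "val (H (nat q)) x" by (rule val_module[OF H xy(1)])
  have vB: "dv p (q - 1) e x y : Bc (nat q) x" by (rule dv_Bc[OF assms(1) ce(2) xy])
  have v: "dv p (q - 1) e x y : Zc (nat q) x" by (rule Bc_Zc[OF xy(1) vB])
  have "a x y = ?d x y +[val (K (nat q)) x] dv p (q - 1) e x y"
   by (subst ce(4)) (simp add: A_simps(3) xy)
  thus ?thesis
   using \<kappa>_add[OF xy(1) d v] \<kappa>_zero_iff[OF xy(1) v] vB \<kappa>_closed[OF xy(1) d] bar_apply[OF xy, of "nat q" a] by simp
 qed
 show "bar (nat p) (nat q) a : coboundaries R D Y (H (nat q)) (nat p)"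
 proof (cases "nat p")
  case 0
  hence p: "p = 0" using assms(1) by simp
  have dz: "?d = zero_hom p q" using p by (simp add: dh_def)
  have "bar (nat p) (nat q) a = pointwise D (Term Y (nat p)) (%x y. \<zero>[val (H (nat q)) x])"
  proof (rule nat_eqI[OF bn nat_trans_zero[OF YM H]])
   fix x y assume xy: "x : Obj D" "y : el (Term Y (nat p)) x"
   have z: "\<zero>[val (K (nat q)) x] : Zc (nat q) x" by (rule submodule_zero[OF Zc_submodule[OF xy(1)]])
   have "\<kappa> (nat q) x \<zero>[val (K (nat q)) x] = \<zero>[val (H (nat q)) x]"
    using hom_zero[OF submodule_module[OF val_module[OF K xy(1)] Zc_submodule[OF xy(1)]] val_module[OF H xy(1)] \<kappa>_hom[OF xy(1)]] by simp
   thus "bar (nat p) (nat q) a x y = pointwise D (Term Y (nat p)) (%x y. \<zero>[val (H (nat q)) x]) x y"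
    using key[OF xy] z zero_hom_apply[OF xy, of q] xy by (simp add: dz)
  qed
  thus ?thesis using 0 by (simp add: coboundaries_0)
 next
  case (Suc m)
  hence m: "nat (p - 1) = m" "ok (p - 1) q" using assms(1) by simp_all
  have cZ: "c x y : Zc (nat q) x" if "x : Obj D" "y : el (Term Y m) x" for x y
   using dv_zero_iff[OF m(2) ce(1)] ce(3) m(1) that by simp
  have cn: "c : nat_trans R D (Term Y m) (K (nat q))" using A_nat[OF ce(1)] m(1) by simp
  have "bar (nat p) (nat q) a = pointwise D (Term Y (Suc m)) (%x y. bar m (nat q) c x (Bd Y m x y))"
  proof (rule nat_eqI[OF bn])
   show "pointwise D (Term Y (Suc m)) (%x y. bar m (nat q) c x (Bd Y m x y)) : nat_trans R D (Term Y (nat p)) (H (nat q))"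
    using nat_comp[OF YM Yn bar_nat[OF cn cZ]] Suc by simp
   fix x y assume xy: "x : Obj D" "y : el (Term Y (nat p)) x"
   have y: "y : el (Term Y (Suc m)) x" using xy(2) Suc by simp
   note bc = Bd_closed[OF Y' xy(1) y]
   have d: "?d x y = c x (Bd Y m x y)" using dh_apply[OF m(2) xy(1), of y c] y m(1) by simp
   show "bar (nat p) (nat q) a x y = pointwise D (Term Y (Suc m)) (%x y. bar m (nat q) c x (Bd Y m x y)) x y"
    using key[OF xy] cZ[OF xy(1) bc] bar_apply[OF xy(1) bc] xy(1) y unfolding d by simp
  qed
  thus ?thesis using coboundariesI[OF bar_nat[OF cn cZ]] Suc by simp
 qed
qed

context
 fixes EE :: "nat => nat => ('r, 'e) module" and \<xi>
 assumes EE: "!!q p. quotient_map R (cochains R D Y (H q) p) (coboundaries R D Y (H q) p) (\<xi> q p) (EE q p)"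
begin

text \<open>Outside the first quadrant some zero module of the right type is needed; the zero
  submodule of \<open>EE 0 0\<close> serves.\<close>

definition E2 :: "int => int => ('r, 'e) module" where
 "E2 p q = (if ok p q then EE (nat q) (nat p)
  else (EE 0 0) <| {\<zero>[EE 0 0]})"

lemma second_quotient_map:
 obtains k where "quotient_map R (A p q <| DC.Z2 p q) (DC.B2 p q) k (E2 p q)"
proof (cases "ok p q")
 case True
 have "quotient_map R (A p q <| DC.Z2 p q) (DC.B2 p q)
  (%a. \<xi> (nat q) (nat p) (bar (nat p) (nat q) a)) (EE (nat q) (nat p))"
 proof (rule quotient_map_precomp[OF EE submodule_module[OF A_module Z2_submodule] bar_hom[OF True]])
  show "\<exists>a\<in>carrier (A p q <| DC.Z2 p q). \<xi> (nat q) (nat p) (bar (nat p) (nat q) a) = \<xi> (nat q) (nat p) g"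
   if "g : carrier (cochains R D Y (H (nat q)) (nat p))" for g
  proof -
   have "g : cocycles R D Y (H (nat q)) (nat p)" using that by simp
   then obtain a where "a : DC.Z2 p q" "bar (nat p) (nat q) a = g" by (rule bar_surj[OF True])
   thus ?thesis by (intro bexI[of _ a]) simp_all
  qed
 qed (use bar_coboundary_iff[OF True] in simp)
 thus thesis using that True by (simp add: E2_def)
next
 case False
 let ?E = "EE 0 0"
 have mE: "module R ?E" using quotD(2)[OF EE] .
 have m: "module R (?E <| {\<zero>[?E]})" by (rule submodule_module[OF mE zero_submodule[OF mE]])
 interpret M: module R "A p q" by (rule A_module)
 have c: "carrier (A p q) = {\<zero>[A p q]}" using False by (intro DC.negative) auto
 hence Z: "DC.Z2 p q = {\<zero>[A p q]}" using submodule_zero[OF Z2_submodule] by (auto simp: DC.Z2_def)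
 have B: "\<zero>[A p q] : DC.B2 p q"
 proof -
  have h: "dh (p - 1) q : mod_hom R (A (p - 1) q) (A p q)" using dh_hom[of "p - 1" q] by simp
  have v: "dv p (q - 1) : mod_hom R (A p (q - 1)) (A p q)" using dv_hom[of p "q - 1"] by simp
  note z = hom_zero[OF A_module A_module h] hom_zero[OF A_module A_module v] hom_zero[OF A_module A_module dv_hom]
  show ?thesis unfolding DC.B2_def mem_Collect_eq
  proof (intro conjI bexI)
   show "\<zero>[A p q] = dh (p - 1) q \<zero>[A (p - 1) q] +[A p q] dv p (q - 1) \<zero>[A p (q - 1)]" by (simp add: z)
  qed (auto simp: z zero_mem[OF A_module])
 qed
 have "quotient_map R (A p q <| DC.Z2 p q) (DC.B2 p q) (%_. \<zero>[?E]) (?E <| {\<zero>[?E]})"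
  unfolding quotient_map_def
 proof (intro conjI ballI)
  show "module R (A p q <| DC.Z2 p q)" by (rule submodule_module[OF A_module Z2_submodule])
  thus "(%_. \<zero>[?E]) : mod_hom R (A p q <| DC.Z2 p q) (?E <| {\<zero>[?E]})"
   using module_zero_hom[OF _ m] by simp
 qed (use m Z B in auto)
 thus thesis using that False by (simp add: E2_def)
qed

end

text \<open>Degree zero cochains that vanish on the boundary are the maps from the constant functor.\<close>

definition invariants :: "nat => ('o => 'y => 'k) set" where
 "invariants q = {a : nat_trans R D (Term Y 0) (K q).
  \<forall>x\<in>Obj D. \<forall>y\<in>el (Term Y (Suc 0)) x. a x (Bd Y 0 x y) = \<zero>[val (K q) x]}"

definition invariant_cocycles :: "nat => ('o => 'y => 'k) set" where
 "invariant_cocycles q = {a : invariants q. \<forall>x\<in>Obj D. \<forall>y\<in>el (Term Y 0) x. a x y : Zc q x}"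

definition invariant_coboundaries :: "nat => ('o => 'y => 'k) set" where
 "invariant_coboundaries q = (case q of 0 => {\<zero>[hom_mod R D (Term Y 0) (K 0)]}
  | Suc m => (%b. pointwise D (Term Y 0) (%x y. \<delta> m x (b x y))) ` invariants m)"

lemma dh_zero_iff:
 assumes "0 \<le> q" "a : nat_trans R D (Term Y 0) (K (nat q))"
 shows "dh 0 q a = \<zero>[A 1 q] \<longleftrightarrow> a : invariants (nat q)"
proof
 have ok: "ok 0 q" using assms(1) by simp
 assume "dh 0 q a = \<zero>[A 1 q]"
 hence "dh 0 q a x y = zero_hom 1 q x y" for x y by (simp add: A_simps(2))
 thus "a : invariants (nat q)"
  using assms dh_apply[OF ok, of _ _ a] zero_hom_apply[of _ _ 1 q] by (simp add: invariants_def)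
next
 have ok: "ok 0 q" using assms(1) by simp
 assume a: "a : invariants (nat q)"
 show "dh 0 q a = \<zero>[A 1 q]" unfolding A_simps(2)
 proof (rule nat_eqI)
  show "dh 0 q a : nat_trans R D (Term Y (Suc 0)) (K (nat q))" using dh_nat[OF ok, of a] assms(2) by simp
  show "zero_hom 1 q : nat_trans R D (Term Y (Suc 0)) (K (nat q))" using zero_hom_nat[of 1 q] by simp
  show "dh 0 q a x y = zero_hom 1 q x y" if "x : Obj D" "y : el (Term Y (Suc 0)) x" for x y
   using a that dh_apply[OF ok, of x y a] zero_hom_apply[of x y 1 q] by (simp add: invariants_def)
 qed
qed

lemma Zedge_eq: "DC.Zedge (int n) = invariant_cocycles n"
proof -
 have ok: "ok 0 (int n)" by simp
 have c: "carrier (A 0 (int n)) = nat_trans R D (Term Y 0) (K n)" by (simp add: A_simps)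
 have "a : DC.Zedge (int n) \<longleftrightarrow> a : invariant_cocycles n" for a
  using dh_zero_iff[of "int n" a] dv_zero_iff[OF ok, of a] c
  by (auto simp: DC.Zedge_def invariant_cocycles_def invariants_def)
 thus ?thesis by blast
qed

lemma Bedge_eq: "DC.Bedge (int n) = invariant_coboundaries n"
proof (cases n)
 case 0
 have "carrier (A 0 (- 1)) = {zero_hom 0 (- 1)}" by (simp add: A_simps)
 moreover have "dh 0 (- 1) (zero_hom 0 (- 1)) = \<zero>[A 1 (- 1)]" by (simp add: dh_def A_simps(2))
 moreover have "dv 0 (- 1) (zero_hom 0 (- 1)) = zero_hom 0 0" by (simp add: dv_def)
 ultimately have "DC.Bedge 0 = {zero_hom 0 0}" unfolding DC.Bedge_def by auto
 thus ?thesis using 0 by (simp add: invariant_coboundaries_def zero_hom_def)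
next
 case (Suc m)
 have i: "int n - 1 = int m" using Suc by simp
 have c: "carrier (A 0 (int m)) = nat_trans R D (Term Y 0) (K m)" by (simp add: A_simps)
 have "dv 0 (int m) b = pointwise D (Term Y 0) (%x y. \<delta> m x (b x y))" for b
  by (simp add: dv_def sgn_def)
 moreover have "{b. b : carrier (A 0 (int m)) \<and> dh 0 (int m) b = \<zero>[A 1 (int m)]} = invariants m"
  using dh_zero_iff[of "int m"] c by (auto simp: invariants_def)
 hence "b : carrier (A 0 (int m)) \<and> dh 0 (int m) b = \<zero>[A 1 (int m)] \<longleftrightarrow> b : invariants m" for b by blast
 ultimately show ?thesis unfolding DC.Bedge_def i Suc invariant_coboundaries_def by auto
qed

lemma rows_exact:
 assumes "1 \<le> p" "a : carrier (A p q)" "dh p q a = \<zero>[A (p + 1) q]"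
 shows "\<exists>c\<in>carrier (A (p - 1) q). a = dh (p - 1) q c"
proof (cases "0 \<le> q")
 case True
 define m where "m = nat (p - 1)"
 have p: "nat p = Suc m" "nat (p + 1) = Suc (Suc m)" using assms(1) by (simp_all add: m_def)
 have ok: "ok p q" "ok (p - 1) q" using assms(1) True by simp_all
 have an: "a : nat_trans R D (Term Y (Suc m)) (K (nat q))" using A_nat[OF assms(2)] p by simp
 have "a x (Bd Y (Suc m) x y) = \<zero>[val (K (nat q)) x]" if "x : Obj D" "y : el (Term Y (Suc (Suc m))) x" for x y
  using assms(3) dh_apply[OF ok(1) that(1), of y a] zero_hom_apply[OF that(1), of y "p + 1" q] that(2) p by (simp add: A_simps(2))
 then obtain g where g: "g : nat_trans R D (Term Y m) (K (nat q))" "a = pointwise D (Term Y (Suc m)) (%x a. g x (Bd Y m x a))"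
  using rows[OF an] by blast
 have "a = dh (p - 1) q g" using g(2) ok(2) by (simp add: dh_def m_def)
 moreover have "g : carrier (A (p - 1) q)" using g(1) ok(2) by (simp add: A_simps m_def)
 ultimately show ?thesis by blast
next
 case False
 hence "a = \<zero>[A p q]" using assms(2) DC.negative[of p q] by auto
 moreover have "dh (p - 1) q \<zero>[A (p - 1) q] = \<zero>[A p q]" using False by (simp add: dh_def A_simps(2))
 ultimately show ?thesis using zero_mem[OF A_module] by metis
qed

text \<open>Two identifications are left to the application: that of the cohomology of the column of
  invariants with \<open>HL\<close>, and a model \<open>EE\<close> for the second page, which need
  not be computed with the resolution \<open>Y\<close>.\<close>

theorem hypercohomology_spectral_sequence:
 assumes \<eta>: "!!n. quotient_map R (hom_mod R D (Term Y 0) (K n) <| invariant_cocycles n)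
  (invariant_coboundaries n) (\<eta> n) (HL n)"
  and EE: "!!q p. quotient_map R (cochains R D Y (H q) p) (coboundaries R D Y (H q) p) (\<xi> q p) (EE q p)"
 obtains E d where "first_quadrant_spectral_sequence R E d"
  "!!i j. E 2 (int i) (int j) = EE j i" "converges_to R E HL"
proof -
 have "\<exists>k. quotient_map R (A p q <| DC.Z2 p q) (DC.B2 p q) k (E2 EE p q)" for p q
  by (rule second_quotient_map[OF EE, of p q]) blast
 then obtain k where k: "!!p q. quotient_map R (A p q <| DC.Z2 p q) (DC.B2 p q) (k p q) (E2 EE p q)" by metis
 have e: "quotient_map R (A 0 (int n) <| DC.Zedge (int n)) (DC.Bedge (int n)) (\<eta> n) (HL n)" for n
  using \<eta>[of n] by (simp add: Zedge_eq Bedge_eq A_def)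
 have "\<exists>\<zeta>. quotient_map R (DC.Tot (int n) <| DC.FC.cocyc (int n)) (DC.D (int n - 1) ` carrier (DC.Tot (int n - 1))) \<zeta> (HL n)" for n
  by (rule DC.total_cohomology[OF rows_exact e[of n]]) blast+
 then obtain \<zeta> where \<zeta>: "!!n. quotient_map R (DC.Tot (int n) <| DC.FC.cocyc (int n))
  (DC.D (int n - 1) ` carrier (DC.Tot (int n - 1))) (\<zeta> n) (HL n)" by metis
 obtain E d where "first_quadrant_spectral_sequence R E d" "!!p q. E 2 p q = E2 EE p q" "converges_to R E HL"
  by (rule DC.FC.spectral_sequence_from_second_page[OF DC.second_page[OF k] \<zeta>]) blast
 thus thesis using that by (simp add: E2_def[OF EE])
qed

end

section \<open>Maps of bar resolutions\<close>

text \<open>The functors to be compared change only the labels of objects, so the chain map rewrites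
  the targets in each chain. Being explicit it is strictly functorial, unlike a comparison map that
  exists only up to homotopy.\<close>

lemma bar_comparison:
 fixes \<Phi> :: "'o => 'u" and C :: "('o, 'm) cat" and C' :: "('u, 'm) cat"
 assumes R: "cring R" and C: "category C" and C': "category C'" and F: "is_functor C C' \<Phi> (%_ _ f. f)"
 defines "lm \<equiv> map (map_prod \<Phi> (%f::'m. f))"
 shows "!!x n. x : Obj C ==> push R lm : mod_hom R (free_module R (paths C n x)) (free_module R (paths C' n (\<Phi> x)))"
  and "comparison_map R C (bar.resolution R C) (bar.resolution R C') \<Phi> (%_ _ f. f)
   (%n. pointwise C (Term (bar.resolution R C) n) (%_. push R lm))"
proof -
 interpret B: bar R C by (rule bar.intro[OF R C])
 interpret B': bar R C' by (rule bar.intro[OF R C'])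
 note FO = functor_Obj[OF F] and FH = functor_Hom[OF F]
 have p: "path C' (\<Phi> x) (lm l)" if "x : Obj C" "path C x l" for x l
  using that by (induction l arbitrary: x) (auto simp: lm_def FO FH)
 hence pn: "lm l : paths C' n (\<Phi> x)" if "x : Obj C" "l : paths C n x" for x l n
  using that by (auto simp: paths_def lm_def)
 show hom: "push R lm : mod_hom R (B.Ch n x) (B'.Ch n (\<Phi> x))" if "x : Obj C" for x n
  by (rule push_hom[OF R]) (rule pn[OF that])
 have pre: "precomp C' (\<Phi> x) (\<Phi> y) f (lm l) = lm (precomp C x y f l)"
  if "x : Obj C" "y : Obj C" "f : Hom C x y" "path C y l" for x y f l
  using that by (cases l) (auto simp: lm_def functor_Comp[OF F])
 have face: "B'.face (\<Phi> x) (lm l) = push R lm (B.face x l)" if "x : Obj C" "l : paths C (Suc n) x" for x l n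
  using that
 proof (induction l arbitrary: x n)
  case Nil
  thus ?case by (simp add: paths_def)
 next
  case (Cons q l)
  obtain y f where q: "q = (y, f)" by (cases q)
  hence y: "y : Obj C" "f : Hom C x y" "l : paths C n y" "path C y l" using Cons.prems by (auto simp: paths_def)
  have 1: "single R (precomp C x y f l) : carrier (B.Ch n x)"
   by (rule single_closed[OF R B.precomp_paths[OF Cons.prems(1) y(1-3)]])
  have e: "push R lm (push R ((#) (y, f)) (B.face y l)) = push R ((#) (\<Phi> y, f)) (B'.face (\<Phi> y) (lm l)) \<and>
   push R ((#) (y, f)) (B.face y l) : carrier (B.Ch n x)"
  proof (cases n)
   case 0
   hence "l = []" using y by (simp add: paths_def)
   thus ?thesis using zero_mem[OF B.Ch_module[of n x]]
    by (simp add: lm_def free_simps(2) B.push_zero B'.push_zero)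
  next
   case (Suc m)
   have fc: "B.face y l : carrier (B.Ch m y)" using B.face_closed[OF y(1)] y(3) Suc by simp
   have "push R lm (push R ((#) (y, f)) (B.face y l)) = push R (%l. lm ((y, f) # l)) (B.face y l)"
    by (rule B.push_push[OF fc])
   also have "\<dots> = push R (%l. (\<Phi> y, f) # lm l) (B.face y l)" by (rule B.push_cong[OF fc]) (simp add: lm_def)
   also have "\<dots> = push R ((#) (\<Phi> y, f)) (push R lm (B.face y l))" by (rule B.push_push[OF fc, symmetric])
   also have "push R lm (B.face y l) = B'.face (\<Phi> y) (lm l)" using Cons.IH[OF y(1)] y(3) Suc by simp
   finally show ?thesis using hom_closed[OF B.push_cons_hom[OF y(1,2)] fc] Suc by simp
  qed
  note h = hom[OF Cons.prems(1), of n]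
  have "push R lm (B.face x (q # l)) = push R lm (single R (precomp C x y f l) -[B.Ch n x] push R ((#) (y, f)) (B.face y l))"
   using B.Ch_minus[OF 1] e by (simp add: q)
  also have "\<dots> = push R lm (single R (precomp C x y f l)) -[B'.Ch n (\<Phi> x)] push R lm (push R ((#) (y, f)) (B.face y l))"
   using hom_minus[OF B.Ch_module B'.Ch_module h 1] e by simp
  also have "\<dots> = push R lm (single R (precomp C x y f l)) -[B'.FU] push R lm (push R ((#) (y, f)) (B.face y l))"
   by (rule B'.Ch_minus[OF hom_closed[OF h 1] hom_closed[OF h conjunct2[OF e]]])
  also have "\<dots> = B'.face (\<Phi> x) (lm (q # l))"
   using pre[OF Cons.prems(1) y(1,2,4)] e by (simp add: q push_single[OF R]) (simp add: lm_def)
  finally show ?case by simp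
 qed
 have boundary: "push R lm (B.boundary x s) = B'.boundary (\<Phi> x) (push R lm s)"
  if "x : Obj C" "s : carrier (B.Ch (Suc n) x)" for x s n
  by (rule free_hom_ext[OF R B'.Ch_module hom_comp[OF B.boundary_hom[OF that(1)] hom[OF that(1)]]
    hom_comp[OF hom[OF that(1)] B'.boundary_hom[OF FO[OF that(1)]]] _ that(2)])
   (simp add: push_single[OF R] B.boundary_single[OF that(1), of _ n] B'.boundary_single[OF FO[OF that(1)] pn[OF that(1)], of _ n] face[OF that(1), of _ n])
 show "comparison_map R C B.resolution B'.resolution \<Phi> (%_ _ f. f) (%n. pointwise C (Term B.resolution n) (%_. push R lm))"
  unfolding comparison_map_def
 proof (intro conjI allI ballI)
  show "pointwise C (Term B.resolution n) (%_. push R lm) : nat_trans R C (Term B.resolution n) (restrict_mod \<Phi> (%_ _ f. f) (Term B'.resolution n))" for n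
   unfolding B.res_simps(1) B'.res_simps(1)
  proof (rule nat_transI[OF B.term_at_module])
   show "push R lm : mod_hom R (val (B.term_at n) x) (val (restrict_mod \<Phi> (%_ _ f. f) (B'.term_at n)) x)" if "x : Obj C" for x
    using hom[OF that] by (simp add: B.val_term_at B'.val_term_at)
   show "push R lm (act (B.term_at n) x y f s) = act (restrict_mod \<Phi> (%_ _ f. f) (B'.term_at n)) x y f (push R lm s)"
    if *: "x : Obj C" "y : Obj C" "f : Hom C x y" "s : el (B.term_at n) y" for x y f s
   proof -
    have s: "s : carrier (B.Ch (Suc n) y)" using * by (simp add: B.val_term_at)
    note hs = hom_closed[OF hom[OF *(2)] s]
    have "push R lm (push R (precomp C x y f) s) = push R (%l. lm (precomp C x y f l)) s" by (rule B.push_push[OF s])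
    also have "\<dots> = push R (%l. precomp C' (\<Phi> x) (\<Phi> y) f (lm l)) s"
     by (rule B.push_cong[OF s]) (insert pre[OF *(1-3)], simp add: paths_def)
    also have "\<dots> = push R (precomp C' (\<Phi> x) (\<Phi> y) f) (push R lm s)" by (rule B.push_push[OF s, symmetric])
    finally show ?thesis
     using B.act_term_at[OF *(1-3) s] B'.act_term_at[OF FO[OF *(1)] FO[OF *(2)] FH[OF *(1-3)] hs] by simp
   qed
  qed
  show "pointwise C (Term B.resolution n) (%_. push R lm) x (Bd B.resolution n x s) =
   Bd B'.resolution n (\<Phi> x) (pointwise C (Term B.resolution (Suc n)) (%_. push R lm) x s)"
   if "x : Obj C" "s : el (Term B.resolution (Suc n)) x" for n x s
  proof -
   have s: "s : carrier (B.Ch (Suc (Suc n)) x)" using that by (simp add: B.res_simps(1) B.val_term_at)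
   show ?thesis
    using boundary[OF that(1) s] hom_closed[OF B.boundary_hom[OF that(1)] s]
     B'.res_simps(2)[OF FO[OF that(1)] hom_closed[OF hom[OF that(1)] s]] that(1) s
    by (simp add: B.res_simps B.val_term_at)
  qed
  show "Aug B'.resolution (\<Phi> x) (pointwise C (Term B.resolution 0) (%_. push R lm) x s) = Aug B.resolution x s"
   if "x : Obj C" "s : el (Term B.resolution 0) x" for x s
  proof -
   have s: "s : carrier (B.Ch (Suc 0) x)" using that by (simp add: B.res_simps(1) B.val_term_at)
   note b = hom_closed[OF B.boundary_hom[OF that(1)] s]
   have ev: "(%t. t []) : mod_hom R (free_module R I) (regular_mod R)" for I :: "('u \<times> 'm) list set"
    by (rule mod_homI) (simp_all add: free_simps regular_mod_def)
   have ev0: "(%t. t []) : mod_hom R (free_module R I) (regular_mod R)" for I :: "('o \<times> 'm) list set"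
    by (rule mod_homI) (simp_all add: free_simps regular_mod_def)
   have m: "module R (regular_mod R)" using val_module[OF const_mod_module[OF R] that(1)] by (simp add: const_mod_def)
   have "push R lm t [] = t []" if "t : carrier (B.Ch 0 x)" for t
    by (rule free_hom_ext[OF R m hom_comp[OF hom[OF \<open>x : Obj C\<close>] ev] ev0 _ that])
     (simp add: B.paths_0 push_single[OF R] lm_def, simp add: single_def)
   thus ?thesis
    using boundary[OF that(1) s] b B'.res_simps(3)[OF FO[OF that(1)] hom_closed[OF hom[OF that(1)] s]] that(1) s
    by (simp add: B.res_simps B.val_term_at) metis
  qed
 qed
qed

section \<open>Comma categories\<close>

fun target :: "'o => ('o \<times> 'm) list => 'o" where
 "target x [] = x"
| "target x ((y, f) # l) = target y l"

text \<open>The two categories share their objects, as a linking system and the orbit category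
  do.\<close>

locale functor_over =
 fixes R :: "'r ring" and L :: "('o, 'm) cat" and D :: "('o, 'd) cat" and \<rho> :: "'o => 'o => 'm => 'd"
  and M :: "('o, 'm, 'r, 'x) cmod"
 assumes R: "cring R" and L: "category L" and D: "category D" and Obj_D: "Obj D = Obj L"
  and \<rho>: "is_functor L D (%x. x) \<rho>" and M: "right_module R L M"
begin

text \<open>The morphisms are those of \<open>L\<close>, not tagged with their endpoints. This is
  possible because composition is indexed by objects, and it keeps the functors between comma
  categories the identity on morphisms.\<close>

definition comma :: "'o => ('o \<times> 'd, 'm) cat" where
 "comma d = \<lparr>Obj = {(x, \<delta>). x : Obj L \<and> \<delta> : Hom D x d},
  Hom = (%x y. {f : Hom L (fst x) (fst y). Comp D (fst x) (fst y) d (snd y) (\<rho> (fst x) (fst y) f) = snd x}),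
  Comp = (%x y z. Comp L (fst x) (fst y) (fst z)), Ident = (%x. Ident L (fst x))\<rparr>"

lemma \<rho>_Hom: "x : Obj L ==> y : Obj L ==> f : Hom L x y ==> \<rho> x y f : Hom D x y"
 using functor_Hom[OF \<rho>] .

lemma \<rho>_Comp: "x : Obj L ==> y : Obj L ==> z : Obj L ==> f : Hom L x y ==> g : Hom L y z ==>
 \<rho> x z (Comp L x y z g f) = Comp D x y z (\<rho> y z g) (\<rho> x y f)"
 using functor_Comp[OF \<rho>] .

lemma \<rho>_Ident: "x : Obj L ==> \<rho> x x (Ident L x) = Ident D x"
 using functor_Ident[OF \<rho>] .

lemmas D_Comp = Comp_Hom[OF D, unfolded Obj_D] and D_assoc = Comp_assoc[OF D, unfolded Obj_D]
 and D_left = Comp_Ident_left[OF D, unfolded Obj_D] and D_right = Comp_Ident_right[OF D, unfolded Obj_D]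
 and D_Ident = Ident_Hom[OF D, unfolded Obj_D]

lemma comma_simps:
 "(x, \<delta>) : Obj (comma d) \<longleftrightarrow> x : Obj L \<and> \<delta> : Hom D x d"
 "f : Hom (comma d) (x, \<delta>) (y, \<gamma>) \<longleftrightarrow> f : Hom L x y \<and> Comp D x y d \<gamma> (\<rho> x y f) = \<delta>"
 "Comp (comma d) (x, \<delta>) (y, \<gamma>) (z, \<zeta>) = Comp L x y z"
 "Ident (comma d) (x, \<delta>) = Ident L x"
 by (auto simp: comma_def)

lemma comma_category: "d : Obj L ==> category (comma d)"
proof -
 assume d: "d : Obj L"
 show ?thesis unfolding category_def
 proof (intro conjI ballI)
  fix x assume "x : Obj (comma d)"
  thus "Ident (comma d) x : Hom (comma d) x x"
   using d by (cases x) (simp add: comma_simps Ident_Hom[OF L] \<rho>_Ident D_right)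
 next
  fix x y z f g assume "x : Obj (comma d)" "y : Obj (comma d)" "z : Obj (comma d)" "f : Hom (comma d) x y" "g : Hom (comma d) y z"
  thus "Comp (comma d) x y z g f : Hom (comma d) x z"
   using d by (cases x; cases y; cases z) (auto simp: comma_simps Comp_Hom[OF L] \<rho>_Comp D_assoc \<rho>_Hom)
 next
  fix x y f assume "x : Obj (comma d)" "y : Obj (comma d)" "f : Hom (comma d) x y"
  thus "Comp (comma d) x x y f (Ident (comma d) x) = f" "Comp (comma d) x y y (Ident (comma d) y) f = f"
   by (cases x; cases y; simp add: comma_simps Comp_Ident_right[OF L] Comp_Ident_left[OF L])+
 next
  fix w x y z f g h assume "w : Obj (comma d)" "x : Obj (comma d)" "y : Obj (comma d)" "z : Obj (comma d)"
   "f : Hom (comma d) w x" "g : Hom (comma d) x y" "h : Hom (comma d) y z"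
  thus "Comp (comma d) w y z h (Comp (comma d) w x y g f) = Comp (comma d) w x z (Comp (comma d) x y z h g) f"
   by (cases w; cases x; cases y; cases z) (simp add: comma_simps Comp_assoc[OF L])
 qed
qed

definition over :: "'o => 'o => 'd => 'o \<times> 'd => 'o \<times> 'd" where
 "over P Q \<Phi> x = (fst x, Comp D (fst x) P Q \<Phi> (snd x))"

lemma over_functor:
 assumes "P : Obj L" "Q : Obj L" "\<Phi> : Hom D P Q"
 shows "is_functor (comma P) (comma Q) (over P Q \<Phi>) (%_ _ f. f)"
 using assms by (auto simp: is_functor_def over_def comma_simps D_Comp D_assoc \<rho>_Hom)

lemma fst_functor: "is_functor (comma d) L fst (%_ _ f. f)"
 by (auto simp: is_functor_def comma_simps)

abbreviation "JM \<equiv> restrict_mod fst (%_ _ f. f) M"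

lemma JM_module: "right_module R (comma d) JM"
 by (rule restrict_module[OF fst_functor M])

lemma JM_over: "restrict_mod (over P Q \<Phi>) (%_ _ f. f) JM = JM"
 by (simp add: restrict_mod_def over_def)

abbreviation "BC d \<equiv> bar.resolution R (comma d)"
abbreviation "shift P Q \<Phi> \<equiv> map (map_prod (over P Q \<Phi>) (%f::'m. f))"

lemma bar_comma: "d : Obj L ==> bar R (comma d)"
 by (rule bar.intro[OF R comma_category])

lemma BC_projective: "d : Obj L ==> projective_resolution R (comma d) (const_mod R) (BC d)"
 by (rule bar.projective_resolution[OF bar_comma])

lemma BC_resolves: "d : Obj L ==> resolves R (comma d) (const_mod R) (BC d)"
 by (rule projective_resolves[OF const_mod_module[OF R] BC_projective])

lemma BC_val: "d : Obj L ==> val (Term (BC d) n) x = free_module R (paths (comma d) (Suc n) x)"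
 by (simp add: bar.res_simps(1)[OF bar_comma] bar.val_term_at[OF bar_comma])

text \<open>Cochains of the comma category with coefficients in \<open>M\<close>, from its bar
  resolution. The explicit chain map \<open>shift\<close> makes the action of \<open>D\<close>
  functorial on the nose, so that \<open>K q\<close> is a module and not merely its
  cohomology.\<close>

definition K :: "nat => ('o, 'd, 'r, 'o \<times> 'd => ((('o \<times> 'd) \<times> 'm) list => 'r) => 'x) cmod" where
 "K q = \<lparr>val = (%P. hom_mod R (comma P) (Term (BC P) q) JM),
  act = (%P Q \<Phi> t. pointwise (comma P) (Term (BC P) q) (%x s. t (over P Q \<Phi> x) (push R (shift P Q \<Phi>) s)))\<rparr>"

lemma K_simps:
 "val (K q) P = hom_mod R (comma P) (Term (BC P) q) JM"
 "act (K q) P Q \<Phi> t = pointwise (comma P) (Term (BC P) q) (%x s. t (over P Q \<Phi> x) (push R (shift P Q \<Phi>) s))"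
 by (simp_all add: K_def)

lemma shift_comparison:
 assumes "P : Obj L" "Q : Obj L" "\<Phi> : Hom D P Q"
 shows "comparison_map R (comma P) (BC P) (BC Q) (over P Q \<Phi>) (%_ _ f. f)
  (%n. pointwise (comma P) (Term (BC P) n) (%_. push R (shift P Q \<Phi>)))"
 by (rule bar_comparison(2)[OF R comma_category[OF assms(1)] comma_category[OF assms(2)] over_functor[OF assms]])

lemma shift_closed:
 assumes "P : Obj L" "Q : Obj L" "\<Phi> : Hom D P Q" "x : Obj (comma P)" "s : el (Term (BC P) n) x"
 shows "push R (shift P Q \<Phi>) s : el (Term (BC Q) n) (over P Q \<Phi> x)"
 using compare_closed[OF shift_comparison[OF assms(1-3)] assms(4,5)] assms(4,5) by simp

lemma over_Obj: "P : Obj L ==> Q : Obj L ==> \<Phi> : Hom D P Q ==> x : Obj (comma P) ==> over P Q \<Phi> x : Obj (comma Q)"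
 using functor_Obj[OF over_functor] .

lemma K_act_apply:
 assumes "x : Obj (comma P)" "s : el (Term (BC P) q) x"
 shows "act (K q) P Q \<Phi> t x s = t (over P Q \<Phi> x) (push R (shift P Q \<Phi>) s)"
 using assms by (simp add: K_simps)

lemma BC_module: "d : Obj L ==> right_module R (comma d) (Term (BC d) n)"
 using Term_module[OF BC_resolves] .

lemma K_nat: "t : el (K q) P \<longleftrightarrow> t : nat_trans R (comma P) (Term (BC P) q) JM"
 by (simp add: K_simps hom_simps)

lemma K_val_module: "P : Obj L ==> module R (val (K q) P)"
 unfolding K_simps by (rule hom_mod_module[OF R BC_module JM_module])

lemma K_act_nat:
 assumes "P : Obj L" "Q : Obj L" "\<Phi> : Hom D P Q" "t : el (K q) Q"
 shows "act (K q) P Q \<Phi> t : el (K q) P"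
proof -
 note t = assms(4)[unfolded K_nat]
 interpret S: comparison_setup R "comma P" "comma Q" "over P Q \<Phi>" "%_ _ f. f" "BC P" "BC Q"
  by (rule comparison_setup.intro[OF R comma_category[OF assms(1)] over_functor[OF assms(1-3)] BC_projective[OF assms(1)] BC_resolves[OF assms(2)]])
 have id: "pointwise (comma P) JM (%x a. a) : nat_trans R (comma P) (restrict_mod (over P Q \<Phi>) (%_ _ f. f) JM) JM"
  unfolding JM_over by (rule nat_transI[OF JM_module mod_hom_id]) auto
 have "pointwise (comma P) (Term (BC P) q) (%x a. pointwise (comma P) JM (%x a. a) x (t (over P Q \<Phi> x)
   (pointwise (comma P) (Term (BC P) q) (%_. push R (shift P Q \<Phi>)) x a))) : nat_trans R (comma P) (Term (BC P) q) JM"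
  by (rule S.pull_nat[OF comparison_nat[OF shift_comparison[OF assms(1-3)]] BC_module[OF assms(1)] t id])
 moreover have "pointwise (comma P) (Term (BC P) q) (%x a. pointwise (comma P) JM (%x a. a) x (t (over P Q \<Phi> x)
   (pointwise (comma P) (Term (BC P) q) (%_. push R (shift P Q \<Phi>)) x a))) = act (K q) P Q \<Phi> t"
 proof -
  have "t (over P Q \<Phi> x) (push R (shift P Q \<Phi>) s) : el JM x"
   if "x : Obj (comma P)" "s : el (Term (BC P) q) x" for x s
   using nat_closed[OF t over_Obj[OF assms(1-3) that(1)] shift_closed[OF assms(1-3) that]] by (simp add: over_def)
  thus ?thesis unfolding K_simps pointwise_def by (intro ext) simp
 qed
 ultimately show ?thesis unfolding K_nat by simp
qed

text \<open>The laws for \<open>over\<close> hold only on objects of the comma category, so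
  rewriting under \<open>map\<close> needs the list to be a path.\<close>

lemma paths_over_cong:
 assumes "!!x. x : Obj (comma d) ==> \<Phi> x = \<Psi> x" "path (comma d) x l"
 shows "map (map_prod \<Phi> (%f. f)) l = map (map_prod \<Psi> (%f. f)) l"
 using assms(2)
proof (induction l arbitrary: x)
 case (Cons q l)
 obtain y f where q: "q = (y, f)" by (cases q)
 have "map (map_prod \<Phi> (%f. f)) l = map (map_prod \<Psi> (%f. f)) l" by (rule Cons.IH[of y]) (use Cons.prems q in simp)
 thus ?case using Cons.prems assms(1)[of y] q by simp
qed simp

lemma K_module: "right_module R D (K q)"
proof (rule right_moduleI, unfold Obj_D)
 show "module R (val (K q) P)" if "P : Obj L" for P by (rule K_val_module[OF that])
 show "act (K q) P Q \<Phi> : mod_hom R (val (K q) Q) (val (K q) P)" if *: "P : Obj L" "Q : Obj L" "\<Phi> : Hom D P Q" for P Q \<Phi>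
 proof (rule mod_homI[OF K_act_nat[OF *]])
  interpret KQ: module R "val (K q) Q" by (rule K_val_module[OF *(2)])
  interpret KP: module R "val (K q) P" by (rule K_val_module[OF *(1)])
  note cl = K_act_nat[OF *]
  have e: "fst (over P Q \<Phi> x) = fst x" for x by (simp add: over_def)
  show "act (K q) P Q \<Phi> (t +[val (K q) Q] u) = act (K q) P Q \<Phi> t +[val (K q) P] act (K q) P Q \<Phi> u"
   if "t : el (K q) Q" "u : el (K q) Q" for t u
  proof (rule nat_eqI)
   show "act (K q) P Q \<Phi> (t +[val (K q) Q] u) : nat_trans R (comma P) (Term (BC P) q) JM"
    "act (K q) P Q \<Phi> t +[val (K q) P] act (K q) P Q \<Phi> u : nat_trans R (comma P) (Term (BC P) q) JM"
    unfolding K_nat[symmetric] using that cl by simp_all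
   show "act (K q) P Q \<Phi> (t +[val (K q) Q] u) x s = (act (K q) P Q \<Phi> t +[val (K q) P] act (K q) P Q \<Phi> u) x s"
    if "x : Obj (comma P)" "s : el (Term (BC P) q) x" for x s
    using that over_Obj[OF * that(1)] shift_closed[OF * that] by (simp add: K_simps hom_simps e)
  qed
  show "act (K q) P Q \<Phi> (r *[val (K q) Q] t) = r *[val (K q) P] act (K q) P Q \<Phi> t"
   if "r : carrier R" "t : el (K q) Q" for r t
  proof (rule nat_eqI)
   show "act (K q) P Q \<Phi> (r *[val (K q) Q] t) : nat_trans R (comma P) (Term (BC P) q) JM"
    "r *[val (K q) P] act (K q) P Q \<Phi> t : nat_trans R (comma P) (Term (BC P) q) JM"
    unfolding K_nat[symmetric] using that cl by simp_all
   show "act (K q) P Q \<Phi> (r *[val (K q) Q] t) x s = (r *[val (K q) P] act (K q) P Q \<Phi> t) x s"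
    if "x : Obj (comma P)" "s : el (Term (BC P) q) x" for x s
    using that over_Obj[OF * that(1)] shift_closed[OF * that] by (simp add: K_simps hom_simps e)
  qed
 qed
 show "act (K q) P P (Ident D P) t = t" if *: "P : Obj L" "t : el (K q) P" for P t
 proof (rule nat_eqI[OF K_act_nat[OF *(1,1) D_Ident[OF *(1)] *(2), unfolded K_nat] *(2)[unfolded K_nat]])
  fix x s assume xs: "x : Obj (comma P)" "s : el (Term (BC P) q) x"
  have o: "over P P (Ident D P) y = y" if "y : Obj (comma P)" for y
   using that *(1) by (cases y) (simp add: over_def comma_simps D_left)
  have "push R (shift P P (Ident D P)) s = s"
  proof (rule bar.push_id[OF bar_comma[OF *(1)] xs(2)[unfolded BC_val[OF *(1)]]])
   fix l assume "l : paths (comma P) (Suc q) x"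
   thus "shift P P (Ident D P) l = l"
    using paths_over_cong[of P "over P P (Ident D P)" "%x. x" x l] o by (simp add: paths_def map_prod_def)
  qed
  thus "act (K q) P P (Ident D P) t x s = t x s" using K_act_apply[OF xs] o[OF xs(1)] by simp
 qed
 show "act (K q) P W (Comp D P Q W \<Psi> \<Phi>) t = act (K q) P Q \<Phi> (act (K q) Q W \<Psi> t)"
  if *: "P : Obj L" "Q : Obj L" "W : Obj L" "\<Phi> : Hom D P Q" "\<Psi> : Hom D Q W" "t : el (K q) W" for P Q W \<Phi> \<Psi> t
 proof (rule nat_eqI[OF K_act_nat[OF *(1,3) D_Comp[OF *(1-5)] *(6), unfolded K_nat] K_act_nat[OF *(1,2,4) K_act_nat[OF *(2,3,5,6)], unfolded K_nat]])
  fix x s assume xs: "x : Obj (comma P)" "s : el (Term (BC P) q) x"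
  have o: "over P W (Comp D P Q W \<Psi> \<Phi>) y = over Q W \<Psi> (over P Q \<Phi> y)" if "y : Obj (comma P)" for y
   using that * by (cases y) (simp add: over_def comma_simps D_assoc)
  note s = xs(2)[unfolded BC_val[OF *(1)]]
  have "push R (shift P W (Comp D P Q W \<Psi> \<Phi>)) s = push R (%l. shift Q W \<Psi> (shift P Q \<Phi> l)) s"
  proof (rule bar.push_cong[OF bar_comma[OF *(1)] s])
   fix l assume "l : paths (comma P) (Suc q) x"
   thus "shift P W (Comp D P Q W \<Psi> \<Phi>) l = shift Q W \<Psi> (shift P Q \<Phi> l)"
    using paths_over_cong[of P "over P W (Comp D P Q W \<Psi> \<Phi>)" "%y. over Q W \<Psi> (over P Q \<Phi> y)" x l] o
    by (simp add: paths_def o_def map_prod_def split_beta)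
  qed
  also have "\<dots> = push R (shift Q W \<Psi>) (push R (shift P Q \<Phi>) s)"
   by (rule bar.push_push[OF bar_comma[OF *(1)] s, symmetric])
  finally show "act (K q) P W (Comp D P Q W \<Psi> \<Phi>) t x s = act (K q) P Q \<Phi> (act (K q) Q W \<Psi> t) x s"
   using K_act_apply[OF xs] K_act_apply[OF over_Obj[OF *(1,2,4) xs(1)] shift_closed[OF *(1,2,4) xs]] o[OF xs(1)] by simp
 qed
qed

definition \<delta> :: "nat => 'o => ('o \<times> 'd => ((('o \<times> 'd) \<times> 'm) list => 'r) => 'x) => 'o \<times> 'd => ((('o \<times> 'd) \<times> 'm) list => 'r) => 'x" where
 "\<delta> q = pointwise D (K q) (%P t. pointwise (comma P) (Term (BC P) (Suc q)) (%x s. t x (Bd (BC P) q x s)))"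

lemma \<delta>_simp: "P : Obj L ==> t : el (K q) P ==>
 \<delta> q P t = pointwise (comma P) (Term (BC P) (Suc q)) (%x s. t x (Bd (BC P) q x s))"
 by (simp add: \<delta>_def Obj_D)

lemma cochain_comma: "d : Obj L ==> cochain_setup R (comma d) (const_mod R) (BC d) JM"
 by (rule cochain_setup.intro[OF R BC_resolves JM_module])

lemma \<delta>_nat: "\<delta> q : nat_trans R D (K q) (K (Suc q))"
 unfolding \<delta>_def
proof (rule nat_transI[OF K_module], unfold Obj_D)
 let ?d = "%P t. pointwise (comma P) (Term (BC P) (Suc q)) (%x s. t x (Bd (BC P) q x s))"
 have cl: "?d P t : el (K (Suc q)) P" if "P : Obj L" "t : el (K q) P" for P t
  using that nat_comp[OF BC_module[OF that(1)] Bd_nat[OF BC_resolves[OF that(1)]]] unfolding K_nat by blast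
 show "?d P : mod_hom R (val (K q) P) (val (K (Suc q)) P)" if P: "P : Obj L" for P
 proof (rule mod_homI[OF cl[OF P]])
  interpret KP: module R "val (K q) P" by (rule K_val_module[OF P])
  interpret KP': module R "val (K (Suc q)) P" by (rule K_val_module[OF P])
  note B = Bd_closed[OF BC_resolves[OF P]]
  show "?d P (t +[val (K q) P] u) = ?d P t +[val (K (Suc q)) P] ?d P u"
   if tu: "t : el (K q) P" "u : el (K q) P" for t u
   by (rule nat_eqI[OF cl[OF P KP.M.a_closed[OF tu], unfolded K_nat] KP'.M.a_closed[OF cl[OF P tu(1)] cl[OF P tu(2)], unfolded K_nat]])
    (simp add: K_simps hom_simps B)
  show "?d P (r *[val (K q) P] t) = r *[val (K (Suc q)) P] ?d P t"
   if rt: "r : carrier R" "t : el (K q) P" for r t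
   by (rule nat_eqI[OF cl[OF P KP.smult_closed[OF rt], unfolded K_nat] KP'.smult_closed[OF rt(1) cl[OF P rt(2)], unfolded K_nat]])
    (simp add: K_simps hom_simps B)
 qed
 show "?d P (act (K q) P Q \<Phi> t) = act (K (Suc q)) P Q \<Phi> (?d Q t)"
  if *: "P : Obj L" "Q : Obj L" "\<Phi> : Hom D P Q" "t : el (K q) Q" for P Q \<Phi> t
 proof (rule nat_eqI[OF cl[OF *(1) K_act_nat[OF *], unfolded K_nat] K_act_nat[OF *(1-3) cl[OF *(2,4)], unfolded K_nat]])
  fix x s assume xs: "x : Obj (comma P)" "s : el (Term (BC P) (Suc q)) x"
  note b = Bd_closed[OF BC_resolves[OF *(1)] xs]
  have "push R (shift P Q \<Phi>) (Bd (BC P) q x s) = Bd (BC Q) q (over P Q \<Phi> x) (push R (shift P Q \<Phi>) s)"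
   using comparison_Bd[OF shift_comparison[OF *(1-3)] xs] b xs by simp
  thus "?d P (act (K q) P Q \<Phi> t) x s = act (K (Suc q)) P Q \<Phi> (?d Q t) x s"
   using K_act_apply[OF xs, of Q \<Phi> "?d Q t"] K_act_apply[OF xs(1) b, of Q \<Phi> t] over_Obj[OF *(1-3) xs(1)] shift_closed[OF *(1-3) xs] xs
   by simp
 qed
qed

lemma \<delta>_zero_iff: "P : Obj L ==> t : el (K q) P ==>
 \<delta> q P t = \<zero>[val (K (Suc q)) P] \<longleftrightarrow> t : cocycles R (comma P) (BC P) JM q"
proof -
 assume P: "P : Obj L" and t: "t : el (K q) P"
 note z = nat_trans_zero[OF BC_module[OF P, of "Suc q"] JM_module]
 note dn = nat_closed[OF \<delta>_nat, unfolded Obj_D, OF P t, unfolded K_nat]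
 have ap: "\<delta> q P t x s = t x (Bd (BC P) q x s)" if "x : Obj (comma P)" "s : el (Term (BC P) (Suc q)) x" for x s
  using that by (simp add: \<delta>_simp[OF P t] pointwise_at)
 show ?thesis
 proof
  assume "\<delta> q P t = \<zero>[val (K (Suc q)) P]"
  hence "\<delta> q P t x s = \<zero>[val JM x]" if "x : Obj (comma P)" "s : el (Term (BC P) (Suc q)) x" for x s
   using that by (simp add: K_simps hom_simps)
  thus "t : cocycles R (comma P) (BC P) JM q" using t ap by (simp add: cocycles_def K_nat)
 next
  assume c: "t : cocycles R (comma P) (BC P) JM q"
  show "\<delta> q P t = \<zero>[val (K (Suc q)) P]"
   unfolding K_simps hom_simps
   by (rule nat_eqI[OF dn z]) (insert c ap, simp add: cocycles_def)
 qed
qed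

lemma \<delta>_\<delta>: "P : Obj L ==> t : el (K q) P ==> \<delta> (Suc q) P (\<delta> q P t) = \<zero>[val (K (Suc (Suc q))) P]"
 using \<delta>_zero_iff[OF _ nat_closed[OF \<delta>_nat, unfolded Obj_D]] cochain_setup.cobound[OF cochain_comma]
 by (simp add: \<delta>_simp K_nat)

lemma K_cocycles: "P : Obj L ==> {u : el (K q) P. \<delta> q P u = \<zero>[val (K (Suc q)) P]} = cocycles R (comma P) (BC P) JM q"
 using \<delta>_zero_iff[of P _ q] cochain_setup.cocycles_nat[OF cochain_comma, of P _ q] by (auto simp: K_nat)

lemma K_coboundaries: "P : Obj L ==> (case q of 0 => {\<zero>[val (K 0) P]} | Suc m => \<delta> m P ` el (K m) P) =
 coboundaries R (comma P) (BC P) JM q"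
proof (cases q)
 case (Suc m)
 assume P: "P : Obj L"
 have "\<delta> m P ` el (K m) P =
  (%f. pointwise (comma P) (Term (BC P) (Suc m)) (%x a. f x (Bd (BC P) m x a))) ` nat_trans R (comma P) (Term (BC P) m) JM"
  by (intro image_cong) (auto simp: K_nat \<delta>_simp[OF P])
 thus ?thesis using Suc by (simp add: coboundaries_def)
qed (simp add: coboundaries_def K_simps)

end

section \<open>Exactness of the rows\<close>

context functor_over
begin

text \<open>A chain over the comma category of \<open>d\<close> is a chain \<open>l\<close> in \<open>L\<close> with a morphism from its last object \<open>z\<close> to \<open>d\<close>;
 the universal one, where \<open>d = z\<close>, is \<open>pul l\<close>.\<close>

fun tot :: "'o => ('o \<times> 'm) list => 'd" where
 "tot x [] = Ident D x"
| "tot x ((y, f) # l) = Comp D x y (target y l) (tot y l) (\<rho> x y f)"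

fun pul :: "('o \<times> 'm) list => (('o \<times> 'd) \<times> 'm) list" where
 "pul [] = []"
| "pul ((y, f) # l) = ((y, tot y l), f) # pul l"

abbreviation fl :: "(('o \<times> 'd) \<times> 'm) list => ('o \<times> 'm) list" where
 "fl \<equiv> map (map_prod fst (%f. f))"

lemma fl_shift: "fl (shift P Q \<Phi> l) = fl l"
 by (induction l) (auto simp: over_def)

lemma target_shift: "target (over P Q \<Phi> x) (shift P Q \<Phi> l) = over P Q \<Phi> (target x l)"
 by (induction l arbitrary: x) auto

lemma target_Obj: "x : Obj C ==> path C x l ==> target x l : Obj C"
 by (induction l arbitrary: x) auto

lemma target_fl: "target (fst x) (fl l) = fst (target x l)"
 by (induction l arbitrary: x) auto

lemma path_fl: "path (comma d) x l ==> path L (fst x) (fl l)"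
 by (induction l arbitrary: x) (auto simp: comma_simps comma_def)

lemma tot_Hom: "x : Obj L ==> path L x l ==> tot x l : Hom D x (target x l)"
proof (induction l arbitrary: x)
 case (Cons p l)
 obtain y f where p: "p = (y, f)" by (cases p)
 have y: "y : Obj L" "f : Hom L x y" "path L y l" using Cons.prems p by simp_all
 thus ?case
  using Cons.IH[OF y(1,3)] D_Comp[OF Cons.prems(1) y(1) target_Obj[OF y(1,3)] \<rho>_Hom[OF Cons.prems(1) y(1,2)]] p by simp
qed (simp add: D_Ident)

lemma pul_path: "x : Obj L ==> path L x l ==> path (comma (target x l)) (x, tot x l) (pul l)"
proof (induction l arbitrary: x)
 case (Cons p l)
 obtain y f where p: "p = (y, f)" by (cases p)
 have y: "y : Obj L" "f : Hom L x y" "path L y l" using Cons.prems p by simp_all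
 thus ?case using Cons.IH[OF y(1,3)] tot_Hom[OF y(1,3)] p by (simp add: comma_simps)
qed simp

lemma fl_pul: "fl (pul l) = l"
 by (induction l) auto

lemma length_pul [simp]: "length (pul l) = length l"
 by (induction l) auto

text \<open>The morphism from any object of the chain to \<open>d\<close> is the one from the last
  object, \<open>\<gamma>\<close>, after the remaining arrows. So \<open>\<gamma>\<close> and the
  underlying chain determine everything, and the chain is the image under \<open>\<gamma>\<close> of
  the universal one.\<close>

lemma path_factor:
 assumes d: "d : Obj L"
 shows "x : Obj (comma d) ==> path (comma d) x l ==> target x l = (z, \<gamma>) ==>
  z : Obj L \<and> \<gamma> : Hom D z d \<and> Comp D (fst x) z d \<gamma> (tot (fst x) (fl l)) = snd x \<and> shift z d \<gamma> (pul (fl l)) = l"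
proof (induction l arbitrary: x)
 case Nil
 hence "x = (z, \<gamma>)" by simp
 thus ?case using Nil(1) d by (simp add: comma_simps D_right)
next
 case (Cons p l)
 obtain Y f where p: "p = (Y, f)" by (cases p)
 obtain y \<zeta> where Y: "Y = (y, \<zeta>)" by (cases Y)
 obtain w \<mu> where x: "x = (w, \<mu>)" by (cases x)
 have y: "Y : Obj (comma d)" "path (comma d) Y l" "target Y l = (z, \<gamma>)" using Cons.prems p by simp_all
 note IH = Cons.IH[OF y]
 have o: "w : Obj L" "y : Obj L" "f : Hom L w y" "Comp D w y d \<zeta> (\<rho> w y f) = \<mu>" "path L y (fl l)"
  using Cons.prems p Y x path_fl[OF y(2)] by (auto simp: comma_simps)
 have t: "target y (fl l) = z" using target_fl[of Y l] y(3) Y by simp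
 have "Comp D w z d \<gamma> (Comp D w y z (tot y (fl l)) (\<rho> w y f)) = Comp D w y d (Comp D y z d \<gamma> (tot y (fl l))) (\<rho> w y f)"
  using D_assoc[OF o(1,2) conjunct1[OF IH] d \<rho>_Hom[OF o(1-3)], of "tot y (fl l)" \<gamma>] tot_Hom[OF o(2,5)] t IH by simp
 thus ?case using IH o t by (simp add: p Y x over_def)
qed

text \<open>A free generator of the bar resolution at \<open>(x, \<mu>)\<close>. An element of
  \<open>K q\<close> amounts to an arbitrary choice of values on these, by \<open>K_ext\<close> and
  \<open>K_lift\<close>.\<close>

definition gen :: "'o => 'd => (('o \<times> 'd) \<times> 'm) list => (('o \<times> 'd) \<times> 'm) list => 'r" where
 "gen x \<mu> l = single R (((x, \<mu>), Ident L x) # l)"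

abbreviation "cpaths d q x \<mu> \<equiv> paths (comma d) q (x, \<mu>)"

lemma gen_closed:
 assumes "d : Obj L" "x : Obj L" "\<mu> : Hom D x d" "l : cpaths d q x \<mu>"
 shows "gen x \<mu> l : el (Term (BC d) q) (x, \<mu>)"
 unfolding gen_def BC_val[OF assms(1)]
 using assms Ident_Hom[OF comma_category[OF assms(1)], of "(x, \<mu>)"]
 by (intro single_closed[OF R] bar.cons_paths[OF bar_comma[OF assms(1)]]) (simp_all add: comma_simps)

lemma K_ext:
 assumes d: "d : Obj L" and t: "t : el (K q) d" "t' : el (K q) d"
  and e: "!!x \<mu> l. x : Obj L ==> \<mu> : Hom D x d ==> l : cpaths d q x \<mu> ==> t (x, \<mu>) (gen x \<mu> l) = t' (x, \<mu>) (gen x \<mu> l)"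
 shows "t = t'"
proof -
 interpret B: bar R "comma d" by (rule bar_comma[OF d])
 note n = t[unfolded K_nat B.res_simps(1)]
 show ?thesis
 proof (rule nat_eqI[OF n])
  fix x a assume xa: "x : Obj (comma d)" "a : el (B.term_at q) x"
  show "t x a = t' x a"
  proof (rule B.F.FM_ext[OF JM_module n[unfolded B.term_at_def] _ xa[unfolded B.term_at_def]])
   fix y l assume "y : Obj (comma d)" "l : paths (comma d) q y"
   thus "t y (single R (case (y, Ident (comma d) y, l) of (y, f, l) => (y, f) # l)) =
    t' y (single R (case (y, Ident (comma d) y, l) of (y, f, l) => (y, f) # l))"
    using e[of "fst y" "snd y" l] by (cases y) (simp add: comma_simps gen_def)
  qed
 qed
qed

lemma K_lift:
 assumes d: "d : Obj L"
  and c: "!!x \<mu> l. x : Obj L ==> \<mu> : Hom D x d ==> l : cpaths d q x \<mu> ==> c x \<mu> l : el M x"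
 shows "\<exists>t\<in>el (K q) d. \<forall>x \<mu> l. x : Obj L --> \<mu> : Hom D x d --> l : cpaths d q x \<mu> -->
  t (x, \<mu>) (gen x \<mu> l) = c x \<mu> l"
proof -
 interpret B: bar R "comma d" by (rule bar_comma[OF d])
 have "(case y of (x, \<mu>) => c x \<mu> l) : el JM y" if "y : Obj (comma d)" "l : paths (comma d) q y" for y l
  using that c by (cases y) (simp add: comma_simps)
 then obtain k where k: "k : nat_trans R (comma d) (B.term_at q) JM"
  "!!x y f l. x : Obj (comma d) ==> y : Obj (comma d) ==> f : Hom (comma d) x y ==> l : paths (comma d) q y ==>
   k x (single R ((y, f) # l)) = act JM x y f (case y of (x, \<mu>) => c x \<mu> l)"
  by (rule B.F.FM_lift[where c = "%y l. case y of (x, \<mu>) => c x \<mu> l", OF JM_module])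
   (assumption+, rule that, simp add: B.term_at_def, simp)
 show ?thesis
 proof (intro bexI[of _ k] allI impI)
  fix x \<mu> l assume *: "x : Obj L" "\<mu> : Hom D x d" "l : cpaths d q x \<mu>"
  hence o: "(x, \<mu>) : Obj (comma d)" by (simp add: comma_simps)
  show "k (x, \<mu>) (gen x \<mu> l) = c x \<mu> l"
   using k(2)[OF o o Ident_Hom[OF B.C o] *(3)] act_Ident[OF M *(1) c[OF *]]
   by (simp add: gen_def comma_simps)
 qed (simp add: K_nat k(1) B.res_simps(1))
qed

lemma shift_gen:
 "push R (shift P Q \<Phi>) (gen x \<mu> l) = gen x (Comp D x P Q \<Phi> \<mu>) (shift P Q \<Phi> l)"
 by (simp add: gen_def push_single[OF R] over_def)

lemma cpaths_path: "l : cpaths d q x \<mu> ==> path (comma d) (x, \<mu>) l"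
 by (simp add: paths_def)

lemma shift_cpaths:
 assumes "P : Obj L" "Q : Obj L" "\<Phi> : Hom D P Q" "l : cpaths P q x \<mu>" "x : Obj L" "\<mu> : Hom D x P"
 shows "shift P Q \<Phi> l : cpaths Q q x (Comp D x P Q \<Phi> \<mu>)"
proof -
 have "path (comma Q) (over P Q \<Phi> y) (shift P Q \<Phi> l)" if "path (comma P) y l" "y : Obj (comma P)" for y
  using that functor_Obj[OF over_functor[OF assms(1-3)]] functor_Hom[OF over_functor[OF assms(1-3)]]
  by (induction l arbitrary: y) auto
 from this[of "(x, \<mu>)"] show ?thesis using assms by (simp add: paths_def comma_simps over_def)
qed

lemma K_act_gen:
 assumes "P : Obj L" "Q : Obj L" "\<Phi> : Hom D P Q" "x : Obj L" "\<mu> : Hom D x P" "l : cpaths P q x \<mu>"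
 shows "act (K q) P Q \<Phi> t (x, \<mu>) (gen x \<mu> l) = t (x, Comp D x P Q \<Phi> \<mu>) (gen x (Comp D x P Q \<Phi> \<mu>) (shift P Q \<Phi> l))"
 using K_act_apply[of "(x, \<mu>)" P "gen x \<mu> l" q Q \<Phi> t] gen_closed[OF assms(1,4-6)] assms shift_gen
 by (simp add: comma_simps over_def)

lemma fl_cpaths: "l : cpaths d q x \<mu> ==> fl l : paths L q x"
 using path_fl[of d "(x, \<mu>)" l] by (simp add: paths_def)

lemma pul_cpaths: "x : Obj L ==> l : paths L q x ==> pul l : cpaths (target x l) q x (tot x l)"
 using pul_path[of x l] by (simp add: paths_def)

lemma K_ops_apply:
 assumes "d : Obj L" "x : Obj L" "\<mu> : Hom D x d" "l : cpaths d q x \<mu>"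
 shows "(t +[val (K q) d] u) (x, \<mu>) (gen x \<mu> l) = t (x, \<mu>) (gen x \<mu> l) +[val M x] u (x, \<mu>) (gen x \<mu> l)"
  and "(r *[val (K q) d] t) (x, \<mu>) (gen x \<mu> l) = r *[val M x] t (x, \<mu>) (gen x \<mu> l)"
  and "\<zero>[val (K q) d] (x, \<mu>) (gen x \<mu> l) = \<zero>[val M x]"
 using assms gen_closed[OF assms] by (simp_all add: K_simps hom_simps comma_simps)

lemma K_gen_closed:
 assumes "d : Obj L" "t : el (K q) d" "x : Obj L" "\<mu> : Hom D x d" "l : cpaths d q x \<mu>"
 shows "t (x, \<mu>) (gen x \<mu> l) : el M x"
 using nat_closed[OF assms(2)[unfolded K_nat], of "(x, \<mu>)" "gen x \<mu> l"] gen_closed[OF assms(1,3-5)] assms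
 by (simp add: comma_simps)

text \<open>Naturality along \<open>\<gamma>\<close> carries the chain back to the universal one
  over its last object \<open>z\<close>.\<close>

lemma nat_determined:
 assumes B: "right_module R D B" and g: "g : nat_trans R D B (K q)" and d: "d : Obj L" and b: "b : el B d"
  and x: "x : Obj L" "\<mu> : Hom D x d" "l : cpaths d q x \<mu>" and t: "target (x, \<mu>) l = (z, \<gamma>)"
 shows "g d b (x, \<mu>) (gen x \<mu> l) =
  g z (act B z d \<gamma> b) (x, tot x (fl l)) (gen x (tot x (fl l)) (pul (fl l)))"
proof -
 have o: "(x, \<mu>) : Obj (comma d)" using x by (simp add: comma_simps)
 note f = path_factor[OF d o cpaths_path[OF x(3)] t, simplified]
 have tz: "target x (fl l) = z" using target_fl[of "(x, \<mu>)" l] t by simp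
 note p = fl_cpaths[OF x(3)]
 have "g z (act B z d \<gamma> b) = act (K q) z d \<gamma> (g d b)" using nat_act[OF g] f d b by (simp add: Obj_D)
 moreover have "act (K q) z d \<gamma> (g d b) (x, tot x (fl l)) (gen x (tot x (fl l)) (pul (fl l))) = g d b (x, \<mu>) (gen x \<mu> l)"
  using K_act_gen[of z d \<gamma> x "tot x (fl l)" "pul (fl l)" q "g d b"] tot_Hom[OF x(1), of "fl l"] pul_cpaths[OF x(1) p] p f tz d x
  by (simp add: paths_def)
 ultimately show ?thesis by simp
qed

text \<open>The converse of \<open>nat_determined\<close>: the linear maps \<open>w x l\<close> are
  prescribed with no compatibility between different chains. Naturality holds because
  \<open>shift\<close> alters neither the underlying chain nor its last object in \<open>L\<close>,
  only the morphism from there to \<open>d\<close>.\<close>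

lemma nat_exists:
 assumes B: "right_module R D B"
  and w: "!!x l. x : Obj L ==> l : paths L q x ==> w x l : mod_hom R (val B (target x l)) (val M x)"
 obtains g where "g : nat_trans R D B (K q)"
  "!!d b x \<mu> l z \<gamma>. d : Obj L ==> b : el B d ==> x : Obj L ==> \<mu> : Hom D x d ==> l : cpaths d q x \<mu> ==>
   target (x, \<mu>) l = (z, \<gamma>) ==> g d b (x, \<mu>) (gen x \<mu> l) = w x (fl l) (act B z d \<gamma> b)"
proof -
 define c where "c d b x \<mu> l = w x (fl l) (act B (fst (target (x, \<mu>) l)) d (snd (target (x, \<mu>) l)) b)" for d b x \<mu> l
 have tgt: "fst (target (x, \<mu>) l) : Obj L" "snd (target (x, \<mu>) l) : Hom D (fst (target (x, \<mu>) l)) d"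
  "target x (fl l) = fst (target (x, \<mu>) l)" "w x (fl l) : mod_hom R (val B (fst (target (x, \<mu>) l))) (val M x)"
  if "d : Obj L" "x : Obj L" "\<mu> : Hom D x d" "l : cpaths d q x \<mu>" for d x \<mu> l
 proof -
  have o: "(x, \<mu>) : Obj (comma d)" using that by (simp add: comma_simps)
  show "fst (target (x, \<mu>) l) : Obj L" "snd (target (x, \<mu>) l) : Hom D (fst (target (x, \<mu>) l)) d"
   using path_factor[OF that(1) o cpaths_path[OF that(4)] surjective_pairing] by simp_all
  show *: "target x (fl l) = fst (target (x, \<mu>) l)" using target_fl[of "(x, \<mu>)" l] by simp
  show "w x (fl l) : mod_hom R (val B (fst (target (x, \<mu>) l))) (val M x)"
   using w[OF that(2) fl_cpaths[OF that(4)]] * by simp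
 qed
 have cc: "c d b x \<mu> l : el M x"
  if "d : Obj L" "b : el B d" "x : Obj L" "\<mu> : Hom D x d" "l : cpaths d q x \<mu>" for d b x \<mu> l
  unfolding c_def using hom_closed[OF tgt(4)[OF that(1,3-5)] act_closed[OF B, unfolded Obj_D, OF tgt(1)[OF that(1,3-5)] that(1) tgt(2)[OF that(1,3-5)] that(2)]] .
 define P where "P d b t \<longleftrightarrow> t : el (K q) d \<and>
  (\<forall>x \<mu> l. x : Obj L --> \<mu> : Hom D x d --> l : cpaths d q x \<mu> --> t (x, \<mu>) (gen x \<mu> l) = c d b x \<mu> l)" for d b t
 define t where "t d b = (SOME t. P d b t)" for d b
 have P: "P d b (t d b)" if "d : Obj L" "b : el B d" for d b
 proof -
  have "\<exists>t. P d b t"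
   using K_lift[where c = "c d b", OF that(1) cc[OF that]] unfolding P_def Bex_def by simp
  thus ?thesis unfolding t_def by (rule someI_ex)
 qed
 from P have t: "!!d b. d : Obj L ==> b : el B d ==> t d b : el (K q) d"
  and tg: "!!d b x \<mu> l. d : Obj L ==> b : el B d ==> x : Obj L ==> \<mu> : Hom D x d ==> l : cpaths d q x \<mu> ==>
   t d b (x, \<mu>) (gen x \<mu> l) = c d b x \<mu> l" by (simp_all add: P_def)
 have "pointwise D B t : nat_trans R D B (K q)"
 proof (rule nat_transI[OF B], unfold Obj_D)
  show "t d : mod_hom R (val B d) (val (K q) d)" if d: "d : Obj L" for d
  proof (rule mod_homI[OF t[OF d]])
   interpret Bd: module R "val B d" by (rule val_module[OF B]) (simp add: Obj_D d)
   interpret Kd: module R "val (K q) d" by (rule K_val_module[OF d])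
   show "t d (a +[val B d] b) = t d a +[val (K q) d] t d b" if ab: "a : el B d" "b : el B d" for a b
   proof (rule K_ext[OF d t[OF d Bd.M.a_closed[OF ab]] Kd.M.a_closed[OF t[OF d ab(1)] t[OF d ab(2)]]])
    fix x \<mu> l assume *: "x : Obj L" "\<mu> : Hom D x d" "l : cpaths d q x \<mu>"
    note h = hom_comp[OF act_hom[OF B, unfolded Obj_D, OF tgt(1)[OF d *] d tgt(2)[OF d *]] tgt(4)[OF d *]]
    show "t d (a +[val B d] b) (x, \<mu>) (gen x \<mu> l) = (t d a +[val (K q) d] t d b) (x, \<mu>) (gen x \<mu> l)"
     unfolding K_ops_apply[OF d *] tg[OF d ab(1) *] tg[OF d ab(2) *] tg[OF d Bd.M.a_closed[OF ab] *] c_def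
     by (rule hom_add[OF h ab])
   qed
   show "t d (r *[val B d] b) = r *[val (K q) d] t d b" if rb: "r : carrier R" "b : el B d" for r b
   proof (rule K_ext[OF d t[OF d Bd.smult_closed[OF rb]] Kd.smult_closed[OF rb(1) t[OF d rb(2)]]])
    fix x \<mu> l assume *: "x : Obj L" "\<mu> : Hom D x d" "l : cpaths d q x \<mu>"
    note h = hom_comp[OF act_hom[OF B, unfolded Obj_D, OF tgt(1)[OF d *] d tgt(2)[OF d *]] tgt(4)[OF d *]]
    show "t d (r *[val B d] b) (x, \<mu>) (gen x \<mu> l) = (r *[val (K q) d] t d b) (x, \<mu>) (gen x \<mu> l)"
     unfolding K_ops_apply[OF d *] tg[OF d rb(2) *] tg[OF d Bd.smult_closed[OF rb] *] c_def
     by (rule hom_smult[OF h rb])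
   qed
  qed
  show "t e (act B e d \<Phi> b) = act (K q) e d \<Phi> (t d b)"
   if *: "e : Obj L" "d : Obj L" "\<Phi> : Hom D e d" "b : el B d" for e d \<Phi> b
  proof (rule K_ext[OF *(1) t[OF *(1) act_closed[OF B, unfolded Obj_D, OF *]] K_act_nat[OF *(1-3) t[OF *(2,4)]]])
   fix x \<mu> l assume x: "x : Obj L" "\<mu> : Hom D x e" "l : cpaths e q x \<mu>"
   let ?\<mu> = "Comp D x e d \<Phi> \<mu>" and ?l = "shift e d \<Phi> l"
   have d': "?\<mu> : Hom D x d" using D_Comp[OF x(1) *(1,2) x(2) *(3)] .
   note l' = shift_cpaths[OF *(1-3) x(3,1,2)]
   have tt: "target (x, ?\<mu>) ?l = over e d \<Phi> (target (x, \<mu>) l)"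
    using target_shift[of e d \<Phi> "(x, \<mu>)" l] by (simp add: over_def)
   have "act (K q) e d \<Phi> (t d b) (x, \<mu>) (gen x \<mu> l) = c d b x ?\<mu> ?l"
    using K_act_gen[OF *(1-3) x] tg[OF *(2,4) x(1) d' l'] by simp
   also have "\<dots> = c e (act B e d \<Phi> b) x \<mu> l"
    unfolding c_def tt fl_shift
    using act_Comp[OF B, unfolded Obj_D, OF tgt(1)[OF *(1) x] *(1,2) tgt(2)[OF *(1) x] *(3,4)] by (simp add: over_def)
   finally show "t e (act B e d \<Phi> b) (x, \<mu>) (gen x \<mu> l) = act (K q) e d \<Phi> (t d b) (x, \<mu>) (gen x \<mu> l)"
    using tg[OF *(1) act_closed[OF B, unfolded Obj_D, OF *] x] by simp
  qed
 qed
 thus thesis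
 proof (rule that)
  fix d b x \<mu> l z \<gamma> assume *: "d : Obj L" "b : el B d" "x : Obj L" "\<mu> : Hom D x d" "l : cpaths d q x \<mu>"
   "target (x, \<mu>) l = (z, \<gamma>)"
  show "pointwise D B t d b (x, \<mu>) (gen x \<mu> l) = w x (fl l) (act B z d \<gamma> b)"
   using tg[OF *(1-5)] *(1,2,6) by (simp add: Obj_D c_def)
 qed
qed

text \<open>The linear maps \<open>V x l\<close> that describe \<open>g\<close> are composed with
  the contracting homotopy \<open>h\<close>. Although \<open>h\<close> is not natural, the resulting
  family is linear, and \<open>nat_exists\<close> asks for nothing more in order to produce
  \<open>g'\<close>.\<close>

lemma rows_exact:
 defines "Y \<equiv> bar.resolution R D"
 assumes g: "g : nat_trans R D (Term Y (Suc p)) (K q)"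
  and c: "!!x a. x : Obj D ==> a : el (Term Y (Suc (Suc p))) x ==> g x (Bd Y (Suc p) x a) = \<zero>[val (K q) x]"
 shows "\<exists>g'\<in>nat_trans R D (Term Y p) (K q). g = pointwise D (Term Y (Suc p)) (%x a. g' x (Bd Y p x a))"
proof -
 have D': "bar R D" by (rule bar.intro[OF R D])
 have Y': "resolves R D (const_mod R) Y"
  unfolding Y_def by (rule projective_resolves[OF const_mod_module[OF R] bar.projective_resolution[OF D']])
 note YM = Term_module[OF Y'] and YB = Bd_closed[OF Y', unfolded Obj_D]
 define h where "h n x = bar.homotopy R D x" for n :: nat and x
 have h: "h n x : mod_hom R (val (Term Y n) x) (val (Term Y (Suc n)) x)"
  "a : el (Term Y (Suc n)) x ==>
   Bd Y (Suc n) x (h (Suc n) x a) +[val (Term Y (Suc n)) x] h n x (Bd Y n x a) = a" if "x : Obj L" for n x a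
  using bar.contraction[OF D', unfolded Obj_D, OF that] by (simp_all add: Y_def h_def)
 define V where "V x l b = g (target x l) b (x, tot x l) (gen x (tot x l) (pul l))" for x l b
 have tgt: "target x l : Obj L" "tot x l : Hom D x (target x l)" "pul l : cpaths (target x l) q x (tot x l)"
  if "x : Obj L" "l : paths L q x" for x l
  using that target_Obj[of x L l] tot_Hom[of x l] pul_cpaths[of x l q] by (simp_all add: paths_def)
 have Vh: "V x l : mod_hom R (val (Term Y (Suc p)) (target x l)) (val M x)" if *: "x : Obj L" "l : paths L q x" for x l
 proof (rule mod_homI)
  note gh = nat_hom[OF g, unfolded Obj_D, OF tgt(1)[OF *]]
  note K = K_ops_apply[OF tgt(1)[OF *] *(1) tgt(2,3)[OF *]]
  show "V x l a : el M x" if "a : el (Term Y (Suc p)) (target x l)" for a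
   unfolding V_def by (rule K_gen_closed[OF tgt(1)[OF *] hom_closed[OF gh that] *(1) tgt(2,3)[OF *]])
 qed (simp_all add: V_def hom_add[OF nat_hom[OF g, unfolded Obj_D, OF tgt(1)[OF *]]]
   hom_smult[OF nat_hom[OF g, unfolded Obj_D, OF tgt(1)[OF *]]] K_ops_apply[OF tgt(1)[OF *] *(1) tgt(2,3)[OF *]])
 have w: "(%b. V x l (h p (target x l) b)) : mod_hom R (val (Term Y p) (target x l)) (val M x)"
  if *: "x : Obj L" "l : paths L q x" for x l
  by (rule hom_comp[OF h(1)[OF tgt(1)[OF *]] Vh[OF *]])
 obtain g' where g': "g' : nat_trans R D (Term Y p) (K q)"
  "!!d b x \<mu> l z \<gamma>. d : Obj L ==> b : el (Term Y p) d ==> x : Obj L ==> \<mu> : Hom D x d ==> l : cpaths d q x \<mu> ==>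
   target (x, \<mu>) l = (z, \<gamma>) ==> g' d b (x, \<mu>) (gen x \<mu> l) = V x (fl l) (h p (target x (fl l)) (act (Term Y p) z d \<gamma> b))"
  by (rule nat_exists[OF YM w]) blast+
 have "g = pointwise D (Term Y (Suc p)) (%x a. g' x (Bd Y p x a))"
 proof (rule nat_eqI[OF g nat_comp[OF YM Bd_nat[OF Y'] g'(1)]], unfold Obj_D)
  fix d b assume db: "d : Obj L" "b : el (Term Y (Suc p)) d"
  note bb = YB[OF db]
  have "g d b = g' d (Bd Y p d b)"
  proof (rule K_ext[OF db(1) nat_closed[OF g, unfolded Obj_D, OF db] nat_closed[OF g'(1), unfolded Obj_D, OF db(1) bb]])
   fix x \<mu> l assume x: "x : Obj L" "\<mu> : Hom D x d" "l : cpaths d q x \<mu>"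
   obtain z \<gamma> where t: "target (x, \<mu>) l = (z, \<gamma>)" by (cases "target (x, \<mu>) l")
   have o: "(x, \<mu>) : Obj (comma d)" using x by (simp add: comma_simps)
   have z: "z : Obj L" "\<gamma> : Hom D z d" using path_factor[OF db(1) o cpaths_path[OF x(3)] t] by simp_all
   have tz: "target x (fl l) = z" using target_fl[of "(x, \<mu>)" l] t by simp
   note f = fl_cpaths[OF x(3)]
   let ?a = "act (Term Y (Suc p)) z d \<gamma> b"
   have a: "?a : el (Term Y (Suc p)) z" using act_closed[OF YM, unfolded Obj_D, OF z(1) db(1) z(2) db(2)] .
   note ba = YB[OF z(1) a]
   have ha: "h (Suc p) z ?a : el (Term Y (Suc (Suc p))) z" "h p z (Bd Y p z ?a) : el (Term Y (Suc p)) z"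
    using hom_closed[OF h(1)[OF z(1)]] a ba by blast+
   have V0: "V x (fl l) (Bd Y (Suc p) z (h (Suc p) z ?a)) = \<zero>[val M x]"
    unfolding V_def tz c[unfolded Obj_D, OF z(1) ha(1)]
    using K_ops_apply(3)[OF z(1) x(1), of "tot x (fl l)" "pul (fl l)" q] tgt(2,3)[OF x(1) f] by (simp add: tz)
   interpret Mx: module R "val M x" by (rule val_module[OF M x(1)])
   \<comment> \<open>The identity is the boundary of \<open>h\<close> plus \<open>h\<close> of the
     boundary; the first summand is killed because \<open>g\<close> vanishes on boundaries.\<close>
   have "V x (fl l) ?a = V x (fl l) (Bd Y (Suc p) z (h (Suc p) z ?a)) +[val M x] V x (fl l) (h p z (Bd Y p z ?a))"
    using hom_add[OF Vh[OF x(1) f, unfolded tz] YB[OF z(1) ha(1)] ha(2)] h(2)[OF z(1) a] by simp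
   also have "\<dots> = V x (fl l) (h p z (Bd Y p z ?a))"
    unfolding V0 using hom_closed[OF Vh[OF x(1) f, unfolded tz] ha(2)] by simp
   also have "Bd Y p z ?a = act (Term Y p) z d \<gamma> (Bd Y p d b)"
    using nat_act[OF Bd_nat[OF Y'], unfolded Obj_D, OF z(1) db(1) z(2) db(2)] .
   finally have "V x (fl l) ?a = g' d (Bd Y p d b) (x, \<mu>) (gen x \<mu> l)"
    using g'(2)[OF db(1) bb x t] by (simp add: tz)
   moreover have "g d b (x, \<mu>) (gen x \<mu> l) = V x (fl l) ?a"
    unfolding V_def tz by (rule nat_determined[OF YM g db x t])
   ultimately show "g d b (x, \<mu>) (gen x \<mu> l) = g' d (Bd Y p d b) (x, \<mu>) (gen x \<mu> l)" by simp
  qed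
  thus "g d b = pointwise D (Term Y (Suc p)) (%x a. g' x (Bd Y p x a)) d b" using db by (simp add: Obj_D)
 qed
 thus ?thesis using g'(1) by blast
qed

end

section \<open>The first column\<close>

lemma quotient_map_transport:
 assumes q: "quotient_map R A N \<kappa> E" and B: "module R B" and J: "J : mod_hom R A B" "bij_betw J (carrier A) (carrier B)"
  and N: "!!x. x : carrier A ==> J x : N' \<longleftrightarrow> x : N"
 shows "quotient_map R B N' (%y. \<kappa> (inv_into (carrier A) J y)) E"
proof (rule quotient_map_precomp[OF q B])
 interpret A: module R A by (rule quotD(1)[OF q])
 let ?I = "inv_into (carrier A) J"
 have I: "?I y : carrier A" "J (?I y) = y" if "y : carrier B" for y
  using that J(2) by (auto simp: bij_betw_def inv_into_into f_inv_into_f)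
 have IJ: "?I (J x) = x" if "x : carrier A" for x using that J(2) by (simp add: bij_betw_def)
 show "?I : mod_hom R B A"
 proof (rule mod_homI[OF I(1)])
  show "?I (x +[B] y) = ?I x +[A] ?I y" if "x : carrier B" "y : carrier B" for x y
   using hom_add[OF J(1) I(1)[OF that(1)] I(1)[OF that(2)]] IJ[OF A.M.a_closed[OF I(1)[OF that(1)] I(1)[OF that(2)]]] I(2) that
   by simp
  show "?I (a *[B] y) = a *[A] ?I y" if "a : carrier R" "y : carrier B" for a y
   using hom_smult[OF J(1) that(1) I(1)[OF that(2)]] IJ[OF A.smult_closed[OF that(1) I(1)[OF that(2)]]] I(2) that by simp
 qed
 show "\<exists>y\<in>carrier B. \<kappa> (?I y) = \<kappa> x" if "x : carrier A" for x
  using hom_closed[OF J(1) that] IJ[OF that] by (intro bexI[of _ "J x"]) simp_all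
 show "?I y : N \<longleftrightarrow> y : N'" if "y : carrier B" for y using N[OF I(1)[OF that]] I(2)[OF that] by simp
qed

context functor_over
begin

abbreviation "BL \<equiv> bar.resolution R L"

lemma bar_L: "bar R L" by (rule bar.intro[OF R L])

lemma BL_projective: "projective_resolution R L (const_mod R) BL"
 by (rule bar.projective_resolution[OF bar_L])

lemma BL_resolves: "resolves R L (const_mod R) BL"
 by (rule projective_resolves[OF const_mod_module[OF R] BL_projective])

lemmas BL_module = Term_module[OF BL_resolves]

lemma BL_val: "val (Term BL n) x = free_module R (paths L (Suc n) x)"
 by (simp add: bar.res_simps(1)[OF bar_L] bar.val_term_at[OF bar_L])

definition genL :: "'o => ('o \<times> 'm) list => ('o \<times> 'm) list => 'r" where
 "genL x l = single R ((x, Ident L x) # l)"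

lemma genL_closed: "x : Obj L ==> l : paths L q x ==> genL x l : el (Term BL q) x"
 unfolding genL_def BL_val using Ident_Hom[OF L, of x]
 by (intro single_closed[OF R] bar.cons_paths[OF bar_L]) simp_all

lemma L_ext:
 assumes u: "u : nat_trans R L (Term BL q) M" "v : nat_trans R L (Term BL q) M"
  and e: "!!x l. x : Obj L ==> l : paths L q x ==> u x (genL x l) = v x (genL x l)"
 shows "u = v"
proof -
 interpret B: bar R L by (rule bar_L)
 note n = u[unfolded B.res_simps(1)]
 show ?thesis
 proof (rule nat_eqI[OF n])
  fix x a assume xa: "x : Obj L" "a : el (B.term_at q) x"
  show "u x a = v x a"
   by (rule B.F.FM_ext[OF M n[unfolded B.term_at_def] _ xa[unfolded B.term_at_def]])
    (insert e, simp add: genL_def)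
 qed
qed

lemma L_lift:
 assumes c: "!!x l. x : Obj L ==> l : paths L q x ==> c x l : el M x"
 obtains u where "u : nat_trans R L (Term BL q) M" "!!x l. x : Obj L ==> l : paths L q x ==> u x (genL x l) = c x l"
proof -
 interpret B: bar R L by (rule bar_L)
 obtain k where k: "k : nat_trans R L (B.term_at q) M"
  "!!x y f l. x : Obj L ==> y : Obj L ==> f : Hom L x y ==> l : paths L q y ==>
   k x (single R ((y, f) # l)) = act M x y f (c y l)"
  by (rule B.F.FM_lift[where c = c, OF M c]) (assumption+, rule that, simp add: B.term_at_def, simp)
 show thesis
  by (rule that[of k]) (simp_all add: B.res_simps(1) k genL_def Ident_Hom[OF L] act_Ident[OF M] c)
qed

lemma fl_comparison: "d : Obj L ==> comparison_map R (comma d) (BC d) BL fst (%_ _ f. f)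
  (%n. pointwise (comma d) (Term (BC d) n) (%_. push R fl))"
 by (rule bar_comparison(2)[OF R comma_category L fst_functor])

text \<open>Restriction along the projection from the comma category to \<open>L\<close>. As
  \<open>d\<close> varies this gives a compatible family, and by \<open>res_surj\<close> every
  compatible family arises: the limit of \<open>K q\<close> over \<open>D\<close> is the module of
  cochains of \<open>L\<close>.\<close>

definition res :: "nat => 'o => ('o => (('o \<times> 'm) list => 'r) => 'x) =>
  'o \<times> 'd => ((('o \<times> 'd) \<times> 'm) list => 'r) => 'x" where
 "res q d u = pointwise (comma d) (Term (BC d) q) (%x s. u (fst x) (push R fl s))"

lemma fl_closed: "d : Obj L ==> x : Obj (comma d) ==> s : el (Term (BC d) q) x ==>
 push R fl s : el (Term BL q) (fst x)"
 using compare_closed[OF fl_comparison, of d x s q] by simp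

lemma res_K: "d : Obj L ==> u : nat_trans R L (Term BL q) M ==> res q d u : el (K q) d"
proof -
 assume d: "d : Obj L" and u: "u : nat_trans R L (Term BL q) M"
 have "res q d u = pointwise (comma d) (Term (BC d) q) (%x s.
  pointwise (comma d) (restrict_mod fst (%_ _ f. f) (Term BL q)) (%x. u (fst x)) x
   (pointwise (comma d) (Term (BC d) q) (%_. push R fl) x s))"
  unfolding res_def using fl_closed[OF d] by (intro ext) (simp add: pointwise_def)
 thus ?thesis unfolding K_nat
  using nat_comp[OF BC_module[OF d] comparison_nat[OF fl_comparison[OF d]] restrict_nat[OF fst_functor BL_module u]] by simp
qed

lemma res_gen:
 assumes "d : Obj L" "x : Obj L" "\<mu> : Hom D x d" "l : cpaths d q x \<mu>"
 shows "res q d u (x, \<mu>) (gen x \<mu> l) = u x (genL x (fl l))"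
 using gen_closed[OF assms] assms by (simp add: res_def comma_simps) (simp add: gen_def genL_def push_single[OF R])

lemma path_data:
 assumes "x : Obj L" "l : paths L q x"
 shows "target x l : Obj L" "tot x l : Hom D x (target x l)" "pul l : cpaths (target x l) q x (tot x l)"
 using assms target_Obj[of x L l] tot_Hom[of x l] pul_cpaths[of x l q] by (simp_all add: paths_def)

lemma res_inj:
 assumes "u : nat_trans R L (Term BL q) M" "v : nat_trans R L (Term BL q) M"
  and "!!d. d : Obj L ==> res q d u = res q d v"
 shows "u = v"
proof (rule L_ext[OF assms(1,2)])
 fix x l assume x: "x : Obj L" "l : paths L q x"
 note p = path_data[OF x]
 show "u x (genL x l) = v x (genL x l)"
  using res_gen[OF p(1) x(1) p(2,3), of u] res_gen[OF p(1) x(1) p(2,3), of v] assms(3)[OF p(1)] by (simp add: fl_pul)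
qed

lemma res_hom:
 assumes d: "d : Obj L"
 shows "res q d : mod_hom R (hom_mod R L (Term BL q) M) (val (K q) d)"
proof (rule mod_homI)
 interpret H: module R "hom_mod R L (Term BL q) M" by (rule hom_mod_module[OF R BL_module M])
 interpret Kd: module R "val (K q) d" by (rule K_val_module[OF d])
 have c: "res q d u : el (K q) d" if "u : carrier (hom_mod R L (Term BL q) M)" for u
  using res_K[OF d] that by (simp add: hom_simps)
 show "res q d u : el (K q) d" if "u : carrier (hom_mod R L (Term BL q) M)" for u by (rule c[OF that])
 have g: "genL x (fl l) : el (Term BL q) x" if "x : Obj L" "l : cpaths d q x \<mu>" for x l \<mu>
  using genL_closed[OF that(1) fl_cpaths[OF that(2)]] .
 show "res q d (u +[hom_mod R L (Term BL q) M] v) = res q d u +[val (K q) d] res q d v"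
  if uv: "u : carrier (hom_mod R L (Term BL q) M)" "v : carrier (hom_mod R L (Term BL q) M)" for u v
  by (rule K_ext[OF d c[OF H.M.a_closed[OF uv]] Kd.M.a_closed[OF c[OF uv(1)] c[OF uv(2)]]])
   (simp add: res_gen[OF d] K_ops_apply[OF d], simp add: hom_simps g)
 show "res q d (r *[hom_mod R L (Term BL q) M] u) = r *[val (K q) d] res q d u"
  if ru: "r : carrier R" "u : carrier (hom_mod R L (Term BL q) M)" for r u
  by (rule K_ext[OF d c[OF H.smult_closed[OF ru]] Kd.smult_closed[OF ru(1) c[OF ru(2)]]])
   (simp add: res_gen[OF d] K_ops_apply[OF d], simp add: hom_simps g)
qed

text \<open>\<open>shift\<close> does not alter the underlying chain in \<open>L\<close>, and
  \<open>res\<close> sees nothing else.\<close>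

lemma res_act:
 assumes "P : Obj L" "Q : Obj L" "\<Phi> : Hom D P Q" "u : nat_trans R L (Term BL q) M"
 shows "act (K q) P Q \<Phi> (res q Q u) = res q P u"
proof (rule K_ext[OF assms(1) K_act_nat[OF assms(1-3) res_K[OF assms(2,4)]] res_K[OF assms(1,4)]])
 fix x \<mu> l assume x: "x : Obj L" "\<mu> : Hom D x P" "l : cpaths P q x \<mu>"
 show "act (K q) P Q \<Phi> (res q Q u) (x, \<mu>) (gen x \<mu> l) = res q P u (x, \<mu>) (gen x \<mu> l)"
  unfolding K_act_gen[OF assms(1-3) x] res_gen[OF assms(1) x]
   res_gen[OF assms(2) x(1) D_Comp[OF x(1) assms(1,2) x(2) assms(3)] shift_cpaths[OF assms(1-3) x(3,1,2)]] fl_shift ..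
qed

lemma res_\<delta>:
 assumes d: "d : Obj L" and u: "u : nat_trans R L (Term BL q) M"
 shows "\<delta> q d (res q d u) = res (Suc q) d (pointwise L (Term BL (Suc q)) (%x s. u x (Bd BL q x s)))"
proof -
 note bu = nat_comp[OF BL_module Bd_nat[OF BL_resolves] u]
 show ?thesis
 proof (rule nat_eqI[OF nat_closed[OF \<delta>_nat, unfolded Obj_D, OF d res_K[OF d u], unfolded K_nat] res_K[OF d bu, unfolded K_nat]])
  fix x s assume xs: "x : Obj (comma d)" "s : el (Term (BC d) (Suc q)) x"
  have fx: "fst x : Obj L" using functor_Obj[OF fst_functor xs(1)] .
  note b = Bd_closed[OF BC_resolves[OF d] xs]
  have "push R fl (Bd (BC d) q x s) = Bd BL q (fst x) (push R fl s)"
   using comparison_Bd[OF fl_comparison[OF d] xs] xs b by simp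
  thus "\<delta> q d (res q d u) x s = res (Suc q) d (pointwise L (Term BL (Suc q)) (%x s. u x (Bd BL q x s))) x s"
   using \<delta>_simp[OF d res_K[OF d u]] xs b fx fl_closed[OF d xs] by (simp add: res_def)
 qed
qed

text \<open>The value of \<open>u\<close> at a chain is read off from the family at the last object
  of the chain, on the universal chain there; compatibility along \<open>\<gamma>\<close> recovers
  the values at all other objects.\<close>

lemma res_surj:
 assumes T: "!!d. d : Obj L ==> T d : el (K q) d"
  and act: "!!P Q \<Phi>. P : Obj L ==> Q : Obj L ==> \<Phi> : Hom D P Q ==> act (K q) P Q \<Phi> (T Q) = T P"
 obtains u where "u : nat_trans R L (Term BL q) M" "!!d. d : Obj L ==> res q d u = T d"
proof -
 have "T (target x l) (x, tot x l) (gen x (tot x l) (pul l)) : el M x" if "x : Obj L" "l : paths L q x" for x l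
  using K_gen_closed[OF path_data(1)[OF that] T[OF path_data(1)[OF that]] that(1) path_data(2,3)[OF that]] .
 then obtain u where u: "u : nat_trans R L (Term BL q) M"
  "!!x l. x : Obj L ==> l : paths L q x ==> u x (genL x l) = T (target x l) (x, tot x l) (gen x (tot x l) (pul l))"
  by (rule L_lift[where c = "%x l. T (target x l) (x, tot x l) (gen x (tot x l) (pul l))"]) (assumption+, rule that)
 show thesis
 proof (rule that[OF u(1)])
  fix d assume d: "d : Obj L"
  show "res q d u = T d"
  proof (rule K_ext[OF d res_K[OF d u(1)] T[OF d]])
   fix x \<mu> l assume x: "x : Obj L" "\<mu> : Hom D x d" "l : cpaths d q x \<mu>"
   obtain z \<gamma> where t: "target (x, \<mu>) l = (z, \<gamma>)" by (cases "target (x, \<mu>) l")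
   have o: "(x, \<mu>) : Obj (comma d)" using x by (simp add: comma_simps)
   note f = path_factor[OF d o cpaths_path[OF x(3)] t, simplified]
   have tz: "target x (fl l) = z" using target_fl[of "(x, \<mu>)" l] t by simp
   note p = path_data[OF x(1) fl_cpaths[OF x(3)], unfolded tz]
   have "T z (x, tot x (fl l)) (gen x (tot x (fl l)) (pul (fl l))) = T d (x, \<mu>) (gen x \<mu> l)"
    using K_act_gen[OF p(1) d _ x(1) p(2,3), of \<gamma> "T d"] act[OF p(1) d, of \<gamma>] f by simp
   thus "res q d u (x, \<mu>) (gen x \<mu> l) = T d (x, \<mu>) (gen x \<mu> l)"
    using res_gen[OF d x, of u] u(2)[OF x(1) fl_cpaths[OF x(3)]] tz by simp
  qed
 qed
qed

section \<open>Maps from the constant functor to \<open>K q\<close>\<close>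

context
 fixes Y H \<kappa>
 assumes CC: "coefficient_complex R D Y K \<delta> H \<kappa>"
begin

interpretation CC: coefficient_complex R D Y K \<delta> H \<kappa> by (rule CC)

text \<open>A compatible family over \<open>D\<close> is a map from the constant functor to
  \<open>K q\<close>; composed with the augmentation of \<open>Y\<close> it becomes a cochain in
  column 0.\<close>

definition J :: "nat => _" where
 "J q u = pointwise D (Term Y 0) (%d y. Aug Y d y *[val (K q) d] res q d u)"

lemma Aug_R: "d : Obj L ==> y : el (Term Y 0) d ==> Aug Y d y : carrier R"
 using nat_closed[OF Aug_nat[OF CC.Y'], unfolded Obj_D, of d y] by (simp add: const_mod_def regular_mod_def)

lemma Aug_one: assumes "d : Obj L" obtains y where "y : el (Term Y 0) d" "Aug Y d y = \<one>\<^bsub>R\<^esub>"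
proof -
 interpret cring R by (rule R)
 have "\<one>\<^bsub>R\<^esub> : el (const_mod R) d" by (simp add: const_mod_def regular_mod_def)
 from Aug_surj[OF CC.Y', unfolded Obj_D, OF assms this] that show thesis by blast
qed

lemma J_apply: "d : Obj L ==> y : el (Term Y 0) d ==> J q u d y = Aug Y d y *[val (K q) d] res q d u"
 by (simp add: J_def Obj_D)

lemma J_nat:
 assumes u: "u : nat_trans R L (Term BL q) M"
 shows "J q u : nat_trans R D (Term Y 0) (K q)"
 unfolding J_def
proof (rule nat_transI[OF CC.YM], unfold Obj_D)
 show "(%y. Aug Y d y *[val (K q) d] res q d u) : mod_hom R (val (Term Y 0) d) (val (K q) d)" if d: "d : Obj L" for d
 proof (rule mod_homI)
  interpret Kd: module R "val (K q) d" by (rule K_val_module[OF d])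
  note A = Aug_R[OF d] and r = res_K[OF d u] and h = nat_hom[OF Aug_nat[OF CC.Y'], unfolded Obj_D, OF d]
  have c: "a +[val (const_mod R) d] b = a +[R] b" "a *[val (const_mod R) d] b = a \<otimes>\<^bsub>R\<^esub> b" for a b
   by (simp_all add: const_mod_def regular_mod_def)
  fix y assume y: "y : el (Term Y 0) d"
  show "Aug Y d y *[val (K q) d] res q d u : el (K q) d" using A[OF y] r by simp
  show "Aug Y d (y +[val (Term Y 0) d] z) *[val (K q) d] res q d u =
   Aug Y d y *[val (K q) d] res q d u +[val (K q) d] Aug Y d z *[val (K q) d] res q d u" if "z : el (Term Y 0) d" for z
   unfolding hom_add[OF h y that] c using A[OF y] A[OF that] r by (simp add: Kd.smult_l_distr)
  show "Aug Y d (a *[val (Term Y 0) d] y) *[val (K q) d] res q d u = a *[val (K q) d] (Aug Y d y *[val (K q) d] res q d u)"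
   if "a : carrier R" for a
   unfolding hom_smult[OF h that y] c using A[OF y] that r by (simp add: Kd.smult_assoc1)
 qed
 show "Aug Y P (act (Term Y 0) P Q \<Phi> y) *[val (K q) P] res q P u = act (K q) P Q \<Phi> (Aug Y Q y *[val (K q) Q] res q Q u)"
  if *: "P : Obj L" "Q : Obj L" "\<Phi> : Hom D P Q" "y : el (Term Y 0) Q" for P Q \<Phi> y
  using nat_act[OF Aug_nat[OF CC.Y'], unfolded Obj_D, OF *] res_act[OF *(1-3) u]
   hom_smult[OF act_hom[OF K_module, unfolded Obj_D, OF *(1-3)] Aug_R[OF *(2,4)] res_K[OF *(2) u]]
  by (simp add: const_mod_def)
qed

lemma J_invariants: "u : nat_trans R L (Term BL q) M ==> J q u : CC.invariants q"
proof -
 assume u: "u : nat_trans R L (Term BL q) M"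
 have "J q u d (Bd Y 0 d y) = \<zero>[val (K q) d]" if d: "d : Obj L" "y : el (Term Y (Suc 0)) d" for d y
 proof -
  interpret Kd: module R "val (K q) d" by (rule K_val_module[OF d(1)])
  show ?thesis
   using J_apply[OF d(1) Bd_closed[OF CC.Y', unfolded Obj_D, OF d]] Aug_Bd[OF CC.Y', unfolded Obj_D, OF d] res_K[OF d(1) u]
   by (simp add: const_mod_def regular_mod_def)
 qed
 thus ?thesis using J_nat[OF u] by (simp add: CC.invariants_def Obj_D)
qed

lemma J_eq: "u : nat_trans R L (Term BL q) M ==> d : Obj L ==> y : el (Term Y 0) d ==> Aug Y d y = \<one>\<^bsub>R\<^esub> ==>
 J q u d y = res q d u"
 using J_apply[of d y q u] module.smult_one[OF K_val_module[of d q] res_K[of d u q]] by simp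

lemma J_inj: "u : nat_trans R L (Term BL q) M ==> v : nat_trans R L (Term BL q) M ==> J q u = J q v ==> u = v"
proof (rule res_inj)
 assume *: "u : nat_trans R L (Term BL q) M" "v : nat_trans R L (Term BL q) M" "J q u = J q v"
 fix d assume d: "d : Obj L"
 obtain y where y: "y : el (Term Y 0) d" "Aug Y d y = \<one>\<^bsub>R\<^esub>" by (rule Aug_one[OF d])
 show "res q d u = res q d v" using J_eq[OF *(1) d y] J_eq[OF *(2) d y] *(3) by simp
qed simp_all

text \<open>An invariant cochain vanishes on the kernel of the augmentation, by exactness of
  \<open>Y\<close>, and so factors through the constant functor. Its value at any element of
  augmentation one is the member of a compatible family.\<close>

lemma J_surj:
 assumes a: "a : CC.invariants q"
 obtains u where "u : nat_trans R L (Term BL q) M" "J q u = a"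
proof -
 have an: "a : nat_trans R D (Term Y 0) (K q)" using a by (simp add: CC.invariants_def)
 have ker: "a d y = \<zero>[val (K q) d]" if "d : Obj L" "y : el (Term Y 0) d" "Aug Y d y = \<zero>[R]" for d y
  using Aug_exact[OF CC.Y', unfolded Obj_D, OF that(1,2)] that a by (auto simp: const_mod_def regular_mod_def CC.invariants_def Obj_D)
 have eq: "a d y = Aug Y d y *[val (K q) d] a d z"
  if d: "d : Obj L" "y : el (Term Y 0) d" "z : el (Term Y 0) d" "Aug Y d z = \<one>\<^bsub>R\<^esub>" for d y z
 proof -
  interpret Yd: module R "val (Term Y 0) d" by (rule val_module[OF CC.YM]) (simp add: Obj_D d)
  interpret Kd: module R "val (K q) d" by (rule K_val_module[OF d(1)])
  interpret c: module R "regular_mod R"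
   using val_module[OF const_mod_module[OF R, of D], of d] d(1) by (simp add: const_mod_def Obj_D)
  have h: "Aug Y d : mod_hom R (val (Term Y 0) d) (regular_mod R)"
   using nat_hom[OF Aug_nat[OF CC.Y'], of d] d(1) by (simp add: const_mod_def Obj_D)
  note A = Aug_R[OF d(1,2)] and ah = nat_hom[OF an, unfolded Obj_D, OF d(1)]
  have sz: "Aug Y d y *[val (Term Y 0) d] z : el (Term Y 0) d" using A d by simp
  have "Aug Y d (Aug Y d y *[val (Term Y 0) d] z) = Aug Y d y"
   using hom_smult[OF h A d(3)] d(4) A by (simp add: regular_mod_def)
  hence "Aug Y d (y -[val (Term Y 0) d] (Aug Y d y *[val (Term Y 0) d] z)) = \<zero>[regular_mod R]"
   using hom_minus[OF Yd.module_axioms c.module_axioms h d(2) sz] c.M.minus_zero_iff hom_closed[OF h d(2)] by simp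
  hence "a d (y -[val (Term Y 0) d] (Aug Y d y *[val (Term Y 0) d] z)) = \<zero>[val (K q) d]"
   using ker[OF d(1) Yd.M.minus_closed[OF d(2) sz]] by (simp add: const_mod_def regular_mod_def)
  hence "a d y = a d (Aug Y d y *[val (Term Y 0) d] z)"
   using hom_minus[OF Yd.module_axioms Kd.module_axioms ah d(2) sz]
    Kd.M.minus_zero_iff[OF hom_closed[OF ah d(2)] hom_closed[OF ah sz]] by simp
  thus ?thesis using hom_smult[OF ah A d(3)] by simp
 qed
 define y1 where "y1 d = (SOME y. y : el (Term Y 0) d \<and> Aug Y d y = \<one>\<^bsub>R\<^esub>)" for d
 have y1: "y1 d : el (Term Y 0) d" "Aug Y d (y1 d) = \<one>\<^bsub>R\<^esub>" if "d : Obj L" for d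
 proof -
  have "\<exists>y. y : el (Term Y 0) d \<and> Aug Y d y = \<one>\<^bsub>R\<^esub>" using Aug_one[OF that] by blast
  from someI_ex[OF this] show "y1 d : el (Term Y 0) d" "Aug Y d (y1 d) = \<one>\<^bsub>R\<^esub>" by (simp_all add: y1_def)
 qed
 have T: "a d (y1 d) : el (K q) d" if "d : Obj L" for d
  using nat_closed[OF an, unfolded Obj_D, OF that y1(1)[OF that]] .
 have "act (K q) P Q \<Phi> (a Q (y1 Q)) = a P (y1 P)" if *: "P : Obj L" "Q : Obj L" "\<Phi> : Hom D P Q" for P Q \<Phi>
 proof -
  interpret KP: module R "val (K q) P" by (rule K_val_module[OF *(1)])
  note c = act_closed[OF CC.YM, unfolded Obj_D, OF * y1(1)[OF *(2)]]
  have "Aug Y P (act (Term Y 0) P Q \<Phi> (y1 Q)) = \<one>\<^bsub>R\<^esub>"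
   using nat_act[OF Aug_nat[OF CC.Y'], unfolded Obj_D, OF * y1(1)[OF *(2)]] y1(2)[OF *(2)] by (simp add: const_mod_def)
  thus ?thesis
   using eq[OF *(1) c y1[OF *(1)]] nat_act[OF an, unfolded Obj_D, OF * y1(1)[OF *(2)]] T[OF *(1)] by simp
 qed
 then obtain u where u: "u : nat_trans R L (Term BL q) M" "!!d. d : Obj L ==> res q d u = a d (y1 d)"
  using res_surj[where T = "%d. a d (y1 d)" and q = q] T by blast
 show thesis
 proof (rule that[OF u(1)])
  show "J q u = a"
   by (rule nat_eqI[OF J_nat[OF u(1)] an]) (simp add: Obj_D J_apply u(2) eq[OF _ _ y1])
 qed
qed

lemma J_\<delta>:
 assumes u: "u : nat_trans R L (Term BL q) M"
 shows "J (Suc q) (pointwise L (Term BL (Suc q)) (%x s. u x (Bd BL q x s))) = pointwise D (Term Y 0) (%d y. \<delta> q d (J q u d y))"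
proof (rule nat_eqI[OF J_nat[OF nat_comp[OF BL_module Bd_nat[OF BL_resolves] u]] nat_comp[OF CC.YM J_nat[OF u] \<delta>_nat]], unfold Obj_D)
 fix d y assume d: "d : Obj L" "y : el (Term Y 0) d"
 show "J (Suc q) (pointwise L (Term BL (Suc q)) (%x s. u x (Bd BL q x s))) d y = pointwise D (Term Y 0) (%d y. \<delta> q d (J q u d y)) d y"
  using d hom_smult[OF nat_hom[OF \<delta>_nat, unfolded Obj_D, OF d(1)] Aug_R[OF d] res_K[OF d(1) u]] res_\<delta>[OF d(1) u]
  by (simp add: J_apply Obj_D)
qed

lemma J_cocycles:
 assumes u: "u : nat_trans R L (Term BL q) M"
 shows "J q u : CC.invariant_cocycles q \<longleftrightarrow> u : cocycles R L BL M q"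
proof -
 let ?b = "pointwise L (Term BL (Suc q)) (%x s. u x (Bd BL q x s))"
 note b = nat_comp[OF BL_module Bd_nat[OF BL_resolves] u]
 note z = nat_trans_zero[OF BL_module[of "Suc q"] M]
 interpret H: module R "hom_mod R L (Term BL (Suc q)) M" by (rule hom_mod_module[OF R BL_module M])
 have co: "u : cocycles R L BL M q \<longleftrightarrow> ?b = \<zero>[hom_mod R L (Term BL (Suc q)) M]"
 proof
  assume "u : cocycles R L BL M q"
  thus "?b = \<zero>[hom_mod R L (Term BL (Suc q)) M]" unfolding hom_simps
   by (intro nat_eqI[OF b z]) (simp add: cocycles_def)
 next
  assume e: "?b = \<zero>[hom_mod R L (Term BL (Suc q)) M]"
  have "u x (Bd BL q x s) = \<zero>[val M x]" if "x : Obj L" "s : el (Term BL (Suc q)) x" for x s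
   using fun_cong[OF fun_cong[OF e, of x], of s] that by (simp add: hom_simps)
  thus "u : cocycles R L BL M q" using u by (simp add: cocycles_def)
 qed
 have rz: "res (Suc q) d \<zero>[hom_mod R L (Term BL (Suc q)) M] = \<zero>[val (K (Suc q)) d]" if "d : Obj L" for d
  by (rule hom_zero[OF H.module_axioms K_val_module[OF that] res_hom[OF that]])
 have J: "\<delta> q d (J q u d y) = Aug Y d y *[val (K (Suc q)) d] res (Suc q) d ?b"
  if "d : Obj L" "y : el (Term Y 0) d" for d y
  using fun_cong[OF fun_cong[OF J_\<delta>[OF u], of d], of y] that J_apply[OF that, of "Suc q" ?b] by (simp add: Obj_D)
 have "J q u : CC.invariant_cocycles q \<longleftrightarrow> (\<forall>d\<in>Obj L. \<forall>y\<in>el (Term Y 0) d. \<delta> q d (J q u d y) = \<zero>[val (K (Suc q)) d])"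
  using J_invariants[OF u] nat_closed[OF J_nat[OF u]] by (simp add: CC.invariant_cocycles_def Obj_D)
 also have "\<dots> \<longleftrightarrow> (\<forall>d\<in>Obj L. res (Suc q) d ?b = \<zero>[val (K (Suc q)) d])"
 proof (intro iffI ballI)
  fix d assume *: "\<forall>d\<in>Obj L. \<forall>y\<in>el (Term Y 0) d. \<delta> q d (J q u d y) = \<zero>[val (K (Suc q)) d]" and d: "d : Obj L"
  obtain y where y: "y : el (Term Y 0) d" "Aug Y d y = \<one>\<^bsub>R\<^esub>" by (rule Aug_one[OF d])
  interpret Kd: module R "val (K (Suc q)) d" by (rule K_val_module[OF d])
  show "res (Suc q) d ?b = \<zero>[val (K (Suc q)) d]" using * d y J[OF d y(1)] res_K[OF d b] by simp
 next
  fix d y assume *: "\<forall>d\<in>Obj L. res (Suc q) d ?b = \<zero>[val (K (Suc q)) d]" and d: "d : Obj L" "y : el (Term Y 0) d"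
  interpret Kd: module R "val (K (Suc q)) d" by (rule K_val_module[OF d(1)])
  show "\<delta> q d (J q u d y) = \<zero>[val (K (Suc q)) d]" using * d J[OF d] Aug_R[OF d] by simp
 qed
 also have "\<dots> \<longleftrightarrow> ?b = \<zero>[hom_mod R L (Term BL (Suc q)) M]"
 proof
  assume *: "\<forall>d\<in>Obj L. res (Suc q) d ?b = \<zero>[val (K (Suc q)) d]"
  show "?b = \<zero>[hom_mod R L (Term BL (Suc q)) M]"
  proof (rule res_inj[OF b])
   show "\<zero>[hom_mod R L (Term BL (Suc q)) M] : nat_trans R L (Term BL (Suc q)) M" using z by (simp add: hom_simps(2))
  qed (use * rz in simp)
 next
  assume "?b = \<zero>[hom_mod R L (Term BL (Suc q)) M]"
  thus "\<forall>d\<in>Obj L. res (Suc q) d ?b = \<zero>[val (K (Suc q)) d]" using rz by simp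
 qed
 finally show ?thesis using co by simp
qed

lemma first_column:
 "\<exists>\<eta>. quotient_map R (hom_mod R D (Term Y 0) (K n) <| CC.invariant_cocycles n) (CC.invariant_coboundaries n) \<eta> (cohomology R L M n)"
proof -
 let ?B = "hom_mod R D (Term Y 0) (K n)" and ?A = "cochains R L BL M n"
 interpret S: cochain_setup R L "const_mod R" BL M by (rule cochain_setup.intro[OF R BL_resolves M])
 interpret HB: module R ?B by (rule hom_mod_module[OF R CC.YM K_module])
 interpret HA: module R "hom_mod R L (Term BL n) M" by (rule hom_mod_module[OF R BL_module M])
 have hom: "J n : mod_hom R (hom_mod R L (Term BL n) M) ?B"
 proof (rule mod_homI)
  show c: "J n u : carrier ?B" if "u : carrier (hom_mod R L (Term BL n) M)" for u using J_nat that by (simp add: hom_simps)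
  fix u assume u: "u : carrier (hom_mod R L (Term BL n) M)"
  have un: "u : nat_trans R L (Term BL n) M" using u by (simp add: hom_simps)
  show "J n (u +[hom_mod R L (Term BL n) M] v) = J n u +[?B] J n v" if v: "v : carrier (hom_mod R L (Term BL n) M)" for v
  proof (rule nat_eqI[OF c[OF HA.M.a_closed[OF u v], unfolded hom_simps(1)] HB.M.a_closed[OF c[OF u] c[OF v], unfolded hom_simps(1)]], unfold Obj_D)
   fix d y assume d: "d : Obj L" "y : el (Term Y 0) d"
   interpret Kd: module R "val (K n) d" by (rule K_val_module[OF d(1)])
   have "J n (u +[hom_mod R L (Term BL n) M] v) d y = J n u d y +[val (K n) d] J n v d y"
    unfolding J_apply[OF d] hom_add[OF res_hom[OF d(1)] u v]
    using Aug_R[OF d] hom_closed[OF res_hom[OF d(1)] u] hom_closed[OF res_hom[OF d(1)] v] by (simp add: Kd.smult_r_distr)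
   thus "J n (u +[hom_mod R L (Term BL n) M] v) d y = (J n u +[?B] J n v) d y"
    using d by (simp add: hom_simps(3)[of R D "Term Y 0"] Obj_D)
  qed
  show "J n (r *[hom_mod R L (Term BL n) M] u) = r *[?B] J n u" if r: "r : carrier R" for r
  proof (rule nat_eqI[OF c[OF HA.smult_closed[OF r u], unfolded hom_simps(1)] HB.smult_closed[OF r c[OF u], unfolded hom_simps(1)]], unfold Obj_D)
   fix d y assume d: "d : Obj L" "y : el (Term Y 0) d"
   interpret Kd: module R "val (K n) d" by (rule K_val_module[OF d(1)])
   have "J n (r *[hom_mod R L (Term BL n) M] u) d y = r *[val (K n) d] J n u d y"
    unfolding J_apply[OF d] hom_smult[OF res_hom[OF d(1)] r u]
    using Aug_R[OF d] r hom_closed[OF res_hom[OF d(1)] u] by (simp add: Kd.smult_assoc1[symmetric] HB.R.m_comm)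
   thus "J n (r *[hom_mod R L (Term BL n) M] u) d y = (r *[?B] J n u) d y"
    using d by (simp add: hom_simps(4)[of R D "Term Y 0"] Obj_D)
  qed
 qed
 have sub: "CC.invariant_cocycles n \<subseteq> CC.invariants n" by (auto simp: CC.invariant_cocycles_def)
 have img: "J n ` cocycles R L BL M n = CC.invariant_cocycles n"
 proof (intro equalityI subsetI)
  fix a assume a: "a : CC.invariant_cocycles n"
  obtain u where u: "u : nat_trans R L (Term BL n) M" "J n u = a" by (rule J_surj[OF subsetD[OF sub a]])
  thus "a : J n ` cocycles R L BL M n" using J_cocycles[OF u(1)] a by blast
 next
  fix a assume "a : J n ` cocycles R L BL M n"
  thus "a : CC.invariant_cocycles n" using J_cocycles S.cocycles_nat by blast
 qed
 have bij: "bij_betw (J n) (carrier ?A) (carrier (?B <| CC.invariant_cocycles n))"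
  unfolding bij_betw_def using img by (auto intro!: inj_onI J_inj[OF S.cocycles_nat S.cocycles_nat])
 have cA: "x : carrier (hom_mod R L (Term BL n) M)" if "x : cocycles R L BL M n" for x
  using S.cocycles_nat[OF that] by (simp add: hom_simps)
 have homr: "J n : mod_hom R ?A (?B <| CC.invariant_cocycles n)"
  by (rule mod_homI) (insert img, auto simp: hom_add[OF hom] hom_smult[OF hom] cA)
 \<comment> \<open>The module structure is obtained as the image of the cocycles under
   \<open>J n\<close>.\<close>
 have mB: "module R (?B <| CC.invariant_cocycles n)"
 proof (rule module_surj_image[OF S.cochains_module[of n], where f = "J n"])
  show "J n ` carrier ?A = carrier (?B <| CC.invariant_cocycles n)" using img by simp
  show "\<zero>[?B <| CC.invariant_cocycles n] = J n \<zero>[?A]"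
   using hom_zero[OF HA.module_axioms HB.module_axioms hom] by simp
 qed (use hom_add[OF homr] hom_smult[OF homr] in blast)+
 have cob: "J n u : CC.invariant_coboundaries n \<longleftrightarrow> u : coboundaries R L BL M n" if u: "u : cocycles R L BL M n" for u
 proof (cases n)
  case 0
  have z0: "J 0 \<zero>[hom_mod R L (Term BL 0) M] = \<zero>[hom_mod R D (Term Y 0) (K 0)]"
   using hom_zero[OF HA.module_axioms HB.module_axioms hom] 0 by simp
  have "J 0 u = \<zero>[hom_mod R D (Term Y 0) (K 0)] \<longleftrightarrow> u = \<zero>[hom_mod R L (Term BL 0) M]"
   using J_inj[of u 0 "\<zero>[hom_mod R L (Term BL 0) M]"] z0 S.cocycles_nat[OF u] HA.M.zero_closed 0 by (auto simp: hom_simps(1))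
  thus ?thesis using 0 by (simp add: CC.invariant_coboundaries_def coboundaries_def)
 next
  case (Suc m)
  let ?d = "%v. pointwise L (Term BL (Suc m)) (%x s. v x (Bd BL m x s))"
  have dn: "?d v : nat_trans R L (Term BL (Suc m)) M" if "v : nat_trans R L (Term BL m) M" for v
   using nat_comp[OF BL_module Bd_nat[OF BL_resolves] that] .
  note un = S.cocycles_nat[OF u, unfolded Suc]
  have "J (Suc m) u : CC.invariant_coboundaries (Suc m) \<longleftrightarrow> (\<exists>v\<in>nat_trans R L (Term BL m) M. J (Suc m) u = J (Suc m) (?d v))"
  proof
   assume "J (Suc m) u : CC.invariant_coboundaries (Suc m)"
   then obtain b where b: "b : CC.invariants m" "J (Suc m) u = pointwise D (Term Y 0) (%x y. \<delta> m x (b x y))"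
    by (auto simp: CC.invariant_coboundaries_def)
   obtain v where v: "v : nat_trans R L (Term BL m) M" "J m v = b" by (rule J_surj[OF b(1)])
   show "\<exists>v\<in>nat_trans R L (Term BL m) M. J (Suc m) u = J (Suc m) (?d v)"
    by (rule bexI[OF _ v(1)]) (simp only: b(2) J_\<delta>[OF v(1)] v(2))
  next
   assume "\<exists>v\<in>nat_trans R L (Term BL m) M. J (Suc m) u = J (Suc m) (?d v)"
   then obtain v where v: "v : nat_trans R L (Term BL m) M" "J (Suc m) u = J (Suc m) (?d v)" by blast
   show "J (Suc m) u : CC.invariant_coboundaries (Suc m)"
    unfolding v(2) J_\<delta>[OF v(1)] CC.invariant_coboundaries_def using J_invariants[OF v(1)] by simp
  qed
  also have "\<dots> \<longleftrightarrow> (\<exists>v\<in>nat_trans R L (Term BL m) M. u = ?d v)"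
   by (intro bex_cong refl iffI J_inj[OF un dn]) simp_all
  finally show ?thesis unfolding Suc coboundaries_def by auto
 qed
 \<comment> \<open>Everything so far uses the bar resolution of \<open>L\<close>; here it is
   exchanged for the chosen one that defines \<open>cohomology\<close>.\<close>
 obtain \<kappa>0 where q: "quotient_map R ?A (coboundaries R L BL M n) \<kappa>0 (cohomology R L M n)"
  unfolding cohomology_def by (rule resolution_indep[OF R L M BL_projective chosen_resolution[OF R L]])
 show ?thesis
  by (rule exI, rule quotient_map_transport[OF q mB homr bij]) (use cob in simp)
qed

theorem coefficient_spectral_sequence:
 assumes EE: "!!q p. quotient_map R (cochains R D Y (H q) p) (coboundaries R D Y (H q) p) (\<xi> q p) (EE q p)"
 obtains E d where "first_quadrant_spectral_sequence R E d"
  "!!i j. E 2 (int i) (int j) = EE j i" "converges_to R E (cohomology R L M)"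
proof -
 obtain \<eta> where "!!n. quotient_map R (hom_mod R D (Term Y 0) (K n) <| CC.invariant_cocycles n)
   (CC.invariant_coboundaries n) (\<eta> n) (cohomology R L M n)"
  using first_column by metis
 from CC.hypercohomology_spectral_sequence[OF this EE] that show thesis by blast
qed

end

end

section \<open>Cohomology of the comma categories\<close>

lemma Union_cls:
 assumes "cochain_setup R C A X M" "f : cocycles R C X M n" "!!g. g : cls R C X M n f ==> F g = F f"
 shows "(\<Union>g\<in>cls R C X M n f. F g) = F f"
 using cochain_setup.cls_self[OF assms(1,2)] assms(3) by blast

lemma id_nat: "right_module R C N ==> pointwise C N (%x a. a) : nat_trans R C N N"
 by (rule nat_transI[OF _ mod_hom_id]) auto

lemma (in comparison_setup) pull_id:
 assumes \<tau>: "comparison_map R C X Y \<Phi> \<phi> \<tau>" and f: "f : nat_trans R D (Term Y n) N"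
 shows "pointwise C (Term X n) (%x a. pointwise C (restrict_mod \<Phi> \<phi> N) (%x a. a) x (f (\<Phi> x) (\<tau> n x a))) =
  pointwise C (Term X n) (%x a. f (\<Phi> x) (\<tau> n x a))"
 using nat_closed[OF f functor_Obj[OF F] compare_closed[OF \<tau>]]
 by (intro ext) (simp add: pointwise_def)

text \<open>Exposes the comparison map hidden in the definition of \<open>pullback_map\<close>.
  Nothing is known about it, but uniqueness makes any comparison map as good as any other.\<close>

lemma pullback_cls:
 assumes R: "cring R" and C: "category C" and D: "category D" and F: "is_functor C D \<Phi> \<phi>" and N: "right_module R D N"
  and f: "f : cocycles R D (chosen_resolution R D) N n"
 obtains \<tau> where "comparison_map R C (chosen_resolution R C) (chosen_resolution R D) \<Phi> \<phi> \<tau>"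
  "pointwise C (Term (chosen_resolution R C) n) (%x a. f (\<Phi> x) (\<tau> n x a)) \<in>
   cocycles R C (chosen_resolution R C) (restrict_mod \<Phi> \<phi> N) n"
  "pullback_map R C D \<Phi> \<phi> N n (cls R D (chosen_resolution R D) N n f) =
   cls R C (chosen_resolution R C) (restrict_mod \<Phi> \<phi> N) n (pointwise C (Term (chosen_resolution R C) n) (%x a. f (\<Phi> x) (\<tau> n x a)))"
proof -
 let ?X = "chosen_resolution R C" and ?Y = "chosen_resolution R D"
 note cX = chosen_resolution[OF R C] and cY = projective_resolves[OF const_mod_module[OF R] chosen_resolution[OF R D]]
 interpret S: comparison_setup R C D \<Phi> \<phi> ?X ?Y by (rule comparison_setup.intro[OF R C F cX cY])
 interpret Y: cochain_setup R D "const_mod R" ?Y N by (rule cochain_setup.intro[OF R cY N])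
 let ?\<tau> = "SOME \<tau>. comparison_map R C ?X ?Y \<Phi> \<phi> \<tau>"
 have \<tau>: "comparison_map R C ?X ?Y \<Phi> \<phi> ?\<tau>"
  using S.comparison_exists someI_ex[of "comparison_map R C ?X ?Y \<Phi> \<phi>"] by metis
 note iN = restrict_module[OF F N]
 note fn = Y.cocycles_nat[OF f]
 let ?F = "%f. cls R C ?X (restrict_mod \<Phi> \<phi> N) n (pointwise C (Term ?X n) (%x a. f (\<Phi> x) (?\<tau> n x a)))"
 have "?F g = ?F f" if g: "g : cls R D ?Y N n f" for g
  using S.pull_cls_cong[OF N iN id_nat[OF iN] \<tau> f g] unfolding S.pull_id[OF \<tau> fn] S.pull_id[OF \<tau> Y.cocycles_nat[OF Y.cls_mem(1)[OF f g]]] .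
 from Union_cls[where F = ?F, OF Y.cochain_setup_axioms f this]
 have "pullback_map R C D \<Phi> \<phi> N n (cls R D ?Y N n f) = ?F f"
  unfolding pullback_map_def Let_def cls_def[symmetric] .
 thus thesis
  using that[OF \<tau>] S.pull_cocycle[OF N iN id_nat[OF iN] \<tau> f] unfolding S.pull_id[OF \<tau> fn] by blast
qed

lemma coefficient_cls:
 assumes R: "cring R" and C: "category C" and N: "right_module R C N" and N': "right_module R C N'"
  and \<eta>: "pointwise C N \<eta> : nat_trans R C N N'" and f: "f : cocycles R C (chosen_resolution R C) N n"
 shows "coefficient_map R C N' \<eta> n (cls R C (chosen_resolution R C) N n f) =
  cls R C (chosen_resolution R C) N' n (pointwise C (Term (chosen_resolution R C) n) (%x a. \<eta> x (f x a)))"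
proof -
 let ?X = "chosen_resolution R C"
 note cX = chosen_resolution[OF R C]
 note X' = projective_resolves[OF const_mod_module[OF R] cX]
 interpret S: comparison_setup R C C "%x. x" "%_ _ f. f" ?X ?X by (rule comparison_setup.intro[OF R C functor_id cX X'])
 interpret X: cochain_setup R C "const_mod R" ?X N by (rule cochain_setup.intro[OF R X' N])
 let ?F = "%f. cls R C ?X N' n (pointwise C (Term ?X n) (%x a. \<eta> x (f x a)))"
 have e: "pointwise C (Term ?X n) (%x a. pointwise C N \<eta> x (g x (pointwise C (Term ?X n) (%x a. a) x a))) =
  pointwise C (Term ?X n) (%x a. \<eta> x (g x a))" if "g : cocycles R C ?X N n" for g
  using nat_closed[OF X.cocycles_nat[OF that]] by (intro ext) (simp add: pointwise_def)
 have "?F g = ?F f" if g: "g : cls R C ?X N n f" for g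
  using S.pull_cls_cong[OF N N' _ comparison_id[OF X'] f g, unfolded restrict_mod_id, OF \<eta>]
  unfolding e[OF f] e[OF X.cls_mem(1)[OF f g]] .
 from Union_cls[where F = ?F, OF X.cochain_setup_axioms f this] show ?thesis
  unfolding coefficient_map_def Let_def cls_def[symmetric] .
qed

text \<open>The passage from a linking system to the orbit category in abstract form:
  \<open>G Q\<close> acts simply transitively, by composition with \<open>\<epsilon> Q\<close>, on
  the set of morphisms of \<open>L\<close> over a given morphism of \<open>D\<close> to
  \<open>Q\<close>.\<close>

locale group_over = functor_over R L D \<rho> M
 for R :: "'r ring" and L :: "('o, 'm) cat" and D :: "('o, 'd) cat" and \<rho> :: "'o => 'o => 'm => 'd"
  and M :: "('o, 'm, 'r, 'x) cmod" +
 fixes G :: "'o => (unit, 'g) cat" and \<epsilon> :: "'o => 'g => 'm"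
 assumes G: "P : Obj L ==> category (G P)" and Obj_G: "P : Obj L ==> Obj (G P) = {()}"
  and \<epsilon>: "P : Obj L ==> is_functor (G P) L (%_. P) (%_ _. \<epsilon> P)"
  and \<rho>_\<epsilon>: "P : Obj L ==> g : Hom (G P) () () ==> \<rho> P P (\<epsilon> P g) = Ident D P"
  and \<rho>_surj: "P : Obj L ==> Q : Obj L ==> \<Phi> : Hom D P Q ==> \<exists>f\<in>Hom L P Q. \<rho> P Q f = \<Phi>"
  and transitive: "P : Obj L ==> Q : Obj L ==> f : Hom L P Q ==> f' : Hom L P Q ==> \<rho> P Q f = \<rho> P Q f' ==>
   \<exists>g\<in>Hom (G Q) () (). f' = Comp L P Q Q (\<epsilon> Q g) f"
  and free: "P : Obj L ==> Q : Obj L ==> f : Hom L P Q ==> g : Hom (G Q) () () ==> h : Hom (G Q) () () ==>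
   Comp L P Q Q (\<epsilon> Q g) f = Comp L P Q Q (\<epsilon> Q h) f ==> g = h"
begin

abbreviation "N P \<equiv> restrict_mod (%_::unit. P) (%_ _. \<epsilon> P) M"
abbreviation "ch P \<equiv> chosen_resolution R (G P)"
abbreviation "pt P \<equiv> (%_::unit. (P, Ident D P))"

lemma \<epsilon>_Hom: "P : Obj L ==> g : Hom (G P) () () ==> \<epsilon> P g : Hom L P P"
 using functor_Hom[OF \<epsilon>] by (simp add: Obj_G)

lemma \<epsilon>_Ident: "P : Obj L ==> \<epsilon> P (Ident (G P) ()) = Ident L P"
 using functor_Ident[OF \<epsilon>] by (simp add: Obj_G)

lemma \<epsilon>_Comp: "P : Obj L ==> g : Hom (G P) () () ==> h : Hom (G P) () () ==>
 \<epsilon> P (Comp (G P) () () () h g) = Comp L P P P (\<epsilon> P h) (\<epsilon> P g)"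
 using functor_Comp[OF \<epsilon>] by (simp add: Obj_G)

lemma pt_functor: "P : Obj L ==> is_functor (G P) (comma P) (pt P) (%_ _. \<epsilon> P)"
 by (simp add: is_functor_def Obj_G comma_simps \<epsilon>_Hom \<epsilon>_Ident \<epsilon>_Comp \<rho>_\<epsilon> D_Ident D_right)

lemma N_module: "P : Obj L ==> right_module R (G P) (N P)"
 by (rule restrict_module[OF \<epsilon> M])

lemma restrict_JM: "restrict_mod (%_::unit. (P, \<Phi>)) (%_ _. \<epsilon> P) JM = N P"
 by (simp add: restrict_mod_def)

lemma ch_projective: "P : Obj L ==> projective_resolution R (G P) (const_mod R) (ch P)"
 by (rule chosen_resolution[OF R G])

lemma ch_resolves: "P : Obj L ==> resolves R (G P) (const_mod R) (ch P)"
 by (rule projective_resolves[OF const_mod_module[OF R] ch_projective])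

section \<open>Restriction to the group, and the retraction of the comma category onto it\<close>

definition \<tau> where
 "\<tau> P = (SOME \<tau>. comparison_map R (G P) (ch P) (BC P) (pt P) (%_ _. \<epsilon> P) \<tau>)"

lemma \<tau>: assumes P: "P : Obj L" shows "comparison_map R (G P) (ch P) (BC P) (pt P) (%_ _. \<epsilon> P) (\<tau> P)"
proof -
 interpret comparison_setup R "G P" "comma P" "pt P" "%_ _. \<epsilon> P" "ch P" "BC P"
  by (rule comparison_setup.intro[OF R G[OF P] pt_functor[OF P] ch_projective[OF P] BC_resolves[OF P]])
 have "\<exists>\<tau>. comparison_map R (G P) (ch P) (BC P) (pt P) (%_ _. \<epsilon> P) \<tau>" using comparison_exists by blast
 thus ?thesis unfolding \<tau>_def by (rule someI_ex)
qed

definition pullG where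
 "pullG q P f = pointwise (G P) (Term (ch P) q) (%y a. f (P, Ident D P) (\<tau> P q y a))"

text \<open>Restriction to the object \<open>(P, Ident D P)\<close>, whose endomorphisms in the
  comma category form the group, expressed in the chosen resolution of that group.\<close>

definition \<kappa> where
 "\<kappa> q P f = cls R (G P) (ch P) (N P) q (pullG q P f)"

text \<open>A preimage under \<open>\<rho>\<close> of the morphism that places \<open>x\<close> over
  \<open>P\<close>. At the object of the group the identity is taken, so that the retraction is
  strict there.\<close>

definition lift :: "'o => 'o \<times> 'd => 'm" where
 "lift P x = (if x = (P, Ident D P) then Ident L P else SOME f. f : Hom L (fst x) P \<and> \<rho> (fst x) P f = snd x)"

lemma lift:
 assumes "P : Obj L" "x : Obj (comma P)"
 shows "lift P x : Hom L (fst x) P" "\<rho> (fst x) P (lift P x) = snd x"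
proof -
 obtain y \<mu> where x: "x = (y, \<mu>)" by (cases x)
 have "\<exists>f. f : Hom L y P \<and> \<rho> y P f = \<mu>" using \<rho>_surj[of y P \<mu>] assms x by (auto simp: comma_simps)
 from someI_ex[OF this] show "lift P x : Hom L (fst x) P" "\<rho> (fst x) P (lift P x) = snd x"
  using assms by (auto simp: lift_def x Ident_Hom[OF L] \<rho>_Ident)
qed

text \<open>\<open>lift P x\<close>, and \<open>lift P y\<close> after \<open>f\<close>, lie over
  the same morphism of \<open>D\<close>, so they differ by exactly one group element. Its uniqueness
  is what makes the assignment a functor.\<close>

definition rel :: "'o => 'o \<times> 'd => 'o \<times> 'd => 'm => 'g" where
 "rel P x y f = (SOME g. g : Hom (G P) () () \<and>
  Comp L (fst x) P P (\<epsilon> P g) (lift P x) = Comp L (fst x) (fst y) P (lift P y) f)"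

lemma rel:
 assumes "P : Obj L" "x : Obj (comma P)" "y : Obj (comma P)" "f : Hom (comma P) x y"
 shows "rel P x y f : Hom (G P) () ()" "Comp L (fst x) P P (\<epsilon> P (rel P x y f)) (lift P x) = Comp L (fst x) (fst y) P (lift P y) f"
proof -
 have o: "fst x : Obj L" "fst y : Obj L" "f : Hom L (fst x) (fst y)" "Comp D (fst x) (fst y) P (snd y) (\<rho> (fst x) (fst y) f) = snd x"
  using assms by (cases x; cases y; simp add: comma_simps)+
 note lx = lift[OF assms(1,2)] and ly = lift[OF assms(1,3)]
 have "\<rho> (fst x) P (Comp L (fst x) (fst y) P (lift P y) f) = snd x"
  using \<rho>_Comp[OF o(1,2) assms(1) o(3) ly(1)] ly(2) o(4) by simp
 hence "\<exists>g. g : Hom (G P) () () \<and> Comp L (fst x) P P (\<epsilon> P g) (lift P x) = Comp L (fst x) (fst y) P (lift P y) f"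
  using transitive[OF o(1) assms(1) lx(1) Comp_Hom[OF L o(1,2) assms(1) o(3) ly(1)]] lx(2) by auto
 from someI_ex[OF this] show "rel P x y f : Hom (G P) () ()"
  "Comp L (fst x) P P (\<epsilon> P (rel P x y f)) (lift P x) = Comp L (fst x) (fst y) P (lift P y) f"
  unfolding rel_def by blast+
qed

lemma rel_unique:
 assumes "P : Obj L" "x : Obj (comma P)" "y : Obj (comma P)" "f : Hom (comma P) x y" "g : Hom (G P) () ()"
  "Comp L (fst x) P P (\<epsilon> P g) (lift P x) = Comp L (fst x) (fst y) P (lift P y) f"
 shows "rel P x y f = g"
 using free[OF functor_Obj[OF fst_functor assms(2)] assms(1) lift(1)[OF assms(1,2)] rel(1)[OF assms(1-4)] assms(5)]
  rel(2)[OF assms(1-4)] assms(6) by simp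

lemma comma_cases:
 assumes "x : Obj (comma P)" shows "fst x : Obj L"
 using functor_Obj[OF fst_functor assms] .

lemma rel_functor:
 assumes P: "P : Obj L" shows "is_functor (comma P) (G P) (%_. ()) (rel P)"
proof -
 note C = comma_category[OF P]
 have 1: "rel P x x (Ident (comma P) x) = Ident (G P) ()" if x: "x : Obj (comma P)" for x
 proof (rule rel_unique[OF P x x Ident_Hom[OF C x]])
  show "Ident (G P) () : Hom (G P) () ()" using Ident_Hom[OF G[OF P]] by (simp add: Obj_G[OF P])
  have "Ident (comma P) x = Ident L (fst x)" by (simp add: comma_def)
  thus "Comp L (fst x) P P (\<epsilon> P (Ident (G P) ())) (lift P x) = Comp L (fst x) (fst x) P (lift P x) (Ident (comma P) x)"
   using comma_cases[OF x] lift(1)[OF P x] P by (simp add: \<epsilon>_Ident Comp_Ident_left[OF L] Comp_Ident_right[OF L])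
 qed
 have 2: "rel P x z (Comp (comma P) x y z g f) = Comp (G P) () () () (rel P y z g) (rel P x y f)"
  if *: "x : Obj (comma P)" "y : Obj (comma P)" "z : Obj (comma P)" "f : Hom (comma P) x y" "g : Hom (comma P) y z" for x y z f g
 proof (rule rel_unique[OF P *(1,3) Comp_Hom[OF C *]])
  note rf = rel[OF P *(1,2,4)] and rg = rel[OF P *(2,3,5)]
  note o = comma_cases[OF *(1)] comma_cases[OF *(2)] comma_cases[OF *(3)]
  note l = lift(1)[OF P *(1)] lift(1)[OF P *(2)] lift(1)[OF P *(3)]
  have h: "f : Hom L (fst x) (fst y)" "g : Hom L (fst y) (fst z)" using *(4,5) by (simp_all add: comma_def)
  show "Comp (G P) () () () (rel P y z g) (rel P x y f) : Hom (G P) () ()"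
   using Comp_Hom[OF G[OF P]] rf(1) rg(1) by (simp add: Obj_G[OF P])
  have "Comp L (fst x) P P (\<epsilon> P (Comp (G P) () () () (rel P y z g) (rel P x y f))) (lift P x) =
   Comp L (fst x) P P (\<epsilon> P (rel P y z g)) (Comp L (fst x) P P (\<epsilon> P (rel P x y f)) (lift P x))"
   using Comp_assoc[OF L o(1) P P P l(1) \<epsilon>_Hom[OF P rf(1)] \<epsilon>_Hom[OF P rg(1)]] \<epsilon>_Comp[OF P rf(1) rg(1)] by simp
  also have "\<dots> = Comp L (fst x) (fst y) P (Comp L (fst y) P P (\<epsilon> P (rel P y z g)) (lift P y)) f"
   using rf(2) Comp_assoc[OF L o(1,2) P P h(1) l(2) \<epsilon>_Hom[OF P rg(1)]] by simp
  also have "\<dots> = Comp L (fst x) (fst z) P (lift P z) (Comp L (fst x) (fst y) (fst z) g f)"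
   using rg(2) Comp_assoc[OF L o P h l(3)] by simp
  finally show "Comp L (fst x) P P (\<epsilon> P (Comp (G P) () () () (rel P y z g) (rel P x y f))) (lift P x) =
   Comp L (fst x) (fst z) P (lift P z) (Comp (comma P) x y z g f)"
   by (simp add: comma_def)
 qed
 show ?thesis unfolding is_functor_def using 1 2 rel(1)[OF P] by (simp add: Obj_G[OF P])
qed

lemma pt_Obj: "P : Obj L ==> (P, Ident D P) : Obj (comma P)"
 by (simp add: comma_simps D_Ident)

text \<open>The retraction is \<open>rel\<close>, and the morphisms \<open>lift P\<close> form a
  natural transformation from the identity to the retraction followed by the inclusion of the
  group.\<close>

lemma \<kappa>_quotient_map:
 assumes P: "P : Obj L"
 shows "quotient_map R (cochains R (comma P) (BC P) JM q) (coboundaries R (comma P) (BC P) JM q) (\<kappa> q P)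
  (cohomology R (G P) (N P) q)"
proof -
 have 1: "rel P (P, Ident D P) (P, Ident D P) (\<epsilon> P g) = g" if g: "g : Hom (G P) () ()" for g
  by (rule rel_unique[OF P pt_Obj[OF P] pt_Obj[OF P] _ g])
   (insert functor_Hom[OF pt_functor[OF P]] \<epsilon>_Hom[OF P g] P g, simp_all add: Obj_G lift_def Comp_Ident_left[OF L] Comp_Ident_right[OF L])
 have lift_comma: "lift P x : Hom (comma P) x (P, Ident D P)" if x: "x : Obj (comma P)" for x
  using lift[OF P x] x P by (cases x) (simp add: comma_simps D_left)
 have \<theta>: "natural_in (comma P) (comma P) (%x. x) (%_ _ f. f) (%x. pt P ()) (%x y f. \<epsilon> P (rel P x y f)) (lift P)"
  unfolding natural_in_def
 proof (intro conjI ballI)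
  fix x y f assume *: "x : Obj (comma P)" "y : Obj (comma P)" "f : Hom (comma P) x y"
  show "Comp (comma P) x (pt P ()) (pt P ()) (\<epsilon> P (rel P x y f)) (lift P x) = Comp (comma P) x y (pt P ()) (lift P y) f"
   using rel(2)[OF P *] by (simp add: comma_def)
 qed (use lift_comma in simp)
 from retract_quotient_map[OF R comma_category[OF P] G[OF P] BC_projective[OF P] ch_projective[OF P] pt_functor[OF P] rel_functor[OF P] _ _ \<theta> _ JM_module \<tau>[OF P], of q]
 show ?thesis
  unfolding restrict_JM \<kappa>_def[abs_def] pullG_def cohomology_def
  using 1 by (simp add: Obj_G[OF P] lift_def comma_def)
qed

text \<open>\<open>\<phi>\<close> stands for a morphism of the fusion system and
  \<open>\<psi>\<close> for a lift of it to \<open>L\<close>. The equation has the form of axiom (4)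
  of a linking system and makes \<open>act M P Q \<psi>\<close> equivariant along
  \<open>\<phi>\<close>.\<close>

definition compat :: "'o => 'o => ('g => 'g) => 'm => bool" where
 "compat P Q \<phi> \<psi> \<longleftrightarrow> is_functor (G P) (G Q) (%_. ()) (%_ _. \<phi>) \<and> \<psi> : Hom L P Q \<and>
  (\<forall>g\<in>Hom (G P) () (). Comp L P P Q \<psi> (\<epsilon> P g) = Comp L P Q Q (\<epsilon> Q (\<phi> g)) \<psi>)"

section \<open>Naturality of the restriction to groups\<close>

lemma pullG_cocycle:
 assumes P: "P : Obj L" and f: "f : cocycles R (comma P) (BC P) JM q"
 shows "pullG q P f : cocycles R (G P) (ch P) (N P) q"
proof -
 interpret S: comparison_setup R "G P" "comma P" "pt P" "%_ _. \<epsilon> P" "ch P" "BC P"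
  by (rule comparison_setup.intro[OF R G[OF P] pt_functor[OF P] ch_projective[OF P] BC_resolves[OF P]])
 note iN = N_module[OF P, folded restrict_JM[of P "Ident D P"]]
 show ?thesis
  using S.pull_cocycle[OF JM_module iN id_nat[OF iN] \<tau>[OF P] f]
   S.pull_id[OF \<tau>[OF P] cochain_setup.cocycles_nat[OF cochain_comma[OF P] f]]
  by (simp add: restrict_JM pullG_def)
qed

text \<open>Both sides restrict \<open>f\<close> to the object \<open>(P, \<rho> P Q \<psi>)\<close>
  over \<open>Q\<close>, by different comparison maps. One, \<open>\<alpha>\<close>, passes through
  the resolution for \<open>Q\<close> and acts by \<open>\<psi>\<close>, viewed as a morphism to
  \<open>(Q, Ident D Q)\<close>; the other, \<open>\<beta>\<close>, passes through the comma
  category of \<open>P\<close>. Uniqueness identifies them in cohomology.\<close>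

lemma \<kappa>_natural:
 assumes P: "P : Obj L" and Q: "Q : Obj L" and c: "compat P Q \<phi> \<psi>"
  and \<sigma>: "comparison_map R (G P) (ch P) (ch Q) (%_. ()) (%_ _. \<phi>) \<sigma>" and f: "f : cocycles R (comma Q) (BC Q) JM q"
 shows "cls R (G P) (ch P) (N P) q (pointwise (G P) (Term (ch P) q) (%y a. act M P Q \<psi> (pullG q Q f () (\<sigma> q y a)))) =
  \<kappa> q P (act (K q) P Q (\<rho> P Q \<psi>) f)"
proof -
 let ?\<Phi> = "\<rho> P Q \<psi>"
 have \<psi>: "\<psi> : Hom L P Q" and \<phi>: "is_functor (G P) (G Q) (%_. ()) (%_ _. \<phi>)" using c by (simp_all add: compat_def)
 have \<Phi>: "?\<Phi> : Hom D P Q" by (rule \<rho>_Hom[OF P Q \<psi>])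
 note fn = cochain_setup.cocycles_nat[OF cochain_comma[OF Q] f]
 let ?k = "%_::unit. (P, ?\<Phi>)"
 have ov: "over P Q ?\<Phi> (P, Ident D P) = (P, ?\<Phi>)" using D_right[OF P Q \<Phi>] by (simp add: over_def)
 have k: "is_functor (G P) (comma Q) ?k (%_ _. \<epsilon> P)"
  using functor_comp[OF pt_functor[OF P] over_functor[OF P Q \<Phi>]] by (simp add: ov)
 have oP: "(P, ?\<Phi>) : Obj (comma Q)" using P \<Phi> by (simp add: comma_simps)
 have \<psi>c: "\<psi> : Hom (comma Q) (P, ?\<Phi>) (Q, Ident D Q)" using \<psi> D_left[OF P Q \<Phi>] by (simp add: comma_simps)
 have k': "is_functor (G P) (comma Q) (%_. pt Q ()) (%_ _ g. \<epsilon> Q (\<phi> g))" by (rule functor_comp[OF \<phi> pt_functor[OF Q]])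
 have nat: "natural_in (G P) (comma Q) ?k (%_ _. \<epsilon> P) (%_. pt Q ()) (%_ _ g. \<epsilon> Q (\<phi> g)) (%_. \<psi>)"
  using c \<psi>c by (simp add: natural_in_def Obj_G[OF P] comma_simps compat_def)
 interpret S: comparison_setup R "G P" "comma Q" ?k "%_ _. \<epsilon> P" "ch P" "BC Q"
  by (rule comparison_setup.intro[OF R G[OF P] k ch_projective[OF P] BC_resolves[OF Q]])
 define \<alpha> where "\<alpha> n = pointwise (G P) (Term (ch P) n) (%y a. act (Term (BC Q) n) (P, ?\<Phi>) (Q, Ident D Q) \<psi>
  (pointwise (G P) (Term (ch P) n) (%y a. \<tau> Q n () (\<sigma> n y a)) y a))" for n
 define \<beta> where "\<beta> n = pointwise (G P) (Term (ch P) n) (%y a. pointwise (comma P) (Term (BC P) n) (%_. push R (shift P Q ?\<Phi>))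
  (P, Ident D P) (\<tau> P n y a))" for n
 have \<alpha>: "comparison_map R (G P) (ch P) (BC Q) ?k (%_ _. \<epsilon> P) \<alpha>"
  using comparison_twist[OF k k' nat ch_resolves[OF P] BC_resolves[OF Q] comparison_comp[OF \<phi> ch_resolves[OF P] \<sigma> \<tau>[OF Q]]]
  unfolding \<alpha>_def .
 have \<beta>: "comparison_map R (G P) (ch P) (BC Q) ?k (%_ _. \<epsilon> P) \<beta>"
  using comparison_comp[OF pt_functor[OF P] ch_resolves[OF P] \<tau>[OF P] shift_comparison[OF P Q \<Phi>]]
  unfolding \<beta>_def ov .
 have iN: "right_module R (G P) (restrict_mod ?k (%_ _. \<epsilon> P) JM)" unfolding restrict_JM by (rule N_module[OF P])
 have u: "cls R (G P) (ch P) (N P) q (pointwise (G P) (Term (ch P) q) (%y a. f (P, ?\<Phi>) (\<alpha> q y a))) =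
  cls R (G P) (ch P) (N P) q (pointwise (G P) (Term (ch P) q) (%y a. f (P, ?\<Phi>) (\<beta> q y a)))"
  using S.pull_unique[OF JM_module iN id_nat[OF iN] \<alpha> \<beta> f] unfolding S.pull_id[OF \<alpha> fn] S.pull_id[OF \<beta> fn] unfolding restrict_JM .
 have "pointwise (G P) (Term (ch P) q) (%y a. f (P, ?\<Phi>) (\<alpha> q y a)) =
  pointwise (G P) (Term (ch P) q) (%y a. act M P Q \<psi> (pullG q Q f () (\<sigma> q y a)))"
 proof -
  have "f (P, ?\<Phi>) (\<alpha> q y a) = act M P Q \<psi> (pullG q Q f () (\<sigma> q y a))" if ya: "y : Obj (G P)" "a : el (Term (ch P) q) y" for y a
  proof -
   have s: "\<sigma> q y a : el (Term (ch Q) q) ()" using compare_closed[OF \<sigma> ya] .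
   have t: "\<tau> Q q () (\<sigma> q y a) : el (Term (BC Q) q) (Q, Ident D Q)"
    using compare_closed[OF \<tau>[OF Q] _ s] by (simp add: Obj_G[OF Q])
   show ?thesis
    using nat_act[OF fn oP pt_Obj[OF Q] \<psi>c t] ya s by (simp add: \<alpha>_def pullG_def Obj_G[OF Q] restrict_simps)
  qed
  thus ?thesis unfolding pointwise_def by (intro ext) simp
 qed
 moreover have "pointwise (G P) (Term (ch P) q) (%y a. f (P, ?\<Phi>) (\<beta> q y a)) = pullG q P (act (K q) P Q ?\<Phi> f)"
 proof -
  have "f (P, ?\<Phi>) (\<beta> q y a) = act (K q) P Q ?\<Phi> f (P, Ident D P) (\<tau> P q y a)" if ya: "y : Obj (G P)" "a : el (Term (ch P) q) y" for y a
  proof -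
   note t = compare_closed[OF \<tau>[OF P] ya]
   show ?thesis using K_act_apply[OF pt_Obj[OF P] t, of Q ?\<Phi> f] ya t pt_Obj[OF P] by (simp add: \<beta>_def ov)
  qed
  thus ?thesis unfolding pullG_def pointwise_def by (intro ext) simp
 qed
 ultimately show ?thesis using u unfolding \<kappa>_def by simp
qed

lemma composite_\<kappa>:
 assumes P: "P : Obj L" and Q: "Q : Obj L" and c: "compat P Q \<phi> \<psi>" and f: "f : cocycles R (comma Q) (BC Q) JM q"
 shows "coefficient_map R (G P) (N P) (%_. act M P Q \<psi>) q (pullback_map R (G P) (G Q) (%_. ()) (%_ _. \<phi>) (N Q) q (\<kappa> q Q f)) =
  \<kappa> q P (act (K q) P Q (\<rho> P Q \<psi>) f)"
proof -
 have \<psi>: "\<psi> : Hom L P Q" and \<phi>: "is_functor (G P) (G Q) (%_. ()) (%_ _. \<phi>)" using c by (simp_all add: compat_def)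
 let ?\<Phi>N = "restrict_mod (%_. ()) (%_ _. \<phi>) (N Q)"
 obtain \<sigma> where \<sigma>: "comparison_map R (G P) (ch P) (ch Q) (%_. ()) (%_ _. \<phi>) \<sigma>"
  "pointwise (G P) (Term (ch P) q) (%x a. pullG q Q f () (\<sigma> q x a)) : cocycles R (G P) (ch P) ?\<Phi>N q"
  "pullback_map R (G P) (G Q) (%_. ()) (%_ _. \<phi>) (N Q) q (\<kappa> q Q f) =
   cls R (G P) (ch P) ?\<Phi>N q (pointwise (G P) (Term (ch P) q) (%x a. pullG q Q f () (\<sigma> q x a)))"
  unfolding \<kappa>_def by (rule pullback_cls[OF R G[OF P] G[OF Q] \<phi> N_module[OF Q] pullG_cocycle[OF Q f]])
 have \<Phi>N: "?\<Phi>N = restrict_mod (%_. Q) (%_ _ g. \<epsilon> Q (\<phi> g)) M" by (simp add: restrict_mod_def)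
 have "natural_in (G P) L (%_. P) (%_ _. \<epsilon> P) (%_. Q) (%_ _ g. \<epsilon> Q (\<phi> g)) (%_. \<psi>)"
  using c by (simp add: natural_in_def Obj_G[OF P] compat_def)
 from twist_nat[OF \<epsilon>[OF P] functor_comp[OF \<phi> \<epsilon>[OF Q]] this M]
 have \<eta>: "pointwise (G P) ?\<Phi>N (%_. act M P Q \<psi>) : nat_trans R (G P) ?\<Phi>N (N P)" unfolding \<Phi>N .
 have "coefficient_map R (G P) (N P) (%_. act M P Q \<psi>) q (pullback_map R (G P) (G Q) (%_. ()) (%_ _. \<phi>) (N Q) q (\<kappa> q Q f)) =
  cls R (G P) (ch P) (N P) q (pointwise (G P) (Term (ch P) q)
   (%x a. act M P Q \<psi> (pointwise (G P) (Term (ch P) q) (%x a. pullG q Q f () (\<sigma> q x a)) x a)))"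
  unfolding \<sigma>(3) by (rule coefficient_cls[OF R G[OF P] restrict_module[OF \<phi> N_module[OF Q]] N_module[OF P] \<eta> \<sigma>(2)])
 also have "pointwise (G P) (Term (ch P) q) (%x a. act M P Q \<psi> (pointwise (G P) (Term (ch P) q) (%x a. pullG q Q f () (\<sigma> q x a)) x a)) =
  pointwise (G P) (Term (ch P) q) (%y a. act M P Q \<psi> (pullG q Q f () (\<sigma> q y a)))"
  by (intro ext) (simp add: pointwise_def)
 finally show ?thesis using \<kappa>_natural[OF P Q c \<sigma>(1) f] by simp
qed

lemma K_act_cocycle:
 assumes "P : Obj L" "Q : Obj L" "\<Phi> : Hom D P Q" "f : cocycles R (comma Q) (BC Q) JM q"
 shows "act (K q) P Q \<Phi> f : cocycles R (comma P) (BC P) JM q"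
proof -
 have f: "f : el (K q) Q" "\<delta> q Q f = \<zero>[val (K (Suc q)) Q]" using K_cocycles[OF assms(2), of q] assms(4) by blast+
 note c = K_act_nat[OF assms(1-3) f(1)]
 have "\<delta> q P (act (K q) P Q \<Phi> f) = \<zero>[val (K (Suc q)) P]"
  using nat_act[OF \<delta>_nat, unfolded Obj_D, OF assms(1-3) f(1)] f(2)
   hom_zero[OF K_val_module[OF assms(2)] K_val_module[OF assms(1)] act_hom[OF K_module, unfolded Obj_D, OF assms(1-3)]] by simp
 thus ?thesis using \<delta>_zero_iff[OF assms(1) c] by simp
qed

section \<open>The coefficient functors as modules, and the spectral sequence\<close>

context
 fixes H :: "nat => ('o, 'd, 'r, (unit => ((unit \<times> 'g) list => 'r) => 'x) set) cmod"
 assumes val_H: "!!q P. P : Obj L ==> val (H q) P = cohomology R (G P) (N P) q"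
  and act_H: "!!q P Q \<Phi> f. P : Obj L ==> Q : Obj L ==> \<Phi> : Hom D P Q ==> f : cocycles R (comma Q) (BC Q) JM q ==>
   act (H q) P Q \<Phi> (\<kappa> q Q f) = \<kappa> q P (act (K q) P Q \<Phi> f)"
begin

text \<open>Every class is some \<open>\<kappa> q Q f\<close>, and on such classes the action is
  that of the module \<open>K q\<close>; so all laws descend.\<close>

lemma H_module: "right_module R D (H q)"
proof (rule right_moduleI, unfold Obj_D)
 let ?Z = "%P. cocycles R (comma P) (BC P) JM q"
 have cZ: "carrier (cochains R (comma P) (BC P) JM q) = ?Z P" for P by simp
 have surj: "\<exists>f\<in>?Z P. u = \<kappa> q P f" if "P : Obj L" "u : el (H q) P" for P u
  using quotD(4)[OF \<kappa>_quotient_map[OF that(1), of q]] that by (auto simp: val_H)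
 have \<kappa>h: "\<kappa> q P : mod_hom R (cochains R (comma P) (BC P) JM q) (val (H q) P)" if "P : Obj L" for P
  using quotD(3)[OF \<kappa>_quotient_map[OF that, of q]] that by (simp add: val_H)
 have op: "f +[cochains R (comma P) (BC P) JM q] g = f +[val (K q) P] g"
  "r *[cochains R (comma P) (BC P) JM q] f = r *[val (K q) P] f" for P f g r by (simp_all add: K_simps)
 have Zm: "module R (cochains R (comma P) (BC P) JM q)" if "P : Obj L" for P
  by (rule cochain_setup.cochains_module[OF cochain_comma[OF that]])
 have KZ: "f : el (K q) P" if "P : Obj L" "f : ?Z P" for P f
  using K_cocycles[OF that(1), of q] that(2) by blast
 show "module R (val (H q) P)" if "P : Obj L" for P
  using quotD(2)[OF \<kappa>_quotient_map[OF that, of q]] that by (simp add: val_H)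
 show "act (H q) P Q \<Phi> : mod_hom R (val (H q) Q) (val (H q) P)" if *: "P : Obj L" "Q : Obj L" "\<Phi> : Hom D P Q" for P Q \<Phi>
 proof (rule mod_homI)
  interpret ZQ: module R "cochains R (comma Q) (BC Q) JM q" by (rule Zm[OF *(2)])
  note a = K_act_cocycle[OF *] and h = act_hom[OF K_module, unfolded Obj_D, OF *]
  fix u assume "u : el (H q) Q"
  with surj[OF *(2)] obtain f where f: "f : ?Z Q" "u = \<kappa> q Q f" by blast
  show "act (H q) P Q \<Phi> u : el (H q) P"
   unfolding f(2) act_H[OF * f(1)] using hom_closed[OF \<kappa>h[OF *(1)]] a[OF f(1)] by simp
  show "act (H q) P Q \<Phi> (r *[val (H q) Q] u) = r *[val (H q) P] act (H q) P Q \<Phi> u" if r: "r : carrier R" for r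
  proof -
   have "r *[val (H q) Q] u = \<kappa> q Q (r *[val (K q) Q] f)"
    unfolding f(2) op(2)[symmetric] by (rule hom_smult[OF \<kappa>h[OF *(2)] r, symmetric]) (simp add: f(1))
   moreover have "r *[val (K q) Q] f : ?Z Q" using ZQ.smult_closed[OF r, unfolded cZ, OF f(1)] unfolding op(2) .
   ultimately have "act (H q) P Q \<Phi> (r *[val (H q) Q] u) = \<kappa> q P (r *[val (K q) P] act (K q) P Q \<Phi> f)"
    using act_H[OF *] hom_smult[OF h r KZ[OF *(2) f(1)]] by simp
   also have "\<dots> = r *[val (H q) P] \<kappa> q P (act (K q) P Q \<Phi> f)"
    unfolding op(2)[symmetric] by (rule hom_smult[OF \<kappa>h[OF *(1)] r]) (simp add: a[OF f(1)])
   finally show ?thesis unfolding f(2) act_H[OF * f(1)] .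
  qed
  fix v assume "v : el (H q) Q"
  with surj[OF *(2)] obtain g where g: "g : ?Z Q" "v = \<kappa> q Q g" by blast
  have "u +[val (H q) Q] v = \<kappa> q Q (f +[val (K q) Q] g)"
   unfolding f(2) g(2) op(1)[symmetric] by (rule hom_add[OF \<kappa>h[OF *(2)], symmetric]) (simp_all add: f(1) g(1))
  moreover have "f +[val (K q) Q] g : ?Z Q" using ZQ.M.a_closed[unfolded cZ, OF f(1) g(1)] unfolding op(1) .
  ultimately have "act (H q) P Q \<Phi> (u +[val (H q) Q] v) = \<kappa> q P (act (K q) P Q \<Phi> f +[val (K q) P] act (K q) P Q \<Phi> g)"
   using act_H[OF *] hom_add[OF h KZ[OF *(2) f(1)] KZ[OF *(2) g(1)]] by simp
  also have "\<dots> = \<kappa> q P (act (K q) P Q \<Phi> f) +[val (H q) P] \<kappa> q P (act (K q) P Q \<Phi> g)"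
   unfolding op(1)[symmetric] by (rule hom_add[OF \<kappa>h[OF *(1)]]) (simp_all add: a[OF f(1)] a[OF g(1)])
  finally show "act (H q) P Q \<Phi> (u +[val (H q) Q] v) = act (H q) P Q \<Phi> u +[val (H q) P] act (H q) P Q \<Phi> v"
   unfolding f(2) g(2) act_H[OF * f(1)] act_H[OF * g(1)] .
 qed
 show "act (H q) P P (Ident D P) u = u" if *: "P : Obj L" "u : el (H q) P" for P u
 proof -
  from surj[OF *] obtain f where f: "f : ?Z P" "u = \<kappa> q P f" by blast
  show ?thesis unfolding f(2) act_H[OF *(1,1) D_Ident[OF *(1)] f(1)] act_Ident[OF K_module, unfolded Obj_D, OF *(1) KZ[OF *(1) f(1)]] ..
 qed
 show "act (H q) P W (Comp D P Q W \<Psi> \<Phi>) u = act (H q) P Q \<Phi> (act (H q) Q W \<Psi> u)"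
  if *: "P : Obj L" "Q : Obj L" "W : Obj L" "\<Phi> : Hom D P Q" "\<Psi> : Hom D Q W" "u : el (H q) W" for P Q W \<Phi> \<Psi> u
 proof -
  from surj[OF *(3,6)] obtain f where f: "f : ?Z W" "u = \<kappa> q W f" by blast
  show ?thesis
   unfolding f(2) act_H[OF *(2,3,5) f(1)] act_H[OF *(1,2,4) K_act_cocycle[OF *(2,3,5) f(1)]]
    act_H[OF *(1,3) D_Comp[OF *(1-5)] f(1)] act_Comp[OF K_module, unfolded Obj_D, OF *(1-5) KZ[OF *(3) f(1)]] ..
 qed
qed

theorem group_spectral_sequence:
 obtains E d where "first_quadrant_spectral_sequence R E d"
  "!!i j. E 2 (int i) (int j) = cohomology R D (H j) i" "converges_to R E (cohomology R L M)"
proof -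
 let ?Y = "bar.resolution R D"
 note Y = bar.projective_resolution[OF bar.intro[OF R D]]
 have "coefficient_complex R D (?Y) K \<delta> H \<kappa>"
 proof (rule coefficient_complex.intro, unfold Obj_D)
  show "cring R" "category D" "projective_resolution R D (const_mod R) (?Y)" by (fact R D Y)+
  show "right_module R D (K q)" "\<delta> q : nat_trans R D (K q) (K (Suc q))" "right_module R D (H q)" for q
   by (fact K_module \<delta>_nat H_module)+
  show "\<delta> (Suc q) P (\<delta> q P u) = \<zero>[val (K (Suc (Suc q))) P]" if "P : Obj L" "u : el (K q) P" for P q u
   by (rule \<delta>_\<delta>[OF that])
  show "quotient_map R (val (K q) P <| {u : el (K q) P. \<delta> q P u = \<zero>[val (K (Suc q)) P]})
   (case q of 0 => {\<zero>[val (K 0) P]} | Suc m => \<delta> m P ` el (K m) P) (\<kappa> q P) (val (H q) P)" if "P : Obj L" for P q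
   unfolding K_cocycles[OF that] K_coboundaries[OF that] val_H[OF that] unfolding K_simps by (rule \<kappa>_quotient_map[OF that])
  show "\<kappa> q P (act (K q) P Q \<Phi> u) = act (H q) P Q \<Phi> (\<kappa> q Q u)"
   if *: "P : Obj L" "Q : Obj L" "\<Phi> : Hom D P Q" "u : el (K q) Q" "\<delta> q Q u = \<zero>[val (K (Suc q)) Q]" for P Q \<Phi> q u
   using act_H[OF *(1-3)] \<delta>_zero_iff[OF *(2,4)] *(5) by simp
  show "\<exists>g'\<in>nat_trans R D (Term (?Y) p) (K q).
   g = pointwise D (Term (?Y) (Suc p)) (%x a. g' x (Bd (?Y) p x a))"
   if "g : nat_trans R D (Term (?Y) (Suc p)) (K q)"
    "!!x a. x : Obj L ==> a : el (Term (?Y) (Suc (Suc p))) x ==>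
     g x (Bd (?Y) (Suc p) x a) = \<zero>[val (K q) x]" for g p q
   by (rule rows_exact[OF that(1)]) (insert that(2), simp add: Obj_D)
 qed
 note cc = this
 \<comment> \<open>The second page arises from the bar resolution of \<open>D\<close>; independence
   of the resolution allows \<open>cohomology\<close> itself, with its chosen resolution, as the
   model.\<close>
 have "\<exists>\<xi>. quotient_map R (cochains R D ?Y (H q) n) (coboundaries R D ?Y (H q) n) \<xi> (cohomology R D (H q) n)" for q n
  unfolding cohomology_def using resolution_indep[OF R D H_module Y chosen_resolution[OF R D]] by blast
 then obtain \<xi> where "!!q n. quotient_map R (cochains R D ?Y (H q) n) (coboundaries R D ?Y (H q) n) (\<xi> q n) (cohomology R D (H q) n)"
  by metis
 from coefficient_spectral_sequence[OF cc this] that show thesis by blast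
qed

end

end

section \<open>Orbit categories and linking systems\<close>

locale linked_fusion_system =
 fixes p :: nat and S :: "'a monoid" and F :: "'a set => 'a set => ('a => 'a) set"
  and L :: "('a set, 'l) cat" and \<epsilon> :: "'a set => 'a set => 'a => 'l" and \<pi> :: "'a set => 'a set => 'l => 'a => 'a"
 assumes p_local: "p_local_finite_group p S F L \<epsilon> \<pi>"
begin

abbreviation "X \<equiv> centrics S F"

lemma fusion: "fusion_system p S F" and linking: "linking_system S F L \<epsilon> \<pi>"
 using p_local by (simp_all add: p_local_finite_group_def)

sublocale S: group S
 using fusion by (simp add: fusion_system_def)

lemma L: "category L" and Obj_L: "Obj L = X" and \<epsilon>_functor: "is_functor (transporter_cat S F) L (%P. P) \<epsilon>"
 and \<pi>_functor: "is_functor L (centric_cat S F) (%P. P) \<pi>"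
 using linking by (simp_all add: linking_system_def)

lemma linkingD:
 assumes "P : X" "Q : X"
 shows \<epsilon>_inj: "inj_on (\<epsilon> P Q) (transporter S P Q)"
  and \<pi>_image: "\<pi> P Q ` Hom L P Q = F P Q"
  and \<epsilon>_free: "\<psi> : Hom L P Q ==> g : P ==> Comp L P P Q \<psi> (\<epsilon> P P g) = \<psi> ==> \<epsilon> P P g = Ident L P"
  and \<pi>_eq_iff: "\<psi> : Hom L P Q ==> \<psi>' : Hom L P Q ==> \<pi> P Q \<psi> = \<pi> P Q \<psi>' \<longleftrightarrow>
   (\<exists>z\<in>P \<inter> centralizer_in S P. \<psi>' = Comp L P P Q \<psi> (\<epsilon> P P z))"
  and \<pi>_\<epsilon>: "g : transporter S P Q ==> \<pi> P Q (\<epsilon> P Q g) = restrict (conj_by S g) P"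
  and slide: "\<psi> : Hom L P Q ==> g : P ==> Comp L P P Q \<psi> (\<epsilon> P P g) = Comp L P Q Q (\<epsilon> Q Q (\<pi> P Q \<psi> g)) \<psi>"
proof -
 have *: "\<forall>P\<in>X. \<forall>Q\<in>X.
    inj_on (\<epsilon> P Q) (transporter S P Q) \<and>
    \<pi> P Q ` Hom L P Q = F P Q \<and>
    (\<forall>\<psi>\<in>Hom L P Q. \<forall>g\<in>P. Comp L P P Q \<psi> (\<epsilon> P P g) = \<psi> --> \<epsilon> P P g = Ident L P) \<and>
    (\<forall>\<psi>\<in>Hom L P Q. \<forall>\<psi>'\<in>Hom L P Q. \<pi> P Q \<psi> = \<pi> P Q \<psi>' \<longleftrightarrow>
     (\<exists>z\<in>P \<inter> centralizer_in S P. \<psi>' = Comp L P P Q \<psi> (\<epsilon> P P z))) \<and>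
    (\<forall>g\<in>transporter S P Q. \<pi> P Q (\<epsilon> P Q g) = restrict (conj_by S g) P) \<and>
    (\<forall>\<psi>\<in>Hom L P Q. \<forall>g\<in>P.
     Comp L P P Q \<psi> (\<epsilon> P P g) = Comp L P Q Q (\<epsilon> Q Q (\<pi> P Q \<psi> g)) \<psi>)"
  using linking unfolding linking_system_def Obj_L by (elim conjE)
 note b = bspec[OF bspec[OF * assms(1)] assms(2)]
 show "inj_on (\<epsilon> P Q) (transporter S P Q)" "\<pi> P Q ` Hom L P Q = F P Q" using b by (simp_all only:)
 show "\<psi> : Hom L P Q ==> g : P ==> Comp L P P Q \<psi> (\<epsilon> P P g) = \<psi> ==> \<epsilon> P P g = Ident L P" using b by blast
 show "\<psi> : Hom L P Q ==> \<psi>' : Hom L P Q ==> \<pi> P Q \<psi> = \<pi> P Q \<psi>' \<longleftrightarrow>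
   (\<exists>z\<in>P \<inter> centralizer_in S P. \<psi>' = Comp L P P Q \<psi> (\<epsilon> P P z))" using b by blast
 show "g : transporter S P Q ==> \<pi> P Q (\<epsilon> P Q g) = restrict (conj_by S g) P" using b by blast
 show "\<psi> : Hom L P Q ==> g : P ==> Comp L P P Q \<psi> (\<epsilon> P P g) = Comp L P Q Q (\<epsilon> Q Q (\<pi> P Q \<psi> g)) \<psi>" using b by blast
qed

lemma X_subgroup: "P : X ==> subgroup P S"
 by (simp add: centrics_def)

lemma X_carrier: "P : X ==> x : P ==> x : carrier S"
 using X_subgroup subgroup.mem_carrier by metis

lemma fusionD:
 assumes "P : X" "Q : X"
 shows "Hom_conj S P Q \<subseteq> F P Q" "F P Q \<subseteq> Inj_hom S P Q" "\<phi> : F P Q ==> \<phi> : isos (fusion_cat S F) P (\<phi> ` P)"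
 using fusion X_subgroup[OF assms(1)] X_subgroup[OF assms(2)] by (simp_all add: fusion_system_def)

lemma F_map:
 assumes "P : X" "Q : X" "\<phi> : F P Q"
 shows F_ext: "\<phi> : extensional P" and F_closed: "x : P ==> \<phi> x : Q"
  and F_mult: "x : P ==> y : P ==> \<phi> (x \<otimes>\<^bsub>S\<^esub> y) = \<phi> x \<otimes>\<^bsub>S\<^esub> \<phi> y"
 using fusionD(2)[OF assms(1,2)] assms(3) by (auto simp: Inj_hom_def mon_def hom_def)

lemma F_one:
 assumes "P : X" "Q : X" "\<phi> : F P Q"
 shows "\<phi> \<one>\<^bsub>S\<^esub> = \<one>\<^bsub>S\<^esub>"
proof -
 have o: "\<one>\<^bsub>S\<^esub> : P" using X_subgroup[OF assms(1)] subgroup.one_closed by blast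
 have c: "\<phi> \<one>\<^bsub>S\<^esub> : carrier S" using X_carrier[OF assms(2) F_closed[OF assms o]] .
 have "\<phi> \<one>\<^bsub>S\<^esub> \<otimes>\<^bsub>S\<^esub> \<phi> \<one>\<^bsub>S\<^esub> = \<phi> \<one>\<^bsub>S\<^esub>" using F_mult[OF assms o o] by simp
 thus ?thesis using c S.l_cancel_one by blast
qed

lemma F_inv:
 assumes "P : X" "Q : X" "\<phi> : F P Q" "x : P"
 shows "\<phi> (inv\<^bsub>S\<^esub> x) = inv\<^bsub>S\<^esub> (\<phi> x)"
proof -
 have i: "inv\<^bsub>S\<^esub> x : P" using subgroup.m_inv_closed[OF X_subgroup[OF assms(1)] assms(4)] .
 note c = X_carrier[OF assms(1,4)]
 have "\<phi> (inv\<^bsub>S\<^esub> x) \<otimes>\<^bsub>S\<^esub> \<phi> x = \<one>\<^bsub>S\<^esub>"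
  using F_mult[OF assms(1-3) i assms(4)] F_one[OF assms(1-3)] c by simp
 thus ?thesis
  using S.inv_equality X_carrier[OF assms(2)] F_closed[OF assms(1-3)] i assms(4) by metis
qed

lemma conj_conj: "x : carrier S ==> y : carrier S ==> z : carrier S ==>
 conj_by S y (conj_by S z x) = conj_by S (y \<otimes>\<^bsub>S\<^esub> z) x"
 by (simp add: conj_by_def S.m_assoc S.inv_mult_group)

lemma conj_one: "x : carrier S ==> conj_by S \<one>\<^bsub>S\<^esub> x = x"
 by (simp add: conj_by_def)

lemma conj_closed: "Q : X ==> x : Q ==> y : Q ==> conj_by S y x : Q"
 using X_subgroup[of Q] by (simp add: conj_by_def subgroup.m_closed subgroup.m_inv_closed)

lemma transporter_self: "Q : X ==> y : Q ==> y : transporter S Q Q"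
 using conj_closed X_carrier by (auto simp: transporter_def)

lemma F_conj:
 assumes "P : X" "Q : X" "\<phi> : F P Q" "x : P" "y : P"
 shows "\<phi> (conj_by S y x) = conj_by S (\<phi> y) (\<phi> x)"
 using assms X_subgroup[OF assms(1)] F_mult[OF assms(1-3)] F_inv[OF assms(1-3)]
 by (simp add: conj_by_def subgroup.m_closed subgroup.m_inv_closed)

lemma fusion_category: "category (fusion_cat S F)"
 using fusion by (simp add: fusion_system_def)

lemma F_id: "P : X ==> (\<lambda>x\<in>P. x) : F P P"
 using Ident_Hom[OF fusion_category, of P] X_subgroup[of P] by (simp add: fusion_cat_def)

lemma F_compose: "P : X ==> Q : X ==> W : X ==> \<phi> : F P Q ==> \<psi> : F Q W ==> compose P \<psi> \<phi> : F P W"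
 using Comp_Hom[OF fusion_category, of P Q W \<phi> \<psi>] X_subgroup by (simp add: fusion_cat_def)

lemma compose_apply: "compose P \<psi> \<phi> = (\<lambda>x\<in>P. \<psi> (\<phi> x))"
 by (simp add: compose_def)

section \<open>The orbit category\<close>

lemma orbit_F:
 assumes "P : X" "Q : X" "\<phi> : F P Q"
 shows "Inn_orbit S P Q \<phi> \<subseteq> F P Q"
proof
 fix \<phi>' assume "\<phi>' : Inn_orbit S P Q \<phi>"
 then obtain y where y: "y : Q" "\<phi>' = compose P (conj_by S y) \<phi>" by (auto simp: Inn_orbit_def)
 have "restrict (conj_by S y) Q : F Q Q"
  using fusionD(1)[OF assms(2,2)] transporter_self[OF assms(2) y(1)] by (auto simp: Hom_conj_def)
 hence "compose P (restrict (conj_by S y) Q) \<phi> : F P Q" by (rule F_compose[OF assms(1,2,2,3)])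
 moreover have "compose P (restrict (conj_by S y) Q) \<phi> = \<phi>'"
  unfolding y(2) compose_apply using F_closed[OF assms] by (intro restrict_ext) simp
 ultimately show "\<phi>' : F P Q" by simp
qed

lemma orbit_self:
 assumes "P : X" "Q : X" "\<phi> : F P Q"
 shows "\<phi> : Inn_orbit S P Q \<phi>"
proof -
 have "compose P (conj_by S \<one>\<^bsub>S\<^esub>) \<phi> = \<phi>"
 proof (rule extensionalityI[of _ P])
  show "compose P (conj_by S \<one>\<^bsub>S\<^esub>) \<phi> : extensional P" by (simp add: compose_apply)
  show "\<phi> : extensional P" by (rule F_ext[OF assms])
  show "compose P (conj_by S \<one>\<^bsub>S\<^esub>) \<phi> x = \<phi> x" if "x : P" for x
   using that conj_one[OF X_carrier[OF assms(2) F_closed[OF assms that]]] by (simp add: compose_apply)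
 qed
 moreover have "\<one>\<^bsub>S\<^esub> : Q" using X_subgroup[OF assms(2)] subgroup.one_closed by blast
 ultimately show ?thesis unfolding Inn_orbit_def by (metis imageI)
qed

lemma conj_compose:
 assumes "P : X" "Q : X" "\<phi> : F P Q" "y : Q" "z : Q"
 shows "compose P (conj_by S z) (compose P (conj_by S y) \<phi>) = compose P (conj_by S (z \<otimes>\<^bsub>S\<^esub> y)) \<phi>"
 unfolding compose_apply
 by (intro restrict_ext)
  (simp add: conj_conj[OF X_carrier[OF assms(2) F_closed[OF assms(1-3)]] X_carrier[OF assms(2,5)] X_carrier[OF assms(2,4)]])

lemma orbit_eq:
 assumes "P : X" "Q : X" "\<phi> : F P Q" "\<phi>' : Inn_orbit S P Q \<phi>"
 shows "Inn_orbit S P Q \<phi>' = Inn_orbit S P Q \<phi>"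
proof -
 obtain y where y: "y : Q" "\<phi>' = compose P (conj_by S y) \<phi>" using assms(4) by (auto simp: Inn_orbit_def)
 note sQ = X_subgroup[OF assms(2)] and cQ = X_carrier[OF assms(2)]
 show ?thesis
 proof (intro equalityI subsetI)
  fix \<chi> assume "\<chi> : Inn_orbit S P Q \<phi>'"
  then obtain z where z: "z : Q" "\<chi> = compose P (conj_by S z) \<phi>'" by (auto simp: Inn_orbit_def)
  have "\<chi> = compose P (conj_by S (z \<otimes>\<^bsub>S\<^esub> y)) \<phi>" unfolding z(2) y(2) by (rule conj_compose[OF assms(1-3) y(1) z(1)])
  thus "\<chi> : Inn_orbit S P Q \<phi>" unfolding Inn_orbit_def using subgroup.m_closed[OF sQ z(1) y(1)] by simp
 next
  fix \<chi> assume "\<chi> : Inn_orbit S P Q \<phi>"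
  then obtain z where z: "z : Q" "\<chi> = compose P (conj_by S z) \<phi>" by (auto simp: Inn_orbit_def)
  let ?w = "z \<otimes>\<^bsub>S\<^esub> inv\<^bsub>S\<^esub> y"
  have w: "?w : Q" using subgroup.m_closed[OF sQ z(1) subgroup.m_inv_closed[OF sQ y(1)]] .
  have "?w \<otimes>\<^bsub>S\<^esub> y = z" using cQ[OF z(1)] cQ[OF y(1)] by (simp add: S.m_assoc)
  hence "\<chi> = compose P (conj_by S ?w) \<phi>'" unfolding z(2) y(2) using conj_compose[OF assms(1-3) y(1) w] by simp
  thus "\<chi> : Inn_orbit S P Q \<phi>'" unfolding Inn_orbit_def using w by simp
 qed
qed

lemma orbit_comp:
 assumes "P : X" "Q : X" "W : X" "\<phi> : F P Q" "\<psi> : F Q W"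
 shows "Comp (orbit_cat S F) P Q W (Inn_orbit S Q W \<psi>) (Inn_orbit S P Q \<phi>) = Inn_orbit S P W (compose P \<psi> \<phi>)"
proof -
 have "{compose P \<psi>' \<phi>' | \<psi>' \<phi>'. \<psi>' : Inn_orbit S Q W \<psi> \<and> \<phi>' : Inn_orbit S P Q \<phi>} = Inn_orbit S P W (compose P \<psi> \<phi>)"
 proof (intro equalityI subsetI)
  fix \<chi> assume "\<chi> : {compose P \<psi>' \<phi>' | \<psi>' \<phi>'. \<psi>' : Inn_orbit S Q W \<psi> \<and> \<phi>' : Inn_orbit S P Q \<phi>}"
  then obtain w y where *: "w : W" "y : Q" "\<chi> = compose P (compose Q (conj_by S w) \<psi>) (compose P (conj_by S y) \<phi>)"
   by (auto simp: Inn_orbit_def)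
  note py = F_closed[OF assms(2,3,5) *(2)]
  have "\<chi> = compose P (conj_by S (w \<otimes>\<^bsub>S\<^esub> \<psi> y)) (compose P \<psi> \<phi>)"
   unfolding *(3) compose_apply
  proof (intro restrict_ext)
   fix x assume x: "x : P"
   note fx = F_closed[OF assms(1,2,4) x]
   show "restrict (%x. conj_by S w (\<psi> x)) Q (restrict (%x. conj_by S y (\<phi> x)) P x) =
    conj_by S (w \<otimes>\<^bsub>S\<^esub> \<psi> y) (restrict (%x. \<psi> (\<phi> x)) P x)"
    using x conj_closed[OF assms(2) fx *(2)] F_conj[OF assms(2,3,5) fx *(2)]
     conj_conj[OF X_carrier[OF assms(3) F_closed[OF assms(2,3,5) fx]] X_carrier[OF assms(3) *(1)] X_carrier[OF assms(3) py]] by simp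
  qed
  thus "\<chi> : Inn_orbit S P W (compose P \<psi> \<phi>)"
   unfolding Inn_orbit_def using subgroup.m_closed[OF X_subgroup[OF assms(3)] *(1) py] by simp
 next
  fix \<chi> assume "\<chi> : Inn_orbit S P W (compose P \<psi> \<phi>)"
  then obtain w where w: "w : W" "\<chi> = compose P (conj_by S w) (compose P \<psi> \<phi>)" by (auto simp: Inn_orbit_def)
  have "\<chi> = compose P (compose Q (conj_by S w) \<psi>) \<phi>"
   unfolding w(2) compose_apply using F_closed[OF assms(1,2,4)] by (intro restrict_ext) simp
  moreover have "compose Q (conj_by S w) \<psi> : Inn_orbit S Q W \<psi>" using w(1) by (simp add: Inn_orbit_def)
  ultimately show "\<chi> : {compose P \<psi>' \<phi>' | \<psi>' \<phi>'. \<psi>' : Inn_orbit S Q W \<psi> \<and> \<phi>' : Inn_orbit S P Q \<phi>}"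
   using orbit_self[OF assms(1,2,4)] by blast
 qed
 thus ?thesis by (simp add: orbit_cat_def)
qed

abbreviation "OC \<equiv> orbit_cat S F"

lemma O_simps: "Obj OC = X" "Hom OC P Q = Inn_orbit S P Q ` F P Q" "Ident OC P = Inn_orbit S P P (\<lambda>x\<in>P. x)"
 by (simp_all add: orbit_cat_def)

lemma compose_id:
 assumes "P : X" "Q : X" "\<phi> : F P Q"
 shows "compose P \<phi> (\<lambda>x\<in>P. x) = \<phi>" "compose P (\<lambda>x\<in>Q. x) \<phi> = \<phi>"
proof -
 show "compose P \<phi> (\<lambda>x\<in>P. x) = \<phi>"
  by (rule extensionalityI[OF _ F_ext[OF assms]]) (simp_all add: compose_apply)
 show "compose P (\<lambda>x\<in>Q. x) \<phi> = \<phi>"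
  by (rule extensionalityI[OF _ F_ext[OF assms]]) (simp_all add: compose_apply F_closed[OF assms])
qed

lemma orbit_category: "category OC"
 unfolding category_def O_simps(1)
proof (intro conjI ballI)
 show "Ident OC P : Hom OC P P" if "P : X" for P using F_id[OF that] by (simp add: O_simps)
 show "Comp OC P Q W \<Psi> \<Phi> : Hom OC P W" if *: "P : X" "Q : X" "W : X" "\<Phi> : Hom OC P Q" "\<Psi> : Hom OC Q W" for P Q W \<Phi> \<Psi>
  using *(4,5) orbit_comp[OF *(1-3)] F_compose[OF *(1-3)] by (auto simp: O_simps)
 show "Comp OC P P Q \<Phi> (Ident OC P) = \<Phi>" if *: "P : X" "Q : X" "\<Phi> : Hom OC P Q" for P Q \<Phi>
  using *(3) orbit_comp[OF *(1,1,2) F_id[OF *(1)]] compose_id(1)[OF *(1,2)] by (auto simp: O_simps)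
 show "Comp OC P Q Q (Ident OC Q) \<Phi> = \<Phi>" if *: "P : X" "Q : X" "\<Phi> : Hom OC P Q" for P Q \<Phi>
  using *(3) orbit_comp[OF *(1,2,2) _ F_id[OF *(2)]] compose_id(2)[OF *(1,2)] by (auto simp: O_simps)
 show "Comp OC V Q W \<Omega> (Comp OC V P Q \<Psi> \<Phi>) = Comp OC V P W (Comp OC P Q W \<Omega> \<Psi>) \<Phi>"
  if *: "V : X" "P : X" "Q : X" "W : X" "\<Phi> : Hom OC V P" "\<Psi> : Hom OC P Q" "\<Omega> : Hom OC Q W" for V P Q W \<Phi> \<Psi> \<Omega>
 proof -
  obtain \<phi> \<psi> \<omega> where f: "\<phi> : F V P" "\<Phi> = Inn_orbit S V P \<phi>" "\<psi> : F P Q" "\<Psi> = Inn_orbit S P Q \<psi>" "\<omega> : F Q W" "\<Omega> = Inn_orbit S Q W \<omega>"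
   using *(5-7) by (auto simp: O_simps)
  have "compose V \<omega> (compose V \<psi> \<phi>) = compose V (compose P \<omega> \<psi>) \<phi>"
   unfolding compose_apply using F_closed[OF *(1,2) f(1)] by (intro restrict_ext) simp
  thus ?thesis
   unfolding f(2,4,6) orbit_comp[OF *(1-3) f(1,3)] orbit_comp[OF *(2-4) f(3,5)]
    orbit_comp[OF *(1,3,4) F_compose[OF *(1-3) f(1,3)] f(5)] orbit_comp[OF *(1,2,4) f(1) F_compose[OF *(2-4) f(3,5)]] by simp
 qed
qed

lemma \<pi>_F: "P : X ==> Q : X ==> f : Hom L P Q ==> \<pi> P Q f : F P Q"
 using \<pi>_image[of P Q] by blast

lemma \<pi>_Comp: "P : X ==> Q : X ==> W : X ==> f : Hom L P Q ==> g : Hom L Q W ==>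
 \<pi> P W (Comp L P Q W g f) = compose P (\<pi> Q W g) (\<pi> P Q f)"
 using functor_Comp[OF \<pi>_functor, unfolded Obj_L, of P Q W f g] by (simp add: centric_cat_def full_subcat_def fusion_cat_def)

lemma \<pi>_Ident: "P : X ==> \<pi> P P (Ident L P) = (\<lambda>x\<in>P. x)"
 using functor_Ident[OF \<pi>_functor, unfolded Obj_L, of P] by (simp add: centric_cat_def full_subcat_def fusion_cat_def)

section \<open>Fibres of the linking system over the orbit category\<close>

abbreviation "orb P Q f \<equiv> Inn_orbit S P Q (\<pi> P Q f)"

lemma orb_functor: "is_functor L OC (%P. P) orb"
 by (simp add: is_functor_def Obj_L O_simps \<pi>_Ident \<pi>_F \<pi>_Comp orbit_comp)

lemma \<epsilon>_Hom: "P : X ==> g : P ==> \<epsilon> P P g : Hom L P P"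
 using functor_Hom[OF \<epsilon>_functor, of P P g] transporter_self[of P g] by (simp add: transporter_cat_def)

lemma \<epsilon>_one: "P : X ==> \<epsilon> P P \<one>\<^bsub>S\<^esub> = Ident L P"
 using functor_Ident[OF \<epsilon>_functor, of P] by (simp add: transporter_cat_def)

lemma \<epsilon>_mult: "P : X ==> g : P ==> h : P ==> \<epsilon> P P (h \<otimes>\<^bsub>S\<^esub> g) = Comp L P P P (\<epsilon> P P h) (\<epsilon> P P g)"
 using functor_Comp[OF \<epsilon>_functor, of P P P g h] transporter_self[of P g] transporter_self[of P h] by (simp add: transporter_cat_def)

lemma sub_cat_simps: "Obj (sub_cat S P) = {()}" "Hom (sub_cat S P) u v = P" "Comp (sub_cat S P) u v w = monoid.mult S"
 "Ident (sub_cat S P) u = \<one>\<^bsub>S\<^esub>"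
 by (simp_all add: sub_cat_def group_cat_def)

lemma sub_cat_category: "P : X ==> category (sub_cat S P)"
 using X_subgroup[of P] X_carrier[of P]
 by (simp add: category_def sub_cat_simps subgroup.one_closed subgroup.m_closed S.m_assoc)

lemma sub_cat_functor: "P : X ==> is_functor (sub_cat S P) L (%_. P) (%_ _. \<epsilon> P P)"
 by (simp add: is_functor_def sub_cat_simps Obj_L \<epsilon>_Hom \<epsilon>_one \<epsilon>_mult)

lemma orb_\<epsilon>: "P : X ==> g : P ==> orb P P (\<epsilon> P P g) = Ident OC P"
proof -
 assume P: "P : X" and g: "g : P"
 have "restrict (conj_by S g) P = compose P (conj_by S g) (\<lambda>x\<in>P. x)"
  unfolding compose_apply by (intro restrict_ext) simp
 hence "restrict (conj_by S g) P : Inn_orbit S P P (\<lambda>x\<in>P. x)" using g by (simp add: Inn_orbit_def)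
 thus ?thesis unfolding O_simps \<pi>_\<epsilon>[OF P P transporter_self[OF P g]] by (rule orbit_eq[OF P P F_id[OF P]])
qed

lemma \<pi>_\<epsilon>_Comp:
 assumes "P : X" "Q : X" "f : Hom L P Q" "y : Q"
 shows "\<pi> P Q (Comp L P Q Q (\<epsilon> Q Q y) f) = compose P (conj_by S y) (\<pi> P Q f)"
 unfolding \<pi>_Comp[OF assms(1,2,2,3) \<epsilon>_Hom[OF assms(2,4)]] \<pi>_\<epsilon>[OF assms(2,2) transporter_self[OF assms(2,4)]] compose_apply
 using F_closed[OF assms(1,2) \<pi>_F[OF assms(1-3)]] by (intro restrict_ext) simp

text \<open>Equality of orbits yields \<open>y\<close> in \<open>Q\<close> such that
  \<open>f'\<close> and \<open>f\<close> followed by \<open>y\<close> agree in the fusion system. By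
  axiom (2) they differ by an element of the centre of \<open>P\<close>, and axiom (4) moves it to
  the other side as an element of \<open>Q\<close>.\<close>

lemma orb_transitive:
 assumes P: "P : X" and Q: "Q : X" and f: "f : Hom L P Q" "f' : Hom L P Q" "orb P Q f = orb P Q f'"
 shows "\<exists>g\<in>Q. f' = Comp L P Q Q (\<epsilon> Q Q g) f"
proof -
 have "\<pi> P Q f' : orb P Q f" using orbit_self[OF P Q \<pi>_F[OF P Q f(2)]] f(3) by simp
 then obtain y where y: "y : Q" "\<pi> P Q f' = compose P (conj_by S y) (\<pi> P Q f)" by (auto simp: Inn_orbit_def)
 let ?h = "Comp L P Q Q (\<epsilon> Q Q y) f"
 have h: "?h : Hom L P Q" using Comp_Hom[OF L, unfolded Obj_L, OF P Q Q f(1) \<epsilon>_Hom[OF Q y(1)]] .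
 have "\<pi> P Q ?h = \<pi> P Q f'" using \<pi>_\<epsilon>_Comp[OF P Q f(1) y(1)] y(2) by simp
 then obtain z where z: "z : P" "f' = Comp L P P Q ?h (\<epsilon> P P z)" using \<pi>_eq_iff[OF P Q h f(2)] by blast
 note pz = F_closed[OF P Q \<pi>_F[OF P Q f(1)] z(1)] and eP = \<epsilon>_Hom[OF P z(1)] and eQ = \<epsilon>_Hom[OF Q y(1)]
 have "f' = Comp L P Q Q (\<epsilon> Q Q y) (Comp L P P Q f (\<epsilon> P P z))"
  unfolding z(2) using Comp_assoc[OF L, unfolded Obj_L, OF P P Q Q eP f(1) eQ] by simp
 also have "\<dots> = Comp L P Q Q (\<epsilon> Q Q y) (Comp L P Q Q (\<epsilon> Q Q (\<pi> P Q f z)) f)" using slide[OF P Q f(1) z(1)] by simp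
 also have "\<dots> = Comp L P Q Q (Comp L Q Q Q (\<epsilon> Q Q y) (\<epsilon> Q Q (\<pi> P Q f z))) f"
  by (rule Comp_assoc[OF L, unfolded Obj_L, OF P Q Q Q f(1) \<epsilon>_Hom[OF Q pz] eQ])
 also have "\<dots> = Comp L P Q Q (\<epsilon> Q Q (y \<otimes>\<^bsub>S\<^esub> \<pi> P Q f z)) f" using \<epsilon>_mult[OF Q pz y(1)] by simp
 finally show ?thesis using subgroup.m_closed[OF X_subgroup[OF Q] y(1) pz] by blast
qed

text \<open>An element of \<open>Q\<close> that fixes \<open>f\<close> centralizes the image of \<open>\<pi>(f)\<close>, hence lies in it, as \<open>P\<close> is centric.\<close>

lemma \<epsilon>_fixes:
 assumes P: "P : X" and Q: "Q : X" and f: "f : Hom L P Q" and k: "k : Q" and e: "Comp L P Q Q (\<epsilon> Q Q k) f = f"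
 shows "k = \<one>\<^bsub>S\<^esub>"
proof -
 let ?\<phi> = "\<pi> P Q f"
 note \<phi> = \<pi>_F[OF P Q f]
 note c = F_closed[OF P Q \<phi>] and cS = X_carrier[OF Q F_closed[OF P Q \<phi>]] and kS = X_carrier[OF Q k]
 have "conj_by S k (?\<phi> x) = ?\<phi> x" if "x : P" for x
  using fun_cong[OF \<pi>_\<epsilon>_Comp[OF P Q f k], of x] e that by (simp add: compose_apply)
 hence com: "k \<otimes>\<^bsub>S\<^esub> ?\<phi> x = ?\<phi> x \<otimes>\<^bsub>S\<^esub> k" if "x : P" for x
  using S.inv_solve_right'[OF cS[OF that] S.m_closed[OF kS cS[OF that]] kS] that by (simp add: conj_by_def)
 \<comment> \<open>The image is isomorphic to \<open>P\<close> in the fusion system, so centricity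
   of \<open>P\<close> applies to its centralizer as soon as it is known to be a subgroup.\<close>
 have sub: "subgroup (?\<phi> ` P) S"
 proof (rule S.subgroupI)
  note sP = X_subgroup[OF P]
  show "?\<phi> ` P \<subseteq> carrier S" using cS by blast
  show "?\<phi> ` P \<noteq> {}" using subgroup.one_closed[OF sP] by blast
  show "inv\<^bsub>S\<^esub> a : ?\<phi> ` P" if "a : ?\<phi> ` P" for a
   using that F_inv[OF P Q \<phi>, symmetric] subgroup.m_inv_closed[OF sP] by auto
  show "a \<otimes>\<^bsub>S\<^esub> b : ?\<phi> ` P" if "a : ?\<phi> ` P" "b : ?\<phi> ` P" for a b
   using that F_mult[OF P Q \<phi>, symmetric] subgroup.m_closed[OF sP] by auto
 qed
 have "centralizer_in S (?\<phi> ` P) \<subseteq> ?\<phi> ` P"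
  using P sub fusionD(3)[OF P Q \<phi>] by (auto simp: centrics_def)
 moreover have "k : centralizer_in S (?\<phi> ` P)" using kS com by (auto simp: centralizer_in_def)
 ultimately obtain x where x: "x : P" "k = ?\<phi> x" by blast
 \<comment> \<open>Axiom (4) turns the fixing on the side of \<open>Q\<close> into fixing on the
   side of \<open>P\<close>, where the action is free by axiom (2).\<close>
 have "Comp L P P Q f (\<epsilon> P P x) = f" using slide[OF P Q f x(1)] e x(2) by simp
 hence "\<epsilon> P P x = \<epsilon> P P \<one>\<^bsub>S\<^esub>" using \<epsilon>_free[OF P Q f x(1)] \<epsilon>_one[OF P] by simp
 moreover have "\<one>\<^bsub>S\<^esub> : P" using subgroup.one_closed[OF X_subgroup[OF P]] .
 ultimately have "x = \<one>\<^bsub>S\<^esub>" using inj_onD[OF \<epsilon>_inj[OF P P]] transporter_self[OF P] x(1) by blast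
 thus ?thesis using x(2) F_one[OF P Q \<phi>] by simp
qed

text \<open>Two elements with the same effect on \<open>f\<close> differ by one that fixes
  \<open>f\<close>.\<close>

lemma orb_free:
 assumes P: "P : X" and Q: "Q : X" and f: "f : Hom L P Q" and g: "g : Q" "h : Q"
  and e: "Comp L P Q Q (\<epsilon> Q Q g) f = Comp L P Q Q (\<epsilon> Q Q h) f"
 shows "g = h"
proof -
 note sQ = X_subgroup[OF Q] and gS = X_carrier[OF Q g(1)] and hS = X_carrier[OF Q g(2)]
 have ih: "inv\<^bsub>S\<^esub> h : Q" using subgroup.m_inv_closed[OF sQ g(2)] .
 have k: "inv\<^bsub>S\<^esub> h \<otimes>\<^bsub>S\<^esub> g : Q" using subgroup.m_closed[OF sQ ih g(1)] .
 note as = Comp_assoc[OF L, unfolded Obj_L, OF P Q Q Q f _ \<epsilon>_Hom[OF Q ih]]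
 have "Comp L P Q Q (\<epsilon> Q Q (inv\<^bsub>S\<^esub> h \<otimes>\<^bsub>S\<^esub> g)) f = Comp L P Q Q (\<epsilon> Q Q (inv\<^bsub>S\<^esub> h)) (Comp L P Q Q (\<epsilon> Q Q h) f)"
  using as[OF \<epsilon>_Hom[OF Q g(1)]] \<epsilon>_mult[OF Q g(1) ih] e by simp
 also have "\<dots> = Comp L P Q Q (\<epsilon> Q Q (inv\<^bsub>S\<^esub> h \<otimes>\<^bsub>S\<^esub> h)) f"
  using as[OF \<epsilon>_Hom[OF Q g(2)]] \<epsilon>_mult[OF Q g(2) ih] by simp
 also have "\<dots> = f" using hS \<epsilon>_one[OF Q] Comp_Ident_left[OF L, unfolded Obj_L, OF P Q f] by simp
 finally have "inv\<^bsub>S\<^esub> h \<otimes>\<^bsub>S\<^esub> g = \<one>\<^bsub>S\<^esub>" by (rule \<epsilon>_fixes[OF P Q f k])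
 hence "h \<otimes>\<^bsub>S\<^esub> (inv\<^bsub>S\<^esub> h \<otimes>\<^bsub>S\<^esub> g) = h" using hS by simp
 thus ?thesis using gS hS by (simp add: S.m_assoc[symmetric])
qed

lemma orb_surj:
 assumes "P : X" "Q : X" "\<Phi> : Hom OC P Q"
 shows "\<exists>f\<in>Hom L P Q. orb P Q f = \<Phi>"
proof -
 obtain \<phi> where \<phi>: "\<phi> : F P Q" "\<Phi> = Inn_orbit S P Q \<phi>" using assms(3) by (auto simp: O_simps)
 then obtain f where "f : Hom L P Q" "\<phi> = \<pi> P Q f" unfolding \<pi>_image[OF assms(1,2), symmetric] by blast
 thus ?thesis using \<phi>(2) by blast
qed

lemma group_over:
 assumes "cring R" "right_module R L M"
 shows "group_over R L OC orb M (sub_cat S) (%P. \<epsilon> P P)"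
proof (rule group_over.intro)
 show "functor_over R L OC orb M" by (rule functor_over.intro[OF assms(1) L orbit_category _ orb_functor assms(2)]) (simp add: O_simps Obj_L)
 show "group_over_axioms L OC orb (sub_cat S) (%P. \<epsilon> P P)"
  by (rule group_over_axioms.intro; unfold Obj_L sub_cat_simps)
   (rule sub_cat_category refl sub_cat_functor orb_\<epsilon> orb_surj orb_transitive orb_free; assumption)+
qed

end

theorem theorem1p5:
  fixes R :: "'r ring"
    and p :: nat
    and S :: "'a monoid"
    and F :: "'a set \<Rightarrow> 'a set \<Rightarrow> ('a \<Rightarrow> 'a) set"
    and L :: "('a set, 'l) cat"
    and \<epsilon> :: "'a set \<Rightarrow> 'a set \<Rightarrow> 'a \<Rightarrow> 'l"
    and \<pi> :: "'a set \<Rightarrow> 'a set \<Rightarrow> 'l \<Rightarrow> 'a \<Rightarrow> 'a"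
    and M :: "('a set, 'l, 'r, 'x) cmod"
  assumes "cring R"
    and "p_local_finite_group p S F L \<epsilon> \<pi>"
    and "right_module R L M"
  shows "(\<forall>q. right_module R (orbit_cat S F) (HM R S L \<epsilon> \<pi> M q)) \<and>
    (\<forall>q. \<forall>P\<in>centrics S F. \<forall>Q\<in>centrics S F. \<forall>\<Phi>\<in>Hom (orbit_cat S F) P Q.
       \<forall>\<phi>\<in>\<Phi>. \<forall>\<psi>\<in>Hom L P Q. \<pi> P Q \<psi> = \<phi> \<longrightarrow>
         (\<forall>U\<in>carrier (cohomology R (sub_cat S Q) (Res_j \<epsilon> M Q) q).
            act (HM R S L \<epsilon> \<pi> M q) P Q \<Phi> U = HM_composite R S \<epsilon> M q P Q \<phi> \<psi> U)) \<and>
    (\<exists>E d. first_quadrant_spectral_sequence R E d \<and>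
       (\<forall>i j. E 2 (int i) (int j) = cohomology R (orbit_cat S F) (HM R S L \<epsilon> \<pi> M j) i) \<and>
       converges_to R E (cohomology R L M))"
proof -
 interpret T: linked_fusion_system p S F L \<epsilon> \<pi> by (rule linked_fusion_system.intro[OF assms(2)])
 interpret W: group_over R L "orbit_cat S F" T.orb M "sub_cat S" "%P. \<epsilon> P P" by (rule T.group_over[OF assms(1,3)])
 let ?H = "HM R S L \<epsilon> \<pi> M"
 let ?Z = "%q P. cocycles R (W.comma P) (W.BC P) W.JM q"
 note XL = T.Obj_L
 have Res: "Res_j \<epsilon> M P = W.N P" for P by (simp add: Res_j_def)
 \<comment> \<open>Axiom (4) of the linking system is the equivariance needed here; the rest says
   that a morphism of the fusion system is a homomorphism.\<close>
 have compat: "W.compat P Q (\<pi> P Q \<psi>) \<psi>" if *: "P : T.X" "Q : T.X" "\<psi> : Hom L P Q" for P Q \<psi>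
 proof -
  note \<phi> = T.\<pi>_F[OF *]
  show ?thesis
   using T.slide[OF *] *(3) T.F_one[OF *(1,2) \<phi>] T.F_closed[OF *(1,2) \<phi>] T.F_mult[OF *(1,2) \<phi>]
   by (simp add: W.compat_def is_functor_def T.sub_cat_simps)
 qed
 have comp: "HM_composite R S \<epsilon> M q P Q (\<pi> P Q \<psi>) \<psi> (W.\<kappa> q Q f) = W.\<kappa> q P (act (W.K q) P Q (T.orb P Q \<psi>) f)"
  if *: "P : T.X" "Q : T.X" "\<psi> : Hom L P Q" "f : ?Z q Q" for P Q \<psi> q f
  unfolding HM_composite_def Res by (rule W.composite_\<kappa>[unfolded XL, OF *(1,2) compat[OF *(1-3)] *(4)])
 have orb: "T.orb P Q \<psi> = \<Phi>" if *: "P : T.X" "Q : T.X" "\<Phi> : Hom (orbit_cat S F) P Q" "\<psi> : Hom L P Q" "\<pi> P Q \<psi> : \<Phi>" for P Q \<Phi> \<psi>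
  using *(3,5) T.orbit_eq[OF *(1,2)] by (auto simp: T.O_simps)
 \<comment> \<open>The choices made in \<open>HM\<close> are unfolded once. The resulting class
   depends on the chosen lift only through its orbit, which is \<open>\<Phi>\<close> whatever the
   choice.\<close>
 have act: "act (?H q) P Q \<Phi> (W.\<kappa> q Q f) = W.\<kappa> q P (act (W.K q) P Q \<Phi> f)"
  if *: "P : T.X" "Q : T.X" "\<Phi> : Hom (orbit_cat S F) P Q" "f : ?Z q Q" for P Q \<Phi> q f
 proof -
  define \<phi> where "\<phi> = (SOME \<phi>. \<phi> : \<Phi>)"
  define \<psi> where "\<psi> = (SOME \<psi>. \<psi> : Hom L P Q \<and> \<pi> P Q \<psi> = \<phi>)"
  obtain \<phi>0 where \<phi>0: "\<phi>0 : F P Q" "\<Phi> = Inn_orbit S P Q \<phi>0" using *(3) by (auto simp: T.O_simps)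
  have \<phi>: "\<phi> : \<Phi>" unfolding \<phi>_def using someI[of "%\<phi>. \<phi> : \<Phi>"] T.orbit_self[OF *(1,2) \<phi>0(1)] \<phi>0(2) by simp
  hence "\<phi> : F P Q" using T.orbit_F[OF *(1,2) \<phi>0(1)] \<phi>0(2) by blast
  hence "\<exists>\<psi>. \<psi> : Hom L P Q \<and> \<pi> P Q \<psi> = \<phi>" using T.\<pi>_image[OF *(1,2)] by (metis imageE)
  hence \<psi>: "\<psi> : Hom L P Q \<and> \<pi> P Q \<psi> = \<phi>" unfolding \<psi>_def by (rule someI_ex)
  have "act (?H q) P Q \<Phi> = HM_composite R S \<epsilon> M q P Q \<phi> \<psi>"
   by (simp add: HM_def Let_def \<phi>_def \<psi>_def)
  thus ?thesis using comp[OF *(1,2) _ *(4), of \<psi>] orb[OF *(1-3), of \<psi>] \<psi> \<phi> by simp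
 qed
 have val: "val (?H q) P = cohomology R (sub_cat S P) (W.N P) q" for q P by (simp add: HM_def Res)
 note H = val act[folded XL]
 \<comment> \<open>Every class is of the form \<open>W.\<kappa> q Q f\<close>, and on these any two
   lifts with the same orbit have the same effect.\<close>
 have "act (?H q) P Q \<Phi> U = HM_composite R S \<epsilon> M q P Q \<phi> \<psi> U"
  if *: "P : T.X" "Q : T.X" "\<Phi> : Hom (orbit_cat S F) P Q" "\<phi> : \<Phi>" "\<psi> : Hom L P Q" "\<pi> P Q \<psi> = \<phi>"
   "U : carrier (cohomology R (sub_cat S Q) (Res_j \<epsilon> M Q) q)" for q P Q \<Phi> \<phi> \<psi> U
 proof -
  obtain f where f: "f : ?Z q Q" "U = W.\<kappa> q Q f"
   using quotient_map_surj[OF W.\<kappa>_quotient_map[unfolded XL, OF *(2), of q] *(7)[unfolded Res]] by auto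
  show ?thesis
   using act[OF *(1-3) f(1)] comp[OF *(1,2,5) f(1)] orb[OF *(1-3,5)] *(4,6) f(2) by simp
 qed
 moreover obtain E d where "first_quadrant_spectral_sequence R E d"
  "!!i j. E 2 (int i) (int j) = cohomology R (orbit_cat S F) (?H j) i" "converges_to R E (cohomology R L M)"
  by (rule W.group_spectral_sequence[of ?H, OF H]) blast+
 moreover have "right_module R (orbit_cat S F) (?H q)" for q by (rule W.H_module[of ?H, OF H])
 ultimately show ?thesis by blast
qed

end
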